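(* Let $R>0$ and let $k>0$ be a fixed wavenumber. Let $S\in H^\perp(B_R)$ (regarded as a source on $\mathbb R^2$ via extension by zero outside $B_R$), and let $u=u(\cdot,k)$ be the radiating solution of the biharmonic wave equation $\Delta^2u-k^4u=S$ in $\mathbb R^2$. Then $$u=\Delta u=\partial_\nu u=\partial_\nu\Delta u=0\quad\text{on }\Gamma_R.$$
   Context: $B_R=\{x\in\mathbb R^2:|x|<R\}$, $\Gamma_R=\partial B_R$, and $\nu$ is the unit outward normal on $\Gamma_R$. Functions are complex valued. Radiating solution: for a source $S\in L^2(\mathbb R^2)$ vanishing outside $B_R$, the radiating solution $u$ is the solution of $\Delta^2u-k^4u=S$ in $\mathbb R^2$ satisfying $$\lim_{r\to\infty}\sqrt r\,(\partial_ru-\mathrm i k u)=0,\qquad \lim_{r\to\infty}\sqrt r\,(\partial_r(\Delta u)-\mathrm i k\,\Delta u)=0$$ uniformly in all directions $\hat x=x/|x|$, $r=|x|$. It is given by $$u(x,k)=\int_{\mathbb R^2}G(x,y,k)S(y)\,\mathrm dy,\qquad G(x,y,k)=\frac{\mathrm i}{8k^2}\left(H_0^{(1)}(k|x-y|)-H_0^{(1)}(\mathrm i k|x-y|)\right),$$ where $H_0^{(1)}$ is the Hankel function of the first kind of order zero. Boundary values on $\Gamma_R$ are understood as traces. The spaces $H(B_R)$ and $H^\perp(B_R)$: a function $v\in H^2(B_R)$ is called a weak solution of $\Delta^2v-k^4v=0$ if $\int_{B_R}(\Delta v\,\Delta\varphi-k^4v\varphi)\,\mathrm dx=0$ for every $\varphi\in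 C_0^\infty(B_R)$. $\mathcal H(B_R)$ denotes the set of all such weak solutions, $H(B_R)$ denotes the closure of $\mathcal H(B_R)$ in the $L^2(B_R)$ norm, and $H^\perp(B_R)$ denotes the orthogonal complement of $H(B_R)$ in $L^2(B_R)$, so that $L^2(B_R)=H(B_R)\oplus H^\perp(B_R)$. (All depend on the fixed $k$.) *)

theory Defs
  imports "HOL-Analysis.Analysis"
begin

section \<open>Classical derivatives and test functions\<close>

type_synonym cfun = "real^2 \<Rightarrow> complex"

definition pd :: "2 \<Rightarrow> cfun \<Rightarrow> cfun" where
  "pd i f x = frechet_derivative f (at x) (axis i 1)"

definition lap :: "cfun \<Rightarrow> cfun" where
  "lap f x = (\<Sum>i\<in>UNIV. pd i (pd i f) x)"

primrec Ck_on :: "nat \<Rightarrow> (real^2) set \<Rightarrow> cfun \<Rightarrow> bool" where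
  "Ck_on 0 U f \<longleftrightarrow> continuous_on U f"
| "Ck_on (Suc n) U f \<longleftrightarrow> (\<forall>x\<in>U. f differentiable (at x)) \<and> (\<forall>i. Ck_on n U (pd i f))"

text \<open>Meant for open sets \<open>U\<close>.\<close>

definition smooth_on :: "(real^2) set \<Rightarrow> cfun \<Rightarrow> bool" where
  "smooth_on U f \<longleftrightarrow> (\<forall>n. Ck_on n U f)"

definition test_functions :: "(real^2) set \<Rightarrow> cfun set" where
  "test_functions U =
     {\<phi>. smooth_on UNIV \<phi> \<and> (\<exists>K. compact K \<and> K \<subseteq> U \<and> (\<forall>x. x \<notin> K \<longrightarrow> \<phi> x = 0))}"

section \<open>Square integrable functions and Sobolev spaces\<close>

text \<open>Elements of the function spaces are represented by functions on the whole plane of which only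
  the values on the given set matter, up to null sets.\<close>

definition L2_on :: "(real^2) set \<Rightarrow> cfun \<Rightarrow> bool" where
  "L2_on A f \<longleftrightarrow> f \<in> borel_measurable (lebesgue_on A) \<and>
     integrable (lebesgue_on A) (\<lambda>x. (cmod (f x))\<^sup>2)"

definition L2_norm_on :: "(real^2) set \<Rightarrow> cfun \<Rightarrow> real" where
  "L2_norm_on A f = sqrt (LINT x|lebesgue_on A. (cmod (f x))\<^sup>2)"

definition L2_inner_on :: "(real^2) set \<Rightarrow> cfun \<Rightarrow> cfun \<Rightarrow> complex" where
  "L2_inner_on A f g = (LINT x|lebesgue_on A. f x * cnj (g x))"

definition locally_integrable_on :: "(real^2) set \<Rightarrow> cfun \<Rightarrow> bool" where
  "locally_integrable_on U f \<longleftrightarrow>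
     (\<forall>K. compact K \<and> K \<subseteq> U \<longrightarrow> f absolutely_integrable_on K)"

definition is_weak_pd :: "(real^2) set \<Rightarrow> 2 \<Rightarrow> cfun \<Rightarrow> cfun \<Rightarrow> bool" where
  "is_weak_pd U i f g \<longleftrightarrow> locally_integrable_on U f \<and> locally_integrable_on U g \<and>
     (\<forall>\<phi>\<in>test_functions U.
        (LINT x|lebesgue_on U. f x * pd i \<phi> x) = - (LINT x|lebesgue_on U. g x * \<phi> x))"

text \<open>The weak derivative is determined up to a null set when it exists, and \<open>wpd\<close> is unspecified
  otherwise; it is only used for functions lying in a suitable Sobolev space.\<close>

definition wpd :: "(real^2) set \<Rightarrow> 2 \<Rightarrow> cfun \<Rightarrow> cfun" where
  "wpd U i f = (SOME g. is_weak_pd U i f g)"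

definition wlap :: "(real^2) set \<Rightarrow> cfun \<Rightarrow> cfun" where
  "wlap U f x = (\<Sum>i\<in>UNIV. wpd U i (wpd U i f) x)"

primrec sobolev :: "nat \<Rightarrow> (real^2) set \<Rightarrow> cfun \<Rightarrow> bool" where
  "sobolev 0 U f \<longleftrightarrow> L2_on U f"
| "sobolev (Suc m) U f \<longleftrightarrow> L2_on U f \<and> (\<forall>i. \<exists>g. is_weak_pd U i f g \<and> sobolev m U g)"

section \<open>Traces on the circle\<close>

definition circle_pt :: "real \<Rightarrow> real \<Rightarrow> real^2" where
  "circle_pt R t = vector [R * cos t, R * sin t]"

definition L2_circle :: "real \<Rightarrow> cfun \<Rightarrow> bool" where
  "L2_circle R g \<longleftrightarrow>
     (\<lambda>t. g (circle_pt R t)) \<in> borel_measurable (lebesgue_on {0..2*pi}) \<and>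
     integrable (lebesgue_on {0..2*pi}) (\<lambda>t. (cmod (g (circle_pt R t)))\<^sup>2)"

definition L2_circle_norm :: "real \<Rightarrow> cfun \<Rightarrow> real" where
  "L2_circle_norm R g =
     sqrt (LINT t|lebesgue_on {0..2*pi}. (cmod (g (circle_pt R t)))\<^sup>2 * R)"

text \<open>\<open>has_trace R w g\<close>: \<open>w\<close> lies in \<open>H\<^sup>1(B\<^sub>R)\<close> and \<open>g\<close> is its image under the continuous extension
  \<open>H\<^sup>1(B\<^sub>R) \<rightarrow> L\<^sup>2(\<Gamma>\<^sub>R)\<close> of the restriction of functions that are smooth up to the boundary. As a
  relation it determines \<open>g\<close> up to null sets of the circle.\<close>

definition has_trace :: "real \<Rightarrow> cfun \<Rightarrow> cfun \<Rightarrow> bool" where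
  "has_trace R w g \<longleftrightarrow> sobolev 1 (ball 0 R) w \<and> L2_circle R g \<and>
     (\<exists>\<phi> :: nat \<Rightarrow> cfun. (\<forall>n. smooth_on UNIV (\<phi> n)) \<and>
        (\<lambda>n. L2_norm_on (ball 0 R) (\<lambda>x. \<phi> n x - w x)) \<longlonglongrightarrow> 0 \<and>
        (\<forall>i. (\<lambda>n. L2_norm_on (ball 0 R) (\<lambda>x. pd i (\<phi> n) x - wpd (ball 0 R) i w x)) \<longlonglongrightarrow> 0) \<and>
        (\<lambda>n. L2_circle_norm R (\<lambda>x. \<phi> n x - g x)) \<longlonglongrightarrow> 0)"

text \<open>Normal derivative of \<open>w \<in> H\<^sup>2(B\<^sub>R)\<close>: the traces of the first derivatives contracted with the
  outward unit normal \<open>\<nu>(x) = x/R\<close>.\<close>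

definition has_normal_trace :: "real \<Rightarrow> cfun \<Rightarrow> cfun \<Rightarrow> bool" where
  "has_normal_trace R w h \<longleftrightarrow> sobolev 2 (ball 0 R) w \<and>
     (\<exists>g :: 2 \<Rightarrow> cfun. (\<forall>i. has_trace R (wpd (ball 0 R) i w) (g i)) \<and>
        (\<forall>x\<in>sphere 0 R. h x = (\<Sum>i\<in>UNIV. complex_of_real (x $ i / R) * g i x)))"

section \<open>The biharmonic wave equation\<close>

definition weak_biharmonic_wave :: "real \<Rightarrow> (real^2) set \<Rightarrow> cfun \<Rightarrow> cfun \<Rightarrow> bool" where
  "weak_biharmonic_wave k U S v \<longleftrightarrow> sobolev 2 U v \<and>
     (\<forall>\<phi>\<in>test_functions U.
        (LINT x|lebesgue_on U. wlap U v x * lap \<phi> x - complex_of_real (k^4) * v x * \<phi> x)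
          = (LINT x|lebesgue_on U. S x * \<phi> x))"

definition weak_solutions :: "real \<Rightarrow> real \<Rightarrow> cfun set" where
  "weak_solutions k R = {v. weak_biharmonic_wave k (ball 0 R) (\<lambda>_. 0) v}"

definition H_space :: "real \<Rightarrow> real \<Rightarrow> cfun set" where
  "H_space k R = {v. L2_on (ball 0 R) v \<and>
     (\<forall>\<epsilon>>0. \<exists>w\<in>weak_solutions k R. L2_norm_on (ball 0 R) (\<lambda>x. v x - w x) < \<epsilon>)}"

definition H_perp :: "real \<Rightarrow> real \<Rightarrow> cfun set" where
  "H_perp k R = {S. L2_on (ball 0 R) S \<and> (\<forall>v\<in>H_space k R. L2_inner_on (ball 0 R) S v = 0)}"

definition zero_ext :: "real \<Rightarrow> cfun \<Rightarrow> cfun" where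
  "zero_ext R S x = (if x \<in> ball 0 R then S x else 0)"

section \<open>Radiating solutions\<close>

text \<open>\<open>\<surd>r (\<partial>\<^sub>r w - \<i>kw) \<rightarrow> 0\<close> as \<open>r \<rightarrow> \<infinity>\<close>, uniformly in all directions.\<close>

definition sommerfeld :: "real \<Rightarrow> cfun \<Rightarrow> bool" where
  "sommerfeld k w \<longleftrightarrow>
     uniform_limit (sphere 0 1)
       (\<lambda>r d. complex_of_real (sqrt r) *
          (vector_derivative (\<lambda>s. w (s *\<^sub>R d)) (at r) - \<i> * complex_of_real k * w (r *\<^sub>R d)))
       (\<lambda>_. 0) at_top"

text \<open>For a source \<open>F\<close> vanishing outside \<open>B\<^sub>R\<close>: \<open>u \<in> H\<^sup>2\<^sub>l\<^sub>o\<^sub>c\<close> solves \<open>\<Delta>\<^sup>2u - k\<^sup>4u = F\<close> weakly in the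
  plane (every test function is supported in some disc), and the radiation conditions hold. The
  latter are pointwise, hence are imposed on the smooth representative \<open>w\<close> that \<open>u\<close> has in the
  exterior of the disc, by elliptic regularity.\<close>

definition radiating_solution :: "real \<Rightarrow> real \<Rightarrow> cfun \<Rightarrow> cfun \<Rightarrow> bool" where
  "radiating_solution k R F u \<longleftrightarrow>
     (\<forall>\<rho>>0. weak_biharmonic_wave k (ball 0 \<rho>) F u) \<and>
     (\<exists>w. smooth_on (- cball 0 R) w \<and>
          (AE x in lebesgue. x \<notin> cball 0 R \<longrightarrow> u x = w x) \<and>
          sommerfeld k w \<and> sommerfeld k (lap w))"

end

(* Outside the disc, u is smooth and p = (Laplacian u) + c u with c = k^2 or c = -k^2 satisfies
   (Laplacian p) = c p. Since S is orthogonal to the entire solutions v of (Laplacian v) = c v, testing the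
   equation with a cutoff times v shows that each angular mode P of p has vanishing Wronskian with the
   regular Bessel solution j. If c = k^2, then P is a multiple of the growing function j, which contradicts
   the radiation condition. If c = -k^2, then P is a complex multiple of the real function j, so
   Im (P' cnj P) = 0 and the radiation condition forces the energy r (|P'|^2 + k^2 |P|^2) to zero, hence
   P = 0. Therefore p = 0 for both c, and u = 0 outside the disc. Thus u and its Laplacian, extended by
   zero, have their distributional Laplacians in L^2 of the whole plane, so both lie in H^2 of the plane. A
   function of class H^1 of the plane that vanishes outside the disc is approximated by mollifications of
   its contractions x -> h (l x), l > 1, which vanish near the circle: its trace is zero. *)
theory Submission
  imports Defs
begin

section \<open>Partial derivatives and smooth functions\<close>

text \<open>The operator factors as (Laplacian - c)(Laplacian + c) with c = k^2 or c = -k^2, so p is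
  annihilated by Laplacian - c, and 2 k^2 u is the difference of the two functions p. One obstacle
  is that a single radiation condition, with the wave number k, is imposed on both parts although
  the part with c = k^2 does not oscillate; this is why the two signs are treated by different
  arguments. The source enters only through the weak equation. A cutoff that equals 1 on the disc
  makes its contribution an inner product with an entire solution, hence zero, and leaves integrals
  over an annulus outside the disc, where u is smooth. The other obstacle is that traces are defined
  by approximation from inside. Vanishing outside yields zero traces only if the zero extension is
  weakly differentiable across the circle. Regularity is therefore proved on the whole plane for
  functions of bounded support, where the square integral of the Hessian equals that of the
  Laplacian and no boundary terms arise.\<close>

lemma pd_eqI: "(f has_derivative f') (at x) \<Longrightarrow> pd i f x = f' (axis i 1)"
  unfolding pd_def by (metis frechet_derivative_at)

text \<open>A real-linear map on the plane is determined by its values on the two axis vectors. In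
  this form bounds on partial derivatives become operator norm bounds for the mean value
  theorem.\<close>

lemma has_derivative_pd:
  assumes "f differentiable (at x)"
  shows "(f has_derivative (\<lambda>h. \<Sum>i\<in>UNIV. of_real (h $ i) * pd i f x)) (at x)"
proof -
  let ?f' = "frechet_derivative f (at x)"
  have f': "(f has_derivative ?f') (at x)"
    using assms by (simp add: frechet_derivative_works)
  have lin: "linear ?f'" using f' by (rule has_derivative_linear)
  have "?f' h = (\<Sum>i\<in>UNIV. of_real (h $ i) * pd i f x)" for h
  proof -
    have "h = (\<Sum>i\<in>UNIV. (h $ i) *\<^sub>R axis i 1)"
      by (simp add: vec_eq_iff forall_2 UNIV_2 axis_def)
    then have "?f' h = ?f' (\<Sum>i\<in>UNIV. (h $ i) *\<^sub>R axis i 1)" by (rule arg_cong)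
    also have "\<dots> = (\<Sum>i\<in>UNIV. (h $ i) *\<^sub>R ?f' (axis i 1))"
      by (simp add: linear_sum[OF lin] linear_scale[OF lin])
    finally show ?thesis by (simp add: pd_def scaleR_conv_of_real[where 'a=complex])
  qed
  then have "?f' = (\<lambda>h. \<Sum>i\<in>UNIV. of_real (h $ i) * pd i f x)" by (rule ext)
  then show ?thesis using f' by metis
qed

text \<open>Near x both functions have exactly the same derivatives in the sense of
  \<open>has_derivative\<close>, so the choice made inside \<open>frechet_derivative\<close> is the
  same too. The rule thus also covers points where no derivative exists.\<close>

lemma pd_cong:
  assumes "open U" "x \<in> U" "\<And>y. y \<in> U \<Longrightarrow> f y = g y"
  shows "pd i f x = pd i g x"
proof -
  have "(f has_derivative D) (at x) = (g has_derivative D) (at x)" for D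
    using has_derivative_transform_within_open[of f D x UNIV U g] assms(3)[symmetric]
      has_derivative_transform_within_open[of g D x UNIV U f] assms by blast
  then show ?thesis by (simp add: pd_def frechet_derivative_def)
qed

lemma differentiable_cong_open:
  assumes "open U" "x \<in> U" "\<And>y. y \<in> U \<Longrightarrow> f y = g y" "f differentiable (at x)"
  shows "g differentiable (at x)"
  using assms has_derivative_transform_within_open[of f _ x UNIV U g] unfolding differentiable_def by blast

lemma lap_cong:
  assumes "open U" "x \<in> U" "\<And>y. y \<in> U \<Longrightarrow> f y = g y"
  shows "lap f x = lap g x"
  unfolding lap_def
  by (intro sum.cong refl pd_cong[OF assms(1,2)] pd_cong[OF assms(1)] assms(3))

lemma pd_const [simp]: "pd i (\<lambda>x. a) = (\<lambda>x. 0)"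
  by (rule ext, subst pd_eqI) (auto intro: derivative_intros)

lemma pd_add:
  assumes "f differentiable (at x)" "g differentiable (at x)"
  shows "pd i (\<lambda>x. f x + g x) x = pd i f x + pd i g x"
  using assms unfolding frechet_derivative_works
  by (subst pd_eqI[OF has_derivative_add]) (auto simp: pd_def)

lemma pd_mult:
  assumes "f differentiable (at x)" "g differentiable (at x)"
  shows "pd i (\<lambda>x. f x * g x) x = pd i f x * g x + f x * pd i g x"
  using assms unfolding frechet_derivative_works
  by (subst pd_eqI[OF has_derivative_mult]) (auto simp: pd_def algebra_simps)

lemma pd_cmult:
  assumes "f differentiable (at x)"
  shows "pd i (\<lambda>x. a * f x) x = a * pd i f x"
  using pd_mult[of "\<lambda>_. a" x f i] assms by simp

lemma pd_diff:
  assumes "f differentiable (at x)" "g differentiable (at x)"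
  shows "pd i (\<lambda>x. f x - g x) x = pd i f x - pd i g x"
  using assms unfolding frechet_derivative_works
  by (subst pd_eqI[OF has_derivative_diff]) (auto simp: pd_def)

lemma has_derivative_coord: "((\<lambda>x. complex_of_real (x $ i)) has_derivative (\<lambda>h. of_real (h $ i))) (at x)"
  by (intro bounded_linear_imp_has_derivative bounded_linear_compose[OF bounded_linear_of_real]
      bounded_linear_vec_nth)

lemma pd_coord: "pd j (\<lambda>x. complex_of_real (x $ i)) = (\<lambda>x. if i = j then 1 else 0)"
  by (rule ext, subst pd_eqI[OF has_derivative_coord]) (auto simp: axis_def)

lemma pd_cnj:
  assumes "f differentiable (at x)"
  shows "pd i (\<lambda>x. cnj (f x)) x = cnj (pd i f x)"
  using assms unfolding frechet_derivative_works
  by (subst pd_eqI[OF has_derivative_cnj]) (auto simp: pd_def)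

lemma has_derivative_affine_comp:
  fixes f :: cfun
  assumes "f differentiable (at (a + c *\<^sub>R x))"
  shows "((\<lambda>x. f (a + c *\<^sub>R x)) has_derivative (\<lambda>h. frechet_derivative f (at (a + c *\<^sub>R x)) (c *\<^sub>R h))) (at x)"
proof -
  have "((\<lambda>x. a + c *\<^sub>R x) has_derivative (\<lambda>h. c *\<^sub>R h)) (at x)"
    by (auto intro!: derivative_eq_intros)
  from diff_chain_at[OF this assms[unfolded frechet_derivative_works]] show ?thesis
    by (simp add: o_def)
qed

lemma pd_affine:
  assumes "f differentiable (at (a + c *\<^sub>R x))"
  shows "pd i (\<lambda>x. f (a + c *\<^sub>R x)) x = of_real c * pd i f (a + c *\<^sub>R x)"
proof -
  have "linear (frechet_derivative f (at (a + c *\<^sub>R x)))"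
    using assms[unfolded frechet_derivative_works] by (rule has_derivative_linear)
  then show ?thesis
    by (subst pd_eqI[OF has_derivative_affine_comp[OF assms]])
      (simp add: pd_def linear_scale scaleR_conv_of_real[where 'a=complex])
qed

section \<open>Closure properties of smoothness\<close>

lemma Ck_on_cong:
  assumes "open U"
  shows "(\<And>x. x \<in> U \<Longrightarrow> f x = g x) \<Longrightarrow> Ck_on n U f = Ck_on n U g"
proof (induction n arbitrary: f g)
  case 0
  then show ?case by (simp cong: continuous_on_cong)
next
  case (Suc n)
  have "Ck_on n U (pd i f) = Ck_on n U (pd i g)" for i
    by (rule Suc.IH) (rule pd_cong[OF assms], auto simp: Suc.prems)
  moreover have "f differentiable (at x) \<longleftrightarrow> g differentiable (at x)" if "x \<in> U" for x
    using differentiable_cong_open[OF assms that] Suc.prems by metis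
  ultimately show ?case by auto
qed

lemma Ck_on_Suc_imp: "Ck_on (Suc n) U f \<Longrightarrow> Ck_on n U f"
proof (induction n arbitrary: f)
  case 0
  then show ?case
    by (auto intro!: differentiable_imp_continuous_on simp: differentiable_on_def
        differentiable_at_withinI)
next
  case (Suc n)
  from Suc.prems have d: "\<forall>x\<in>U. f differentiable (at x)" and "\<And>i. Ck_on (Suc n) U (pd i f)" by simp_all
  from this(2) have "\<And>i. Ck_on n U (pd i f)" by (rule Suc.IH)
  with d show ?case by simp
qed

lemma Ck_on_subset: "Ck_on n U f \<Longrightarrow> V \<subseteq> U \<Longrightarrow> Ck_on n V f"
  by (induction n arbitrary: f) (auto intro: continuous_on_subset)

lemma Ck_on_const: "Ck_on n U (\<lambda>x. a)"
  by (induction n arbitrary: a) auto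

lemma Ck_on_add:
  assumes U: "open U"
  shows "Ck_on n U f \<Longrightarrow> Ck_on n U g \<Longrightarrow> Ck_on n U (\<lambda>x. f x + g x)"
proof (induction n arbitrary: f g)
  case (Suc n)
  have "Ck_on n U (pd i (\<lambda>x. f x + g x)) = Ck_on n U (\<lambda>x. pd i f x + pd i g x)" for i
    using Suc.prems by (intro Ck_on_cong[OF U] pd_add) auto
  then show ?case using Suc by (auto intro: differentiable_add)
qed (auto intro: continuous_intros)

lemma Ck_on_mult:
  assumes U: "open U"
  shows "Ck_on n U f \<Longrightarrow> Ck_on n U g \<Longrightarrow> Ck_on n U (\<lambda>x. f x * g x)"
proof (induction n arbitrary: f g)
  case (Suc n)
  have "Ck_on n U (pd i (\<lambda>x. f x * g x)) = Ck_on n U (\<lambda>x. pd i f x * g x + f x * pd i g x)" for i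
    using Suc.prems by (intro Ck_on_cong[OF U] pd_mult) auto
  moreover have "Ck_on n U f" "Ck_on n U g" using Suc.prems Ck_on_Suc_imp by blast+
  ultimately show ?case using Suc by (auto intro!: Ck_on_add[OF U] differentiable_mult)
qed (auto intro: continuous_intros)

lemma Ck_on_cnj:
  assumes U: "open U"
  shows "Ck_on n U f \<Longrightarrow> Ck_on n U (\<lambda>x. cnj (f x))"
proof (induction n arbitrary: f)
  case (Suc n)
  have "Ck_on n U (pd i (\<lambda>x. cnj (f x))) = Ck_on n U (\<lambda>x. cnj (pd i f x))" for i
    using Suc.prems by (intro Ck_on_cong[OF U] pd_cnj) auto
  moreover have "(\<lambda>x. cnj (f x)) differentiable (at x)" if "x \<in> U" for x
    using Suc.prems that by (simp add: differentiable_cnj_iff)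
  ultimately show ?case using Suc by auto
qed (auto intro: continuous_intros)

lemma Ck_on_affine:
  shows "Ck_on n UNIV f \<Longrightarrow> Ck_on n UNIV (\<lambda>x. f (a + c *\<^sub>R x))"
proof (induction n arbitrary: f)
  case 0
  then show ?case by (auto intro!: continuous_on_compose2[of UNIV f] continuous_intros)
next
  case (Suc n)
  have "Ck_on n UNIV (pd i (\<lambda>x. f (a + c *\<^sub>R x))) = Ck_on n UNIV (\<lambda>x. of_real c * pd i f (a + c *\<^sub>R x))" for i
    using Suc.prems by (intro Ck_on_cong[OF open_UNIV] pd_affine) auto
  moreover have "(\<lambda>x. f (a + c *\<^sub>R x)) differentiable (at x)" for x
    using Suc.prems has_derivative_affine_comp[of f a c x] by (auto simp: differentiable_def)
  ultimately show ?case using Suc by (auto intro!: Ck_on_mult Ck_on_const)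
qed

lemma smooth_on_imp_differentiable: "smooth_on U f \<Longrightarrow> x \<in> U \<Longrightarrow> f differentiable (at x)"
  unfolding smooth_on_def by (metis Ck_on.simps(2))

lemma smooth_on_pd: "smooth_on U f \<Longrightarrow> smooth_on U (pd i f)"
  unfolding smooth_on_def by (metis Ck_on.simps(2))

lemma smooth_on_continuous: "smooth_on U f \<Longrightarrow> continuous_on U f"
  unfolding smooth_on_def by (metis Ck_on.simps(1))

lemma smooth_on_subset: "smooth_on U f \<Longrightarrow> V \<subseteq> U \<Longrightarrow> smooth_on V f"
  unfolding smooth_on_def by (metis Ck_on_subset)

lemma smooth_on_cong: "open U \<Longrightarrow> (\<And>x. x \<in> U \<Longrightarrow> f x = g x) \<Longrightarrow> smooth_on U f = smooth_on U g"
  unfolding smooth_on_def by (metis Ck_on_cong)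

lemma smooth_on_const: "smooth_on U (\<lambda>x. a)"
  by (simp add: smooth_on_def Ck_on_const)

lemma smooth_on_add: "open U \<Longrightarrow> smooth_on U f \<Longrightarrow> smooth_on U g \<Longrightarrow> smooth_on U (\<lambda>x. f x + g x)"
  by (simp add: smooth_on_def Ck_on_add)

lemma smooth_on_mult: "open U \<Longrightarrow> smooth_on U f \<Longrightarrow> smooth_on U g \<Longrightarrow> smooth_on U (\<lambda>x. f x * g x)"
  by (simp add: smooth_on_def Ck_on_mult)

lemma smooth_on_cmult: "open U \<Longrightarrow> smooth_on U f \<Longrightarrow> smooth_on U (\<lambda>x. a * f x)"
  by (simp add: smooth_on_mult smooth_on_const)

lemma smooth_on_diff: "open U \<Longrightarrow> smooth_on U f \<Longrightarrow> smooth_on U g \<Longrightarrow> smooth_on U (\<lambda>x. f x - g x)"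
  using smooth_on_add[of U f "\<lambda>x. (-1) * g x"] smooth_on_cmult[of U g "-1"] by simp

lemma smooth_on_power: "open U \<Longrightarrow> smooth_on U f \<Longrightarrow> smooth_on U (\<lambda>x. f x ^ n)"
  by (induction n) (auto intro: smooth_on_const smooth_on_mult)

lemma smooth_on_sum:
  "open U \<Longrightarrow> (\<And>i. i \<in> A \<Longrightarrow> smooth_on U (f i)) \<Longrightarrow> smooth_on U (\<lambda>x. \<Sum>i\<in>A. f i x)"
  by (induction A rule: infinite_finite_induct) (auto intro: smooth_on_const smooth_on_add)

lemma smooth_on_cnj: "open U \<Longrightarrow> smooth_on U f \<Longrightarrow> smooth_on U (\<lambda>x. cnj (f x))"
  by (simp add: smooth_on_def Ck_on_cnj)

lemma smooth_on_affine: "smooth_on UNIV f \<Longrightarrow> smooth_on UNIV (\<lambda>x. f (a + c *\<^sub>R x))"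
  by (simp add: smooth_on_def Ck_on_affine)

lemma smooth_on_coord: "smooth_on U (\<lambda>x. complex_of_real (x $ i))"
proof -
  have "Ck_on n U (\<lambda>x. complex_of_real (x $ i))" for n
    using has_derivative_coord
    by (cases n) (auto simp: pd_coord Ck_on_const differentiable_def intro!: continuous_intros)
  then show ?thesis by (simp add: smooth_on_def)
qed

lemma smooth_on_lap: "open U \<Longrightarrow> smooth_on U f \<Longrightarrow> smooth_on U (lap f)"
  unfolding lap_def[abs_def] by (intro smooth_on_sum smooth_on_pd)

text \<open>Smoothness is local; this glues a function that is smooth on \<open>U\<close> to the
  zero function off a compact support.\<close>

lemma smooth_on_open_cover:
  assumes "smooth_on U f" "smooth_on V f"
  shows "open U \<Longrightarrow> open V \<Longrightarrow> smooth_on (U \<union> V) f"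
proof -
  assume "open U" "open V"
  have "Ck_on n U f \<Longrightarrow> Ck_on n V f \<Longrightarrow> Ck_on n (U \<union> V) f" for n f
    by (induction n arbitrary: f) (auto intro: continuous_on_open_Un \<open>open U\<close> \<open>open V\<close>)
  then show ?thesis using assms by (auto simp: smooth_on_def)
qed

lemma sum_UNIV_2: "(\<Sum>i\<in>(UNIV::2 set). f i) = f 1 + f 2"
  by (simp add: UNIV_2)

lemma lap_mult:
  assumes U: "open U" "x \<in> U" and f: "smooth_on U f" and g: "smooth_on U g"
  shows "lap (\<lambda>x. f x * g x) x = lap f x * g x + 2 * (\<Sum>i\<in>UNIV. pd i f x * pd i g x) + f x * lap g x"
proof -
  have df: "f differentiable (at y)" "g differentiable (at y)"
     "pd i f differentiable (at y)" "pd i g differentiable (at y)" if "y \<in> U" for y i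
    using that f g by (auto intro: smooth_on_imp_differentiable smooth_on_pd)
  have "pd i (pd i (\<lambda>x. f x * g x)) x = pd i (\<lambda>x. pd i f x * g x + f x * pd i g x) x" for i
    by (intro pd_cong[OF U] pd_mult df)
  also have "\<dots> i = pd i (pd i f) x * g x + 2 * (pd i f x * pd i g x) + f x * pd i (pd i g) x" for i
    using U df by (subst pd_add) (auto intro: differentiable_mult simp: pd_mult)
  finally show ?thesis by (simp add: lap_def sum.distrib sum_distrib_left sum_distrib_right)
qed

lemma lap_add:
  assumes U: "open U" "x \<in> U" and f: "smooth_on U f" and g: "smooth_on U g"
  shows "lap (\<lambda>x. f x + g x) x = lap f x + lap g x"
proof -
  have df: "f differentiable (at y)" "g differentiable (at y)"
     "pd i f differentiable (at y)" "pd i g differentiable (at y)" if "y \<in> U" for y i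
    using that f g by (auto intro: smooth_on_imp_differentiable smooth_on_pd)
  have "pd i (pd i (\<lambda>x. f x + g x)) x = pd i (\<lambda>x. pd i f x + pd i g x) x" for i
    by (intro pd_cong[OF U] pd_add df)
  then show ?thesis using df U by (simp add: lap_def sum.distrib pd_add)
qed

lemma lap_cmult:
  assumes U: "open U" "x \<in> U" and f: "smooth_on U f"
  shows "lap (\<lambda>x. a * f x) x = a * lap f x"
  using lap_mult[OF U smooth_on_const f, of a] by (simp add: lap_def)

lemma lap_diff:
  assumes U: "open U" "x \<in> U" and f: "smooth_on U f" and g: "smooth_on U g"
  shows "lap (\<lambda>x. f x - g x) x = lap f x - lap g x"
  using lap_add[OF U f smooth_on_cmult[OF U(1) g, of "-1"]] lap_cmult[OF U g, of "-1"] by simp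

lemma lap_cnj:
  assumes U: "open U" "x \<in> U" and f: "smooth_on U f"
  shows "lap (\<lambda>x. cnj (f x)) x = cnj (lap f x)"
proof -
  have df: "f differentiable (at y)" "pd i f differentiable (at y)" if "y \<in> U" for y i
    using that f by (auto intro: smooth_on_imp_differentiable smooth_on_pd)
  have "pd i (pd i (\<lambda>x. cnj (f x))) x = pd i (\<lambda>x. cnj (pd i f x)) x" for i
    by (intro pd_cong[OF U] pd_cnj df)
  then show ?thesis using df U by (simp add: lap_def pd_cnj)
qed

section \<open>The algebra of test functions\<close>

lemma test_functionsI:
  "smooth_on UNIV \<phi> \<Longrightarrow> compact K \<Longrightarrow> K \<subseteq> U \<Longrightarrow> (\<And>x. x \<notin> K \<Longrightarrow> \<phi> x = 0) \<Longrightarrow> \<phi> \<in> test_functions U"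
  by (auto simp: test_functions_def)

lemma test_functionsE:
  assumes "\<phi> \<in> test_functions U"
  obtains K where "smooth_on UNIV \<phi>" "compact K" "K \<subseteq> U" "\<And>x. x \<notin> K \<Longrightarrow> \<phi> x = 0"
  using assms by (auto simp: test_functions_def)

lemma test_functions_smooth: "\<phi> \<in> test_functions U \<Longrightarrow> smooth_on UNIV \<phi>"
  by (auto simp: test_functions_def)

lemma test_functions_mono: "\<phi> \<in> test_functions U \<Longrightarrow> U \<subseteq> V \<Longrightarrow> \<phi> \<in> test_functions V"
  by (auto simp: test_functions_def)

lemma pd_zero_outside:
  assumes "compact K" "\<And>x. x \<notin> K \<Longrightarrow> f x = 0" "x \<notin> K"
  shows "pd i f x = 0"
proof -
  have "pd i f x = pd i (\<lambda>_. 0) x"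
    using assms compact_imp_closed by (intro pd_cong[of "-K"]) auto
  then show ?thesis by simp
qed

lemma test_functions_pd: "\<phi> \<in> test_functions U \<Longrightarrow> pd i \<phi> \<in> test_functions U"
  by (elim test_functionsE, rule test_functionsI) (auto intro: smooth_on_pd pd_zero_outside)

lemma test_functions_add:
  assumes "\<phi> \<in> test_functions U" "\<psi> \<in> test_functions U"
  shows "(\<lambda>x. \<phi> x + \<psi> x) \<in> test_functions U"
  using assms(1)
proof (rule test_functionsE)
  fix K assume K: "smooth_on UNIV \<phi>" "compact K" "K \<subseteq> U" "\<And>x. x \<notin> K \<Longrightarrow> \<phi> x = 0"
  from assms(2) obtain L where L: "smooth_on UNIV \<psi>" "compact L" "L \<subseteq> U" "\<And>x. x \<notin> L \<Longrightarrow> \<psi> x = 0"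
    by (rule test_functionsE) blast
  show ?thesis
    by (rule test_functionsI[of _ "K \<union> L"]) (use K L in \<open>auto intro: smooth_on_add\<close>)
qed

text \<open>The factor \<open>f\<close> is arbitrary off \<open>U\<close>, but there the product is
  zero: \<open>U\<close> and the complement of the support \<open>K\<close> cover the plane, and the
  product is smooth on each. The exterior function \<open>w\<close> is multiplied by test functions
  in this way.\<close>

lemma test_functions_mult:
  assumes "\<phi> \<in> test_functions U" "open U" "smooth_on U f"
  shows "(\<lambda>x. \<phi> x * f x) \<in> test_functions U"
  using assms(1)
proof (rule test_functionsE)
  fix K assume K: "smooth_on UNIV \<phi>" "compact K" "K \<subseteq> U" "\<And>x. x \<notin> K \<Longrightarrow> \<phi> x = 0"
  have "smooth_on U (\<lambda>x. \<phi> x * f x)"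
    using K assms by (auto intro: smooth_on_mult smooth_on_subset)
  moreover have o: "open (- K)" using K by (simp add: compact_imp_closed open_Compl)
  have "smooth_on (- K) (\<lambda>x. \<phi> x * f x) = smooth_on (- K) (\<lambda>x. 0)"
    using K by (intro smooth_on_cong[OF o]) auto
  then have "smooth_on (- K) (\<lambda>x. \<phi> x * f x)" by (simp add: smooth_on_const)
  ultimately have "smooth_on (U \<union> - K) (\<lambda>x. \<phi> x * f x)"
    using o \<open>open U\<close> by (intro smooth_on_open_cover)
  moreover have "U \<union> - K = UNIV" using K by auto
  ultimately show ?thesis using K by (intro test_functionsI[of _ K]) auto
qed

lemma test_functions_cmult: "\<phi> \<in> test_functions U \<Longrightarrow> (\<lambda>x. a * \<phi> x) \<in> test_functions U"
  by (elim test_functionsE, rule test_functionsI) (auto intro: smooth_on_cmult)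

lemma test_functions_diff:
  "\<phi> \<in> test_functions U \<Longrightarrow> \<psi> \<in> test_functions U \<Longrightarrow> (\<lambda>x. \<phi> x - \<psi> x) \<in> test_functions U"
  using test_functions_add[of \<phi> U "\<lambda>x. (-1) * \<psi> x"] test_functions_cmult[of \<psi> U "-1"] by simp

lemma test_functions_lap: "\<phi> \<in> test_functions U \<Longrightarrow> lap \<phi> \<in> test_functions U"
  unfolding lap_def[abs_def] sum_UNIV_2 by (intro test_functions_add test_functions_pd)

lemma test_functions_cnj: "\<phi> \<in> test_functions U \<Longrightarrow> (\<lambda>x. cnj (\<phi> x)) \<in> test_functions U"
  by (elim test_functionsE, rule test_functionsI) (auto intro: smooth_on_cnj)

section \<open>Cutoff functions\<close>

text \<open>The derivatives of exp(-1/t) are polynomials in 1/t times exp(-1/t); carrying the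
  polynomial as a parameter gives a family closed under differentiation.\<close>

definition flat :: "real poly \<Rightarrow> real \<Rightarrow> real" where
  "flat p t = (if t > 0 then poly p (1 / t) * exp (- (1 / t)) else 0)"

lemma flat_limit: "((\<lambda>t::real. poly p (1 / t) * exp (- (1 / t))) \<longlongrightarrow> 0) (at_right 0)"
proof -
  have "((\<lambda>s::real. poly p s * exp (- s)) \<longlongrightarrow> 0) at_top"
  proof (induction p)
    case (pCons a p)
    have "((\<lambda>s::real. s ^ m * exp (- s)) \<longlongrightarrow> 0) at_top" for m
      using tendsto_power_div_exp_0[of m] by (simp add: exp_minus field_simps)
    then have "((\<lambda>s. \<Sum>i\<le>degree (pCons a p). coeff (pCons a p) i * (s ^ i * exp (- s))) \<longlongrightarrow> (\<Sum>i\<le>degree (pCons a p). coeff (pCons a p) i * 0)) at_top"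
      by (intro tendsto_sum tendsto_mult tendsto_const)
    then show ?case by (simp add: poly_altdef sum_distrib_right mult.assoc del: coeff_pCons)
  qed simp
  then have "((\<lambda>t. poly p (inverse t) * exp (- inverse t)) \<longlongrightarrow> 0) (at_right 0)"
    by (rule filterlim_compose[OF _ filterlim_inverse_at_top_right])
  then show ?thesis by (simp add: inverse_eq_divide)
qed

text \<open>With s = 1/t one has ds/dt = -s^2, so differentiating p(s) exp(-s) replaces p by s^2 (p
  - p'). This is the origin of the factor \<open>[:0, 0, 1:]\<close>.\<close>

lemma flat_has_derivative:
  "(flat p has_real_derivative flat ([:0, 0, 1:] * (p - pderiv p)) t) (at t)"
proof -
  consider "t > 0" | "t < 0" | "t = 0" by linarith
  then show ?thesis
  proof cases
    case 1
    have "((\<lambda>t. poly p (1 / t) * exp (- (1 / t))) has_real_derivative flat ([:0, 0, 1:] * (p - pderiv p)) t) (at t)"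
      using 1 by (auto intro!: derivative_eq_intros poly_DERIV[THEN DERIV_chain2] simp: flat_def field_simps)
    then show ?thesis
      by (rule has_field_derivative_transform_within_open[where S="{0<..}"]) (use 1 in \<open>auto simp: flat_def\<close>)
  next
    case 2
    have "((\<lambda>t. 0) has_real_derivative flat ([:0, 0, 1:] * (p - pderiv p)) t) (at t)"
      using 2 by (auto simp: flat_def)
    then show ?thesis
      by (rule has_field_derivative_transform_within_open[where S="{..<0}"]) (use 2 in \<open>auto simp: flat_def\<close>)
  next
    case 3
    \<comment> \<open>At the origin the difference quotient from the right is p(1/t) exp(-1/t) / t,
      again of flat type with the polynomial s p(s), so it tends to zero.\<close>
    have "((\<lambda>t. flat p t / t) \<longlongrightarrow> 0) (at_right 0)"
    proof (rule Lim_transform_eventually)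
      show "((\<lambda>t. poly ([:0, 1:] * p) (1 / t) * exp (- (1 / t))) \<longlongrightarrow> 0) (at_right 0)"
        by (rule flat_limit)
      show "\<forall>\<^sub>F x in at_right 0. poly ([:0, 1:] * p) (1 / x) * exp (- (1 / x)) = flat p x / x"
        by (auto simp: eventually_at_right_field flat_def intro!: exI[of _ 1])
    qed
    moreover have "((\<lambda>t. flat p t / t) \<longlongrightarrow> 0) (at_left 0)"
      by (rule Lim_transform_eventually[OF tendsto_const])
        (auto simp: eventually_at_left_field flat_def intro!: exI[of _ "-1"])
    ultimately have "((\<lambda>t. flat p t / t) \<longlongrightarrow> 0) (at 0)" by (rule filterlim_split_at_real[rotated])
    then show ?thesis using 3 by (simp add: has_field_derivative_iff flat_def)
  qed
qed

definition flat_deriv :: "nat \<Rightarrow> real \<Rightarrow> real" where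
  "flat_deriv m = flat (((\<lambda>p. [:0, 0, 1:] * (p - pderiv p)) ^^ m) 1)"

lemma flat_deriv_has_derivative: "(flat_deriv m has_real_derivative flat_deriv (Suc m) t) (at t)"
  unfolding flat_deriv_def funpow.simps o_def by (rule flat_has_derivative)

lemma flat_deriv_0: "flat_deriv 0 t = (if t > 0 then exp (- (1 / t)) else 0)"
  by (simp add: flat_deriv_def flat_def)

lemma flat_deriv_1: "flat_deriv (Suc 0) t = (if t > 0 then exp (- (1 / t)) / t\<^sup>2 else 0)"
  by (simp add: flat_deriv_def flat_def power2_eq_square)

lemma flat_deriv_0_bounds: "0 \<le> flat_deriv 0 t" "flat_deriv 0 t \<le> 1" "t > 0 \<Longrightarrow> 0 < flat_deriv 0 t"
   "t \<le> 0 \<Longrightarrow> flat_deriv 0 t = 0"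
  by (auto simp: flat_deriv_0)

lemma flat_deriv_0_mono: "s \<le> t \<Longrightarrow> flat_deriv 0 s \<le> flat_deriv 0 t"
  by (auto simp: flat_deriv_0 field_simps)

lemma flat_deriv_1_nonneg: "0 \<le> flat_deriv (Suc 0) t" "t > 0 \<Longrightarrow> 0 < flat_deriv (Suc 0) t"
  by (auto simp: flat_deriv_1)

text \<open>The inner function is real but stored as a complex one; its derivative therefore equals
  its own real part, and the real chain rule applies.\<close>

lemma has_derivative_comp_real:
  fixes f :: "real^2 \<Rightarrow> real"
  assumes "(\<lambda>x. complex_of_real (f x)) differentiable (at x)" "(g has_real_derivative g') (at (f x))"
  shows "((\<lambda>x. complex_of_real (g (f x))) has_derivative
      (\<lambda>h. of_real g' * frechet_derivative (\<lambda>x. complex_of_real (f x)) (at x) h)) (at x)"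
proof -
  let ?D = "frechet_derivative (\<lambda>x. complex_of_real (f x)) (at x)"
  have D: "((\<lambda>x. complex_of_real (f x)) has_derivative ?D) (at x)"
    using assms(1) by (simp add: frechet_derivative_works)
  have fD: "(f has_derivative (\<lambda>h. Re (?D h))) (at x)"
    using has_derivative_Re[OF D] by simp
  have "?D = (\<lambda>h. complex_of_real (Re (?D h)))"
    using has_derivative_of_real[OF fD] D by (rule has_derivative_unique[THEN sym])
  then have eq: "?D h = complex_of_real (Re (?D h))" for h by metis
  have "((\<lambda>x. g (f x)) has_derivative (\<lambda>h. Re (?D h) * g')) (at x)"
    using has_derivative_compose[OF fD assms(2)[unfolded has_field_derivative_def]]
    by (simp add: mult.commute)
  from has_derivative_of_real[OF this] show ?thesis
    by (subst eq) (simp add: mult.commute)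
qed

lemma pd_comp_real:
  fixes f :: "real^2 \<Rightarrow> real"
  assumes "(\<lambda>x. complex_of_real (f x)) differentiable (at x)" "(g has_real_derivative g') (at (f x))"
  shows "pd i (\<lambda>x. complex_of_real (g (f x))) x = of_real g' * pd i (\<lambda>x. complex_of_real (f x)) x"
  by (subst pd_eqI[OF has_derivative_comp_real[OF assms]]) (simp add: pd_def)

text \<open>A sequence \<open>G\<close> in which each member is the derivative of the one before
  supplies all derivatives of the outer function, so one induction over the order serves
  \<open>flat_deriv\<close> and the Bessel series alike.\<close>

lemma smooth_on_comp_real:
  fixes f :: "real^2 \<Rightarrow> real"
  assumes U: "open U" and f: "smooth_on U (\<lambda>x. complex_of_real (f x))"
    and G: "\<And>m t. (G m has_real_derivative G (Suc m) t) (at t)"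
  shows "smooth_on U (\<lambda>x. complex_of_real (G m (f x)))"
proof -
  have df: "(\<lambda>x. complex_of_real (f x)) differentiable (at x)" if "x \<in> U" for x
    using f that by (rule smooth_on_imp_differentiable)
  have dG: "(\<lambda>x. complex_of_real (G m (f x))) differentiable (at x)" if "x \<in> U" for x m
    using has_derivative_comp_real[OF df[OF that] G] by (rule differentiableI)
  have "Ck_on n U (\<lambda>x. complex_of_real (G m (f x)))" for n
  proof (induction n arbitrary: m)
    case 0
    show ?case unfolding Ck_on.simps
      by (rule differentiable_imp_continuous_on)
        (use dG in \<open>auto simp: differentiable_on_def intro: differentiable_at_withinI\<close>)
  next
    case (Suc n)
    have "Ck_on n U (pd i (\<lambda>x. complex_of_real (G m (f x)))) =
          Ck_on n U (\<lambda>x. of_real (G (Suc m) (f x)) * pd i (\<lambda>x. complex_of_real (f x)) x)" for i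
      by (intro Ck_on_cong[OF U] pd_comp_real df G)
    moreover have "Ck_on n U (pd i (\<lambda>x. complex_of_real (f x)))" for i
      using smooth_on_pd[OF f] by (simp add: smooth_on_def)
    ultimately show ?case using Suc dG by (auto intro: Ck_on_mult[OF U])
  qed
  then show ?thesis by (simp add: smooth_on_def)
qed

lemma norm_sq_vec2: "(norm (x::real^2))\<^sup>2 = (x $ 1)\<^sup>2 + (x $ 2)\<^sup>2"
  by (simp add: norm_vec_def L2_set_def UNIV_2)

lemma smooth_on_norm_sq: "smooth_on U (\<lambda>x. complex_of_real ((norm x)\<^sup>2))"
proof -
  have "smooth_on UNIV (\<lambda>x. (complex_of_real (x $ 1))\<^sup>2 + (complex_of_real (x $ 2))\<^sup>2)"
    by (intro smooth_on_add smooth_on_power smooth_on_coord) auto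
  then show ?thesis by (auto simp: norm_sq_vec2 intro: smooth_on_subset)
qed

lemma pd_norm_sq: "pd i (\<lambda>x. complex_of_real ((norm x)\<^sup>2)) x = 2 * of_real (x $ i)"
proof -
  have "((\<lambda>x::real^2. complex_of_real ((norm x)\<^sup>2)) has_derivative (\<lambda>h. of_real (2 * (x \<bullet> h)))) (at x)"
    unfolding power2_norm_eq_inner
    by (auto intro!: derivative_eq_intros simp: inner_commute)
  from pd_eqI[OF this] show ?thesis by (simp add: inner_axis)
qed

lemma pd_radial:
  assumes "(g has_real_derivative g') (at ((norm x)\<^sup>2))"
  shows "pd i (\<lambda>x. complex_of_real (g ((norm x)\<^sup>2))) x = 2 * of_real (x $ i) * of_real g'"
  using smooth_on_imp_differentiable[OF smooth_on_norm_sq UNIV_I]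
  by (subst pd_comp_real[where f = "\<lambda>x. (norm x)\<^sup>2", OF _ assms]) (auto simp: pd_norm_sq simp del: of_real_power)

lemma smooth_on_radial:
  assumes "\<And>m t. (G m has_real_derivative G (Suc m) t) (at t)" "open U"
  shows "smooth_on U (\<lambda>x. complex_of_real (G m ((norm x)\<^sup>2)))"
  by (rule smooth_on_comp_real[where G = G, OF assms(2) smooth_on_norm_sq assms(1)])

text \<open>A smooth step in the variable s = |x|^2, which keeps it smooth at the origin. The inner
  quotient is 0 for s <= a and at least 1 for s >= b, so the outer flat function sees the argument 1
  or a nonpositive one. The closed form also yields a derivative that is strictly negative between a
  and b.\<close>

definition cutoff :: "real \<Rightarrow> real \<Rightarrow> real \<Rightarrow> real" where
  "cutoff a b s = flat_deriv 0 (1 - flat_deriv 0 (s - a) / flat_deriv 0 (b - a)) / flat_deriv 0 1"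

definition cutoff' :: "real \<Rightarrow> real \<Rightarrow> real \<Rightarrow> real" where
  "cutoff' a b s = - (flat_deriv 1 (1 - flat_deriv 0 (s - a) / flat_deriv 0 (b - a)) *
     flat_deriv 1 (s - a) / (flat_deriv 0 (b - a) * flat_deriv 0 1))"

lemma cutoff_has_derivative:
  assumes "a < b"
  shows "(cutoff a b has_real_derivative cutoff' a b s) (at s)"
  unfolding cutoff_def[abs_def] cutoff'_def
  using flat_deriv_0_bounds(3)[of "b - a"] flat_deriv_0_bounds(3)[of 1] assms
  by (auto intro!: derivative_eq_intros flat_deriv_has_derivative[THEN DERIV_chain2] simp: field_simps)

lemma cutoff_eq_1: "s \<le> a \<Longrightarrow> cutoff a b s = 1"
  using flat_deriv_0_bounds(3)[of 1] by (simp add: cutoff_def flat_deriv_0_bounds(4))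

lemma cutoff_eq_0: "a < b \<Longrightarrow> b \<le> s \<Longrightarrow> cutoff a b s = 0"
  using flat_deriv_0_mono[of "b - a" "s - a"] flat_deriv_0_bounds(3)[of "b - a"]
  by (simp add: cutoff_def flat_deriv_0_bounds(4))

lemma cutoff'_eq_0: "a < b \<Longrightarrow> s \<le> a \<or> b \<le> s \<Longrightarrow> cutoff' a b s = 0"
  using flat_deriv_0_mono[of "b - a" "s - a"] flat_deriv_0_bounds(3)[of "b - a"]
  by (auto simp: cutoff'_def flat_deriv_1)

lemma cutoff'_nonpos: "cutoff' a b s \<le> 0"
  using flat_deriv_1_nonneg flat_deriv_0_bounds by (simp add: cutoff'_def)

lemma cutoff'_neg: "a < s \<Longrightarrow> s < b \<Longrightarrow> cutoff' a b s < 0"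
proof -
  assume s: "a < s" "s < b"
  have "flat_deriv 0 (s - a) < flat_deriv 0 (b - a)"
    using s by (simp add: flat_deriv_0 field_simps)
  moreover have p: "0 < flat_deriv 0 (b - a)" "0 < flat_deriv 0 1" "0 < flat_deriv (Suc 0) (s - a)"
    using s by (auto intro!: flat_deriv_0_bounds flat_deriv_1_nonneg)
  ultimately have "0 < flat_deriv (Suc 0) (1 - flat_deriv 0 (s - a) / flat_deriv 0 (b - a))"
    by (intro flat_deriv_1_nonneg) (simp add: field_simps)
  with p show ?thesis by (simp add: cutoff'_def)
qed

lemma smooth_on_flat:
  fixes f :: "real^2 \<Rightarrow> real"
  assumes "open U" "smooth_on U (\<lambda>x. complex_of_real (f x))"
  shows "smooth_on U (\<lambda>x. complex_of_real (flat_deriv m (f x)))"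
  by (rule smooth_on_comp_real[where G = flat_deriv, OF assms flat_deriv_has_derivative])

lemma smooth_cutoff:
  assumes "a < b"
  shows "smooth_on UNIV (\<lambda>x. complex_of_real (cutoff a b ((norm x)\<^sup>2)))"
proof -
  let ?c = "flat_deriv 0 (b - a)"
  have "smooth_on UNIV (\<lambda>x. complex_of_real ((norm x)\<^sup>2) - complex_of_real a)"
    by (intro smooth_on_diff smooth_on_norm_sq smooth_on_const open_UNIV)
  then have "smooth_on UNIV (\<lambda>x. complex_of_real (flat_deriv 0 ((norm x)\<^sup>2 - a)))"
    by (intro smooth_on_flat) auto
  then have "smooth_on UNIV (\<lambda>x. 1 - complex_of_real (1 / ?c) * complex_of_real (flat_deriv 0 ((norm x)\<^sup>2 - a)))"
    by (intro smooth_on_diff smooth_on_mult smooth_on_const open_UNIV)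
  then have "smooth_on UNIV (\<lambda>x. complex_of_real (flat_deriv 0 (1 - (1 / ?c) * (flat_deriv 0 ((norm x)\<^sup>2 - a)))))"
    by (intro smooth_on_flat) auto
  then have "smooth_on UNIV (\<lambda>x. complex_of_real (1 / flat_deriv 0 1) * complex_of_real (flat_deriv 0 (1 - (1 / ?c) * (flat_deriv 0 ((norm x)\<^sup>2 - a)))))"
    by (intro smooth_on_mult smooth_on_const open_UNIV)
  then show ?thesis by (simp add: cutoff_def)
qed

lemma pd_cutoff:
  "a < b \<Longrightarrow> pd i (\<lambda>x. complex_of_real (cutoff a b ((norm x)\<^sup>2))) x = 2 * of_real (x $ i) * of_real (cutoff' a b ((norm x)\<^sup>2))"
  by (rule pd_radial) (rule cutoff_has_derivative)

lemma test_cutoff: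
  assumes "0 \<le> a" "a < b" "cball 0 b \<subseteq> U"
  shows "(\<lambda>x. complex_of_real (cutoff (a\<^sup>2) (b\<^sup>2) ((norm x)\<^sup>2))) \<in> test_functions U"
proof (rule test_functionsI[of _ "cball 0 b"])
  have "a\<^sup>2 < b\<^sup>2" using assms by (simp add: power_strict_mono)
  then show "smooth_on UNIV (\<lambda>x. complex_of_real (cutoff (a\<^sup>2) (b\<^sup>2) ((norm x)\<^sup>2)))"
    by (rule smooth_cutoff)
  show "complex_of_real (cutoff (a\<^sup>2) (b\<^sup>2) ((norm x)\<^sup>2)) = 0" if "x \<notin> cball 0 b" for x :: "real^2"
    using that \<open>a\<^sup>2 < b\<^sup>2\<close> assms power_mono[of b "norm x" 2] by (auto intro!: cutoff_eq_0)
qed (use assms in auto)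

text \<open>Inside the box each factor is exp(-1/(m d)), with d the distance to a face, and tends to
  1 as m grows. The bumps are test functions that converge boundedly to the indicator of an open
  box.\<close>

definition box_bump :: "real^2 \<Rightarrow> real^2 \<Rightarrow> nat \<Rightarrow> real^2 \<Rightarrow> real" where
  "box_bump a b m x = (\<Prod>i\<in>UNIV. flat_deriv 0 (real m * (x $ i - a $ i)) * flat_deriv 0 (real m * (b $ i - x $ i)))"

lemma box_bump_eq_0:
  assumes "x \<notin> box a b"
  shows "box_bump a b m x = 0"
proof -
  obtain i where "x $ i \<le> a $ i \<or> b $ i \<le> x $ i"
    using assms by (auto simp: mem_box_cart not_less)
  then have "flat_deriv 0 (real m * (x $ i - a $ i)) * flat_deriv 0 (real m * (b $ i - x $ i)) = 0"
    by (auto intro!: flat_deriv_0_bounds simp: mult_nonneg_nonpos)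
  then show ?thesis unfolding box_bump_def by (intro prod_zero) auto
qed

lemma box_bump_bounds: "0 \<le> box_bump a b m x" "box_bump a b m x \<le> 1"
  unfolding box_bump_def
  by (auto intro!: prod_nonneg prod_le_1 mult_nonneg_nonneg mult_le_one flat_deriv_0_bounds)

lemma box_bump_limit: "(\<lambda>m. box_bump a b m x) \<longlonglongrightarrow> indicator (box a b) x"
proof (cases "x \<in> box a b")
  case True
  have *: "(\<lambda>m. flat_deriv 0 (real m * t)) \<longlonglongrightarrow> 1" if "t > 0" for t
  proof (rule Lim_transform_eventually)
    have "(\<lambda>m. - (inverse (real m) / t)) \<longlonglongrightarrow> - (0 / t)"
      by (intro tendsto_intros lim_inverse_n) (use that in auto)
    then show "(\<lambda>m. exp (- (inverse (real m) / t))) \<longlonglongrightarrow> 1"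
      using tendsto_exp by fastforce
    show "\<forall>\<^sub>F m in sequentially. exp (- (inverse (real m) / t)) = flat_deriv 0 (real m * t)"
      using eventually_gt_at_top[of 0] by eventually_elim (use that in \<open>auto simp: flat_deriv_0 field_simps\<close>)
  qed
  have "(\<lambda>m. box_bump a b m x) \<longlonglongrightarrow> (\<Prod>i\<in>(UNIV::2 set). 1 * 1)"
    unfolding box_bump_def using True by (intro tendsto_intros *) (auto simp: mem_box_cart)
  then show ?thesis using True by simp
qed (simp add: box_bump_eq_0)

lemma test_box_bump:
  assumes "cbox a b \<subseteq> U"
  shows "(\<lambda>x. complex_of_real (box_bump a b m x)) \<in> test_functions U"
proof (rule test_functionsI[of _ "cbox a b"])
  have "smooth_on UNIV (\<lambda>x. complex_of_real (real m) * (complex_of_real (x $ i) - complex_of_real (a $ i)))"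
       "smooth_on UNIV (\<lambda>x. complex_of_real (real m) * (complex_of_real (b $ i) - complex_of_real (x $ i)))" for i
    by (intro smooth_on_mult smooth_on_diff smooth_on_coord smooth_on_const open_UNIV)+
  then have "smooth_on UNIV (\<lambda>x. complex_of_real (flat_deriv 0 (real m * (x $ i - a $ i))))"
    "smooth_on UNIV (\<lambda>x. complex_of_real (flat_deriv 0 (real m * (b $ i - x $ i))))" for i
    by (auto intro!: smooth_on_flat)
  then show "smooth_on UNIV (\<lambda>x. complex_of_real (box_bump a b m x))"
    unfolding box_bump_def by (simp add: UNIV_2 smooth_on_mult)
  show "complex_of_real (box_bump a b m x) = 0" if "x \<notin> cbox a b" for x
    using that box_subset_cbox box_bump_eq_0 by (metis of_real_0 subsetD)
qed (use assms in auto)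

lemma has_bounded_test:
  assumes "\<phi> \<in> test_functions U"
  obtains B where "0 \<le> B" "\<And>x. cmod (\<phi> x) \<le> B"
proof -
  obtain K where K: "smooth_on UNIV \<phi>" "compact K" "\<And>x. x \<notin> K \<Longrightarrow> \<phi> x = 0"
    using assms by (rule test_functionsE) blast
  have "compact (\<phi> ` K)"
    using K by (intro compact_continuous_image continuous_on_subset[OF smooth_on_continuous[OF K(1)]]) auto
  then obtain B where "\<And>y. y \<in> \<phi> ` K \<Longrightarrow> norm y \<le> B"
    by (metis compact_imp_bounded bounded_iff)
  then have "cmod (\<phi> x) \<le> max B 0" for x
    using K(3)[of x] by (cases "x \<in> K") (auto simp: le_max_iff_disj)
  then show ?thesis by (intro that[of "max B 0"]) auto
qed

section \<open>Integration by parts and convolution\<close>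

lemma test_continuous: "\<phi> \<in> test_functions U \<Longrightarrow> continuous_on UNIV \<phi>"
  by (intro smooth_on_continuous test_functions_smooth)

lemma test_measurable [measurable_dest]: "\<phi> \<in> test_functions U \<Longrightarrow> \<phi> \<in> borel_measurable borel"
  by (intro borel_measurable_continuous_onI test_continuous)

lemma test_differentiable: "\<phi> \<in> test_functions U \<Longrightarrow> \<phi> differentiable (at x)"
  by (rule smooth_on_imp_differentiable[OF test_functions_smooth UNIV_I])

lemma integrable_compact_support:
  fixes f :: cfun
  assumes "continuous_on UNIV f" "compact K" "\<And>x. x \<notin> K \<Longrightarrow> f x = 0"
  shows "integrable lborel f"
proof -
  have "integrable lborel (\<lambda>x. indicator K x *\<^sub>R f x)"
    using assms by (intro borel_integrable_compact) (auto intro: continuous_on_subset)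
  moreover have "(\<lambda>x. indicator K x *\<^sub>R f x) = f" using assms by (auto simp: indicator_def)
  ultimately show ?thesis by simp
qed

lemma test_integrable: "\<phi> \<in> test_functions U \<Longrightarrow> integrable lborel \<phi>"
  by (elim test_functionsE) (auto intro: integrable_compact_support smooth_on_continuous)

lemma integrable_mult_bounded:
  fixes f g :: "'a \<Rightarrow> complex"
  assumes "integrable M f" "g \<in> borel_measurable M" "\<And>x. cmod (g x) \<le> B"
  shows "integrable M (\<lambda>x. f x * g x)"
proof (rule Bochner_Integration.integrable_bound)
  show "integrable M (\<lambda>x. B *\<^sub>R f x)" using assms by auto
  have "norm (f x * g x) \<le> norm (B *\<^sub>R f x)" for x
    using assms(3)[of x] order_trans[OF norm_ge_zero assms(3)]
    by (simp add: norm_mult) (metis mult.commute mult_right_mono norm_ge_zero)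
  then show "AE x in M. norm (f x * g x) \<le> norm (B *\<^sub>R f x)" by simp
qed (use assms in auto)

lemma integrable_mult_test:
  assumes "integrable lborel f" "\<phi> \<in> test_functions U"
  shows "integrable lborel (\<lambda>x. f x * \<phi> x)"
proof -
  obtain B where "0 \<le> B" "\<And>x. cmod (\<phi> x) \<le> B"
    using has_bounded_test[OF assms(2)] by blast
  with assms show ?thesis by (intro integrable_mult_bounded[of _ _ _ B]) (auto dest: test_measurable)
qed

section \<open>Affine substitutions and uniform Taylor bounds in the plane\<close>

lemma nn_integral_affine_vec2:
  assumes [measurable]: "f \<in> borel_measurable borel" and c: "c \<noteq> 0"
  shows "(\<integral>\<^sup>+x. f x \<partial>lborel) = ennreal (c\<^sup>2) * (\<integral>\<^sup>+x. f (t + c *\<^sub>R (x::real^2)) \<partial>lborel)"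
  by (subst lborel_affine[OF c, of t])
     (simp add: nn_integral_density nn_integral_distr nn_integral_cmult power2_eq_square)

lemma lborel_integrable_affine_vec2:
  fixes f :: "real^2 \<Rightarrow> 'a :: {banach, second_countable_topology}"
  assumes f: "integrable lborel f" and "c \<noteq> 0"
  shows "integrable lborel (\<lambda>x. f (t + c *\<^sub>R x))"
  using f f[THEN borel_measurable_integrable] \<open>c \<noteq> 0\<close> unfolding integrable_iff_bounded
  by (subst (asm) nn_integral_affine_vec2[where c=c and t=t]) (auto simp: ennreal_mult_less_top)

lemma lborel_integral_affine_vec2:
  fixes f :: "real^2 \<Rightarrow> 'a :: {banach, second_countable_topology}"
  assumes c: "c \<noteq> 0" and [measurable]: "f \<in> borel_measurable borel"
  shows "(\<integral>x. f x \<partial> lborel) = c\<^sup>2 *\<^sub>R (\<integral>x. f (t + c *\<^sub>R x) \<partial>lborel)"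
proof -
  have "(\<integral>x. f x \<partial> lborel) = (\<integral>x. f x \<partial> density (distr lborel borel (\<lambda>x. t + c *\<^sub>R x)) (\<lambda>_. ennreal (c\<^sup>2)))"
    by (subst lborel_affine[OF c, of t]) (simp add: power2_eq_square)
  also have "\<dots> = (\<integral>x. c\<^sup>2 *\<^sub>R f x \<partial> distr lborel borel (\<lambda>x. t + c *\<^sub>R x))"
    by (subst integral_density) auto
  also have "\<dots> = (\<integral>x. c\<^sup>2 *\<^sub>R f (t + c *\<^sub>R x) \<partial>lborel)"
    by (subst integral_distr) auto
  finally show ?thesis by simp
qed

lemma norm_pd_sum_le: "cmod (\<Sum>i\<in>UNIV. of_real (h $ i) * c i) \<le> norm h * (\<Sum>i\<in>UNIV. cmod (c i))"
  unfolding sum_distrib_left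
  by (intro sum_norm_le) (auto simp: norm_mult intro!: mult_right_mono component_le_norm_cart)

lemma onorm_pd_le: "onorm (\<lambda>h. \<Sum>i\<in>UNIV. of_real (h $ i) * c i) \<le> (\<Sum>i\<in>UNIV. cmod (c i))"
  by (rule onorm_le) (rule order_trans[OF norm_pd_sum_le], simp add: mult.commute)

lemma test_lipschitz:
  assumes "\<phi> \<in> test_functions U"
  obtains B where "0 \<le> B" "\<And>x y. cmod (\<phi> x - \<phi> y) \<le> B * norm (x - y)"
proof -
  have "\<exists>B. 0 \<le> B \<and> (\<forall>x. cmod (pd i \<phi> x) \<le> B)" for i
    by (rule has_bounded_test[OF test_functions_pd[OF assms, of i]]) blast
  then have "\<forall>i. \<exists>B. 0 \<le> B \<and> (\<forall>x. cmod (pd i \<phi> x) \<le> B)" by blast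
  from choice[OF this] obtain B where B: "\<And>i. 0 \<le> B i" "\<And>i x. cmod (pd i \<phi> x) \<le> B i" by blast
  have "cmod (\<phi> x - \<phi> y) \<le> (\<Sum>i\<in>UNIV. B i) * norm (x - y)" for x y
  proof (rule differentiable_bound[of UNIV])
    show "(\<phi> has_derivative (\<lambda>h. \<Sum>i\<in>UNIV. of_real (h $ i) * pd i \<phi> x)) (at x within UNIV)" for x
      using assms by (intro has_derivative_pd test_differentiable)
    show "onorm (\<lambda>h. \<Sum>i\<in>UNIV. of_real (h $ i) * pd i \<phi> x) \<le> (\<Sum>i\<in>UNIV. B i)" for x
      by (rule order_trans[OF onorm_pd_le]) (auto intro: sum_mono B)
  qed auto
  then show ?thesis using B by (intro that[of "\<Sum>i\<in>UNIV. B i"]) (auto intro: sum_nonneg)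
qed

text \<open>The first derivatives are Lipschitz because the second ones are bounded, which makes the
  quadratic remainder uniform in x. The uniformity is what allows differentiation under an integral
  later on.\<close>

lemma test_taylor:
  assumes "\<phi> \<in> test_functions U"
  obtains B where "0 \<le> B"
    "\<And>x h. cmod (\<phi> (x + h) - \<phi> x - (\<Sum>i\<in>UNIV. of_real (h $ i) * pd i \<phi> x)) \<le> B * (norm h)\<^sup>2"
proof -
  have "\<exists>B. 0 \<le> B \<and> (\<forall>x y. cmod (pd i \<phi> x - pd i \<phi> y) \<le> B * norm (x - y))" for i
    by (rule test_lipschitz[OF test_functions_pd[OF assms, of i]]) blast
  then have "\<forall>i. \<exists>B. 0 \<le> B \<and> (\<forall>x y. cmod (pd i \<phi> x - pd i \<phi> y) \<le> B * norm (x - y))" by blast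
  from choice[OF this] obtain B where B: "\<And>i. 0 \<le> B i" "\<And>i x y. cmod (pd i \<phi> x - pd i \<phi> y) \<le> B i * norm (x - y)" by blast
  have "cmod (\<phi> (x + h) - \<phi> x - (\<Sum>i\<in>UNIV. of_real (h $ i) * pd i \<phi> x)) \<le> (\<Sum>i\<in>UNIV. B i) * (norm h)\<^sup>2" for x h
  proof -
    let ?D = "\<lambda>z h. \<Sum>i\<in>UNIV. of_real (h $ i) * pd i \<phi> z"
    have "norm (\<phi> (x + h) - \<phi> x - ?D x ((x + h) - x)) \<le> norm ((x + h) - x) * ((\<Sum>i\<in>UNIV. B i) * norm h)"
    proof (rule differentiable_bound_linearization[where S = "cball x (norm h)" and f' = ?D])
      show "x + t *\<^sub>R (x + h - x) \<in> cball x (norm h)" if "t \<in> {0..1}" for t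
        using that by (auto simp: dist_norm mult_left_le_one_le)
      show "(\<phi> has_derivative ?D z) (at z within cball x (norm h))" for z
        by (rule has_derivative_at_withinI[OF has_derivative_pd[OF test_differentiable[OF assms]]])
      fix z assume z: "z \<in> cball x (norm h)"
      have "?D z - ?D x = (\<lambda>h. \<Sum>i\<in>UNIV. of_real (h $ i) * (pd i \<phi> z - pd i \<phi> x))"
        by (simp add: fun_eq_iff algebra_simps sum_subtractf)
      then have "onorm (?D z - ?D x) \<le> (\<Sum>i\<in>UNIV. cmod (pd i \<phi> z - pd i \<phi> x))"
        using onorm_pd_le by (simp only:)
      also have "\<dots> \<le> (\<Sum>i\<in>UNIV. B i * norm h)"
        using z B by (intro sum_mono order_trans[OF B(2)] mult_left_mono) (auto simp: dist_norm norm_minus_commute)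
      finally show "onorm (?D z - ?D x) \<le> (\<Sum>i\<in>UNIV. B i) * norm h"
        by (simp add: sum_distrib_right)
    qed auto
    then show ?thesis by (simp add: power2_eq_square mult_ac)
  qed
  then show ?thesis using B by (intro that[of "\<Sum>i\<in>UNIV. B i"]) (auto intro: sum_nonneg)
qed

text \<open>Translation invariance makes every difference quotient integrate to zero, and the
  quotients converge to the derivative with a common bound on a common disc.\<close>

lemma integral_pd_test:
  assumes "\<phi> \<in> test_functions U"
  shows "(\<integral>x. pd i \<phi> x \<partial>lborel) = 0"
proof -
  obtain B where B: "0 \<le> B" "\<And>x y. cmod (\<phi> x - \<phi> y) \<le> B * norm (x - y)"
    using test_lipschitz[OF assms] by blast
  obtain T where T: "0 \<le> T" "\<And>x h. cmod (\<phi> (x + h) - \<phi> x - (\<Sum>i\<in>UNIV. of_real (h $ i) * pd i \<phi> x)) \<le> T * (norm h)\<^sup>2"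
    using test_taylor[OF assms] by blast
  obtain K where K: "compact K" "\<And>x. x \<notin> K \<Longrightarrow> \<phi> x = 0" using assms by (rule test_functionsE) blast
  obtain r where r: "K \<subseteq> cball 0 r" by (metis compact_imp_bounded[OF K(1)] bounded_iff mem_cball_0 subsetI)
  define e :: "real^2" where "e = axis i 1"
  have ne: "norm e = 1" by (simp add: e_def)
  have [measurable]: "\<phi> \<in> borel_measurable borel" using assms by measurable
  let ?h = "\<lambda>n. inverse (real (Suc n))"
  let ?D = "\<lambda>n x. real (Suc n) *\<^sub>R (\<phi> (x + ?h n *\<^sub>R e) - \<phi> x)"
  have "(\<lambda>n. \<integral>x. ?D n x \<partial>lborel) \<longlonglongrightarrow> (\<integral>x. pd i \<phi> x \<partial>lborel)"
  \<comment> \<open>The steps have length at most 1, so all quotients vanish off the disc of radius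
    r + 1; the Lipschitz constant \<open>B\<close> bounds them.\<close>
  proof (rule integral_dominated_convergence[where w = "\<lambda>x. indicator (cball 0 (r + 1)) x *\<^sub>R B"])
    show "pd i \<phi> \<in> borel_measurable lborel"
      using test_functions_pd[OF assms] by measurable
    show "integrable lborel (\<lambda>x. indicator (cball 0 (r + 1)) x *\<^sub>R B)"
      by (intro borel_integrable_compact) auto
    show "AE x in lborel. (\<lambda>n. ?D n x) \<longlonglongrightarrow> pd i \<phi> x"
    proof (rule AE_I2)
      fix x
      have s: "(\<Sum>j\<in>UNIV. of_real ((c *\<^sub>R e) $ j) * pd j \<phi> x) = of_real c * pd i \<phi> x" for c
        by (simp add: e_def axis_def if_distrib if_distribR cong: if_cong)
      have "cmod (?D n x - pd i \<phi> x) \<le> T * ?h n" for n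
      proof -
        have "?D n x - pd i \<phi> x = real (Suc n) *\<^sub>R (\<phi> (x + ?h n *\<^sub>R e) - \<phi> x - of_real (?h n) * pd i \<phi> x)"
          by (simp add: scaleR_conv_of_real field_simps del: of_nat_Suc)
        then have "cmod (?D n x - pd i \<phi> x) = real (Suc n) * cmod (\<phi> (x + ?h n *\<^sub>R e) - \<phi> x - of_real (?h n) * pd i \<phi> x)"
          by (simp del: of_nat_Suc)
        also have "\<dots> \<le> real (Suc n) * (T * (norm (?h n *\<^sub>R e))\<^sup>2)"
          using T(2)[of x "?h n *\<^sub>R e"] unfolding s by (intro mult_left_mono) auto
        also have "\<dots> = T * ?h n" by (simp add: ne power2_eq_square field_simps del: of_nat_Suc)
        finally show ?thesis .
      qed
      moreover have "(\<lambda>n. T * ?h n) \<longlonglongrightarrow> 0"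
        using tendsto_mult[OF tendsto_const LIMSEQ_inverse_real_of_nat, of T] by simp
      ultimately have "(\<lambda>n. ?D n x - pd i \<phi> x) \<longlonglongrightarrow> 0"
        by - (rule Lim_null_comparison[where g = "\<lambda>n. T * ?h n", OF always_eventually[OF allI]], assumption+)
      then show "(\<lambda>n. ?D n x) \<longlonglongrightarrow> pd i \<phi> x" by (simp add: LIM_zero_iff)
    qed
    show "AE x in lborel. norm (?D n x) \<le> indicator (cball 0 (r + 1)) x *\<^sub>R B" for n
    proof (rule AE_I2)
      fix x
      show "norm (?D n x) \<le> indicator (cball 0 (r + 1)) x *\<^sub>R B"
      proof (cases "x \<in> cball 0 (r + 1)")
        case True
        have "norm (?D n x) \<le> real (Suc n) * (B * norm (?h n *\<^sub>R e))"
          using mult_left_mono[OF B(2)[of "x + ?h n *\<^sub>R e" x], of "real (Suc n)"] by (simp del: of_nat_Suc)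
        also have "\<dots> = B" by (simp add: ne field_simps del: of_nat_Suc)
        finally show ?thesis using True by (simp del: of_nat_Suc)
      next
        case False
        have "norm (?h n *\<^sub>R e) \<le> 1" by (simp add: ne field_simps)
        then have "norm x \<le> norm (x + ?h n *\<^sub>R e) + 1"
          using norm_triangle_ineq4[of "x + ?h n *\<^sub>R e" "?h n *\<^sub>R e"] by simp
        then have "x \<notin> K" "x + ?h n *\<^sub>R e \<notin> K" using False r by auto
        then show ?thesis using False K by simp
      qed
    qed
  qed measurable
  moreover have "(\<integral>x. ?D n x \<partial>lborel) = 0" for n
  proof -
    have i: "integrable lborel \<phi>" using assms by (rule test_integrable)
    have "integrable lborel (\<lambda>x. \<phi> (x + ?h n *\<^sub>R e))"
      using lborel_integrable_affine_vec2[OF i, of 1 "?h n *\<^sub>R e"] by (simp add: add.commute)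
    moreover have "(\<integral>x. \<phi> (x + ?h n *\<^sub>R e) \<partial>lborel) = (\<integral>x. \<phi> x \<partial>lborel)"
      using lborel_integral_affine_vec2[of 1 \<phi> "?h n *\<^sub>R e"] by (simp add: add.commute)
    ultimately show ?thesis using i by (simp del: of_nat_Suc)
  qed
  ultimately have "(\<lambda>n. 0) \<longlonglongrightarrow> (\<integral>x. pd i \<phi> x \<partial>lborel)" by (simp only:)
  then show ?thesis using LIMSEQ_unique[OF _ tendsto_const] by metis
qed

lemma integral_by_parts:
  assumes U: "open U" and f: "smooth_on U f" and \<phi>: "\<phi> \<in> test_functions U"
  shows "(\<integral>x. f x * pd i \<phi> x \<partial>lborel) = - (\<integral>x. pd i f x * \<phi> x \<partial>lborel)"
proof -
  obtain K where K: "smooth_on UNIV \<phi>" "compact K" "K \<subseteq> U" "\<And>x. x \<notin> K \<Longrightarrow> \<phi> x = 0"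
    using \<phi> by (rule test_functionsE) blast
  have t: "(\<lambda>x. pd i \<phi> x * f x) \<in> test_functions U" "(\<lambda>x. \<phi> x * pd i f x) \<in> test_functions U"
    "(\<lambda>x. \<phi> x * f x) \<in> test_functions U"
    using assms by (auto intro: test_functions_mult test_functions_pd smooth_on_pd)
  \<comment> \<open>Outside \<open>U\<close> the point is off the support, so every term vanishes
    there whatever values \<open>f\<close> takes.\<close>
  have "pd i (\<lambda>x. \<phi> x * f x) x = pd i \<phi> x * f x + \<phi> x * pd i f x" for x
  proof (cases "x \<in> U")
    case True
    then show ?thesis
      using f \<phi> by (intro pd_mult test_differentiable smooth_on_imp_differentiable) auto
  next
    case False
    then have "x \<notin> K" using K by auto
    then show ?thesis using K
      by (simp add: pd_zero_outside[OF K(2)])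
  qed
  then have "(\<integral>x. pd i \<phi> x * f x + \<phi> x * pd i f x \<partial>lborel) = 0"
    using integral_pd_test[OF t(3), of i] by simp
  then have "(\<integral>x. pd i \<phi> x * f x \<partial>lborel) + (\<integral>x. \<phi> x * pd i f x \<partial>lborel) = 0"
    using t by (subst (asm) Bochner_Integration.integral_add) (auto intro: test_integrable)
  then show ?thesis by (simp add: mult.commute eq_neg_iff_add_eq_0)
qed

lemma integral_lap_by_parts:
  assumes U: "open U" and f: "smooth_on U f" and \<phi>: "\<phi> \<in> test_functions U"
  shows "(\<integral>x. f x * lap \<phi> x \<partial>lborel) = (\<integral>x. lap f x * \<phi> x \<partial>lborel)"
proof -
  have 1: "(\<integral>x. f x * pd i (pd i \<phi>) x \<partial>lborel) = (\<integral>x. pd i (pd i f) x * \<phi> x \<partial>lborel)" for i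
    using integral_by_parts[OF U f test_functions_pd[OF \<phi>], of i i]
      integral_by_parts[OF U smooth_on_pd[OF f] \<phi>, of i i] by simp
  have "integrable lborel (\<lambda>x. f x * pd i (pd i \<phi>) x)" "integrable lborel (\<lambda>x. pd i (pd i f) x * \<phi> x)" for i
    using test_integrable[OF test_functions_mult[OF test_functions_pd[OF test_functions_pd[OF \<phi>]] U f]]
      test_integrable[OF test_functions_mult[OF \<phi> U smooth_on_pd[OF smooth_on_pd[OF f]]]]
    by (simp_all add: mult.commute)
  then show ?thesis using 1 by (simp add: lap_def sum_UNIV_2 algebra_simps)
qed

definition conv :: "cfun \<Rightarrow> cfun \<Rightarrow> cfun" where
  "conv f \<kappa> x = (\<integral>y. f y * \<kappa> (x - y) \<partial>lborel)"

lemma test_reflect: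
  assumes "\<kappa> \<in> test_functions UNIV"
  shows "(\<lambda>y. \<kappa> (x - y)) \<in> test_functions UNIV" "pd i (\<lambda>y. \<kappa> (x - y)) y = - pd i \<kappa> (x - y)"
proof -
  obtain K where K: "smooth_on UNIV \<kappa>" "compact K" "\<And>x. x \<notin> K \<Longrightarrow> \<kappa> x = 0"
    using assms by (rule test_functionsE) blast
  show "(\<lambda>y. \<kappa> (x - y)) \<in> test_functions UNIV"
  proof (rule test_functionsI)
    show "smooth_on UNIV (\<lambda>y. \<kappa> (x - y))" using smooth_on_affine[OF K(1), of x "-1"] by simp
    show "compact ((\<lambda>y. x - y) ` K)" using K by (intro compact_continuous_image continuous_intros)
    show "\<kappa> (x - y) = 0" if "y \<notin> (\<lambda>y. x - y) ` K" for y
      using that by (intro K(3)) (metis (no_types, opaque_lifting) diff_diff_eq2 add_diff_cancel_left' imageI)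
  qed auto
  show "pd i (\<lambda>y. \<kappa> (x - y)) y = - pd i \<kappa> (x - y)"
    using pd_affine[of \<kappa> x "-1" y i] test_differentiable[OF assms] by simp
qed

lemma conv_integrable:
  assumes "integrable lborel f" "\<kappa> \<in> test_functions UNIV"
  shows "integrable lborel (\<lambda>y. f y * \<kappa> (x - y))"
  by (rule integrable_mult_test[OF assms(1) test_reflect(1)[OF assms(2)]])

text \<open>Integrating the uniform Taylor remainder of the kernel against |f| bounds the error of
  the linearisation by a constant times |h|^2.\<close>

lemma has_derivative_conv:
  assumes f: "integrable lborel f" and \<kappa>: "\<kappa> \<in> test_functions UNIV"
  shows "(conv f \<kappa> has_derivative (\<lambda>h. \<Sum>i\<in>UNIV. of_real (h $ i) * conv f (pd i \<kappa>) x)) (at x)"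
    (is "(_ has_derivative ?D) _")
proof -
  obtain T where T: "0 \<le> T" "\<And>x h. cmod (\<kappa> (x + h) - \<kappa> x - (\<Sum>i\<in>UNIV. of_real (h $ i) * pd i \<kappa> x)) \<le> T * (norm h)\<^sup>2"
    using test_taylor[OF \<kappa>] by blast
  have bl: "bounded_linear ?D"
    unfolding linear_conv_bounded_linear[symmetric]
    by (intro linearI) (auto simp: algebra_simps sum.distrib scaleR_conv_of_real[where 'a=complex] sum_distrib_left)
  let ?F = "\<integral>y. cmod (f y) \<partial>lborel"
  have bd: "cmod (conv f \<kappa> (x + h) - conv f \<kappa> x - ?D h) \<le> ?F * T * (norm h)\<^sup>2" for h
  proof -
    have i: "integrable lborel (\<lambda>y. f y * \<kappa> (x + h - y))" "integrable lborel (\<lambda>y. f y * \<kappa> (x - y))"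
      "integrable lborel (\<lambda>y. f y * pd i \<kappa> (x - y))" for i
      using assms by (auto intro: conv_integrable test_functions_pd)
    have eq: "(\<lambda>y. f y * (\<kappa> ((x - y) + h) - \<kappa> (x - y) - (\<Sum>i\<in>UNIV. of_real (h $ i) * pd i \<kappa> (x - y))))
      = (\<lambda>y. f y * \<kappa> (x + h - y) - f y * \<kappa> (x - y) -
           (of_real (h $ 1) * (f y * pd 1 \<kappa> (x - y)) + of_real (h $ 2) * (f y * pd 2 \<kappa> (x - y))))"
      by (simp add: sum_UNIV_2 algebra_simps)
    have "conv f \<kappa> (x + h) - conv f \<kappa> x - ?D h =
      (\<integral>y. f y * (\<kappa> ((x - y) + h) - \<kappa> (x - y) - (\<Sum>i\<in>UNIV. of_real (h $ i) * pd i \<kappa> (x - y))) \<partial>lborel)"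
      unfolding eq using i by (simp add: conv_def sum_UNIV_2)
    also have "cmod \<dots> \<le> (\<integral>y. cmod (f y) * (T * (norm h)\<^sup>2) \<partial>lborel)"
    proof (rule Bochner_Integration.integral_norm_bound_integral)
      show "integrable lborel (\<lambda>y. f y * (\<kappa> ((x - y) + h) - \<kappa> (x - y) - (\<Sum>i\<in>UNIV. of_real (h $ i) * pd i \<kappa> (x - y))))"
        unfolding eq using i by simp
      show "norm (f y * (\<kappa> ((x - y) + h) - \<kappa> (x - y) - (\<Sum>i\<in>UNIV. of_real (h $ i) * pd i \<kappa> (x - y)))) \<le> cmod (f y) * (T * (norm h)\<^sup>2)" for y
        unfolding norm_mult by (intro mult_left_mono T) auto
    qed (use f in auto)
    finally show ?thesis by (simp add: mult.assoc)
  qed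
  have "((\<lambda>h. norm (conv f \<kappa> (x + h) - conv f \<kappa> x - ?D h) / norm h) \<longlongrightarrow> 0) (at 0)"
  proof (rule Lim_null_comparison)
    show "\<forall>\<^sub>F h in at 0. norm (norm (conv f \<kappa> (x + h) - conv f \<kappa> x - ?D h) / norm h) \<le> ?F * T * norm h"
      using bd by (intro eventually_at_filter[THEN iffD2] always_eventually)
        (auto simp: divide_simps power2_eq_square mult.assoc)
    have "((\<lambda>h::real^2. ?F * T * norm h) \<longlongrightarrow> ?F * T * norm (0::real^2)) (at 0)" by (rule tendsto_mult[OF tendsto_const tendsto_norm[OF tendsto_ident_at]])
    then show "((\<lambda>h::real^2. ?F * T * norm h) \<longlongrightarrow> 0) (at 0)" by simp
  qed
  then show ?thesis using bl by (simp add: has_derivative_at)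
qed

lemma pd_conv:
  assumes f: "integrable lborel f" and \<kappa>: "\<kappa> \<in> test_functions UNIV"
  shows "pd i (conv f \<kappa>) = conv f (pd i \<kappa>)"
  by (rule ext, subst pd_eqI[OF has_derivative_conv[OF assms]])
    (simp add: axis_def if_distrib if_distribR cong: if_cong)

lemma smooth_conv:
  assumes f: "integrable lborel f" and \<kappa>: "\<kappa> \<in> test_functions UNIV"
  shows "smooth_on UNIV (conv f \<kappa>)"
proof -
  have "Ck_on n UNIV (conv f \<kappa>)" if "\<kappa> \<in> test_functions UNIV" for n \<kappa>
    using that
  proof (induction n arbitrary: \<kappa>)
    case 0
    show ?case unfolding Ck_on.simps
      by (rule differentiable_imp_continuous_on)
        (use has_derivative_conv[OF f 0] in \<open>auto simp: differentiable_on_def differentiable_def\<close>)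
  next
    case (Suc n)
    show ?case
      using has_derivative_conv[OF f Suc.prems] Suc.IH[OF test_functions_pd[OF Suc.prems]]
      by (auto simp: pd_conv[OF f Suc.prems] differentiable_def)
  qed
  then show ?thesis using \<kappa> by (simp add: smooth_on_def)
qed

section \<open>Borel representatives and weak derivatives\<close>

lemma borel_version:
  fixes f :: cfun
  assumes "f \<in> borel_measurable lebesgue"
  obtains f' where "f' \<in> borel_measurable borel" "AE x in lborel. f x = f' x"
proof -
  have "(\<lambda>x. Re (f x)) \<in> borel_measurable lebesgue" "(\<lambda>x. Im (f x)) \<in> borel_measurable lebesgue"
    using assms by measurable
  from this[THEN completion_ex_borel_measurable_real]
  obtain g h where gh: "g \<in> borel_measurable lborel" "h \<in> borel_measurable lborel"
    "AE x in lborel. Re (f x) = g x" "AE x in lborel. Im (f x) = h x" by blast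
  show thesis
  proof
    show "(\<lambda>x. Complex (g x) (h x)) \<in> borel_measurable borel"
      using gh(1,2) by (simp add: Complex_eq)
    show "AE x in lborel. f x = Complex (g x) (h x)"
      using gh(3,4) by eventually_elim (simp add: complex_eq_iff)
  qed
qed

text \<open>Borel representatives turn integrals over \<open>lebesgue_on U\<close> into integrals over \<open>lborel\<close>, where Fubini's
  theorem and translation invariance are at hand.\<close>
definition brep :: "(real^2) set \<Rightarrow> cfun \<Rightarrow> cfun \<Rightarrow> bool" where
  "brep U f f' \<longleftrightarrow> f' \<in> borel_measurable borel \<and> (\<forall>x. x \<notin> U \<longrightarrow> f' x = 0) \<and> (AE x in lborel. x \<in> U \<longrightarrow> f x = f' x)"

lemma brepD:
  assumes "brep U f f'"
  shows "f' \<in> borel_measurable borel" "x \<notin> U \<Longrightarrow> f' x = 0" "AE x in lborel. x \<in> U \<longrightarrow> f x = f' x"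
  using assms by (auto simp: brep_def)

lemma ex_brep:
  assumes "open U" "(\<lambda>x. indicator U x *\<^sub>R f x) \<in> borel_measurable lebesgue"
  obtains f' where "brep U f f'"
proof -
  obtain g where g: "g \<in> borel_measurable borel" "AE x in lborel. indicator U x *\<^sub>R f x = g x"
    using borel_version[OF assms(2)] by blast
  have [measurable]: "U \<in> sets borel" using assms(1) by simp
  show thesis
  proof
    show "brep U f (\<lambda>x. indicator U x *\<^sub>R g x)"
      unfolding brep_def
    proof (intro conjI)
      show "(\<lambda>x. indicator U x *\<^sub>R g x) \<in> borel_measurable borel" using g(1) by measurable
      show "AE x in lborel. x \<in> U \<longrightarrow> f x = indicator U x *\<^sub>R g x"
        using g(2) by eventually_elim auto
    qed auto
  qed
qed

lemma ex_brep_measurable: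
  assumes "open U" "f \<in> borel_measurable (lebesgue_on U)"
  obtains f' where "brep U f f'"
proof -
  have "U \<in> sets lebesgue" using assms(1) by (auto intro: sets_completionI_sets)
  then have "(\<lambda>x. indicator U x *\<^sub>R f x) \<in> borel_measurable lebesgue"
    using assms by (subst (asm) borel_measurable_restrict_space_iff) auto
  then show thesis using ex_brep[OF assms(1)] that by blast
qed

lemma brep_measurable:
  assumes "open U" "brep U f f'"
  shows "(\<lambda>x. indicator U x *\<^sub>R f x) \<in> borel_measurable lebesgue" "f \<in> borel_measurable (lebesgue_on U)"
proof -
  have U: "U \<in> sets lebesgue" using assms(1) by (auto intro: sets_completionI_sets)
  show *: "(\<lambda>x. indicator U x *\<^sub>R f x) \<in> borel_measurable lebesgue"
  proof (rule borel_measurable_AE)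
    show "f' \<in> borel_measurable lebesgue" using brepD(1)[OF assms(2)] by (intro measurable_completion) simp
    show "AE x in lebesgue. f' x = indicator U x *\<^sub>R f x"
      unfolding AE_completion_iff using brepD(3)[OF assms(2)]
      by eventually_elim (use brepD(2)[OF assms(2)] in \<open>auto simp: indicator_def\<close>)
  qed
  then show "f \<in> borel_measurable (lebesgue_on U)"
    using U by (subst borel_measurable_restrict_space_iff) auto
qed

lemma brep_AE_cong:
  assumes "brep U f f'" "AE x in lborel. x \<in> U \<longrightarrow> f x = g x"
  shows "brep U g f'"
proof -
  have "AE x in lborel. x \<in> U \<longrightarrow> g x = f' x"
    using brepD(3)[OF assms(1)] assms(2) by eventually_elim auto
  then show ?thesis using assms(1) by (simp add: brep_def)
qed

lemma brep_restrict:
  assumes "brep U f f'" "open V" "V \<subseteq> U"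
  shows "brep V f (\<lambda>x. indicator V x *\<^sub>R f' x)"
proof -
  have [measurable]: "V \<in> sets borel" "f' \<in> borel_measurable borel" using assms by (auto simp: brep_def)
  have "AE x in lborel. x \<in> V \<longrightarrow> f x = indicator V x *\<^sub>R f' x"
    using brepD(3)[OF assms(1)] by eventually_elim (use assms in auto)
  then show ?thesis by (simp add: brep_def)
qed

lemma brep_binop:
  assumes "brep U f f'" "brep U g g'" "h 0 0 = 0" "(\<lambda>x. h (f' x) (g' x)) \<in> borel_measurable borel"
  shows "brep U (\<lambda>x. h (f x) (g x)) (\<lambda>x. h (f' x) (g' x))"
proof -
  have "AE x in lborel. x \<in> U \<longrightarrow> h (f x) (g x) = h (f' x) (g' x)"
    using brepD(3)[OF assms(1)] brepD(3)[OF assms(2)] by eventually_elim auto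
  then show ?thesis using assms by (simp add: brep_def)
qed

lemma brep_add: "brep U f f' \<Longrightarrow> brep U g g' \<Longrightarrow> brep U (\<lambda>x. f x + g x) (\<lambda>x. f' x + g' x)"
  by (rule brep_binop[where h = "\<lambda>a b. a + b"]) (auto dest!: brepD(1))

lemma brep_diff: "brep U f f' \<Longrightarrow> brep U g g' \<Longrightarrow> brep U (\<lambda>x. f x - g x) (\<lambda>x. f' x - g' x)"
  by (rule brep_binop[where h = "\<lambda>a b. a - b"]) (auto dest!: brepD(1))

lemma brep_indicator:
  assumes "open U" "f \<in> borel_measurable borel"
  shows "brep U f (\<lambda>x. indicator U x *\<^sub>R f x)"
proof -
  have [measurable]: "U \<in> sets borel" "f \<in> borel_measurable borel" using assms by auto
  show ?thesis by (auto simp: brep_def)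
qed

text \<open>Off \<open>U\<close> the representative is zero, and the condition
  \<open>h x 0 = 0\<close> makes the integrand vanish as well, so the restriction to
  \<open>U\<close> disappears. Keeping \<open>h\<close> general covers squares and products with
  test functions at once.\<close>

lemma lint_on_brep:
  fixes h :: "real^2 \<Rightarrow> complex \<Rightarrow> 'a::{banach, second_countable_topology, euclidean_space}"
  assumes U: "open U" and f: "brep U f f'"
    and h: "(\<lambda>x. h x (f' x)) \<in> borel_measurable borel" "\<And>x. x \<notin> U \<Longrightarrow> h x 0 = 0"
  shows "(LINT x|lebesgue_on U. h x (f x)) = (\<integral>x. h x (f' x) \<partial>lborel)"
    and "integrable (lebesgue_on U) (\<lambda>x. h x (f x)) \<longleftrightarrow> integrable lborel (\<lambda>x. h x (f' x))"
proof -
  have U': "U \<in> sets lebesgue" using U by (auto intro: sets_completionI_sets)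
  have m: "(\<lambda>x. h x (f' x)) \<in> borel_measurable lebesgue" using h(1) by (intro measurable_completion) simp
  have ae: "AE x in lebesgue. h x (f' x) = indicator U x *\<^sub>R h x (f x)"
    unfolding AE_completion_iff using brepD(3)[OF f]
    by eventually_elim (use brepD(2)[OF f] h(2) in \<open>auto simp: indicator_def\<close>)
  have m2: "(\<lambda>x. indicator U x *\<^sub>R h x (f x)) \<in> borel_measurable lebesgue"
    by (rule borel_measurable_AE[OF m ae])
  have "(LINT x|lebesgue_on U. h x (f x)) = (LINT x|lebesgue. indicator U x *\<^sub>R h x (f x))"
    using U' by (subst integral_restrict_space) auto
  also have "\<dots> = (LINT x|lebesgue. h x (f' x))"
    using m m2 ae by (intro integral_cong_AE) auto
  also have "\<dots> = (\<integral>x. h x (f' x) \<partial>lborel)" using h(1) by (intro integral_completion) auto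
  finally show "(LINT x|lebesgue_on U. h x (f x)) = (\<integral>x. h x (f' x) \<partial>lborel)" .
  have "integrable (lebesgue_on U) (\<lambda>x. h x (f x)) = integrable lebesgue (\<lambda>x. indicator U x *\<^sub>R h x (f x))"
    using U' by (subst integrable_restrict_space) auto
  also have "\<dots> = integrable lebesgue (\<lambda>x. h x (f' x))"
    using m m2 ae by (intro integrable_cong_AE) auto
  also have "\<dots> = integrable lborel (\<lambda>x. h x (f' x))" using h(1) by (intro integrable_completion) auto
  finally show "integrable (lebesgue_on U) (\<lambda>x. h x (f x)) \<longleftrightarrow> integrable lborel (\<lambda>x. h x (f' x))" .
qed

definition L2b :: "cfun \<Rightarrow> bool" where
  "L2b f \<longleftrightarrow> f \<in> borel_measurable borel \<and> integrable lborel (\<lambda>x. (cmod (f x))\<^sup>2)"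

lemma L2_on_brep:
  assumes "open U" "brep U f f'"
  shows "L2_on U f \<longleftrightarrow> L2b f'"
proof -
  have [measurable]: "f' \<in> borel_measurable borel" using assms(2) by (rule brepD)
  have "integrable (lebesgue_on U) (\<lambda>x. (cmod (f x))\<^sup>2) \<longleftrightarrow> integrable lborel (\<lambda>x. (cmod (f' x))\<^sup>2)"
    by (rule lint_on_brep(2)[OF assms, where h = "\<lambda>_ z. (cmod z)\<^sup>2"]) auto
  then show ?thesis using brep_measurable[OF assms] by (simp add: L2_on_def L2b_def)
qed

lemma L2_on_ex_brep:
  assumes "open U" "L2_on U f"
  obtains f' where "brep U f f'" "L2b f'"
  using assms L2_on_brep ex_brep_measurable[OF assms(1)] unfolding L2_on_def by metis

lemma L2_norm_on_brep:
  assumes "open U" "brep U f f'"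
  shows "L2_norm_on U f = sqrt (\<integral>x. (cmod (f' x))\<^sup>2 \<partial>lborel)"
proof -
  have [measurable]: "f' \<in> borel_measurable borel" using assms(2) by (rule brepD)
  show ?thesis unfolding L2_norm_on_def
    by (subst lint_on_brep(1)[OF assms, where h = "\<lambda>_ z. (cmod z)\<^sup>2"]) auto
qed

lemma lint_on_mult_brep:
  assumes "open U" "brep U f f'" "\<psi> \<in> borel_measurable borel"
  shows "(LINT x|lebesgue_on U. f x * \<psi> x) = (\<integral>x. f' x * \<psi> x \<partial>lborel)"
proof -
  have [measurable]: "f' \<in> borel_measurable borel" using assms(2) by (rule brepD)
  show ?thesis using assms(3) by (subst lint_on_brep(1)[OF assms(1,2), where h = "\<lambda>x z. z * \<psi> x"]) auto
qed

lemma locally_integrable_on_brep: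
  assumes "open U" "brep U f f'"
  shows "locally_integrable_on U f \<longleftrightarrow> (\<forall>K. compact K \<and> K \<subseteq> U \<longrightarrow> integrable lborel (\<lambda>x. indicator K x *\<^sub>R f' x))"
proof -
  have [measurable]: "f' \<in> borel_measurable borel" using assms(2) by (rule brepD)
  have "f absolutely_integrable_on K \<longleftrightarrow> integrable lborel (\<lambda>x. indicator K x *\<^sub>R f' x)" if K: "compact K" "K \<subseteq> U" for K
  proof -
    have [measurable]: "K \<in> sets borel" using K by (simp add: borel_compact)
    have m: "(\<lambda>x. indicator K x *\<^sub>R f' x) \<in> borel_measurable lborel" by simp
    have ae: "AE x in lebesgue. indicator K x *\<^sub>R f' x = indicator K x *\<^sub>R f x"
      unfolding AE_completion_iff using brepD(3)[OF assms(2)]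
      by eventually_elim (use K in \<open>auto simp: indicator_def\<close>)
    have "(\<lambda>x. indicator K x *\<^sub>R f x) \<in> borel_measurable lebesgue"
      by (rule borel_measurable_AE[OF measurable_completion[OF m] ae])
    then have "f absolutely_integrable_on K \<longleftrightarrow> integrable lebesgue (\<lambda>x. indicator K x *\<^sub>R f' x)"
      unfolding set_integrable_def
      by (intro integrable_cong_AE measurable_completion[OF m]) (use ae in \<open>auto elim: eventually_mono\<close>)
    then show ?thesis using integrable_completion[OF m] by simp
  qed
  then show ?thesis by (auto simp: locally_integrable_on_def)
qed

text \<open>Local integrability gives measurability on compact sets only; exhausting
  \<open>U\<close> by finite unions of closed boxes and passing to the limit gives it on
  \<open>U\<close>.\<close>

lemma locally_integrable_ex_brep:
  assumes "open U" "locally_integrable_on U f"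
  obtains f' where "brep U f f'" "\<And>K. compact K \<Longrightarrow> K \<subseteq> U \<Longrightarrow> integrable lborel (\<lambda>x. indicator K x *\<^sub>R f' x)"
proof -
  obtain D where D: "countable D" "D \<subseteq> Pow U" "\<And>X. X \<in> D \<Longrightarrow> \<exists>a b. X = cbox a b" "\<Union>D = U"
    using open_countable_Union_open_cbox[OF assms(1)] by metis
  have "(\<lambda>x. indicator U x *\<^sub>R f x) \<in> borel_measurable lebesgue"
  proof (cases "D = {}")
    case False
    define K where "K n = (\<Union>i\<le>n. from_nat_into D i)" for n :: nat
    have inD: "from_nat_into D i \<in> D" for i using False by (rule from_nat_into)
    have cK: "compact (K n)" "K n \<subseteq> U" for n
    proof -
      have "compact (from_nat_into D i)" for i using D(3)[OF inD] by (metis compact_cbox)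
      then show "compact (K n)" unfolding K_def by (intro compact_UN) auto
      show "K n \<subseteq> U" unfolding K_def using inD D(2) by blast
    qed
    show ?thesis
    proof (rule borel_measurable_LIMSEQ_metric)
      show "(\<lambda>x. indicator (K n) x *\<^sub>R f x) \<in> borel_measurable lebesgue" for n
        using assms(2) cK[of n] unfolding locally_integrable_on_def set_integrable_def
        by (auto dest: borel_measurable_integrable)
      fix x
      show "(\<lambda>n. indicator (K n) x *\<^sub>R f x) \<longlonglongrightarrow> indicator U x *\<^sub>R f x"
      proof (cases "x \<in> U")
        case True
        then obtain X where "X \<in> D" "x \<in> X" using D(4) by auto
        then obtain m where "x \<in> from_nat_into D m" using from_nat_into_surj[OF D(1)] by metis
        then have "x \<in> K n" if "n \<ge> m" for n using that by (auto simp: K_def)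
        then have "\<forall>\<^sub>F n in sequentially. indicator U x *\<^sub>R f x = indicator (K n) x *\<^sub>R f x"
          by (intro eventually_sequentiallyI[of m]) (use True in auto)
        then show ?thesis by (rule Lim_transform_eventually[OF tendsto_const])
      next
        case False
        then have "x \<notin> K n" for n using cK by auto
        then show ?thesis using False by simp
      qed
    qed
  qed (use D in auto)
  then obtain f' where "brep U f f'" using ex_brep[OF assms(1)] by blast
  then show thesis using that locally_integrable_on_brep[OF assms(1)] assms(2) by blast
qed

section \<open>The fundamental lemma of the calculus of variations\<close>

lemma box_Int_box_cart:
  fixes a :: "real^'n"
  shows "box a b \<inter> box c d = box (\<chi> i. max (a$i) (c$i)) (\<chi> i. min (b$i) (d$i))"
  by (auto simp: mem_box_cart)

text \<open>The bumps recover the integral of \<open>h\<close> over every open box. Boxes form a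
  generator of the Borel sets closed under intersection, and the sets over which \<open>h\<close>
  integrates to zero are closed under complements and countable disjoint unions, so \<open>h\<close>
  integrates to zero over every Borel set.\<close>

lemma fundamental_lemma_box:
  fixes h :: cfun
  assumes h: "integrable lborel h" "\<And>x. x \<notin> box a b \<Longrightarrow> h x = 0"
    and 0: "\<And>c d m. box c d \<subseteq> box a b \<Longrightarrow> cbox c d \<subseteq> cbox a b \<Longrightarrow>
      (\<integral>x. h x * complex_of_real (box_bump c d m x) \<partial>lborel) = 0"
  shows "AE x in lborel. h x = 0"
proof (rule sigma_finite_measure.density_zero[OF sigma_finite_lborel h(1)])
  have [measurable]: "h \<in> borel_measurable borel" using h(1) by auto
  have box: "(\<integral>x. indicator (box c d) x *\<^sub>R h x \<partial>lborel) = 0" for c d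
  proof -
    \<comment> \<open>Only the part inside the given box matters, since \<open>h\<close> vanishes
      elsewhere; intersecting keeps the bumps admissible.\<close>
    define c' d' where "c' = (\<chi> i. max (c$i) (a$i))" and "d' = (\<chi> i. min (d$i) (b$i))"
    have eq: "box c d \<inter> box a b = box c' d'"
      unfolding c'_def d'_def by (rule box_Int_box_cart)
    have "cbox c' d' \<subseteq> cbox a b" by (auto simp: mem_box_cart c'_def d'_def)
    moreover have "box c' d' \<subseteq> box a b" using eq by blast
    ultimately have z: "(\<integral>x. h x * complex_of_real (box_bump c' d' m x) \<partial>lborel) = 0" for m
      by (intro 0)
    have "(\<lambda>m. \<integral>x. h x * complex_of_real (box_bump c' d' m x) \<partial>lborel) \<longlonglongrightarrow> (\<integral>x. indicator (box c d) x *\<^sub>R h x \<partial>lborel)"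
    proof (rule integral_dominated_convergence[where w = "\<lambda>x. norm (h x)"])
      show "AE x in lborel. (\<lambda>m. h x * complex_of_real (box_bump c' d' m x)) \<longlonglongrightarrow> indicator (box c d) x *\<^sub>R h x"
      proof (rule AE_I2)
        fix x
        have "(\<lambda>m. h x * complex_of_real (box_bump c' d' m x)) \<longlonglongrightarrow> h x * complex_of_real (indicator (box c' d') x)"
          by (intro tendsto_intros box_bump_limit)
        moreover have "h x * complex_of_real (indicator (box c' d') x) = indicator (box c d) x *\<^sub>R h x"
          unfolding eq[symmetric] using h(2)[of x] by (auto simp: indicator_def)
        ultimately show "(\<lambda>m. h x * complex_of_real (box_bump c' d' m x)) \<longlonglongrightarrow> indicator (box c d) x *\<^sub>R h x"
          by simp
      qed
      show "(\<lambda>x. h x * complex_of_real (box_bump c' d' m x)) \<in> borel_measurable lborel" for m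
        using test_measurable[OF test_box_bump[OF order_refl[of "cbox c' d'"]]] by measurable
      show "AE x in lborel. norm (h x * complex_of_real (box_bump c' d' m x)) \<le> norm (h x)" for m
        using box_bump_bounds by (auto simp: norm_mult mult_left_le)
    qed (use h in auto)
    then have "(\<lambda>m. 0) \<longlonglongrightarrow> (\<integral>x. indicator (box c d) x *\<^sub>R h x \<partial>lborel)"
      using z by simp
    then show ?thesis using LIMSEQ_unique tendsto_const by blast
  qed
  fix A :: "(real^2) set" assume "A \<in> sets lborel"
  then have A: "A \<in> sigma_sets UNIV (range (\<lambda>(a, b). box a b))"
    by (simp add: borel_eq_box)
  have "Int_stable (range (\<lambda>(a, b). box a b :: (real^2) set))"
    unfolding Int_stable_def by (auto simp: box_Int_box_cart)
  moreover have "range (\<lambda>(a, b). box a b :: (real^2) set) \<subseteq> Pow UNIV" by simp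
  ultimately show "set_lebesgue_integral lborel A h = 0"
    using A
  proof (induction rule: sigma_sets_induct_disjoint)
    case (basic A)
    then show ?case using box by (auto simp: set_lebesgue_integral_def)
  next
    case empty
    show ?case by (simp add: set_lebesgue_integral_def)
  next
    case (compl A)
    then have [measurable]: "A \<in> sets borel" by (simp add: borel_eq_box)
    \<comment> \<open>The whole plane contributes what the box from \<open>a\<close> to
      \<open>b\<close> does, namely zero, so complements follow by subtraction.\<close>
    have "(\<integral>x. h x \<partial>lborel) = (\<integral>x. indicator (box a b) x *\<^sub>R h x \<partial>lborel)"
      by (rule Bochner_Integration.integral_cong) (use h(2) in \<open>auto simp: indicator_def\<close>)
    then have "(\<integral>x. h x \<partial>lborel) = 0" using box by simp
    moreover have "(\<integral>x. indicator (UNIV - A) x *\<^sub>R h x \<partial>lborel) = (\<integral>x. h x - indicator A x *\<^sub>R h x \<partial>lborel)"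
      by (rule Bochner_Integration.integral_cong) (auto simp: indicator_def)
    moreover have "\<dots> = (\<integral>x. h x \<partial>lborel) - (\<integral>x. indicator A x *\<^sub>R h x \<partial>lborel)"
      using h(1) by (intro Bochner_Integration.integral_diff integrable_mult_indicator) auto
    ultimately show ?case using compl by (simp add: set_lebesgue_integral_def)
  next
    case (union A)
    then have [measurable]: "A i \<in> sets borel" for i by (auto simp add: borel_eq_box)
    have "set_lebesgue_integral lborel (\<Union>i. A i) h = (\<Sum>i. set_lebesgue_integral lborel (A i) h)"
    proof (rule lebesgue_integral_countable_add)
      show "set_integrable lborel (\<Union> (range A)) h"
        unfolding set_integrable_def using h(1) by (intro integrable_mult_indicator) auto
    qed (use union in \<open>auto simp: disjoint_family_on_def\<close>)
    then show ?case using union by simp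
  qed
qed

text \<open>The box version applies on every closed box inside \<open>U\<close>; box boundaries are
  null, and countably many closed boxes cover \<open>U\<close>.\<close>

lemma fundamental_lemma:
  fixes h :: cfun
  assumes U: "open U" and h: "h \<in> borel_measurable borel"
    "\<And>K. compact K \<Longrightarrow> K \<subseteq> U \<Longrightarrow> integrable lborel (\<lambda>x. indicator K x *\<^sub>R h x)"
    and 0: "\<And>\<phi>. \<phi> \<in> test_functions U \<Longrightarrow> (\<integral>x. h x * \<phi> x \<partial>lborel) = 0"
  shows "AE x in lborel. x \<in> U \<longrightarrow> h x = 0"
proof -
  note [measurable] = h(1)
  have *: "AE x in lborel. x \<in> box a b \<longrightarrow> h x = 0" if ab: "cbox a b \<subseteq> U" for a b
  proof -
    have i: "integrable lborel (\<lambda>x. indicator (box a b) x *\<^sub>R h x)"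
    proof (rule Bochner_Integration.integrable_bound[OF h(2)[OF compact_cbox ab]])
      have "norm (indicator (box a b) x *\<^sub>R h x) \<le> norm (indicator (cbox a b) x *\<^sub>R h x)" for x
        using box_subset_cbox[of a b] by (auto simp: indicator_def)
      then show "AE x in lborel. norm (indicator (box a b) x *\<^sub>R h x) \<le> norm (indicator (cbox a b) x *\<^sub>R h x)"
        by simp
    qed simp
    have "AE x in lborel. indicator (box a b) x *\<^sub>R h x = 0"
    proof (rule fundamental_lemma_box[OF i])
      fix c d m assume cd: "box c d \<subseteq> box a b" "cbox c d \<subseteq> cbox a b"
      have "(\<integral>x. h x * complex_of_real (box_bump c d m x) \<partial>lborel) = 0"
        using ab cd by (intro 0 test_box_bump) blast
      moreover have "(\<lambda>x. indicator (box a b) x *\<^sub>R h x * complex_of_real (box_bump c d m x)) = (\<lambda>x. h x * complex_of_real (box_bump c d m x))"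
        using cd(1) box_bump_eq_0[of _ c d m] by (fastforce simp: indicator_def fun_eq_iff)
      ultimately show "(\<integral>x. indicator (box a b) x *\<^sub>R h x * complex_of_real (box_bump c d m x) \<partial>lborel) = 0" by simp
    qed auto
    then show ?thesis by eventually_elim (auto simp: indicator_def split: if_splits)
  qed
  have c: "AE x in lborel. x \<in> cbox a b \<longrightarrow> h x = 0" if ab: "cbox a b \<subseteq> U" for a b
  proof -
    have "cbox a b - box a b \<in> null_sets lborel"
      using negligible_frontier_interval[of a b]
      by (simp add: negligible_iff_null_sets null_sets_completion_iff)
    then have "AE x in lborel. x \<notin> cbox a b - box a b" by (rule AE_not_in)
    with *[OF ab] show ?thesis by eventually_elim auto
  qed
  obtain D where D: "countable D" "D \<subseteq> Pow U" "\<And>X. X \<in> D \<Longrightarrow> \<exists>a b. X = cbox a b" "\<Union>D = U"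
    using open_countable_Union_open_cbox[OF U] by metis
  have "AE x in lborel. \<forall>X\<in>D. x \<in> X \<longrightarrow> h x = 0"
    unfolding AE_ball_countable[OF D(1)]
  proof
    fix X assume "X \<in> D"
    moreover then obtain a b where "X = cbox a b" using D(3) by blast
    ultimately show "AE x in lborel. x \<in> X \<longrightarrow> h x = 0" using c D(2) by blast
  qed
  then show ?thesis by eventually_elim (use D(4) in auto)
qed

section \<open>Uniqueness of weak derivatives and independence of representatives\<close>

lemma weak_pd_brep:
  assumes "open U" "brep U f f'" "brep U g g'"
  shows "is_weak_pd U i f g \<longleftrightarrow> locally_integrable_on U f \<and> locally_integrable_on U g \<and>
     (\<forall>\<phi>\<in>test_functions U. (\<integral>x. f' x * pd i \<phi> x \<partial>lborel) = - (\<integral>x. g' x * \<phi> x \<partial>lborel))"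
  unfolding is_weak_pd_def
  by (intro conj_cong refl ball_cong)
    (simp only: lint_on_mult_brep[OF assms(1,2) test_measurable[OF test_functions_pd]]
      lint_on_mult_brep[OF assms(1,3) test_measurable])

lemma integrable_loc_mult_test:
  assumes "\<And>K. compact K \<Longrightarrow> K \<subseteq> U \<Longrightarrow> integrable lborel (\<lambda>x. indicator K x *\<^sub>R h x)"
    and "\<phi> \<in> test_functions U"
  shows "integrable lborel (\<lambda>x. h x * \<phi> x)"
proof -
  obtain K where K: "compact K" "K \<subseteq> U" "\<And>x. x \<notin> K \<Longrightarrow> \<phi> x = 0"
    using assms(2) by (rule test_functionsE) blast
  have "integrable lborel (\<lambda>x. (indicator K x *\<^sub>R h x) * \<phi> x)"
    using assms K by (intro integrable_mult_test)
  moreover have "(\<lambda>x. (indicator K x *\<^sub>R h x) * \<phi> x) = (\<lambda>x. h x * \<phi> x)"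
    using K by (auto simp: indicator_def fun_eq_iff)
  ultimately show ?thesis by simp
qed

text \<open>Since \<open>wpd\<close> is a choice among all weak derivatives, and \<open>wlap\<close>
  iterates it, every identity for them rests on uniqueness up to null sets, here also up to the
  representative of the function being differentiated.\<close>

lemma weak_pd_unique:
  assumes U: "open U" and 1: "is_weak_pd U i f1 g1" and 2: "is_weak_pd U i f2 g2"
    and eq: "AE x in lborel. x \<in> U \<longrightarrow> f1 x = f2 x"
  shows "AE x in lborel. x \<in> U \<longrightarrow> g1 x = g2 x"
proof -
  have l: "locally_integrable_on U f1" "locally_integrable_on U g1" "locally_integrable_on U g2"
    using 1 2 by (auto simp: is_weak_pd_def)
  obtain f' where f': "brep U f1 f'" using locally_integrable_ex_brep[OF U l(1)] by blast
  obtain g1' where g1: "brep U g1 g1'" "\<And>K. compact K \<Longrightarrow> K \<subseteq> U \<Longrightarrow> integrable lborel (\<lambda>x. indicator K x *\<^sub>R g1' x)"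
    using locally_integrable_ex_brep[OF U l(2)] by blast
  obtain g2' where g2: "brep U g2 g2'" "\<And>K. compact K \<Longrightarrow> K \<subseteq> U \<Longrightarrow> integrable lborel (\<lambda>x. indicator K x *\<^sub>R g2' x)"
    using locally_integrable_ex_brep[OF U l(3)] by blast
  have f2: "brep U f2 f'" using brep_AE_cong[OF f' eq] .
  have "AE x in lborel. x \<in> U \<longrightarrow> g1' x - g2' x = 0"
  proof (rule fundamental_lemma[OF U])
    show "(\<lambda>x. g1' x - g2' x) \<in> borel_measurable borel" using brepD(1)[OF g1(1)] brepD(1)[OF g2(1)] by simp
    show "integrable lborel (\<lambda>x. indicator K x *\<^sub>R (g1' x - g2' x))" if "compact K" "K \<subseteq> U" for K
      using Bochner_Integration.integrable_diff[OF g1(2)[OF that] g2(2)[OF that]] by (simp add: algebra_simps)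
    fix \<phi> assume \<phi>: "\<phi> \<in> test_functions U"
    have "(\<integral>x. (g1' x - g2' x) * \<phi> x \<partial>lborel) = (\<integral>x. g1' x * \<phi> x - g2' x * \<phi> x \<partial>lborel)"
      by (simp add: algebra_simps)
    also have "\<dots> = (\<integral>x. g1' x * \<phi> x \<partial>lborel) - (\<integral>x. g2' x * \<phi> x \<partial>lborel)"
      by (intro Bochner_Integration.integral_diff integrable_loc_mult_test[OF _ \<phi>] g1(2) g2(2))
    also have "\<dots> = 0"
      using 1[unfolded weak_pd_brep[OF U f' g1(1)]] 2[unfolded weak_pd_brep[OF U f2 g2(1)]] \<phi> by simp
    finally show "(\<integral>x. (g1' x - g2' x) * \<phi> x \<partial>lborel) = 0" .
  qed
  with brepD(3)[OF g1(1)] brepD(3)[OF g2(1)] show ?thesis by eventually_elim auto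
qed

lemma is_weak_pd_wpd: "is_weak_pd U i f g \<Longrightarrow> is_weak_pd U i f (wpd U i f)"
  unfolding wpd_def by (rule someI[where P = "is_weak_pd U i f"])

lemma wpd_AE:
  assumes "open U" "is_weak_pd U i f g"
  shows "AE x in lborel. x \<in> U \<longrightarrow> wpd U i f x = g x"
  using weak_pd_unique[OF assms(1) is_weak_pd_wpd[OF assms(2)] assms(2)] by simp

lemma locally_integrable_AE_cong:
  assumes "open U" "AE x in lborel. x \<in> U \<longrightarrow> f x = g x" "locally_integrable_on U f"
  shows "locally_integrable_on U g"
proof -
  obtain f' where f: "brep U f f'" using locally_integrable_ex_brep[OF assms(1,3)] by blast
  show ?thesis
    using assms(3) locally_integrable_on_brep[OF assms(1) f] locally_integrable_on_brep[OF assms(1) brep_AE_cong[OF f assms(2)]] by simp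
qed

lemma is_weak_pd_AE_cong:
  assumes U: "open U" and "AE x in lborel. x \<in> U \<longrightarrow> f1 x = f2 x" "AE x in lborel. x \<in> U \<longrightarrow> g1 x = g2 x"
    and w: "is_weak_pd U i f1 g1"
  shows "is_weak_pd U i f2 g2"
proof -
  have l: "locally_integrable_on U f1" "locally_integrable_on U g1"
    using w by (auto simp: is_weak_pd_def)
  obtain f' where f': "brep U f1 f'" using locally_integrable_ex_brep[OF U l(1)] by blast
  obtain g' where g': "brep U g1 g'" using locally_integrable_ex_brep[OF U l(2)] by blast
  show ?thesis
    using w locally_integrable_AE_cong[OF U assms(2)] locally_integrable_AE_cong[OF U assms(3)]
    unfolding weak_pd_brep[OF U f' g'] weak_pd_brep[OF U brep_AE_cong[OF f' assms(2)] brep_AE_cong[OF g' assms(3)]]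
    by blast
qed

lemma L2_on_AE_cong:
  assumes "open U" "AE x in lborel. x \<in> U \<longrightarrow> f x = g x" "L2_on U f"
  shows "L2_on U g"
proof -
  obtain f' where f: "brep U f f'" "L2b f'" using L2_on_ex_brep[OF assms(1,3)] by blast
  then show ?thesis using L2_on_brep[OF assms(1) brep_AE_cong[OF f(1) assms(2)]] by simp
qed

lemma sobolev_AE_cong:
  assumes U: "open U"
  shows "AE x in lborel. x \<in> U \<longrightarrow> f x = g x \<Longrightarrow> sobolev m U f \<Longrightarrow> sobolev m U g"
proof (induction m arbitrary: f g)
  case 0
  then show ?case using L2_on_AE_cong[OF U] by simp
next
  case (Suc m)
  have "\<exists>h. is_weak_pd U i g h \<and> sobolev m U h" for i
  proof -
    obtain h where "is_weak_pd U i f h" "sobolev m U h" using Suc.prems(2) by auto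
    then show ?thesis using is_weak_pd_AE_cong[OF U Suc.prems(1), of h h i] by auto
  qed
  then show ?case
    using Suc.prems(2) L2_on_AE_cong[OF U Suc.prems(1)] by auto
qed

lemma sobolev_L2: "sobolev m U f \<Longrightarrow> L2_on U f"
  by (cases m) auto

text \<open>The definition of \<open>sobolev\<close> provides some weak derivative of the right
  class; uniqueness passes the class on to the chosen one.\<close>

lemma sobolev_Suc_wpd:
  assumes U: "open U" and f: "sobolev (Suc m) U f"
  shows "is_weak_pd U i f (wpd U i f)" "sobolev m U (wpd U i f)"
proof -
  obtain g where g: "is_weak_pd U i f g" "sobolev m U g" using f by auto
  show "is_weak_pd U i f (wpd U i f)" using g(1) by (rule is_weak_pd_wpd)
  have "AE x in lborel. x \<in> U \<longrightarrow> g x = wpd U i f x"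
    using wpd_AE[OF U g(1)] by eventually_elim auto
  then show "sobolev m U (wpd U i f)" using sobolev_AE_cong[OF U] g(2) by blast
qed

section \<open>Mollification in the square mean\<close>

text \<open>The squared norm takes values in the extended nonnegative reals, so that monotone
  bounds, Fatou and Fubini apply before finiteness is known.\<close>

definition N2 :: "cfun \<Rightarrow> ennreal" where
  "N2 f = (\<integral>\<^sup>+x. ennreal ((cmod (f x))\<^sup>2) \<partial>lborel)"

lemma L2b_iff_N2: "L2b f \<longleftrightarrow> f \<in> borel_measurable borel \<and> N2 f < \<infinity>"
  unfolding L2b_def N2_def by (auto simp: integrable_iff_bounded)

lemma N2_eq_integral: "L2b f \<Longrightarrow> N2 f = ennreal (\<integral>x. (cmod (f x))\<^sup>2 \<partial>lborel)"
  unfolding N2_def L2b_def by (intro nn_integral_eq_integral) auto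

lemma cmod_add_sq_le: "(cmod (a + b))\<^sup>2 \<le> 2 * (cmod a)\<^sup>2 + 2 * (cmod b)\<^sup>2"
proof -
  have "(cmod (a + b))\<^sup>2 \<le> (cmod a + cmod b)\<^sup>2" by (intro power_mono norm_triangle_ineq) auto
  also have "\<dots> \<le> 2 * (cmod a)\<^sup>2 + 2 * (cmod b)\<^sup>2"
    using sum_squares_ge_zero[of "cmod a - cmod b" 0] by (simp add: power2_eq_square algebra_simps)
  finally show ?thesis .
qed

lemma N2_mono:
  assumes "\<And>x. cmod (f x) \<le> cmod (g x)"
  shows "N2 f \<le> N2 g"
  unfolding N2_def using assms by (intro nn_integral_mono ennreal_leI power_mono) auto

lemma N2_cong_AE: "AE x in lborel. f x = g x \<Longrightarrow> N2 f = N2 g"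
  unfolding N2_def by (intro nn_integral_cong_AE) (auto elim: eventually_mono)

lemma N2_add:
  assumes [measurable]: "f \<in> borel_measurable borel" "g \<in> borel_measurable borel"
  shows "N2 (\<lambda>x. f x + g x) \<le> 2 * N2 f + 2 * N2 g"
proof -
  have "N2 (\<lambda>x. f x + g x) \<le> (\<integral>\<^sup>+x. 2 * ennreal ((cmod (f x))\<^sup>2) + 2 * ennreal ((cmod (g x))\<^sup>2) \<partial>lborel)"
    unfolding N2_def
  proof (intro nn_integral_mono)
    fix x
    have "ennreal ((cmod (f x + g x))\<^sup>2) \<le> ennreal (2 * (cmod (f x))\<^sup>2 + 2 * (cmod (g x))\<^sup>2)"
      by (intro ennreal_leI cmod_add_sq_le)
    then show "ennreal ((cmod (f x + g x))\<^sup>2) \<le> 2 * ennreal ((cmod (f x))\<^sup>2) + 2 * ennreal ((cmod (g x))\<^sup>2)"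
      by (simp add: ennreal_mult)
  qed
  also have "\<dots> = 2 * N2 f + 2 * N2 g"
    unfolding N2_def by (simp add: nn_integral_add nn_integral_cmult)
  finally show ?thesis .
qed

lemma N2_diff_commute: "N2 (\<lambda>x. f x - g x) = N2 (\<lambda>x. g x - f x)"
  by (simp add: N2_def norm_minus_commute)

lemma N2_triangle:
  assumes [measurable]: "f \<in> borel_measurable borel" "g \<in> borel_measurable borel" "h \<in> borel_measurable borel"
  shows "N2 (\<lambda>x. f x - h x) \<le> 2 * N2 (\<lambda>x. f x - g x) + 2 * N2 (\<lambda>x. g x - h x)"
  using N2_add[of "\<lambda>x. f x - g x" "\<lambda>x. g x - h x"] by simp

lemma N2_cmult: "f \<in> borel_measurable borel \<Longrightarrow> N2 (\<lambda>x. a * f x) = ennreal ((cmod a)\<^sup>2) * N2 f"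
  unfolding N2_def by (simp add: norm_mult power_mult_distrib ennreal_mult nn_integral_cmult)

lemma L2b_add: "L2b f \<Longrightarrow> L2b g \<Longrightarrow> L2b (\<lambda>x. f x + g x)"
  using N2_add[of f g] by (auto simp: L2b_iff_N2 ennreal_mult_less_top intro: le_less_trans)

lemma L2b_cmult: "L2b f \<Longrightarrow> L2b (\<lambda>x. a * f x)"
  by (auto simp: L2b_iff_N2 N2_cmult ennreal_mult_less_top)

lemma L2b_diff: "L2b f \<Longrightarrow> L2b g \<Longrightarrow> L2b (\<lambda>x. f x - g x)"
  using L2b_add[of f "\<lambda>x. (-1) * g x"] L2b_cmult[of g "-1"] by simp

lemma L2b_measurable: "L2b f \<Longrightarrow> f \<in> borel_measurable borel"
  by (simp add: L2b_def)

lemma L2b_AE_cong: "L2b f \<Longrightarrow> g \<in> borel_measurable borel \<Longrightarrow> AE x in lborel. f x = g x \<Longrightarrow> L2b g"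
  using N2_cong_AE[of f g] by (simp add: L2b_iff_N2)

lemma L2b_bounded_mult:
  assumes "L2b f" "g \<in> borel_measurable borel" "\<And>x. cmod (g x) \<le> B"
  shows "L2b (\<lambda>x. f x * g x)"
proof -
  have B: "0 \<le> B" using assms(3)[of 0] norm_ge_zero order_trans by blast
  have "N2 (\<lambda>x. f x * g x) \<le> N2 (\<lambda>x. complex_of_real B * f x)"
    using assms(3) B by (intro N2_mono) (simp add: norm_mult, metis mult.commute mult_left_mono norm_ge_zero)
  also have "\<dots> < \<infinity>" using L2b_cmult[OF assms(1)] by (simp add: L2b_iff_N2)
  finally show ?thesis using assms by (auto simp: L2b_iff_N2)
qed

lemma integrable_sq_compact:
  fixes f :: cfun
  assumes "continuous_on UNIV f" "compact K" "\<And>x. x \<notin> K \<Longrightarrow> f x = 0"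
  shows "L2b f"
proof -
  have "integrable lborel (\<lambda>x. indicator K x *\<^sub>R (cmod (f x))\<^sup>2)"
    using assms(1,2) by (intro borel_integrable_compact continuous_intros) (auto intro: continuous_on_subset)
  moreover have "(\<lambda>x. indicator K x *\<^sub>R (cmod (f x))\<^sup>2) = (\<lambda>x. (cmod (f x))\<^sup>2)"
    using assms by (auto simp: indicator_def fun_eq_iff)
  ultimately show ?thesis using assms by (simp add: L2b_def borel_measurable_continuous_onI)
qed

lemma L2b_test: "\<phi> \<in> test_functions U \<Longrightarrow> L2b \<phi>"
  by (elim test_functionsE) (auto intro: integrable_sq_compact smooth_on_continuous)

text \<open>On the disc |f| is at most |f|^2 + 1, and the disc has finite measure.\<close>

lemma L2b_integrable:
  assumes f: "L2b f" and M: "\<And>x. x \<notin> cball 0 M \<Longrightarrow> f x = 0"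
  shows "integrable lborel f"
proof (rule Bochner_Integration.integrable_bound)
  show "integrable lborel (\<lambda>x. (cmod (f x))\<^sup>2 + indicator (cball 0 M) x *\<^sub>R (1::real))"
    using f by (intro Bochner_Integration.integrable_add borel_integrable_compact) (auto simp: L2b_def)
  show "f \<in> borel_measurable lborel" using f by (simp add: L2b_def)
  have "cmod z \<le> (cmod z)\<^sup>2 + 1" for z :: complex
    using sum_squares_ge_zero[of "cmod z - 1" 0] by (simp add: power2_eq_square algebra_simps)
      (smt (verit) mult_nonneg_nonneg norm_ge_zero)
  then have "norm (f x) \<le> norm ((cmod (f x))\<^sup>2 + indicator (cball 0 M) x *\<^sub>R (1::real))" for x
    using M[of x] by (auto simp: indicator_def)
  then show "AE x in lborel. norm (f x) \<le> norm ((cmod (f x))\<^sup>2 + indicator (cball 0 M) x *\<^sub>R (1::real))"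
    by simp
qed

lemma Cauchy_Schwarz_L2b:
  assumes f: "L2b f" and g: "L2b g"
  shows "integrable lborel (\<lambda>x. f x * g x)"
    "ennreal ((cmod (\<integral>x. f x * g x \<partial>lborel))\<^sup>2) \<le> N2 f * N2 g"
proof -
  have [measurable]: "f \<in> borel_measurable borel" "g \<in> borel_measurable borel"
    using f g by (auto simp: L2b_def)
  have cs: "(\<integral>\<^sup>+x. ennreal (cmod (f x)) * ennreal (cmod (g x)) \<partial>lborel)\<^sup>2 \<le> N2 f * N2 g"
    unfolding N2_def
    using Cauchy_Schwarz_nn_integral[of "\<lambda>x. ennreal (cmod (f x))" lborel "\<lambda>x. ennreal (cmod (g x))"]
    by (simp add: ennreal_power)
  have eq: "(\<integral>\<^sup>+x. ennreal (norm (f x * g x)) \<partial>lborel) = (\<integral>\<^sup>+x. ennreal (cmod (f x)) * ennreal (cmod (g x)) \<partial>lborel)"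
    by (simp add: norm_mult ennreal_mult)
  have "N2 f * N2 g < \<infinity>" using f g by (simp add: L2b_iff_N2 ennreal_mult_less_top)
  then have "(\<integral>\<^sup>+x. ennreal (norm (f x * g x)) \<partial>lborel)\<^sup>2 < \<infinity>" using cs eq by (simp add: le_less_trans)
  then have "(\<integral>\<^sup>+x. ennreal (norm (f x * g x)) \<partial>lborel) < \<infinity>" by (simp add: power_less_top_ennreal)
  then show i: "integrable lborel (\<lambda>x. f x * g x)" by (intro integrableI_bounded) auto
  have "ennreal ((cmod (\<integral>x. f x * g x \<partial>lborel))\<^sup>2) = (ennreal (cmod (\<integral>x. f x * g x \<partial>lborel)))\<^sup>2"
    by (simp add: ennreal_power)
  also have "\<dots> \<le> (\<integral>\<^sup>+x. ennreal (norm (f x * g x)) \<partial>lborel)\<^sup>2"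
    using integral_norm_bound_ennreal[OF i] by (intro power_mono) auto
  also have "\<dots> \<le> N2 f * N2 g" using cs eq by simp
  finally show "ennreal ((cmod (\<integral>x. f x * g x \<partial>lborel))\<^sup>2) \<le> N2 f * N2 g" .
qed

lemma N2_affine:
  assumes [measurable]: "f \<in> borel_measurable borel" and "c \<noteq> 0"
  shows "N2 f = ennreal (c\<^sup>2) * N2 (\<lambda>x. f (t + c *\<^sub>R x))"
  unfolding N2_def by (rule nn_integral_affine_vec2[of "\<lambda>x. ennreal ((cmod (f x))\<^sup>2)"]) (use assms in auto)

section \<open>Density of continuous functions in the square mean\<close>

lemma N2_tendsto_0_dominated:
  assumes [measurable]: "\<And>n. h n \<in> borel_measurable borel"
    and w: "integrable lborel w" "\<And>n x. (cmod (h n x))\<^sup>2 \<le> w x"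
    and lim: "AE x in lborel. (\<lambda>n. h n x) \<longlonglongrightarrow> 0"
  shows "(\<lambda>n. N2 (h n)) \<longlonglongrightarrow> 0"
proof -
  have i: "L2b (h n)" for n unfolding L2b_def
    by (auto intro!: Bochner_Integration.integrable_bound[OF w(1)] order_trans[OF w(2) abs_ge_self])
  have "(\<lambda>n. \<integral>x. (cmod (h n x))\<^sup>2 \<partial>lborel) \<longlonglongrightarrow> integral\<^sup>L lborel (\<lambda>x::real^2. 0)"
  proof (rule integral_dominated_convergence[where w = w and f = "\<lambda>_. 0"])
    show "AE x in lborel. (\<lambda>n. (cmod (h n x))\<^sup>2) \<longlonglongrightarrow> 0"
      using lim by eventually_elim (auto intro!: tendsto_eq_intros simp: tendsto_norm_zero_iff)
  qed (use w in auto)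
  then have "(\<lambda>n. ennreal (\<integral>x. (cmod (h n x))\<^sup>2 \<partial>lborel)) \<longlonglongrightarrow> ennreal 0"
    by (intro tendsto_ennrealI) simp
  then show ?thesis by (simp add: N2_eq_integral[OF i])
qed

text \<open>The squared norm obeys the triangle inequality only with factors 2, so each splitting of
  an error costs a factor 4 in the tolerance.\<close>

lemma ennreal_quarter:
  assumes "x < ennreal (d / 4)" "y < ennreal (d / 4)"
  shows "2 * x + 2 * y < ennreal d"
proof -
  obtain a b where ab: "x = ennreal a" "y = ennreal b" "0 \<le> a" "0 \<le> b"
    using assms by (cases x; cases y) auto
  then have "a < d / 4" "b < d / 4" using assms by (auto simp: ennreal_less_iff)
  then have "2 * a + 2 * b < d" by simp
  then have "ennreal (2 * a + 2 * b) < ennreal d" using ab by (intro ennreal_lessI) auto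
  then show ?thesis using ab by (simp add: ennreal_mult)
qed

text \<open>A Lebesgue measurable function is a pointwise limit of continuous ones off a null set.
  Clipping their values and multiplying by a radial cutoff gives a common bound on a common disc, so
  dominated convergence upgrades this to the square mean.\<close>

lemma N2_dense_bounded:
  assumes f: "f \<in> borel_measurable borel" "0 \<le> M" "\<And>x. cmod (f x) \<le> M" "\<And>x. x \<notin> cball 0 M \<Longrightarrow> f x = 0"
    and \<delta>: "0 < (\<delta>::real)"
  obtains g r where "continuous_on UNIV g" "\<And>x. x \<notin> cball 0 r \<Longrightarrow> g x = 0" "N2 (\<lambda>x. g x - f x) < ennreal \<delta>"
proof -
  have "f \<in> borel_measurable (lebesgue_on UNIV)"
    using f(1) by (simp add: lebesgue_on_UNIV_eq measurable_completion)
  then have "f measurable_on UNIV" by (subst measurable_on_iff_borel_measurable) auto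
  then obtain N g where N: "negligible N" "\<And>n. continuous_on UNIV (g n)" "\<And>x. x \<notin> N \<Longrightarrow> (\<lambda>n. g n x) \<longlonglongrightarrow> f x"
    by (auto simp: measurable_on_def)
  \<comment> \<open>The added 1 keeps the clipping radius positive when \<open>M\<close> is
    zero.\<close>
  define M' where "M' = M + 1"
  have M': "0 < M'" using f(2) by (simp add: M'_def)
  \<comment> \<open>The radial retraction onto the disc of radius \<open>M'\<close>: continuous, and
    the identity on the values of \<open>f\<close>.\<close>
  define clip :: "complex \<Rightarrow> complex" where "clip z = complex_of_real (M' / max M' (cmod z)) * z" for z
  have clip_cont: "continuous_on UNIV clip"
    unfolding clip_def using M' by (intro continuous_intros) auto
  have clip_le: "cmod (clip z) \<le> M'" for z
    using M' by (auto simp: clip_def norm_mult norm_divide max_def field_simps)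
  have clip_id: "cmod z \<le> M' \<Longrightarrow> clip z = z" for z using M' by (simp add: clip_def max_absorb1)
  define c :: "real^2 \<Rightarrow> real" where "c x = max 0 (min 1 (M + 1 - norm x))" for x
  define h where "h n x = clip (g n x) * complex_of_real (c x)" for n x
  have h_cont: "continuous_on UNIV (h n)" for n
    unfolding h_def c_def by (intro continuous_intros continuous_on_compose2[OF clip_cont N(2)]) auto
  have h_0: "h n x = 0" if "x \<notin> cball 0 (M + 1)" for n x
    using that by (simp add: h_def c_def)
  have h_le: "cmod (h n x) \<le> M'" for n x
  proof -
    have "cmod (h n x) \<le> cmod (clip (g n x)) * 1"
      unfolding h_def norm_mult by (intro mult_left_mono) (auto simp: c_def)
    then show ?thesis using clip_le[of "g n x"] by simp
  qed
  have [measurable]: "h n \<in> borel_measurable borel" "f \<in> borel_measurable borel" for n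
    using h_cont f(1) by (auto intro: borel_measurable_continuous_onI)
  have "(\<lambda>n. N2 (\<lambda>x. h n x - f x)) \<longlonglongrightarrow> 0"
  proof (rule N2_tendsto_0_dominated)
    show "integrable lborel (\<lambda>x::real^2. indicator (cball 0 (M + 1)) x *\<^sub>R (2 * M')\<^sup>2)"
      by (intro borel_integrable_compact) auto
    show "(cmod (h n x - f x))\<^sup>2 \<le> indicator (cball 0 (M + 1)) x *\<^sub>R (2 * M')\<^sup>2" for n x
    proof (cases "x \<in> cball 0 (M + 1)")
      case True
      have "cmod (h n x - f x) \<le> 2 * M'"
        using norm_triangle_ineq4[of "h n x" "f x"] h_le[of n x] f(3)[of x] by (simp add: M'_def)
      from power_mono[OF this norm_ge_zero, of 2] show ?thesis using True by simp
    next
      case False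
      then have "x \<notin> cball 0 M" by simp
      then show ?thesis using False h_0 f(4) by simp
    qed
    have "N \<in> null_sets lebesgue" using N(1) by (simp add: negligible_iff_null_sets)
    then have "AE x in lebesgue. x \<notin> N" by (rule AE_not_in)
    then have "AE x in lborel. x \<notin> N" by (simp add: AE_completion_iff)
    then show "AE x in lborel. (\<lambda>n. h n x - f x) \<longlonglongrightarrow> 0"
    proof eventually_elim
      case (elim x)
      have "(\<lambda>n. clip (g n x)) \<longlonglongrightarrow> clip (f x)"
        using clip_cont N(3)[OF elim] by (auto simp: continuous_on_eq_continuous_at intro: isCont_tendsto_compose)
      then have "(\<lambda>n. h n x) \<longlonglongrightarrow> clip (f x) * complex_of_real (c x)"
        unfolding h_def by (intro tendsto_intros)
      moreover have "clip (f x) * complex_of_real (c x) = f x"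
        using f(3)[of x] f(4)[of x] clip_id[of "f x"] by (cases "x \<in> cball 0 M") (auto simp: M'_def c_def clip_def)
      ultimately show ?case using LIM_zero by fastforce
    qed
  qed simp
  then have "\<forall>\<^sub>F n in sequentially. N2 (\<lambda>x. h n x - f x) < ennreal \<delta>" using \<delta> by (intro order_tendstoD) auto
  then obtain n where "N2 (\<lambda>x. h n x - f x) < ennreal \<delta>" by (auto simp: eventually_sequentially)
  then show thesis using that h_cont h_0 by blast
qed

lemma N2_dense:
  assumes f: "L2b f" and \<delta>: "0 < (\<delta>::real)"
  obtains g r where "continuous_on UNIV g" "\<And>x. x \<notin> cball 0 r \<Longrightarrow> g x = 0" "N2 (\<lambda>x. g x - f x) < ennreal \<delta>"
proof -
  have [measurable]: "f \<in> borel_measurable borel" using f by (rule L2b_measurable)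
  define F where "F n x = (if cmod (f x) \<le> real n \<and> norm x \<le> real n then f x else 0)" for n x
  have [measurable]: "F n \<in> borel_measurable borel" for n unfolding F_def by measurable
  have \<delta>4: "0 < \<delta> / 4" using \<delta> by simp
  have "(\<lambda>n. N2 (\<lambda>x. F n x - f x)) \<longlonglongrightarrow> 0"
  proof (rule N2_tendsto_0_dominated)
    show "integrable lborel (\<lambda>x. (cmod (f x))\<^sup>2)" using f by (simp add: L2b_def)
    show "AE x in lborel. (\<lambda>n. F n x - f x) \<longlonglongrightarrow> 0"
    proof (rule AE_I2)
      fix x
      obtain n where n: "max (cmod (f x)) (norm x) \<le> real n" using real_arch_simple by blast
      have "\<forall>\<^sub>F m in sequentially. 0 = F m x - f x"
        by (intro eventually_sequentiallyI[of n]) (use n in \<open>auto simp: F_def\<close>)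
      then show "(\<lambda>n. F n x - f x) \<longlonglongrightarrow> 0" by (rule Lim_transform_eventually[OF tendsto_const])
    qed
  qed (auto simp: F_def)
  then have "\<forall>\<^sub>F n in sequentially. N2 (\<lambda>x. F n x - f x) < ennreal (\<delta> / 4)" using \<delta>4 by (intro order_tendstoD) auto
  then obtain n where n: "N2 (\<lambda>x. F n x - f x) < ennreal (\<delta> / 4)" by (auto simp: eventually_sequentially)
  obtain g r where g: "continuous_on UNIV g" "\<And>x. x \<notin> cball 0 r \<Longrightarrow> g x = 0" "N2 (\<lambda>x. g x - F n x) < ennreal (\<delta> / 4)"
    by (rule N2_dense_bounded[of "F n" "real n" "\<delta> / 4"]) (use \<delta>4 in \<open>auto simp: F_def\<close>)
  have [measurable]: "g \<in> borel_measurable borel" using g(1) by (rule borel_measurable_continuous_onI)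
  have "N2 (\<lambda>x. g x - f x) \<le> 2 * N2 (\<lambda>x. g x - F n x) + 2 * N2 (\<lambda>x. F n x - f x)"
    by (rule N2_triangle) auto
  also have "\<dots> < ennreal \<delta>" using ennreal_quarter[OF g(3) n] .
  finally show thesis using that g by blast
qed

text \<open>For a continuous \<open>g\<close> of bounded support the estimate is uniform continuity.
  With T x = l x - y it passes to \<open>f\<close> by splitting f o T - f into (f - g) o T, g o T -
  g and g - f. Translation and dilation are treated together because the approximation of zero
  traces uses both.\<close>

lemma N2_affine_continuous:
  assumes f: "L2b f" and \<delta>: "0 < (\<delta>::real)"
  obtains \<eta> where "0 < \<eta>" "\<eta> \<le> 1/2"
    "\<And>l y. \<bar>l - 1\<bar> < \<eta> \<Longrightarrow> norm y < \<eta> \<Longrightarrow> N2 (\<lambda>x. f (l *\<^sub>R x - y) - f x) < ennreal \<delta>"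
proof -
  have [measurable]: "f \<in> borel_measurable borel" using f by (rule L2b_measurable)
  obtain g r where g: "continuous_on UNIV g" "\<And>x. x \<notin> cball 0 r \<Longrightarrow> g x = 0" "N2 (\<lambda>x. g x - f x) < ennreal (\<delta> / 64)"
    using N2_dense[OF f, of "\<delta> / 64"] \<delta> by auto
  have [measurable]: "g \<in> borel_measurable borel" using g(1) by (rule borel_measurable_continuous_onI)
  \<comment> \<open>For l > 1/2 and |y| < 1/2, any x beyond radius \<open>s\<close> has both itself
    and its image beyond radius \<open>r\<close>, where \<open>g\<close> vanishes.\<close>
  define s where "s = 2 * (\<bar>r\<bar> + 1)"
  define V where "V = measure lborel (cball (0::real^2) s)"
  \<comment> \<open>Chosen so that a pointwise error \<open>e\<close> on the disc of measure
    \<open>V\<close> has squared norm below \<delta>/16; the added 1 keeps the denominator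
    positive.\<close>
  define e where "e = sqrt (\<delta> / (64 * (V + 1)))"
  have V: "0 \<le> V" by (simp add: V_def)
  have e: "0 < e" "e\<^sup>2 * V < \<delta> / 16"
  proof -
    show "0 < e" using \<delta> V by (simp add: e_def)
    have "e\<^sup>2 = \<delta> / (64 * (V + 1))" using \<delta> V by (simp add: e_def)
    then have "e\<^sup>2 * V = \<delta> / 64 * (V / (V + 1))" by simp
    also have "\<dots> \<le> \<delta> / 64" using \<delta> V by (intro mult_left_le) auto
    finally have "e\<^sup>2 * V \<le> \<delta> / 64" .
    then show "e\<^sup>2 * V < \<delta> / 16" using \<delta> by simp
  qed
  have "uniformly_continuous_on (cball 0 (2 * s + 1)) g"
    using g(1) by (intro compact_uniformly_continuous continuous_on_subset[OF g(1)]) auto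
  then obtain d where d: "0 < d" "\<And>x x'. x \<in> cball 0 (2 * s + 1) \<Longrightarrow> x' \<in> cball 0 (2 * s + 1) \<Longrightarrow> dist x' x < d \<Longrightarrow> dist (g x') (g x) < e"
    unfolding uniformly_continuous_on_def using e(1) by metis
  \<comment> \<open>For |x| <= s the displacement is at most |l - 1| s + |y|, hence below \<eta> (s
    + 1) <= d.\<close>
  define \<eta> where "\<eta> = min (1/2) (d / (s + 1))"
  have s: "2 \<le> s" by (simp add: s_def)
  have \<eta>: "0 < \<eta>" "\<eta> \<le> 1/2" "\<eta> * (s + 1) \<le> d"
  proof -
    show "0 < \<eta>" using d(1) s by (simp add: \<eta>_def)
    show "\<eta> \<le> 1/2" unfolding \<eta>_def by (rule min.cobounded1)
    have "\<eta> \<le> d / (s + 1)" by (simp add: \<eta>_def)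
    then show "\<eta> * (s + 1) \<le> d" using s by (simp add: pos_le_divide_eq)
  qed
  show thesis
  proof (rule that[OF \<eta>(1,2)])
    fix l :: real and y :: "real^2" assume l: "\<bar>l - 1\<bar> < \<eta>" and y: "norm y < \<eta>"
    have l': "1/2 < l" "l < 2" using l \<eta>(2) by (auto simp: abs_if split: if_splits)
    let ?T = "\<lambda>x. l *\<^sub>R x - y"
    have gT: "cmod (g (?T x) - g x) \<le> cmod (complex_of_real (indicator (cball 0 s) x * e))" for x
    proof (cases "x \<in> cball 0 s")
      case True
      have "norm (?T x) \<le> l * norm x + norm y" using norm_triangle_ineq4[of "l *\<^sub>R x" y] l' by simp
      also have "\<dots> \<le> 2 * s + 1" using True l' y \<eta>(2) s by (intro add_mono mult_mono) auto
      finally have 1: "?T x \<in> cball 0 (2 * s + 1)" by simp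
      have "dist (?T x) x = norm ((l - 1) *\<^sub>R x - y)" by (simp add: dist_norm algebra_simps)
      also have "\<dots> \<le> \<bar>l - 1\<bar> * norm x + norm y" using norm_triangle_ineq4[of "(l - 1) *\<^sub>R x" y] by simp
      also have "\<dots> < \<eta> * s + \<eta>" using True l y \<eta>(1) by (intro add_le_less_mono mult_mono) auto
      also have "\<dots> \<le> d" using \<eta>(3) by (simp add: algebra_simps)
      finally have "dist (g (?T x)) (g x) < e" using True s 1 by (intro d(2)) auto
      then show ?thesis using True e(1) by (simp add: dist_norm)
    next
      case False
      have "(1/2) * norm x \<le> l * norm x" using l' by (intro mult_right_mono) auto
      also have "\<dots> \<le> norm (?T x) + norm y" using norm_triangle_ineq2[of "l *\<^sub>R x" y] l' by simp
      finally have "r < norm (?T x)" using False y \<eta>(2) by (simp add: s_def)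
      moreover have "r < norm x" using False by (simp add: s_def)
      ultimately show ?thesis using g(2) by simp
    qed
    have "N2 (\<lambda>x. g (?T x) - g x) \<le> N2 (\<lambda>x. complex_of_real (indicator (cball 0 s) x * e))"
      using gT by (rule N2_mono)
    also have "\<dots> = (\<integral>\<^sup>+x. ennreal (e\<^sup>2) * indicator (cball 0 s) (x::real^2) \<partial>lborel)"
      unfolding N2_def by (intro nn_integral_cong) (auto simp: indicator_def)
    also have "\<dots> = ennreal (e\<^sup>2) * emeasure lborel (cball 0 s :: (real^2) set)"
      by (rule nn_integral_cmult_indicator) simp
    also have "\<dots> = ennreal (e\<^sup>2 * V)"
      unfolding V_def using emeasure_lborel_cball_finite[of "0::real^2" s]
      by (simp add: ennreal_mult emeasure_eq_ennreal_measure less_top)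
    also have "\<dots> < ennreal (\<delta> / 16)" using e(2) V \<delta> by (intro ennreal_lessI) auto
    finally have 1: "N2 (\<lambda>x. g (?T x) - g x) < ennreal (\<delta> / 4 / 4)" by simp
    have "N2 (\<lambda>x. g x - f x) = ennreal (l\<^sup>2) * N2 (\<lambda>x. g (- y + l *\<^sub>R x) - f (- y + l *\<^sub>R x))"
      using l' by (intro N2_affine) auto
    moreover have "(\<lambda>x. g (- y + l *\<^sub>R x) - f (- y + l *\<^sub>R x)) = (\<lambda>x. g (?T x) - f (?T x))" by simp
    ultimately have eq: "N2 (\<lambda>x. g x - f x) = ennreal (l\<^sup>2) * N2 (\<lambda>x. g (?T x) - f (?T x))" by simp
    \<comment> \<open>Changing variables in the plane costs the factor 1/l^2, which is at most 4 for
      l > 1/2.\<close>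
    have "1/4 \<le> l\<^sup>2" using power_mono[of "1/2" l 2] l' by (simp add: power2_eq_square)
    then have "N2 (\<lambda>x. g (?T x) - f (?T x)) = ennreal (4 * (1/4)) * N2 (\<lambda>x. g (?T x) - f (?T x))" by simp
    also have "\<dots> \<le> ennreal (4 * l\<^sup>2) * N2 (\<lambda>x. g (?T x) - f (?T x))"
      using \<open>1/4 \<le> l\<^sup>2\<close> by (intro mult_right_mono ennreal_leI mult_left_mono) auto
    also have "\<dots> = 4 * N2 (\<lambda>x. g x - f x)"
      unfolding eq by (simp add: ennreal_mult mult.assoc)
    also have "\<dots> = 2 * N2 (\<lambda>x. g x - f x) + 2 * N2 (\<lambda>x. g x - f x)"
      by (simp add: distrib_right[symmetric])
    also have "\<dots> < ennreal (\<delta> / 16)" using g(3) by (intro ennreal_quarter) auto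
    finally have 2: "N2 (\<lambda>x. f (?T x) - g (?T x)) < ennreal (\<delta> / 16)"
      unfolding N2_diff_commute[of "\<lambda>x. f (?T x)" "\<lambda>x. g (?T x)"] .
    have 3: "N2 (\<lambda>x. g x - f x) < ennreal (\<delta> / 4 / 4)"
      using g(3) \<delta> by (elim order_less_trans) (auto intro!: ennreal_lessI)
    have "N2 (\<lambda>x. g (?T x) - f x) \<le> 2 * N2 (\<lambda>x. g (?T x) - g x) + 2 * N2 (\<lambda>x. g x - f x)"
      by (rule N2_triangle) auto
    also have "\<dots> < ennreal (\<delta> / 4)" by (rule ennreal_quarter[OF 1 3])
    finally have 4: "N2 (\<lambda>x. g (?T x) - f x) < ennreal (\<delta> / 4)" .
    have 5: "N2 (\<lambda>x. f (?T x) - g (?T x)) < ennreal (\<delta> / 4)"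
      using 2 \<delta> by (elim order_less_trans) (auto intro!: ennreal_lessI)
    have "N2 (\<lambda>x. f (?T x) - f x) \<le> 2 * N2 (\<lambda>x. f (?T x) - g (?T x)) + 2 * N2 (\<lambda>x. g (?T x) - f x)"
      by (rule N2_triangle) auto
    also have "\<dots> < ennreal \<delta>" by (rule ennreal_quarter[OF 5 4])
    finally show "N2 (\<lambda>x. f (?T x) - f x) < ennreal \<delta>" .
  qed
qed

section \<open>A radial mollifier of unit mass\<close>

definition bump :: "real^2 \<Rightarrow> real" where
  "bump x = flat_deriv 0 (1 - (norm x)\<^sup>2)"

definition mol :: "real \<Rightarrow> cfun" where
  "mol e x = complex_of_real (bump ((1 / e) *\<^sub>R x) / (e\<^sup>2 * (\<integral>x. bump x \<partial>lborel)))"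

lemma bump_nonneg: "0 \<le> bump x"
  by (simp add: bump_def flat_deriv_0_bounds)

lemma bump_eq_0: "1 \<le> norm x \<Longrightarrow> bump x = 0"
  using power_mono[of 1 "norm x" 2] by (simp add: bump_def flat_deriv_0_bounds)

lemma smooth_bump: "smooth_on UNIV (\<lambda>x. complex_of_real (bump x))"
  unfolding bump_def
  by (rule smooth_on_flat) (simp_all add: smooth_on_diff smooth_on_norm_sq smooth_on_const flip: of_real_power)

lemma bump_continuous: "continuous_on UNIV bump"
  using continuous_on_Re[OF smooth_on_continuous[OF smooth_bump]] unfolding Re_complex_of_real .

lemma integrable_bump: "integrable lborel bump"
proof -
  have "integrable lborel (\<lambda>x. complex_of_real (bump x))"
    by (rule integrable_compact_support[of _ "cball 0 1"])
      (auto intro: bump_continuous bump_eq_0)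
  from integrable_Re[OF this] show ?thesis unfolding Re_complex_of_real .
qed

lemma integral_bump_pos: "0 < (\<integral>x. bump x \<partial>lborel)"
proof -
  have [measurable]: "bump \<in> borel_measurable borel" using bump_continuous by (rule borel_measurable_continuous_onI)
  have "(\<integral>x. bump x \<partial>lborel) \<noteq> 0"
  proof
    assume "(\<integral>x. bump x \<partial>lborel) = 0"
    then have "AE x in lborel. bump x = 0"
      using integral_nonneg_eq_0_iff_AE[OF integrable_bump] bump_nonneg by simp
    then have "AE x in lborel. x \<notin> ball (0::real^2) 1"
    proof eventually_elim
      case (elim x)
      show ?case
      proof
        assume "x \<in> ball 0 1"
        then have "(norm x)\<^sup>2 < 1" using power_strict_mono[of "norm x" 1 2] by simp
        then show False using elim flat_deriv_0_bounds(3)[of "1 - (norm x)\<^sup>2"] by (simp add: bump_def)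
      qed
    qed
    then have "ball (0::real^2) 1 \<in> null_sets lborel" by (simp add: AE_iff_null_sets)
    then have "negligible (ball (0::real^2) 1)"
      by (simp add: negligible_iff_null_sets null_sets_completion_iff)
    then show False using open_not_negligible[of "ball (0::real^2) 1"] by simp
  qed
  moreover have "0 \<le> (\<integral>x. bump x \<partial>lborel)" by (simp add: bump_nonneg)
  ultimately show ?thesis by simp
qed

lemma mol_eq_0: "0 < e \<Longrightarrow> e \<le> norm x \<Longrightarrow> mol e x = 0"
  by (simp add: mol_def bump_eq_0 field_simps)

lemma test_mol:
  assumes "0 < e"
  shows "mol e \<in> test_functions UNIV"
proof (rule test_functionsI[of _ "cball 0 e"])
  have "smooth_on UNIV (\<lambda>x. complex_of_real (1 / (e\<^sup>2 * (\<integral>x. bump x \<partial>lborel))) * complex_of_real (bump (0 + (1 / e) *\<^sub>R x)))"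
    by (intro smooth_on_cmult smooth_on_affine[OF smooth_bump] open_UNIV)
  then show "smooth_on UNIV (mol e)" by (simp add: mol_def[abs_def])
qed (use assms mol_eq_0 in auto)

lemma cmod_mol: "cmod (mol e x) = bump ((1 / e) *\<^sub>R x) / (e\<^sup>2 * (\<integral>x. bump x \<partial>lborel))"
  unfolding mol_def norm_of_real using integral_bump_pos bump_nonneg by (intro abs_of_nonneg) simp

lemma mol_nonneg: "mol e x = complex_of_real (cmod (mol e x))"
  unfolding cmod_mol by (simp add: mol_def)

lemma nn_integral_mol:
  assumes "0 < e"
  shows "(\<integral>\<^sup>+x. ennreal (cmod (mol e x)) \<partial>lborel) = 1"
proof -
  let ?I = "\<integral>x. bump x \<partial>lborel"
  have [measurable]: "bump \<in> borel_measurable borel" using bump_continuous by (rule borel_measurable_continuous_onI)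
  have "ennreal (cmod (mol e x)) = ennreal (1 / (e\<^sup>2 * ?I)) * ennreal (bump (0 + (1 / e) *\<^sub>R x))" for x
    unfolding cmod_mol using integral_bump_pos bump_nonneg by (subst ennreal_mult[symmetric]) auto
  then have "(\<integral>\<^sup>+x. ennreal (cmod (mol e x)) \<partial>lborel) = (\<integral>\<^sup>+x. ennreal (1 / (e\<^sup>2 * ?I)) * ennreal (bump (0 + (1 / e) *\<^sub>R x)) \<partial>lborel)"
    by simp
  also have "\<dots> = ennreal (1 / (e\<^sup>2 * ?I)) * (\<integral>\<^sup>+x. ennreal (bump (0 + (1 / e) *\<^sub>R x)) \<partial>lborel)"
    by (rule nn_integral_cmult) simp
  also have "\<dots> = ennreal (1 / ?I) * (ennreal ((1 / e)\<^sup>2) * (\<integral>\<^sup>+x. ennreal (bump (0 + (1 / e) *\<^sub>R x)) \<partial>lborel))"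
    using integral_bump_pos assms by (simp add: mult.assoc[symmetric] ennreal_mult'[symmetric] power_divide mult.commute[of "e\<^sup>2"])
  also have "ennreal ((1 / e)\<^sup>2) * (\<integral>\<^sup>+x. ennreal (bump (0 + (1 / e) *\<^sub>R x)) \<partial>lborel) = (\<integral>\<^sup>+x. ennreal (bump x) \<partial>lborel)"
    using assms by (intro nn_integral_affine_vec2[symmetric]) auto
  also have "\<dots> = ennreal ?I" using integrable_bump bump_nonneg by (intro nn_integral_eq_integral) auto
  finally show ?thesis using integral_bump_pos by (simp flip: ennreal_mult)
qed

lemma integral_mol: "0 < e \<Longrightarrow> (\<integral>x. mol e x \<partial>lborel) = 1"
proof -
  assume e: "0 < e"
  have "(\<integral>x. cmod (mol e x) \<partial>lborel) = 1"
    using nn_integral_mol[OF e] test_measurable[OF test_mol[OF e]] by (subst integral_eq_nn_integral) auto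
  then have "(\<integral>x. complex_of_real (cmod (mol e x)) \<partial>lborel) = 1" by simp
  then show ?thesis by (simp flip: mol_nonneg)
qed

lemma conv_commute:
  assumes "f \<in> borel_measurable borel" "\<kappa> \<in> test_functions UNIV"
  shows "conv f \<kappa> x = (\<integral>y. f (x - y) * \<kappa> y \<partial>lborel)"
proof -
  have [measurable]: "f \<in> borel_measurable borel" "\<kappa> \<in> borel_measurable borel" using assms by (auto intro: test_measurable)
  show ?thesis
    unfolding conv_def by (subst lborel_integral_affine_vec2[of "-1" _ x]) auto
qed

text \<open>With the weight \<open>mol e y\<close> of mass one, the square of the mean is at most
  the mean of the squares. Integrating in x and exchanging the integrals leaves an average of the
  errors for single shifts y, each at most \<open>d\<close>.\<close>

lemma N2_mollify:
  assumes f: "L2b f" "integrable lborel f" and e: "0 < e"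
    and b: "\<And>y. norm y < e \<Longrightarrow> N2 (\<lambda>x. f (l *\<^sub>R x - y) - f x) \<le> d"
  shows "N2 (\<lambda>x. conv f (mol e) (l *\<^sub>R x) - f x) \<le> d"
proof -
  note [measurable] = L2b_measurable[OF f(1)] test_measurable[OF test_mol[OF e]]
  have pt: "ennreal ((cmod (conv f (mol e) (l *\<^sub>R x) - f x))\<^sup>2) \<le> (\<integral>\<^sup>+y. ennreal (cmod (mol e y)) * ennreal ((cmod (f (l *\<^sub>R x - y) - f x))\<^sup>2) \<partial>lborel)" for x
  proof -
    let ?F = "\<lambda>y. f (l *\<^sub>R x - y) - f x"
    have i: "integrable lborel (\<lambda>y. f (l *\<^sub>R x - y) * mol e y)"
      using lborel_integrable_affine_vec2[OF f(2), of "-1" "l *\<^sub>R x"] by (intro integrable_mult_test[OF _ test_mol[OF e]]) auto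
    have i2: "integrable lborel (\<lambda>y. f x * mol e y)" using test_integrable[OF test_mol[OF e]] by simp
    have "conv f (mol e) (l *\<^sub>R x) - f x = (\<integral>y. f (l *\<^sub>R x - y) * mol e y \<partial>lborel) - (\<integral>y. f x * mol e y \<partial>lborel)"
      using conv_commute[OF L2b_measurable[OF f(1)] test_mol[OF e]] integral_mol[OF e] by simp
    also have "\<dots> = (\<integral>y. ?F y * mol e y \<partial>lborel)"
      using i i2 by (subst Bochner_Integration.integral_diff[symmetric]) (auto simp: algebra_simps)
    finally have eq: "conv f (mol e) (l *\<^sub>R x) - f x = (\<integral>y. ?F y * mol e y \<partial>lborel)" .
    have "ennreal (cmod (conv f (mol e) (l *\<^sub>R x) - f x)) \<le> (\<integral>\<^sup>+y. ennreal (norm (?F y * mol e y)) \<partial>lborel)"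
      unfolding eq using Bochner_Integration.integrable_diff[OF i i2]
      by (intro integral_norm_bound_ennreal) (simp add: algebra_simps)
    \<comment> \<open>The weight is split into two square roots, so that one factor of the
      Cauchy-Schwarz inequality integrates to the mass 1.\<close>
    also have "\<dots> = (\<integral>\<^sup>+y. ennreal (sqrt (cmod (mol e y))) * ennreal (sqrt (cmod (mol e y)) * cmod (?F y)) \<partial>lborel)"
      by (intro nn_integral_cong) (simp add: norm_mult ennreal_mult'[symmetric] mult.assoc[symmetric] mult.commute)
    finally have "(ennreal (cmod (conv f (mol e) (l *\<^sub>R x) - f x)))\<^sup>2 \<le> (\<integral>\<^sup>+y. ennreal (sqrt (cmod (mol e y))) * ennreal (sqrt (cmod (mol e y)) * cmod (?F y)) \<partial>lborel)\<^sup>2"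
      by (rule power_mono) simp
    also have "\<dots> \<le> (\<integral>\<^sup>+y. (ennreal (sqrt (cmod (mol e y))))\<^sup>2 \<partial>lborel) * (\<integral>\<^sup>+y. (ennreal (sqrt (cmod (mol e y)) * cmod (?F y)))\<^sup>2 \<partial>lborel)"
      by (rule Cauchy_Schwarz_nn_integral) measurable
    also have "\<dots> = (\<integral>\<^sup>+y. ennreal (cmod (mol e y)) * ennreal ((cmod (?F y))\<^sup>2) \<partial>lborel)"
      using nn_integral_mol[OF e] by (simp add: ennreal_power power_mult_distrib ennreal_mult)
    finally show ?thesis by (simp add: ennreal_power)
  qed
  have "N2 (\<lambda>x. conv f (mol e) (l *\<^sub>R x) - f x) \<le> (\<integral>\<^sup>+x. \<integral>\<^sup>+y. ennreal (cmod (mol e y)) * ennreal ((cmod (f (l *\<^sub>R x - y) - f x))\<^sup>2) \<partial>lborel \<partial>lborel)"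
    unfolding N2_def by (intro nn_integral_mono pt)
  also have "\<dots> = (\<integral>\<^sup>+y. \<integral>\<^sup>+x. ennreal (cmod (mol e y)) * ennreal ((cmod (f (l *\<^sub>R x - y) - f x))\<^sup>2) \<partial>lborel \<partial>lborel)"
    by (rule lborel_pair.Fubini'[symmetric]) measurable
  also have "\<dots> = (\<integral>\<^sup>+y. ennreal (cmod (mol e y)) * N2 (\<lambda>x. f (l *\<^sub>R x - y) - f x) \<partial>lborel)"
    unfolding N2_def by (intro nn_integral_cong nn_integral_cmult) measurable
  also have "\<dots> \<le> (\<integral>\<^sup>+y. ennreal (cmod (mol e y)) * d \<partial>lborel)"
  proof (rule nn_integral_mono)
    fix y
    show "ennreal (cmod (mol e y)) * N2 (\<lambda>x. f (l *\<^sub>R x - y) - f x) \<le> ennreal (cmod (mol e y)) * d"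
    proof (cases "norm y < e")
      case True
      then show ?thesis using b by (intro mult_left_mono) auto
    next
      case False
      then show ?thesis using mol_eq_0[OF e] by simp
    qed
  qed
  also have "\<dots> = d" using nn_integral_mol[OF e] by (simp add: nn_integral_multc)
  finally show ?thesis .
qed

text \<open>Dilation by \<open>l > 1\<close> moves the support of a function vanishing outside a disc away from the
  boundary circle, so that mollification does not reach the circle.\<close>
lemma mollify_dilate_tendsto:
  assumes f: "L2b f" "integrable lborel f" and e: "\<And>n. 0 < e n" "e \<longlonglongrightarrow> 0" and l: "l \<longlonglongrightarrow> 1"
  shows "(\<lambda>n. N2 (\<lambda>x. conv f (mol (e n)) (l n *\<^sub>R x) - f x)) \<longlonglongrightarrow> 0"
proof (rule order_tendstoI)
  fix a :: ennreal assume "0 < a"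
  then obtain d where d: "0 < d" "ennreal d < a"
    by (metis ennreal_less_zero_iff ennreal_0 dense ennreal_cases top.extremum_strict ennreal_neg not_less)
  obtain h where h: "0 < h" "\<And>l y. \<bar>l - 1\<bar> < h \<Longrightarrow> norm y < h \<Longrightarrow> N2 (\<lambda>x. f (l *\<^sub>R x - y) - f x) < ennreal d"
    by (rule N2_affine_continuous[OF f(1) d(1)]) blast
  have "\<forall>\<^sub>F n in sequentially. \<bar>l n - 1\<bar> < h" "\<forall>\<^sub>F n in sequentially. e n < h"
    using tendstoD[OF l h(1)] order_tendstoD(2)[OF e(2) h(1)] by (simp_all add: dist_real_def)
  then show "\<forall>\<^sub>F n in sequentially. N2 (\<lambda>x. conv f (mol (e n)) (l n *\<^sub>R x) - f x) < a"
  proof eventually_elim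
    case (elim n)
    have "N2 (\<lambda>x. conv f (mol (e n)) (l n *\<^sub>R x) - f x) \<le> ennreal d"
      using elim h(2) by (intro N2_mollify f e less_imp_le) auto
    then show ?case using d(2) by simp
  qed
qed simp

text \<open>The Riesz-Fischer argument: along a fast subsequence the increments are absolutely
  summable almost everywhere, and Fatou identifies the limit in the square mean. The common disc
  converts square integrals into integrals of the absolute value.\<close>

lemma L2_complete:
  assumes a: "\<And>n. L2b (a n)" "\<And>n x. x \<notin> cball 0 M \<Longrightarrow> a n x = 0"
    and Cauchy: "\<And>\<delta>. 0 < \<delta> \<Longrightarrow> \<exists>N. \<forall>m\<ge>N. \<forall>n\<ge>N. N2 (\<lambda>x. a m x - a n x) \<le> ennreal \<delta>"
  obtains b where "L2b b" "\<And>x. x \<notin> cball 0 M \<Longrightarrow> b x = 0" "(\<lambda>n. N2 (\<lambda>x. a n x - b x)) \<longlonglongrightarrow> 0"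
proof -
  note [measurable] = L2b_measurable[OF a(1)]
  \<comment> \<open>The rate 4^-k in the squared norm leaves 2^-k in the integral of the absolute
    value, which is summable.\<close>
  have "\<forall>k. \<exists>N. \<forall>m\<ge>N. \<forall>n\<ge>N. N2 (\<lambda>x. a m x - a n x) \<le> ennreal ((1/4)^k)" using Cauchy by simp
  from choice[OF this] obtain N where N: "\<And>k m n. N k \<le> m \<Longrightarrow> N k \<le> n \<Longrightarrow> N2 (\<lambda>x. a m x - a n x) \<le> ennreal ((1/4)^k)"
    by blast
  \<comment> \<open>The partial sum makes \<open>s\<close> nondecreasing and at least
    \<open>N k\<close>; the added k makes it unbounded.\<close>
  define s where "s k = k + (\<Sum>i\<le>k. N i)" for k
  have s: "k \<le> s k" "N k \<le> s k" "s k \<le> s (Suc k)" for k by (auto simp: s_def intro: member_le_sum trans_le_add2)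
  define d where "d k x = a (s (Suc k)) x - a (s k) x" for k x
  have [measurable]: "d k \<in> borel_measurable borel" for k unfolding d_def by measurable
  have d2: "N2 (d k) \<le> ennreal ((1/4)^k)" for k
    unfolding d_def using N[of k "s (Suc k)" "s k"] s[of k] by simp
  define V where "V = measure lborel (cball (0::real^2) M)"
  have V: "0 \<le> V" "emeasure lborel (cball (0::real^2) M) = ennreal V"
    unfolding V_def using emeasure_lborel_cball_finite[of "0::real^2" M]
    by (auto simp: emeasure_eq_ennreal_measure less_top)
  have d1: "(\<integral>\<^sup>+x. ennreal (cmod (d k x)) \<partial>lborel) \<le> ennreal ((1 + V) * (1/2)^k)" for k
  proof -
    have "(\<integral>\<^sup>+x. ennreal (cmod (d k x)) \<partial>lborel) \<le>
       (\<integral>\<^sup>+x. ennreal (2^k) * ennreal ((cmod (d k x))\<^sup>2) + ennreal ((1/2)^k) * indicator (cball 0 M) x \<partial>lborel)"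
    proof (rule nn_integral_mono)
      fix x :: "real^2"
      \<comment> \<open>Expanding the square of t - 2^-k. Weighted by 2^k, a squared norm of size
        4^-k becomes 2^-k, in balance with the constant term.\<close>
      have *: "t \<le> 2^k * t\<^sup>2 + (1/2)^k" if "0 \<le> t" for t :: real
      proof -
        have "0 \<le> 2^k * (t - (1/2)^k)\<^sup>2" by simp
        also have "\<dots> = 2^k * t\<^sup>2 + (1/2)^k - 2 * t"
          by (simp add: power2_eq_square algebra_simps power_one_over)
        finally show ?thesis using that by simp
      qed
      show "ennreal (cmod (d k x)) \<le> ennreal (2^k) * ennreal ((cmod (d k x))\<^sup>2) + ennreal ((1/2)^k) * indicator (cball 0 M) x"
      proof (cases "x \<in> cball 0 M")
        case True
        have "ennreal (cmod (d k x)) \<le> ennreal (2^k * (cmod (d k x))\<^sup>2 + (1/2)^k)"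
          by (intro ennreal_leI * norm_ge_zero)
        then show ?thesis using True by (simp add: ennreal_mult ennreal_plus del: ennreal_plus[symmetric])
      next
        case False
        then show ?thesis using a(2) by (simp add: d_def)
      qed
    qed
    also have "\<dots> = ennreal (2^k) * N2 (d k) + ennreal ((1/2)^k) * ennreal V"
      unfolding N2_def V(2)[symmetric]
      by (subst nn_integral_add, measurable, simp)
        (intro arg_cong2[where f = "(+)"] nn_integral_cmult nn_integral_cmult_indicator; simp)
    also have "\<dots> \<le> ennreal (2^k) * ennreal ((1/4)^k) + ennreal ((1/2)^k) * ennreal V"
      by (intro add_right_mono mult_left_mono d2) auto
    also have "\<dots> = ennreal (2^k * (1/4)^k + (1/2)^k * V)"
      using V by (simp add: ennreal_mult ennreal_plus)
    also have "2^k * (1/4)^k + (1/2)^k * V = (1 + V) * (1/2)^k"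
      by (simp add: power_mult_distrib[symmetric] algebra_simps)
    finally show ?thesis .
  qed
  have "(\<integral>\<^sup>+x. (\<Sum>k. ennreal (cmod (d k x))) \<partial>lborel) = (\<Sum>k. \<integral>\<^sup>+x. ennreal (cmod (d k x)) \<partial>lborel)"
    by (rule nn_integral_suminf) measurable
  also have "\<dots> \<le> (\<Sum>k. ennreal ((1 + V) * (1/2)^k))" by (intro suminf_le d1) auto
  also have "\<dots> = ennreal (\<Sum>k. (1 + V) * (1/2)^k)"
    using V by (intro suminf_ennreal2 summable_mult summable_geometric) auto
  finally have "(\<integral>\<^sup>+x. (\<Sum>k. ennreal (cmod (d k x))) \<partial>lborel) \<noteq> \<infinity>" by (auto simp: top_unique)
  then have "AE x in lborel. (\<Sum>k. ennreal (cmod (d k x))) \<noteq> \<infinity>"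
    by (intro nn_integral_PInf_AE) measurable
  then have conv: "AE x in lborel. convergent (\<lambda>k. a (s k) x)"
  proof eventually_elim
    case (elim x)
    have "summable (\<lambda>k. cmod (d k x))" using elim by (intro summable_suminf_not_top) auto
    then have "summable (\<lambda>k. d k x)" by (rule summable_norm_cancel)
    then have "convergent (\<lambda>n. \<Sum>k<n. d k x)" by (simp add: summable_iff_convergent)
    moreover have "(\<lambda>n. \<Sum>k<n. d k x) = (\<lambda>n. a (s n) x - a (s 0) x)"
      unfolding d_def by (rule ext) (rule sum_lessThan_telescope)
    ultimately have "convergent (\<lambda>n. (a (s n) x - a (s 0) x) + a (s 0) x)"
      by (intro convergent_add convergent_const) simp
    then show ?case by simp
  qed
  define b where "b x = lim (\<lambda>k. a (s k) x)" for x
  have [measurable]: "b \<in> borel_measurable borel" unfolding b_def by measurable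
  have lim: "AE x in lborel. (\<lambda>k. a (s k) x) \<longlonglongrightarrow> b x"
    using conv by eventually_elim (simp add: b_def convergent_LIMSEQ_iff)
  have b0: "b x = 0" if "x \<notin> cball 0 M" for x using a(2)[OF that] by (simp add: b_def)
  have bd: "N2 (\<lambda>x. a m x - b x) \<le> ennreal \<delta>" if m: "\<And>n. N' \<le> n \<Longrightarrow> N2 (\<lambda>x. a m x - a n x) \<le> ennreal \<delta>" for m N' \<delta>
  proof -
    have "N2 (\<lambda>x. a m x - b x) = (\<integral>\<^sup>+x. liminf (\<lambda>k. ennreal ((cmod (a m x - a (s k) x))\<^sup>2)) \<partial>lborel)"
      unfolding N2_def
    proof (rule nn_integral_cong_AE)
      show "AE x in lborel. ennreal ((cmod (a m x - b x))\<^sup>2) = liminf (\<lambda>k. ennreal ((cmod (a m x - a (s k) x))\<^sup>2))"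
        using lim
      proof eventually_elim
        case (elim x)
        then have "(\<lambda>k. ennreal ((cmod (a m x - a (s k) x))\<^sup>2)) \<longlonglongrightarrow> ennreal ((cmod (a m x - b x))\<^sup>2)"
          by (intro tendsto_intros tendsto_ennrealI)
        then show ?case using lim_imp_Liminf[OF sequentially_bot] by metis
      qed
    qed
    also have "\<dots> \<le> liminf (\<lambda>k. N2 (\<lambda>x. a m x - a (s k) x))"
      unfolding N2_def by (intro nn_integral_liminf) measurable
    also have "\<dots> \<le> ennreal \<delta>"
    proof (rule Liminf_le)
      show "\<forall>\<^sub>F k in sequentially. N2 (\<lambda>x. a m x - a (s k) x) \<le> ennreal \<delta>"
        using m s(1) by (intro eventually_sequentiallyI[of N']) (meson le_trans)
    qed simp
    finally show ?thesis .
  qed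
  have lim2: "(\<lambda>n. N2 (\<lambda>x. a n x - b x)) \<longlonglongrightarrow> 0"
  proof (rule order_tendstoI)
    fix e :: ennreal assume "0 < e"
    then obtain d where d: "0 < d" "ennreal d < e"
      by (metis ennreal_less_zero_iff ennreal_0 dense ennreal_cases top.extremum_strict ennreal_neg not_less)
    obtain N' where N': "\<And>m n. N' \<le> m \<Longrightarrow> N' \<le> n \<Longrightarrow> N2 (\<lambda>x. a m x - a n x) \<le> ennreal d"
      using Cauchy[OF d(1)] by blast
    show "\<forall>\<^sub>F n in sequentially. N2 (\<lambda>x. a n x - b x) < e"
      by (intro eventually_sequentiallyI[of N'] le_less_trans[OF bd d(2)] N')
  qed simp
  obtain N' where N': "\<And>m n. N' \<le> m \<Longrightarrow> N' \<le> n \<Longrightarrow> N2 (\<lambda>x. a m x - a n x) \<le> ennreal 1"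
    using Cauchy[of 1] by auto
  have "N2 (\<lambda>x. a N' x - b x) \<le> ennreal 1" by (rule bd[of N']) (rule N', auto)
  then have "N2 (\<lambda>x. a N' x - b x) < \<infinity>" by (rule le_less_trans) simp
  then have "L2b (\<lambda>x. a N' x - b x)" by (simp add: L2b_iff_N2)
  from L2b_diff[OF a(1)[of N'] this] have "L2b b" by simp
  with b0 lim2 show thesis using that by blast
qed

lemma tendsto_integral_mult_L2:
  assumes a: "\<And>n. L2b (a n)" "L2b b" "(\<lambda>n. N2 (\<lambda>x. a n x - b x)) \<longlonglongrightarrow> 0" and g: "L2b g"
  shows "(\<lambda>n. \<integral>x. a n x * g x \<partial>lborel) \<longlonglongrightarrow> (\<integral>x. b x * g x \<partial>lborel)"
proof -
  have d: "L2b (\<lambda>x. a n x - b x)" for n using a by (intro L2b_diff)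
  let ?I = "\<lambda>n. (\<integral>x. a n x * g x \<partial>lborel) - (\<integral>x. b x * g x \<partial>lborel)"
  have I: "?I n = (\<integral>x. (a n x - b x) * g x \<partial>lborel)" for n
    using Cauchy_Schwarz_L2b(1)[OF a(1) g] Cauchy_Schwarz_L2b(1)[OF a(2) g]
    by (simp add: algebra_simps)
  have "(\<lambda>n. ennreal ((cmod (?I n))\<^sup>2)) \<longlonglongrightarrow> 0"
  proof (rule tendsto_sandwich[of "\<lambda>_. 0" _ _ "\<lambda>n. N2 (\<lambda>x. a n x - b x) * N2 g"])
    show "\<forall>\<^sub>F n in sequentially. ennreal ((cmod (?I n))\<^sup>2) \<le> N2 (\<lambda>x. a n x - b x) * N2 g"
      unfolding I using Cauchy_Schwarz_L2b(2)[OF d g] by simp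
    have "(\<lambda>n. N2 (\<lambda>x. a n x - b x) * N2 g) \<longlonglongrightarrow> 0 * N2 g"
      using a(3) g by (intro tendsto_mult_ennreal tendsto_const) (auto simp: L2b_iff_N2)
    then show "(\<lambda>n. N2 (\<lambda>x. a n x - b x) * N2 g) \<longlonglongrightarrow> 0" by simp
  qed auto
  then have "(\<lambda>n. enn2real (ennreal ((cmod (?I n))\<^sup>2))) \<longlonglongrightarrow> enn2real 0"
    by (intro tendsto_enn2real) auto
  then have "(\<lambda>n. (cmod (?I n))\<^sup>2) \<longlonglongrightarrow> 0" by simp
  then have "(\<lambda>n. cmod (?I n)) \<longlonglongrightarrow> 0" by (simp add: power_tendsto_0_iff)
  then have "?I \<longlonglongrightarrow> 0" by (rule tendsto_norm_zero_cancel)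
  then show ?thesis by (rule LIM_zero_cancel)
qed

lemma continuous_AE_zero:
  fixes f :: cfun
  assumes "open U" "continuous_on U f" "AE x in lborel. x \<in> U \<longrightarrow> f x = 0" "x \<in> U"
  shows "f x = 0"
proof -
  have o: "open {x \<in> U. f x \<noteq> 0}"
  proof -
    have "open (f -` (- {0}) \<inter> U)"
      using assms(1,2) by (intro continuous_on_open_vimage[THEN iffD1, rule_format]) auto
    moreover have "f -` (- {0}) \<inter> U = {x \<in> U. f x \<noteq> 0}" by auto
    ultimately show ?thesis by simp
  qed
  have "AE x in lborel. x \<notin> {x \<in> U. f x \<noteq> 0}"
    using assms(3) by eventually_elim auto
  then have "{x \<in> U. f x \<noteq> 0} \<in> null_sets lborel"
    using o by (subst AE_iff_null_sets) auto
  then have "negligible {x \<in> U. f x \<noteq> 0}"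
    using o by (simp add: negligible_iff_null_sets null_sets_completion_iff)
  then have "{x \<in> U. f x \<noteq> 0} = {}" using open_not_negligible[OF o] by auto
  then show ?thesis using assms(4) by auto
qed

section \<open>Regularity of the Laplace equation in the plane\<close>

text \<open>Weak derivative on the whole plane for Borel functions. For a function vanishing off the
  disc it also asserts that there is no jump across the circle, which \<open>is_weak_pd\<close> on
  the disc cannot see.\<close>

definition gweak :: "2 \<Rightarrow> cfun \<Rightarrow> cfun \<Rightarrow> bool" where
  "gweak i h d \<longleftrightarrow> (\<forall>\<phi>\<in>test_functions UNIV. (\<integral>x. h x * pd i \<phi> x \<partial>lborel) = - (\<integral>x. d x * \<phi> x \<partial>lborel))"

lemma gweakD: "gweak i h d \<Longrightarrow> \<phi> \<in> test_functions UNIV \<Longrightarrow> (\<integral>x. h x * pd i \<phi> x \<partial>lborel) = - (\<integral>x. d x * \<phi> x \<partial>lborel)"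
  by (simp add: gweak_def)

lemma gweak_smooth: "smooth_on UNIV f \<Longrightarrow> gweak i f (pd i f)"
  unfolding gweak_def using integral_by_parts[OF open_UNIV] by blast

text \<open>For fixed x the reflected kernel \<kappa>(x - y) is a test function of y, and reflection
  absorbs the minus sign of the weak derivative.\<close>

lemma conv_gweak:
  assumes "gweak i h d" "\<kappa> \<in> test_functions UNIV"
  shows "conv h (pd i \<kappa>) = conv d \<kappa>"
proof
  fix x
  have "(\<integral>y. h y * pd i (\<lambda>y. \<kappa> (x - y)) y \<partial>lborel) = - (\<integral>y. d y * \<kappa> (x - y) \<partial>lborel)"
    by (rule gweakD[OF assms(1) test_reflect(1)[OF assms(2)]])
  then show "conv h (pd i \<kappa>) x = conv d \<kappa> x"
    by (simp add: conv_def test_reflect(2)[OF assms(2)])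
qed

lemma pd_conv_gweak:
  assumes "integrable lborel h" "gweak i h d" "\<kappa> \<in> test_functions UNIV"
  shows "pd i (conv h \<kappa>) = conv d \<kappa>"
  using pd_conv[OF assms(1,3)] conv_gweak[OF assms(2,3)] by simp

lemma conv_eq_0:
  assumes "0 < e" "\<And>x. x \<notin> cball 0 R \<Longrightarrow> h x = 0" "R + e \<le> norm x"
  shows "conv h (mol e) x = 0"
proof -
  have "h y * mol e (x - y) = 0" for y
  proof (cases "y \<in> cball 0 R")
    case True
    then have "e \<le> norm (x - y)" using norm_triangle_ineq2[of x y] assms(3) by simp
    then show ?thesis using mol_eq_0[OF assms(1)] by simp
  qed (use assms in simp)
  then show ?thesis by (simp only: conv_def Bochner_Integration.integral_zero)
qed

lemma test_conv_mol:
  assumes "0 < e" "\<And>x. x \<notin> cball 0 R \<Longrightarrow> h x = 0" "integrable lborel h"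
  shows "conv h (mol e) \<in> test_functions UNIV"
  by (rule test_functionsI[of _ "cball 0 (R + e)"])
    (use assms conv_eq_0[of e R h] in \<open>auto intro: smooth_conv test_mol\<close>)

lemma mollify_tendsto:
  assumes f: "L2b f" "integrable lborel f" and e: "\<And>n. 0 < e n" "e \<longlonglongrightarrow> 0"
  shows "(\<lambda>n. N2 (\<lambda>x. conv f (mol (e n)) x - f x)) \<longlonglongrightarrow> 0"
  using mollify_dilate_tendsto[OF f e tendsto_const] by simp

lemma N2_eq_0_iff: "f \<in> borel_measurable borel \<Longrightarrow> N2 f = 0 \<longleftrightarrow> (AE x in lborel. f x = 0)"
  unfolding N2_def by (subst nn_integral_0_iff_AE) auto

text \<open>After mollification each derivative may fall on \<open>f\<close> or on the kernel, so
  both orders give the same smooth function. The limit in the square mean, together with continuity,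
  brings the equality back to \<open>f\<close>.\<close>

lemma pd_commute_test:
  assumes f: "f \<in> test_functions UNIV"
  shows "pd i (pd j f) x = pd j (pd i f) x"
proof -
  define e where "e n = inverse (real (Suc n))" for n
  have e: "0 < e n" "e \<longlonglongrightarrow> 0" for n
    using LIMSEQ_inverse_real_of_nat by (auto simp: e_def[abs_def])
  have eq: "conv (pd i (pd j f)) (mol (e n)) = conv (pd j (pd i f)) (mol (e n))" for n
  proof -
    have t: "mol (e n) \<in> test_functions UNIV" by (rule test_mol[OF e(1)])
    have *: "conv (pd i (pd j f)) (mol (e n)) = conv (pd j f) (pd i (mol (e n)))" for i j
      by (rule conv_gweak[symmetric, OF gweak_smooth t]) (rule test_functions_smooth[OF test_functions_pd[OF f]])
    have **: "conv (pd j f) (pd i (mol (e n))) = pd j (conv f (pd i (mol (e n))))" for i j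
      by (rule pd_conv_gweak[symmetric, OF test_integrable[OF f] gweak_smooth[OF test_functions_smooth[OF f]] test_functions_pd[OF t]])
    have "conv (pd i (pd j f)) (mol (e n)) = pd j (pd i (conv f (mol (e n))))" for i j
      unfolding * ** by (simp add: pd_conv[OF test_integrable[OF f] t])
    moreover have "conv (pd j f) (pd i (mol (e n))) = pd i (conv (pd j f) (mol (e n)))" for i j
      by (rule pd_conv[symmetric, OF test_integrable[OF test_functions_pd[OF f]] t])
    moreover have "conv (pd j f) (mol (e n)) = pd j (conv f (mol (e n)))" for j
      by (rule pd_conv_gweak[symmetric, OF test_integrable[OF f] gweak_smooth[OF test_functions_smooth[OF f]] t])
    ultimately show ?thesis using * by metis
  qed
  have tt: "pd i (pd j f) \<in> test_functions UNIV" for i j using f by (intro test_functions_pd)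
  note [measurable] = test_measurable[OF tt]
  have m: "conv (pd i (pd j f)) (mol (e n)) \<in> borel_measurable borel" for n i j
    by (intro borel_measurable_continuous_onI smooth_on_continuous smooth_conv test_integrable[OF tt] test_mol e)
  let ?A = "pd i (pd j f)" and ?B = "pd j (pd i f)"
  let ?c = "\<lambda>n. conv ?A (mol (e n))"
  have "(\<lambda>n. 2 * N2 (\<lambda>x. ?c n x - ?A x) + 2 * N2 (\<lambda>x. ?c n x - ?B x)) \<longlonglongrightarrow> 2 * 0 + 2 * 0"
  proof (intro tendsto_add tendsto_mult_ennreal tendsto_const)
    show "(\<lambda>n. N2 (\<lambda>x. ?c n x - ?A x)) \<longlonglongrightarrow> 0" by (rule mollify_tendsto[OF L2b_test[OF tt] test_integrable[OF tt] e])
    show "(\<lambda>n. N2 (\<lambda>x. ?c n x - ?B x)) \<longlonglongrightarrow> 0" unfolding eq by (rule mollify_tendsto[OF L2b_test[OF tt] test_integrable[OF tt] e])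
  qed auto
  moreover have "N2 (\<lambda>x. ?A x - ?B x) \<le> 2 * N2 (\<lambda>x. ?c n x - ?A x) + 2 * N2 (\<lambda>x. ?c n x - ?B x)" for n
    using N2_triangle[of ?A "?c n" ?B] m by (simp add: N2_diff_commute[of ?A])
  ultimately have "N2 (\<lambda>x. ?A x - ?B x) \<le> 0"
    by (intro LIMSEQ_le_const[where X = "\<lambda>n. 2 * N2 (\<lambda>x. ?c n x - ?A x) + 2 * N2 (\<lambda>x. ?c n x - ?B x)"]) auto
  then have "AE x in lborel. ?A x - ?B x = 0"
    by (subst (asm) le_zero_eq, subst (asm) N2_eq_0_iff) measurable
  then have "?A x - ?B x = 0"
    by (intro continuous_AE_zero[of UNIV "\<lambda>x. ?A x - ?B x" x])
      (auto intro!: continuous_intros test_continuous[OF tt])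
  then show ?thesis by simp
qed

lemma lap_pd_commute_test:
  assumes f: "f \<in> test_functions UNIV"
  shows "lap (pd i f) = pd i (lap f)"
proof
  fix x
  have d: "pd j (pd j f) differentiable (at x)" for j x
    by (intro test_differentiable[OF test_functions_pd[OF test_functions_pd[OF f]]])
  have "pd j (pd j (pd i f)) = pd i (pd j (pd j f))" for j
    using pd_commute_test[OF f] pd_commute_test[OF test_functions_pd[OF f]] by (metis ext)
  then show "lap (pd i f) x = pd i (lap f) x"
    unfolding lap_def[abs_def] sum_UNIV_2 using d by (subst pd_add) auto
qed

section \<open>A priori estimates: the Laplacian controls the Hessian and, with the function, the
  gradient\<close>

definition I2 :: "cfun \<Rightarrow> real" where
  "I2 f = (\<integral>x. (cmod (f x))\<^sup>2 \<partial>lborel)"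

lemma I2_eq: "complex_of_real (I2 f) = (\<integral>x. f x * cnj (f x) \<partial>lborel)"
  unfolding I2_def complex_norm_square[symmetric] of_real_power[symmetric]
  by (rule integral_complex_of_real[symmetric])

lemma I2_nonneg: "0 \<le> I2 f"
  by (simp add: I2_def)

lemma N2_I2: "L2b f \<Longrightarrow> N2 f = ennreal (I2 f)"
  by (simp add: I2_def N2_eq_integral)

lemma I2_pd_test:
  assumes a: "a \<in> test_functions UNIV" and b: "b \<in> test_functions UNIV"
  shows "(\<integral>x. pd i a x * cnj (b x) \<partial>lborel) = - (\<integral>x. a x * cnj (pd i b x) \<partial>lborel)"
proof -
  have "(\<integral>x. a x * pd i (\<lambda>x. cnj (b x)) x \<partial>lborel) = - (\<integral>x. pd i a x * cnj (b x) \<partial>lborel)"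
    using integral_by_parts[OF open_UNIV test_functions_smooth[OF a] test_functions_cnj[OF b]] .
  moreover have "pd i (\<lambda>x. cnj (b x)) x = cnj (pd i b x)" for x
    by (rule pd_cnj[OF test_differentiable[OF b]])
  ultimately show ?thesis by simp
qed

lemma test_mult_cnj_integrable:
  "a \<in> test_functions UNIV \<Longrightarrow> b \<in> test_functions UNIV \<Longrightarrow> integrable lborel (\<lambda>x. a x * cnj (b x))"
  by (intro integrable_mult_test[OF test_integrable test_functions_cnj])

lemma I2_grad:
  assumes a: "a \<in> test_functions UNIV"
  shows "(\<Sum>i\<in>UNIV. complex_of_real (I2 (pd i a))) = - (\<integral>x. a x * cnj (lap a x) \<partial>lborel)"
proof -
  have i: "integrable lborel (\<lambda>x. a x * cnj (pd i (pd i a) x))" for i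
    using a by (intro test_mult_cnj_integrable test_functions_pd)
  have "complex_of_real (I2 (pd i a)) = - (\<integral>x. a x * cnj (pd i (pd i a) x) \<partial>lborel)" for i
    unfolding I2_eq using a by (intro I2_pd_test test_functions_pd)
  then show ?thesis
    using i by (simp add: lap_def sum_UNIV_2 distrib_left)
qed

text \<open>Two integrations by parts, and the exchange of derivatives between them, turn the sum
  over all second derivatives into the square of the trace of the Hessian; compact support leaves no
  boundary terms.\<close>

lemma I2_hessian:
  assumes a: "a \<in> test_functions UNIV"
  shows "(\<Sum>i\<in>UNIV. \<Sum>j\<in>UNIV. I2 (pd j (pd i a))) = I2 (lap a)"
proof -
  have i: "integrable lborel (\<lambda>x. pd i (pd i a) x * cnj (lap a x))" for i
    using a by (intro test_mult_cnj_integrable test_functions_pd test_functions_lap)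
  have "(\<Sum>j\<in>UNIV. complex_of_real (I2 (pd j (pd i a)))) = (\<integral>x. pd i (pd i a) x * cnj (lap a x) \<partial>lborel)" for i
    unfolding I2_grad[OF test_functions_pd[OF a]] lap_pd_commute_test[OF a]
    using a by (subst I2_pd_test[symmetric]) (auto intro: test_functions_pd test_functions_lap)
  then have "(\<Sum>i\<in>UNIV. \<Sum>j\<in>UNIV. complex_of_real (I2 (pd j (pd i a)))) = complex_of_real (I2 (lap a))"
    unfolding I2_eq[of "lap a"] using i by (simp add: lap_def[of a] sum_UNIV_2 distrib_right)
  then have "complex_of_real (\<Sum>i\<in>UNIV. \<Sum>j\<in>UNIV. I2 (pd j (pd i a))) = complex_of_real (I2 (lap a))"
    by simp
  then show ?thesis by (simp only: of_real_eq_iff)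
qed

text \<open>The gradient energy equals minus the pairing of \<open>a\<close> with its Laplacian,
  which s t <= s^2 + t^2 separates.\<close>

lemma I2_pd_le:
  assumes a: "a \<in> test_functions UNIV"
  shows "I2 (pd i a) \<le> I2 a + I2 (lap a)"
proof -
  have l: "lap a \<in> test_functions UNIV" by (rule test_functions_lap[OF a])
  have i: "integrable lborel (\<lambda>x. (cmod (a x))\<^sup>2)" "integrable lborel (\<lambda>x. (cmod (lap a x))\<^sup>2)"
    using L2b_test[OF a] L2b_test[OF l] by (auto simp: L2b_def)
  have "I2 (pd i a) \<le> (\<Sum>i\<in>UNIV. I2 (pd i a))"
    by (intro member_le_sum) (auto simp: I2_nonneg)
  also have "\<dots> = cmod (complex_of_real (\<Sum>i\<in>UNIV. I2 (pd i a)))"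
    by (simp add: I2_nonneg sum_nonneg del: of_real_sum)
  also have "\<dots> = cmod (\<integral>x. a x * cnj (lap a x) \<partial>lborel)"
    using I2_grad[OF a] by simp
  also have "\<dots> \<le> (\<integral>x. (cmod (a x))\<^sup>2 + (cmod (lap a x))\<^sup>2 \<partial>lborel)"
  proof (rule Bochner_Integration.integral_norm_bound_integral)
    have "s * t \<le> s\<^sup>2 + t\<^sup>2" if "0 \<le> s" "0 \<le> t" for s t :: real
      using sum_squares_ge_zero[of "s - t" 0] mult_nonneg_nonneg[OF that] by (simp add: power2_eq_square algebra_simps)
    then show "norm (a x * cnj (lap a x)) \<le> (cmod (a x))\<^sup>2 + (cmod (lap a x))\<^sup>2" for x
      by (simp add: norm_mult)
  qed (use i test_mult_cnj_integrable[OF a l] in auto)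
  also have "\<dots> = I2 a + I2 (lap a)" using i by (simp add: I2_def)
  finally show ?thesis .
qed

lemma I2_pd_pd_le:
  assumes a: "a \<in> test_functions UNIV"
  shows "I2 (pd j (pd i a)) \<le> I2 (lap a)"
proof -
  have "I2 (pd j (pd i a)) \<le> (\<Sum>j\<in>UNIV. I2 (pd j (pd i a)))"
    by (intro member_le_sum) (auto simp: I2_nonneg)
  also have "\<dots> \<le> (\<Sum>i\<in>UNIV. \<Sum>j\<in>UNIV. I2 (pd j (pd i a)))"
    by (rule member_le_sum[of i UNIV "\<lambda>i. \<Sum>j\<in>UNIV. I2 (pd j (pd i a))"]) (auto simp: I2_nonneg sum_nonneg)
  also have "\<dots> = I2 (lap a)" by (rule I2_hessian[OF a])
  finally show ?thesis .
qed

lemma N2_pd_le: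
  assumes a: "a \<in> test_functions UNIV"
  shows "N2 (pd i a) \<le> N2 a + N2 (lap a)" "N2 (pd j (pd i a)) \<le> N2 (lap a)"
proof -
  note N = N2_I2[OF L2b_test[OF a]] N2_I2[OF L2b_test[OF test_functions_lap[OF a]]]
    N2_I2[OF L2b_test[OF test_functions_pd[OF a]]]
    N2_I2[OF L2b_test[OF test_functions_pd[OF test_functions_pd[OF a]]]]
  show "N2 (pd i a) \<le> N2 a + N2 (lap a)"
    unfolding N using I2_pd_le[OF a, of i] by (simp add: I2_nonneg flip: ennreal_plus)
  show "N2 (pd j (pd i a)) \<le> N2 (lap a)"
    unfolding N using I2_pd_pd_le[OF a, of j i] by (simp add: ennreal_leI)
qed

lemma L2_Cauchy_of_convergent:
  assumes [measurable]: "\<And>n. a n \<in> borel_measurable borel" "b \<in> borel_measurable borel"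
    and lim: "(\<lambda>n. N2 (\<lambda>x. a n x - b x)) \<longlonglongrightarrow> 0" and \<delta>: "0 < (\<delta>::real)"
  shows "\<exists>N. \<forall>m\<ge>N. \<forall>n\<ge>N. N2 (\<lambda>x. a m x - a n x) < ennreal \<delta>"
proof -
  have "\<forall>\<^sub>F n in sequentially. N2 (\<lambda>x. a n x - b x) < ennreal (\<delta> / 4)"
    using lim \<delta> by (intro order_tendstoD) auto
  then obtain N where N: "\<And>n. N \<le> n \<Longrightarrow> N2 (\<lambda>x. a n x - b x) < ennreal (\<delta> / 4)"
    by (auto simp: eventually_sequentially)
  have "N2 (\<lambda>x. a m x - a n x) < ennreal \<delta>" if "N \<le> m" "N \<le> n" for m n
  proof -
    have "N2 (\<lambda>x. a m x - a n x) \<le> 2 * N2 (\<lambda>x. a m x - b x) + 2 * N2 (\<lambda>x. b x - a n x)"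
      by (rule N2_triangle) auto
    also have "N2 (\<lambda>x. b x - a n x) = N2 (\<lambda>x. a n x - b x)" by (rule N2_diff_commute)
    also have "2 * N2 (\<lambda>x. a m x - b x) + 2 * N2 (\<lambda>x. a n x - b x) < ennreal \<delta>"
      using that by (intro ennreal_quarter N)
    finally show ?thesis .
  qed
  then show ?thesis by blast
qed

text \<open>Test functions supported where \<open>h\<close> vanishes give zero on the left of the
  weak identity. This confines the limits of the mollified derivatives to the closed disc.\<close>

lemma gweak_support:
  assumes "gweak i h d" "integrable lborel d" "\<And>x. x \<notin> cball 0 R \<Longrightarrow> h x = 0"
  shows "AE x in lborel. x \<notin> cball 0 R \<longrightarrow> d x = 0"
proof -
  have "AE x in lborel. x \<in> - cball 0 R \<longrightarrow> d x = 0"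
  proof (rule fundamental_lemma)
    show "integrable lborel (\<lambda>x. indicator K x *\<^sub>R d x)" if "compact K" for K
      using that assms(2) by (intro integrable_mult_indicator) (auto simp: borel_compact)
    fix \<phi> assume \<phi>: "\<phi> \<in> test_functions (- cball 0 R)"
    obtain K where K: "compact K" "K \<subseteq> - cball 0 R" "\<And>x. x \<notin> K \<Longrightarrow> \<phi> x = 0"
      using \<phi> by (rule test_functionsE) blast
    have "h x * pd i \<phi> x = 0" for x
    proof (cases "x \<in> K")
      case True
      then show ?thesis using assms(3)[of x] K(2) by auto
    next
      case False
      then show ?thesis using pd_zero_outside[OF K(1), of \<phi>] K(3) by simp
    qed
    then have "(\<integral>x. h x * pd i \<phi> x \<partial>lborel) = 0" by (simp only: Bochner_Integration.integral_zero)
    then show "(\<integral>x. d x * \<phi> x \<partial>lborel) = 0"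
      using gweakD[OF assms(1) test_functions_mono[OF \<phi>]] by simp
  qed (use assms in auto)
  then show ?thesis by simp
qed

lemma null_sphere: "AE x in lborel. x \<notin> sphere (0::real^2) R"
proof -
  have "sphere (0::real^2) R \<in> null_sets lborel"
    using negligible_sphere[of "0::real^2" R] by (simp add: negligible_iff_null_sets null_sets_completion_iff)
  then show ?thesis by (rule AE_not_in)
qed

lemma gweak_AE_cong:
  assumes "gweak i h d" "AE x in lborel. h x = h' x" "AE x in lborel. d x = d' x"
    "h \<in> borel_measurable borel" "h' \<in> borel_measurable borel" "d \<in> borel_measurable borel" "d' \<in> borel_measurable borel"
  shows "gweak i h' d'"
  unfolding gweak_def
proof
  fix \<phi> assume \<phi>: "\<phi> \<in> test_functions UNIV"
  note [measurable] = test_measurable[OF \<phi>] test_measurable[OF test_functions_pd[OF \<phi>]] assms(4-)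
  have "(\<integral>x. h' x * pd i \<phi> x \<partial>lborel) = (\<integral>x. h x * pd i \<phi> x \<partial>lborel)"
    using assms(2) by (intro integral_cong_AE) (auto elim: eventually_mono)
  moreover have "(\<integral>x. d' x * \<phi> x \<partial>lborel) = (\<integral>x. d x * \<phi> x \<partial>lborel)"
    using assms(3) by (intro integral_cong_AE) (auto elim: eventually_mono)
  ultimately show "(\<integral>x. h' x * pd i \<phi> x \<partial>lborel) = - (\<integral>x. d' x * \<phi> x \<partial>lborel)"
    using gweakD[OF assms(1) \<phi>] by simp
qed

text \<open>Square integrable functions on the plane that are zero extensions from the open disc.
  They vanish at every point outside, the circle included, so each is its own Borel representative
  on the disc.\<close>

definition L2_ball :: "real \<Rightarrow> cfun \<Rightarrow> bool" where
  "L2_ball R h \<longleftrightarrow> L2b h \<and> (\<forall>x. x \<notin> ball 0 R \<longrightarrow> h x = 0)"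

lemma L2_ballD:
  assumes "L2_ball R h"
  shows "L2b h" "x \<notin> ball 0 R \<Longrightarrow> h x = 0" "x \<notin> cball 0 R \<Longrightarrow> h x = 0" "integrable lborel h"
    "h \<in> borel_measurable borel"
proof -
  show 1: "L2b h" and 2: "x \<notin> ball 0 R \<Longrightarrow> h x = 0" for x using assms by (auto simp: L2_ball_def)
  show 3: "x \<notin> cball 0 R \<Longrightarrow> h x = 0" for x by (rule 2) auto
  show "integrable lborel h" by (rule L2b_integrable[OF 1 3])
  show "h \<in> borel_measurable borel" using 1 by (rule L2b_measurable)
qed

lemma gweak_limit:
  assumes a: "\<And>n. a n \<in> test_functions UNIV" and h: "L2b h" "(\<lambda>n. N2 (\<lambda>x. a n x - h x)) \<longlonglongrightarrow> 0"
    and d: "L2b d" "(\<lambda>n. N2 (\<lambda>x. pd i (a n) x - d x)) \<longlonglongrightarrow> 0"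
  shows "gweak i h d"
  unfolding gweak_def
proof
  fix \<phi> assume \<phi>: "\<phi> \<in> test_functions UNIV"
  have "(\<lambda>n. \<integral>x. a n x * pd i \<phi> x \<partial>lborel) \<longlonglongrightarrow> (\<integral>x. h x * pd i \<phi> x \<partial>lborel)"
    by (rule tendsto_integral_mult_L2[OF L2b_test[OF a] h L2b_test[OF test_functions_pd[OF \<phi>]]])
  moreover have "(\<lambda>n. - (\<integral>x. pd i (a n) x * \<phi> x \<partial>lborel)) \<longlonglongrightarrow> - (\<integral>x. d x * \<phi> x \<partial>lborel)"
    by (intro tendsto_minus tendsto_integral_mult_L2[OF L2b_test[OF test_functions_pd[OF a]] d L2b_test[OF \<phi>]])
  moreover have "(\<integral>x. a n x * pd i \<phi> x \<partial>lborel) = - (\<integral>x. pd i (a n) x * \<phi> x \<partial>lborel)" for n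
    by (rule integral_by_parts[OF open_UNIV test_functions_smooth[OF a] \<phi>])
  ultimately show "(\<integral>x. h x * pd i \<phi> x \<partial>lborel) = - (\<integral>x. d x * \<phi> x \<partial>lborel)"
    using LIMSEQ_unique by simp
qed

lemma L2_ball_truncate:
  assumes "L2b d" "AE x in lborel. x \<notin> cball 0 R \<longrightarrow> d x = 0"
  shows "L2_ball R (\<lambda>x. indicator (ball 0 R) x *\<^sub>R d x)" "AE x in lborel. d x = indicator (ball 0 R) x *\<^sub>R d x"
proof -
  have [measurable]: "d \<in> borel_measurable borel" using assms(1) by (rule L2b_measurable)
  show 1: "AE x in lborel. d x = indicator (ball 0 R) x *\<^sub>R d x"
    using assms(2) null_sphere[of R] by eventually_elim (auto simp: indicator_def)
  show "L2_ball R (\<lambda>x. indicator (ball 0 R) x *\<^sub>R d x)"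
  proof -
    have "(\<lambda>x. indicator (ball 0 R) x *\<^sub>R d x) \<in> borel_measurable borel"
      using L2b_measurable[OF assms(1)] by (intro borel_measurable_scaleR borel_measurable_indicator) auto
    from L2b_AE_cong[OF assms(1) this 1] show ?thesis by (simp add: L2_ball_def)
  qed
qed

text \<open>The \<open>L\<^sup>2\<close> bounds on the first and second derivatives of a test function by its Laplacian
  make the mollifications of \<open>h\<close> a Cauchy sequence in \<open>H\<^sup>2\<close>.\<close>
lemma laplace_regularity:
  assumes h: "L2_ball R h" and g: "L2_ball R g"
    and eq: "\<And>\<phi>. \<phi> \<in> test_functions UNIV \<Longrightarrow> (\<integral>x. h x * lap \<phi> x \<partial>lborel) = (\<integral>x. g x * \<phi> x \<partial>lborel)"
  obtains d D where "\<And>i. L2_ball R (d i)" "\<And>i. gweak i h (d i)"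
    "\<And>i j. L2_ball R (D i j)" "\<And>i j. gweak j (d i) (D i j)"
proof -
  define e where "e n = inverse (real (Suc n))" for n
  have e: "0 < e n" "e n \<le> 1" "e \<longlonglongrightarrow> 0" for n
    using LIMSEQ_inverse_real_of_nat by (auto simp: e_def[abs_def] field_simps)
  define a where "a n = conv h (mol (e n))" for n
  have a: "a n \<in> test_functions UNIV" for n
    unfolding a_def by (rule test_conv_mol[OF e(1) L2_ballD(3)[OF h] L2_ballD(4)[OF h]])
  \<comment> \<open>Testing the equation with the reflected mollifier shows that the classical
    Laplacian of the mollified \<open>h\<close> is the mollified \<open>g\<close>.\<close>
  have lap_a: "lap (a n) = conv g (mol (e n))" for n
  proof
    fix x
    have t: "mol (e n) \<in> test_functions UNIV" by (rule test_mol[OF e(1)])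
    have 1: "pd i (pd i (a n)) = conv h (pd i (pd i (mol (e n))))" for i
      unfolding a_def by (simp add: pd_conv[OF L2_ballD(4)[OF h]] t test_functions_pd)
    have r: "pd i (pd i (\<lambda>y. mol (e n) (x - y))) y = pd i (pd i (mol (e n))) (x - y)" for i y
    proof -
      have "pd i (\<lambda>y. mol (e n) (x - y)) = (\<lambda>y. (- 1) * pd i (mol (e n)) (x - y))"
        using test_reflect(2)[OF t] by auto
      then have "pd i (pd i (\<lambda>y. mol (e n) (x - y))) y = pd i (\<lambda>y. (- 1) * pd i (mol (e n)) (x - y)) y"
        by (simp only:)
      also have "\<dots> = (- 1) * pd i (\<lambda>y. pd i (mol (e n)) (x - y)) y"
        by (rule pd_cmult[OF test_differentiable[OF test_reflect(1)[OF test_functions_pd[OF t]]]])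
      finally show ?thesis
        using test_reflect(2)[OF test_functions_pd[OF t]] by simp
    qed
    have "lap (a n) x = (\<integral>y. h y * pd 1 (pd 1 (mol (e n))) (x - y) \<partial>lborel) + (\<integral>y. h y * pd 2 (pd 2 (mol (e n))) (x - y) \<partial>lborel)"
      unfolding lap_def sum_UNIV_2 1 by (simp add: conv_def)
    also have "\<dots> = (\<integral>y. h y * pd 1 (pd 1 (mol (e n))) (x - y) + h y * pd 2 (pd 2 (mol (e n))) (x - y) \<partial>lborel)"
      by (intro Bochner_Integration.integral_add[symmetric] conv_integrable[OF L2_ballD(4)[OF h]] test_functions_pd t)
    also have "\<dots> = (\<integral>y. h y * lap (\<lambda>y. mol (e n) (x - y)) y \<partial>lborel)"
      unfolding lap_def sum_UNIV_2 r by (simp add: distrib_left)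
    also have "\<dots> = (\<integral>y. g y * mol (e n) (x - y) \<partial>lborel)" by (rule eq[OF test_reflect(1)[OF t]])
    finally show "lap (a n) x = conv g (mol (e n)) x" by (simp add: conv_def)
  qed
  have lim: "(\<lambda>n. N2 (\<lambda>x. a n x - h x)) \<longlonglongrightarrow> 0" "(\<lambda>n. N2 (\<lambda>x. lap (a n) x - g x)) \<longlonglongrightarrow> 0"
    unfolding lap_a unfolding a_def
    using L2_ballD(1,4)[OF h] L2_ballD(1,4)[OF g] e(1,3) by (auto intro: mollify_tendsto)
  have zero: "a n x = 0" if "x \<notin> cball 0 (R + 1)" for n x
    unfolding a_def using that e(2)[of n] by (intro conv_eq_0[OF e(1) L2_ballD(3)[OF h]]) auto
  have zero1: "pd i (a n) x = 0" if "x \<notin> cball 0 (R + 1)" for i n x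
    using that by (intro pd_zero_outside[of "cball 0 (R + 1)"] zero) auto
  have zero2: "pd j (pd i (a n)) x = 0" if "x \<notin> cball 0 (R + 1)" for i j n x
    using that by (intro pd_zero_outside[of "cball 0 (R + 1)"] zero1) auto
  have Ca: "\<exists>N. \<forall>m\<ge>N. \<forall>n\<ge>N. N2 (\<lambda>x. a m x - a n x) < ennreal \<delta>" if "0 < \<delta>" for \<delta>
    using L2_Cauchy_of_convergent[OF test_measurable[OF a] L2_ballD(5)[OF h] lim(1) that] .
  have Cl: "\<exists>N. \<forall>m\<ge>N. \<forall>n\<ge>N. N2 (\<lambda>x. lap (a m) x - lap (a n) x) < ennreal \<delta>" if "0 < \<delta>" for \<delta>
    using L2_Cauchy_of_convergent[OF test_measurable[OF test_functions_lap[OF a]] L2_ballD(5)[OF g] lim(2) that] .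
  have df: "(\<lambda>x. a m x - a n x) \<in> test_functions UNIV" for m n using a by (intro test_functions_diff)
  have pdf: "pd i (\<lambda>x. a m x - a n x) = (\<lambda>x. pd i (a m) x - pd i (a n) x)" for i m n
    by (rule ext, rule pd_diff) (auto intro: test_differentiable[OF a])
  have pddf: "pd j (pd i (\<lambda>x. a m x - a n x)) = (\<lambda>x. pd j (pd i (a m)) x - pd j (pd i (a n)) x)" for i j m n
    unfolding pdf by (rule ext, rule pd_diff) (auto intro: test_differentiable[OF test_functions_pd[OF a]])
  have lapf: "lap (\<lambda>x. a m x - a n x) = (\<lambda>x. lap (a m) x - lap (a n) x)" for m n
    by (rule ext, rule lap_diff[OF open_UNIV UNIV_I]) (auto intro: test_functions_smooth[OF a])
  have ex1: "\<exists>d. L2b d \<and> (\<forall>x. x \<notin> cball 0 (R + 1) \<longrightarrow> d x = 0) \<and> (\<lambda>n. N2 (\<lambda>x. pd i (a n) x - d x)) \<longlonglongrightarrow> 0" for i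
  proof -
    have C: "\<exists>N. \<forall>m\<ge>N. \<forall>n\<ge>N. N2 (\<lambda>x. pd i (a m) x - pd i (a n) x) \<le> ennreal \<delta>" if \<delta>: "0 < \<delta>" for \<delta>
    proof -
      obtain N1 where N1: "\<And>m n. N1 \<le> m \<Longrightarrow> N1 \<le> n \<Longrightarrow> N2 (\<lambda>x. a m x - a n x) < ennreal (\<delta> / 2)"
        using Ca[of "\<delta> / 2"] \<delta> by auto
      obtain N3 where N3: "\<And>m n. N3 \<le> m \<Longrightarrow> N3 \<le> n \<Longrightarrow> N2 (\<lambda>x. lap (a m) x - lap (a n) x) < ennreal (\<delta> / 2)"
        using Cl[of "\<delta> / 2"] \<delta> by auto
      have "N2 (\<lambda>x. pd i (a m) x - pd i (a n) x) \<le> ennreal \<delta>" if "max N1 N3 \<le> m" "max N1 N3 \<le> n" for m n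
      proof -
        have "N2 (\<lambda>x. pd i (a m) x - pd i (a n) x) \<le> N2 (\<lambda>x. a m x - a n x) + N2 (\<lambda>x. lap (a m) x - lap (a n) x)"
          using N2_pd_le(1)[OF df, of i m n] unfolding pdf lapf .
        also have "\<dots> \<le> ennreal (\<delta> / 2) + ennreal (\<delta> / 2)"
          using that by (intro add_mono less_imp_le[OF N1] less_imp_le[OF N3]) auto
        also have "\<dots> = ennreal \<delta>" using \<delta> by (subst ennreal_plus[symmetric]) auto
        finally show ?thesis .
      qed
      then show ?thesis by blast
    qed
    show ?thesis
      by (rule L2_complete[of "\<lambda>n. pd i (a n)" "R + 1", OF L2b_test[OF test_functions_pd[OF a]] zero1 C]) auto
  qed
  then have "\<forall>i. \<exists>d. L2b d \<and> (\<forall>x. x \<notin> cball 0 (R + 1) \<longrightarrow> d x = 0) \<and> (\<lambda>n. N2 (\<lambda>x. pd i (a n) x - d x)) \<longlonglongrightarrow> 0" by blast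
  from choice[OF this] obtain d0 where d0: "\<And>i. L2b (d0 i)" "\<And>i x. x \<notin> cball 0 (R + 1) \<Longrightarrow> d0 i x = 0"
      "\<And>i. (\<lambda>n. N2 (\<lambda>x. pd i (a n) x - d0 i x)) \<longlonglongrightarrow> 0" by blast
  have ex2: "\<exists>d. L2b d \<and> (\<forall>x. x \<notin> cball 0 (R + 1) \<longrightarrow> d x = 0) \<and> (\<lambda>n. N2 (\<lambda>x. pd j (pd i (a n)) x - d x)) \<longlonglongrightarrow> 0" for i j
  proof -
    have C: "\<exists>N. \<forall>m\<ge>N. \<forall>n\<ge>N. N2 (\<lambda>x. pd j (pd i (a m)) x - pd j (pd i (a n)) x) \<le> ennreal \<delta>" if \<delta>: "0 < \<delta>" for \<delta>
    proof -
      obtain N3 where N3: "\<And>m n. N3 \<le> m \<Longrightarrow> N3 \<le> n \<Longrightarrow> N2 (\<lambda>x. lap (a m) x - lap (a n) x) < ennreal \<delta>"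
        using Cl[OF \<delta>] by auto
      have "N2 (\<lambda>x. pd j (pd i (a m)) x - pd j (pd i (a n)) x) \<le> ennreal \<delta>" if "N3 \<le> m" "N3 \<le> n" for m n
        using N2_pd_le(2)[OF df, of j i m n] N3[OF that] unfolding pddf lapf by (rule order_trans[OF _ less_imp_le])
      then show ?thesis by blast
    qed
    show ?thesis
      by (rule L2_complete[of "\<lambda>n. pd j (pd i (a n))" "R + 1", OF L2b_test[OF test_functions_pd[OF test_functions_pd[OF a]]] zero2 C]) auto
  qed
  then have "\<forall>p. \<exists>d. L2b d \<and> (\<forall>x. x \<notin> cball 0 (R + 1) \<longrightarrow> d x = 0) \<and> (\<lambda>n. N2 (\<lambda>x. pd (snd p) (pd (fst p) (a n)) x - d x)) \<longlonglongrightarrow> 0" by blast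
  from choice[OF this] obtain D1 where D1: "\<forall>p. L2b (D1 p) \<and> (\<forall>x. x \<notin> cball 0 (R + 1) \<longrightarrow> D1 p x = 0) \<and> (\<lambda>n. N2 (\<lambda>x. pd (snd p) (pd (fst p) (a n)) x - D1 p x)) \<longlonglongrightarrow> 0" by blast
  define D0 where "D0 i j = D1 (i, j)" for i j
  have D0: "L2b (D0 i j)" "x \<notin> cball 0 (R + 1) \<Longrightarrow> D0 i j x = 0"
      "(\<lambda>n. N2 (\<lambda>x. pd j (pd i (a n)) x - D0 i j x)) \<longlonglongrightarrow> 0" for i j x
    using D1[rule_format, of "(i, j)"] by (auto simp: D0_def)
  have w1: "gweak i h (d0 i)" for i
    by (rule gweak_limit[OF a L2_ballD(1)[OF h] lim(1) d0(1) d0(3)])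
  have w2: "gweak j (d0 i) (D0 i j)" for i j
    by (rule gweak_limit[OF test_functions_pd[OF a] d0(1) d0(3) D0(1) D0(3)])
  \<comment> \<open>The limits are so far known to vanish only off the larger disc. Since
    \<open>h\<close> vanishes off the closed disc, its weak derivatives do so almost everywhere, and
    the circle is null, so truncation to the open disc changes them on a null set only.\<close>
  define d where "d i x = indicator (ball 0 R) x *\<^sub>R d0 i x" for i x
  define D where "D i j x = indicator (ball 0 R) x *\<^sub>R D0 i j x" for i j x
  have s1: "AE x in lborel. x \<notin> cball 0 R \<longrightarrow> d0 i x = 0" for i
    by (rule gweak_support[OF w1 L2b_integrable[OF d0(1,2)] L2_ballD(3)[OF h]])
  have d: "L2_ball R (d i)" "AE x in lborel. d0 i x = d i x" for i
    using L2_ball_truncate[OF d0(1) s1] by (simp_all add: d_def[abs_def])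
  have hh: "AE x in lborel. h x = h x" by simp
  have g1: "gweak i h (d i)" for i
    by (rule gweak_AE_cong[OF w1 hh d(2)]) (use L2_ballD(5)[OF h] L2_ballD(5)[OF d(1)] L2b_measurable[OF d0(1)] in auto)
  have DD: "AE x in lborel. D0 i j x = D0 i j x" for i j by simp
  have w3: "gweak j (d i) (D0 i j)" for i j
    by (rule gweak_AE_cong[OF w2 d(2) DD]) (use L2_ballD(5)[OF d(1)] L2b_measurable[OF d0(1)] L2b_measurable[OF D0(1)] in auto)
  have s2: "AE x in lborel. x \<notin> cball 0 R \<longrightarrow> D0 i j x = 0" for i j
    by (rule gweak_support[OF w3 L2b_integrable[OF D0(1,2)] L2_ballD(3)[OF d(1)]])
  have D: "L2_ball R (D i j)" "AE x in lborel. D0 i j x = D i j x" for i j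
    using L2_ball_truncate[OF D0(1) s2] by (simp_all add: D_def[abs_def])
  have dd: "AE x in lborel. d i x = d i x" for i by simp
  have g2: "gweak j (d i) (D i j)" for i j
    by (rule gweak_AE_cong[OF w3 dd D(2)]) (use L2_ballD(5)[OF d(1)] L2_ballD(5)[OF D(1)] L2b_measurable[OF D0(1)] in auto)
  show thesis by (rule that[OF d(1) g1 D(1) g2])
qed

section \<open>Functions with vanishing traces\<close>

lemma L2_ball_brep: "L2_ball R h \<Longrightarrow> brep (ball 0 R) h h"
  by (auto simp: brep_def L2_ball_def L2b_measurable)

lemma brep_L2_ball_locally_integrable:
  assumes "brep (ball 0 R) w h" "L2_ball R h"
  shows "locally_integrable_on (ball 0 R) w"
proof -
  have "integrable lborel (\<lambda>x. indicator K x *\<^sub>R h x)" if "compact K" for K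
    using L2_ballD(4)[OF assms(2)] that by (intro integrable_mult_indicator) (auto simp: borel_compact)
  then show ?thesis using locally_integrable_on_brep[OF open_ball assms(1)] by blast
qed

lemma gweak_is_weak_pd:
  assumes w: "brep (ball 0 R) w h" and v: "brep (ball 0 R) v d" and h: "L2_ball R h" and d: "L2_ball R d"
    and g: "gweak i h d"
  shows "is_weak_pd (ball 0 R) i w v"
  unfolding weak_pd_brep[OF open_ball w v]
  using brep_L2_ball_locally_integrable[OF w h] brep_L2_ball_locally_integrable[OF v d] gweakD[OF g]
  by (auto intro: test_functions_mono)

text \<open>Uniqueness identifies the chosen \<open>wpd\<close> on the disc with the weak derivative
  on the plane.\<close>

lemma wpd_brep:
  assumes w: "brep (ball 0 R) w h" and h: "L2_ball R h" and d: "L2_ball R d"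
    and g: "gweak i h d"
  shows "brep (ball 0 R) (wpd (ball 0 R) i w) d"
proof (rule brep_AE_cong[OF L2_ball_brep[OF d]])
  have "is_weak_pd (ball 0 R) i w d"
    by (rule gweak_is_weak_pd[OF w L2_ball_brep[OF d] h d g])
  from wpd_AE[OF open_ball this] show "AE x in lborel. x \<in> ball 0 R \<longrightarrow> d x = wpd (ball 0 R) i w x"
    by eventually_elim auto
qed

lemma sobolev1_brep:
  assumes w: "brep (ball 0 R) w h" and h: "L2_ball R h" and d: "\<And>i. L2_ball R (d i)" "\<And>i. gweak i h (d i)"
  shows "sobolev 1 (ball 0 R) w"
proof -
  have "L2_on (ball 0 R) w" using L2_on_brep[OF open_ball w] L2_ballD(1)[OF h] by simp
  moreover have "is_weak_pd (ball 0 R) i w (d i)" "L2_on (ball 0 R) (d i)" for i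
    using gweak_is_weak_pd[OF w L2_ball_brep[OF d(1)] h d(1) d(2)]
      L2_on_brep[OF open_ball L2_ball_brep[OF d(1)]] L2_ballD(1)[OF d(1)] by auto
  ultimately show ?thesis by auto
qed

lemma L2_norm_on_tendsto_0:
  assumes w: "brep (ball 0 R) w h" and h: "L2_ball R h"
    and F: "\<And>n. F n \<in> borel_measurable borel" and lim: "(\<lambda>n. N2 (\<lambda>x. F n x - h x)) \<longlonglongrightarrow> 0"
  shows "(\<lambda>n. L2_norm_on (ball 0 R) (\<lambda>x. F n x - w x)) \<longlonglongrightarrow> 0"
proof -
  note [measurable] = F L2_ballD(5)[OF h]
  let ?G = "\<lambda>n x. indicator (ball 0 R) x *\<^sub>R F n x - h x"
  have b: "brep (ball 0 R) (\<lambda>x. F n x - w x) (?G n)" for n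
    by (rule brep_diff[OF brep_indicator[OF open_ball F] w])
  have le: "N2 (?G n) \<le> N2 (\<lambda>x. F n x - h x)" for n
    using L2_ballD(2)[OF h] by (intro N2_mono) (auto simp: indicator_def)
  have "(\<lambda>n. N2 (?G n)) \<longlonglongrightarrow> 0"
    by (rule tendsto_sandwich[OF _ _ tendsto_const lim]) (use le in auto)
  then have "(\<lambda>n. sqrt (enn2real (N2 (?G n)))) \<longlonglongrightarrow> sqrt (enn2real 0)"
    by (intro tendsto_real_sqrt tendsto_enn2real) auto
  moreover have "enn2real (N2 (?G n)) = (\<integral>x. (cmod (?G n x))\<^sup>2 \<partial>lborel)" for n
    unfolding N2_def
  proof (rule integral_eq_nn_integral[symmetric])
    have "?G n \<in> borel_measurable lborel"
      using F[of n] L2_ballD(5)[OF h]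
      by (intro borel_measurable_diff borel_measurable_scaleR borel_measurable_indicator) auto
    then show "(\<lambda>x. (cmod (?G n x))\<^sup>2) \<in> borel_measurable lborel"
      by (intro borel_measurable_power measurable_compose[OF _ borel_measurable_norm])
  qed simp
  ultimately show ?thesis
    using L2_norm_on_brep[OF open_ball b] by simp
qed

lemma has_trace_zero:
  assumes R: "0 < R" and w: "brep (ball 0 R) w h" and h: "L2_ball R h"
    and d: "\<And>i. L2_ball R (d i)" "\<And>i. gweak i h (d i)"
  shows "has_trace R w (\<lambda>_. 0)"
proof -
  \<comment> \<open>The two sequences satisfy l R = R + e, so for |x| = R the point l x lies exactly
    at the radius from which the mollified function is zero.\<close>
  define e where "e n = R / real (Suc n)" for n
  define l where "l n = 1 + 1 / real (Suc n)" for n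
  have e: "0 < e n" "e \<longlonglongrightarrow> 0" and l: "l \<longlonglongrightarrow> 1" for n
  proof -
    show "0 < e n" using R by (simp add: e_def)
    have "(\<lambda>n. R * inverse (real (Suc n))) \<longlonglongrightarrow> R * 0"
      by (intro tendsto_mult tendsto_const LIMSEQ_inverse_real_of_nat)
    then show "e \<longlonglongrightarrow> 0" by (simp add: e_def[abs_def] divide_inverse)
    have "(\<lambda>n. 1 + inverse (real (Suc n))) \<longlonglongrightarrow> 1 + 0"
      by (intro tendsto_add tendsto_const LIMSEQ_inverse_real_of_nat)
    then show "l \<longlonglongrightarrow> 1" by (simp add: l_def[abs_def] divide_inverse)
  qed
  have lR: "R + e n = l n * R" for n by (simp add: e_def l_def field_simps)
  define \<phi> where "\<phi> n x = conv h (mol (e n)) (l n *\<^sub>R x)" for n x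
  have t: "mol (e n) \<in> test_functions UNIV" for n by (rule test_mol[OF e(1)])
  have sm: "smooth_on UNIV (\<phi> n)" for n
    using smooth_on_affine[OF smooth_conv[OF L2_ballD(4)[OF h] t[of n]], of 0 "l n"] by (simp add: \<phi>_def[abs_def])
  have pd: "pd i (\<phi> n) x = of_real (l n) * conv (d i) (mol (e n)) (l n *\<^sub>R x)" for i n x
    using pd_affine[of "conv h (mol (e n))" 0 "l n" x i]
      smooth_on_imp_differentiable[OF smooth_conv[OF L2_ballD(4)[OF h] t]]
    by (simp add: \<phi>_def[abs_def] pd_conv_gweak[OF L2_ballD(4)[OF h] d(2) t])
  have m: "smooth_on UNIV f \<Longrightarrow> f \<in> borel_measurable borel" for f
    by (intro borel_measurable_continuous_onI smooth_on_continuous)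
  have lim0: "(\<lambda>n. N2 (\<lambda>x. \<phi> n x - h x)) \<longlonglongrightarrow> 0"
    unfolding \<phi>_def by (rule mollify_dilate_tendsto[OF L2_ballD(1)[OF h] L2_ballD(4)[OF h] e l])
  have lim1: "(\<lambda>n. N2 (\<lambda>x. pd i (\<phi> n) x - d i x)) \<longlonglongrightarrow> 0" for i
  proof -
    let ?c = "\<lambda>n x. conv (d i) (mol (e n)) (l n *\<^sub>R x)"
    have [measurable]: "?c n \<in> borel_measurable borel" "d i \<in> borel_measurable borel" for n
      using m[OF smooth_on_affine[OF smooth_conv[OF L2_ballD(4)[OF d(1)[of i]] t[of n]], of 0 "l n"]] L2_ballD(5)[OF d(1)] by auto
    \<comment> \<open>The chain rule brings a factor l, so the error is l times the mollification
      error plus (l - 1) times the derivative itself.\<close>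
    have bd: "N2 (\<lambda>x. pd i (\<phi> n) x - d i x) \<le> 2 * (ennreal ((l n)\<^sup>2) * N2 (\<lambda>x. ?c n x - d i x)) + 2 * (ennreal ((l n - 1)\<^sup>2) * N2 (d i))" for n
    proof -
      have "N2 (\<lambda>x. pd i (\<phi> n) x - d i x) = N2 (\<lambda>x. of_real (l n) * (?c n x - d i x) + of_real (l n - 1) * d i x)"
        unfolding pd by (simp add: algebra_simps)
      also have "\<dots> \<le> 2 * N2 (\<lambda>x. of_real (l n) * (?c n x - d i x)) + 2 * N2 (\<lambda>x. of_real (l n - 1) * d i x)"
        by (rule N2_add) auto
      also have "N2 (\<lambda>x. of_real (l n) * (?c n x - d i x)) = ennreal ((l n)\<^sup>2) * N2 (\<lambda>x. ?c n x - d i x)"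
        by (subst N2_cmult) (auto simp: norm_of_real)
      also have "N2 (\<lambda>x. of_real (l n - 1) * d i x) = ennreal ((l n - 1)\<^sup>2) * N2 (d i)"
        by (subst N2_cmult) (auto simp: norm_of_real simp del: of_real_diff)
      finally show ?thesis .
    qed
    have "(\<lambda>n. 2 * (ennreal ((l n)\<^sup>2) * N2 (\<lambda>x. ?c n x - d i x)) + 2 * (ennreal ((l n - 1)\<^sup>2) * N2 (d i))) \<longlonglongrightarrow>
        2 * (ennreal (1\<^sup>2) * 0) + 2 * (ennreal ((1 - 1)\<^sup>2) * N2 (d i))"
      using mollify_dilate_tendsto[OF L2_ballD(1)[OF d(1)] L2_ballD(4)[OF d(1)] e l] L2_ballD(1)[OF d(1), of i]
      by (intro tendsto_add tendsto_mult_ennreal tendsto_const tendsto_ennrealI tendsto_power tendsto_diff l)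
         (auto simp: L2b_iff_N2)
    then have "(\<lambda>n. 2 * (ennreal ((l n)\<^sup>2) * N2 (\<lambda>x. ?c n x - d i x)) + 2 * (ennreal ((l n - 1)\<^sup>2) * N2 (d i))) \<longlonglongrightarrow> 0"
      by simp
    then show ?thesis by (rule tendsto_sandwich[OF _ _ tendsto_const, rotated 2]) (use bd in auto)
  qed
  have circ: "\<phi> n (circle_pt R t) = 0" for n t
  proof -
    have "norm (circle_pt R t) = R"
    proof -
      have "(norm (circle_pt R t))\<^sup>2 = R\<^sup>2 * ((cos t)\<^sup>2 + (sin t)\<^sup>2)"
        by (simp add: norm_sq_vec2 circle_pt_def power_mult_distrib distrib_left del: sin_cos_squared_add2)
      then show ?thesis using R by (simp add: power2_eq_iff_nonneg)
    qed
    moreover have "0 < l n" by (simp add: l_def add_pos_nonneg)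
    ultimately have "norm (l n *\<^sub>R circle_pt R t) = R + e n"
      unfolding lR norm_scaleR by simp
    then show ?thesis
      unfolding \<phi>_def by (intro conv_eq_0[OF e(1) L2_ballD(3)[OF h]]) auto
  qed
  have "L2_circle_norm R (\<lambda>x. \<phi> n x - 0) = 0" for n
    by (simp add: L2_circle_norm_def circ)
  moreover have "L2_circle R (\<lambda>_. 0)" by (simp add: L2_circle_def)
  moreover have "(\<lambda>n. L2_norm_on (ball 0 R) (\<lambda>x. \<phi> n x - w x)) \<longlonglongrightarrow> 0"
    by (rule L2_norm_on_tendsto_0[OF w h m[OF sm] lim0])
  moreover have "(\<lambda>n. L2_norm_on (ball 0 R) (\<lambda>x. pd i (\<phi> n) x - wpd (ball 0 R) i w x)) \<longlonglongrightarrow> 0" for i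
    by (rule L2_norm_on_tendsto_0[OF wpd_brep[OF w h d(1) d(2)] d(1) m[OF smooth_on_pd[OF sm]] lim1])
  ultimately show ?thesis
    unfolding has_trace_def using sobolev1_brep[OF w h d] sm
    by (intro conjI exI[of _ \<phi>] allI) (simp_all only: tendsto_const)
qed

lemma has_trace_normal_zero:
  assumes R: "0 < R" and w: "brep (ball 0 R) w h" and h: "L2_ball R h"
    and d: "\<And>i. L2_ball R (d i)" "\<And>i. gweak i h (d i)"
    and D: "\<And>i j. L2_ball R (D i j)" "\<And>i j. gweak j (d i) (D i j)"
  shows "has_trace R w (\<lambda>_. 0)" "has_normal_trace R w (\<lambda>_. 0)"
proof -
  show "has_trace R w (\<lambda>_. 0)" by (rule has_trace_zero[OF R w h d])
  have b: "brep (ball 0 R) (wpd (ball 0 R) i w) (d i)" for i by (rule wpd_brep[OF w h d])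
  have "is_weak_pd (ball 0 R) i w (wpd (ball 0 R) i w)" for i
    by (rule gweak_is_weak_pd[OF w b h d(1) d(2)])
  moreover have "sobolev 1 (ball 0 R) (wpd (ball 0 R) i w)" for i
    by (rule sobolev1_brep[OF b d(1) D])
  moreover have "L2_on (ball 0 R) w" using L2_on_brep[OF open_ball w] L2_ballD(1)[OF h] by simp
  ultimately have "sobolev (Suc 1) (ball 0 R) w" unfolding sobolev.simps(2)[of 1] by blast
  then have "sobolev 2 (ball 0 R) w" by (simp only: Suc_1)
  moreover have "has_trace R (wpd (ball 0 R) i w) (\<lambda>_. 0)" for i
    by (rule has_trace_zero[OF R b d(1) D])
  ultimately show "has_normal_trace R w (\<lambda>_. 0)"
    unfolding has_normal_trace_def by (auto intro!: exI[of _ "\<lambda>_ _. 0"])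
qed

text \<open>Both \<open>h\<close> and its Laplacian \<open>f\<close> solve an equation of the same
  kind, so regularity applies to each. In between, the \<open>wlap\<close> built from chosen weak
  derivatives has to be identified with \<open>f\<close>.\<close>

lemma traces_vanish:
  assumes R: "0 < R" and u: "brep (ball 0 R) u h" and L: "L2_ball R h" "L2_ball R f" "L2_ball R g"
    and 1: "\<And>\<phi>. \<phi> \<in> test_functions UNIV \<Longrightarrow> (\<integral>x. h x * lap \<phi> x \<partial>lborel) = (\<integral>x. f x * \<phi> x \<partial>lborel)"
    and 2: "\<And>\<phi>. \<phi> \<in> test_functions UNIV \<Longrightarrow> (\<integral>x. f x * lap \<phi> x \<partial>lborel) = (\<integral>x. g x * \<phi> x \<partial>lborel)"
  shows "has_trace R u (\<lambda>_. 0)" "has_trace R (wlap (ball 0 R) u) (\<lambda>_. 0)"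
    "has_normal_trace R u (\<lambda>_. 0)" "has_normal_trace R (wlap (ball 0 R) u) (\<lambda>_. 0)"
proof -
  obtain d D where d: "\<And>i. L2_ball R (d i)" "\<And>i. gweak i h (d i)"
    and D: "\<And>i j. L2_ball R (D i j)" "\<And>i j. gweak j (d i) (D i j)"
    using laplace_regularity[OF L(1,2) 1] by metis
  show "has_trace R u (\<lambda>_. 0)" "has_normal_trace R u (\<lambda>_. 0)"
    using has_trace_normal_zero[OF R u L(1) d D] by auto
  obtain e E where e: "\<And>i. L2_ball R (e i)" "\<And>i. gweak i f (e i)"
    and E: "\<And>i j. L2_ball R (E i j)" "\<And>i j. gweak j (e i) (E i j)"
    using laplace_regularity[OF L(2,3) 2] by metis
  have b: "brep (ball 0 R) (wpd (ball 0 R) i (wpd (ball 0 R) i u)) (D i i)" for i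
    by (rule wpd_brep[OF wpd_brep[OF u L(1) d] d(1) D])
  have "brep (ball 0 R) (\<lambda>x. wpd (ball 0 R) 1 (wpd (ball 0 R) 1 u) x + wpd (ball 0 R) 2 (wpd (ball 0 R) 2 u) x)
      (\<lambda>x. D 1 1 x + D 2 2 x)"
    by (rule brep_add[OF b b])
  then have w: "brep (ball 0 R) (wlap (ball 0 R) u) (\<lambda>x. D 1 1 x + D 2 2 x)"
    by (simp add: wlap_def[abs_def] sum_UNIV_2)
  \<comment> \<open>The trace of the weak Hessian and \<open>f\<close> act alike on all test
    functions of the plane.\<close>
  have "AE x in lborel. x \<in> UNIV \<longrightarrow> (D 1 1 x + D 2 2 x) - f x = 0"
  proof (rule fundamental_lemma[OF open_UNIV])
    have i: "integrable lborel (\<lambda>x. (D 1 1 x + D 2 2 x) - f x)"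
      by (intro Bochner_Integration.integrable_diff Bochner_Integration.integrable_add L2_ballD(4)[OF D(1)] L2_ballD(4)[OF L(2)])
    then show "(\<lambda>x. (D 1 1 x + D 2 2 x) - f x) \<in> borel_measurable borel" by auto
    show "integrable lborel (\<lambda>x. indicator K x *\<^sub>R ((D 1 1 x + D 2 2 x) - f x))" if "compact K" for K
      using i that by (intro integrable_mult_indicator) (auto simp: borel_compact)
    fix \<phi> assume \<phi>: "\<phi> \<in> test_functions UNIV"
    have i2: "integrable lborel (\<lambda>x. D i j x * \<phi> x)" "integrable lborel (\<lambda>x. f x * \<phi> x)"
      "integrable lborel (\<lambda>x. h x * pd i (pd i \<phi>) x)" for i j
      by (intro integrable_mult_test[OF _ \<phi>] L2_ballD(4)[OF D(1)] L2_ballD(4)[OF L(2)]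
          integrable_mult_test[OF L2_ballD(4)[OF L(1)] test_functions_pd[OF test_functions_pd[OF \<phi>]]])+
    have "(\<integral>x. h x * pd i (pd i \<phi>) x \<partial>lborel) = (\<integral>x. D i i x * \<phi> x \<partial>lborel)" for i
      using gweakD[OF d(2) test_functions_pd[OF \<phi>], of i i] gweakD[OF D(2) \<phi>, of i i] by simp
    then have "(\<integral>x. D 1 1 x * \<phi> x \<partial>lborel) + (\<integral>x. D 2 2 x * \<phi> x \<partial>lborel) = (\<integral>x. h x * lap \<phi> x \<partial>lborel)"
      using i2 by (simp add: lap_def sum_UNIV_2 distrib_left)
    then show "(\<integral>x. ((D 1 1 x + D 2 2 x) - f x) * \<phi> x \<partial>lborel) = 0"
      using 1[OF \<phi>] i2 by (simp add: algebra_simps)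
  qed
  then have ae: "AE x in lborel. D 1 1 x + D 2 2 x = f x" by eventually_elim simp
  have w': "brep (ball 0 R) (wlap (ball 0 R) u) f"
  proof -
    have "AE x in lborel. x \<in> ball 0 R \<longrightarrow> f x = wlap (ball 0 R) u x"
      using brepD(3)[OF w] ae by eventually_elim auto
    then show ?thesis by (rule brep_AE_cong[OF L2_ball_brep[OF L(2)]])
  qed
  show "has_trace R (wlap (ball 0 R) u) (\<lambda>_. 0)" "has_normal_trace R (wlap (ball 0 R) u) (\<lambda>_. 0)"
    using has_trace_normal_zero[OF R w' L(2) e E] by auto
qed

section \<open>Separated entire solutions\<close>

text \<open>The entire function for which (r/2)^n \<open>besF n\<close> at r^2/4 is the modified
  Bessel function I_n(r), and at -r^2/4 the Bessel function J_n(r). Without the power of r both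
  signs of c share one series, and differentiation raises n by one.\<close>

definition besF :: "nat \<Rightarrow> real \<Rightarrow> real" where
  "besF n s = (\<Sum>j. inverse (fact j * fact (j + n)) * s ^ j)"

lemma summable_besF: "summable (\<lambda>j. inverse (fact j * fact (j + n)) * (s::real) ^ j)"
proof (rule summable_comparison_test')
  show "summable (\<lambda>j. inverse (fact j) * \<bar>s\<bar> ^ j)" using summable_exp[of "\<bar>s\<bar>"] by simp
  fix j :: nat assume "j \<ge> 0"
  have "inverse (fact j * fact (j + n)) \<le> (inverse (fact j) :: real)"
    using fact_ge_1[of "j + n", where 'a = real] by (intro le_imp_inverse_le) auto
  then show "norm (inverse (fact j * fact (j + n)) * s ^ j) \<le> inverse (fact j) * \<bar>s\<bar> ^ j"
    by (simp add: abs_mult power_abs mult_right_mono)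
qed

lemma besF_has_derivative: "(besF n has_real_derivative besF (Suc n) s) (at s)"
proof -
  have "((\<lambda>x. \<Sum>j. inverse (fact j * fact (j + n)) * x ^ j) has_real_derivative
      (\<Sum>j. diffs (\<lambda>j. inverse (fact j * fact (j + n))) j * s ^ j)) (at s)"
    by (rule termdiffs_strong_converges_everywhere) (rule summable_besF)
  moreover have "diffs (\<lambda>j. inverse (fact j * fact (j + n))) = (\<lambda>j. inverse (fact j * fact (j + Suc n)) :: real)"
  proof
    fix j
    have "real (Suc j) * inverse ((real (Suc j) * fact j) * F) = inverse (fact j * F)" if "F \<noteq> 0" for F
      using that by (simp add: field_simps del: of_nat_Suc)
    from this[of "fact (Suc j + n)"] show "diffs (\<lambda>j. inverse (fact j * fact (j + n))) j = (inverse (fact j * fact (j + Suc n)) :: real)"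
      by (simp add: diffs_def fact_Suc[of j] del: of_nat_Suc)
  qed
  ultimately show ?thesis by (simp add: besF_def[abs_def])
qed

text \<open>Comparison of coefficients. Read with the derivative rule it is the differential
  equation f = s f'' + (n + 1) f', Bessel's equation in the variable s.\<close>

lemma besF_recurrence: "besF n s = s * besF (Suc (Suc n)) s + (real n + 1) * besF (Suc n) s"
proof -
  let ?f = "\<lambda>n j. inverse (fact j * fact (j + n)) * s ^ j"
  have split: "besF n s = ?f n 0 + (\<Sum>j. ?f n (Suc j))" for n
    unfolding besF_def using suminf_split_head[OF summable_besF[of n s]] by simp
  have s1: "summable (\<lambda>j. ?f n (Suc j))" for n using summable_besF[of n s] by (subst summable_Suc_iff)
  have t: "?f n (Suc j) = s * ?f (Suc (Suc n)) j + (real n + 1) * ?f (Suc n) (Suc j)" for j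
  proof -
    define A :: real where "A = fact j"
    define B :: real where "B = fact (j + n + 1)"
    have p: "A \<noteq> 0" "B \<noteq> 0" "real j + 1 \<noteq> 0" "real j + real n + 2 \<noteq> 0" by (auto simp: A_def B_def)
    have f: "fact (Suc j) = (real j + 1) * A" "fact (Suc j + n) = B" "fact (j + Suc (Suc n)) = (real j + real n + 2) * B"
      "fact (Suc j + Suc n) = (real j + real n + 2) * B"
      by (simp_all add: A_def B_def algebra_simps)
    have "inverse (E * A * B) = inverse (A * (D * B)) + (D - E) * inverse (E * A * (D * B))"
      if "E \<noteq> 0" "D \<noteq> 0" for D E using that p by (simp add: field_simps)
    from this[OF p(3,4)] have "inverse ((real j + 1) * A * B) = inverse (A * ((real j + real n + 2) * B)) +
        (real n + 1) * inverse ((real j + 1) * A * ((real j + real n + 2) * B))" by (simp add: algebra_simps)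
    then show ?thesis unfolding f A_def[symmetric] by (simp add: distrib_right)
  qed
  have "(\<Sum>j. ?f n (Suc j)) = s * besF (Suc (Suc n)) s + (real n + 1) * (\<Sum>j. ?f (Suc n) (Suc j))"
    unfolding t besF_def using summable_besF[of "Suc (Suc n)" s] s1[of "Suc n"]
    by (subst suminf_add[symmetric]) (auto simp: suminf_mult summable_mult)
  moreover have "inverse F = (real n + 1) * inverse ((real n + 1) * F)" for F
  proof -
    have "(real n + 1) * inverse (real n + 1) = 1" by (rule right_inverse) linarith
    then show ?thesis by (simp only: inverse_mult_distrib mult.assoc[symmetric] mult_1)
  qed
  from this[of "fact n"] have "?f n 0 = (real n + 1) * ?f (Suc n) 0"
    by (simp add: algebra_simps)
  ultimately show ?thesis using split[of n] split[of "Suc n"] by (simp add: algebra_simps)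
qed

text \<open>For a nonnegative argument all terms are nonnegative and the first is 1/n!. This bound
  keeps the regular solution with c = k^2 away from zero, and at s = 0 it shows that the series is
  not trivial.\<close>

lemma besF_ge:
  assumes "0 \<le> s"
  shows "inverse (fact n) \<le> besF n s"
proof -
  have "(\<Sum>j<1. inverse (fact j * fact (j + n)) * s ^ j) \<le> besF n s"
    unfolding besF_def using assms by (intro sum_le_suminf summable_besF) auto
  then show ?thesis by simp
qed

text \<open>For \<sigma> = 1 this is the complex coordinate, for \<sigma> = -1 its conjugate, so
  powers produce positive and negative angular frequencies.\<close>

definition zeta :: "real \<Rightarrow> cfun" where
  "zeta \<sigma> x = of_real (x $ 1) + \<i> * of_real \<sigma> * of_real (x $ 2)"

definition vrad :: "real \<Rightarrow> nat \<Rightarrow> nat \<Rightarrow> real \<Rightarrow> real" where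
  "vrad c n m s = (c / 4) ^ m * besF (n + m) (c / 4 * s)"

text \<open>Up to a constant factor, \<open>vsol c \<sigma> n\<close> is \<open>J\<^sub>n(\<surd>(-c) r) e\<^sup>i\<^sup>\<sigma>\<^sup>n\<^sup>\<theta>\<close> written as a power series in \<open>r\<^sup>2\<close> times
  \<open>(x\<^sub>1 + \<i>\<sigma>x\<^sub>2)\<^sup>n\<close>, and \<open>vrad c n m\<close> is the \<open>m\<close>-th derivative of that series with respect to \<open>r\<^sup>2\<close>.\<close>

definition vsol :: "real \<Rightarrow> real \<Rightarrow> nat \<Rightarrow> cfun" where
  "vsol c \<sigma> n x = zeta \<sigma> x ^ n * of_real (vrad c n 0 ((norm x)\<^sup>2))"

lemma smooth_zeta: "smooth_on UNIV (zeta \<sigma>)"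
  unfolding zeta_def by (intro smooth_on_add smooth_on_cmult smooth_on_coord open_UNIV)

lemma pd_zeta: "pd i (zeta \<sigma>) x = (if i = 1 then 1 else \<i> * of_real \<sigma>)"
proof -
  have "pd i (zeta \<sigma>) x = pd i (\<lambda>x. of_real (x $ 1)) x + pd i (\<lambda>x. \<i> * of_real \<sigma> * of_real (x $ 2)) x"
    unfolding zeta_def
    by (intro pd_add smooth_on_imp_differentiable[of UNIV] smooth_on_cmult smooth_on_coord) auto
  also have "pd i (\<lambda>x. \<i> * of_real \<sigma> * of_real (x $ 2)) x = \<i> * of_real \<sigma> * pd i (\<lambda>x. of_real (x $ 2)) x"
    by (intro pd_cmult smooth_on_imp_differentiable[of UNIV] smooth_on_coord) auto
  finally show ?thesis using exhaust_2[of i] by (auto simp: pd_coord)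
qed

lemma smooth_zeta_power: "smooth_on UNIV (\<lambda>x. zeta \<sigma> x ^ n)"
  by (intro smooth_on_power smooth_zeta open_UNIV)

lemma pd_zeta_power: "pd i (\<lambda>x. zeta \<sigma> x ^ n) x = of_nat n * zeta \<sigma> x ^ (n - 1) * pd i (zeta \<sigma>) x"
proof (induction n)
  case (Suc n)
  have "pd i (\<lambda>x. zeta \<sigma> x * zeta \<sigma> x ^ n) x = pd i (zeta \<sigma>) x * zeta \<sigma> x ^ n + zeta \<sigma> x * pd i (\<lambda>x. zeta \<sigma> x ^ n) x"
    by (intro pd_mult smooth_on_imp_differentiable[of UNIV] smooth_zeta smooth_zeta_power) auto
  then show ?case using Suc by (cases n) (auto simp: algebra_simps)
qed simp

text \<open>The bilinear square of the gradient of \<open>zeta\<close> is 1 - \<sigma>^2 = 0, so the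
  product rule for the Laplacian leaves nothing.\<close>

lemma lap_zeta_power:
  assumes "\<sigma>\<^sup>2 = 1"
  shows "lap (\<lambda>x. zeta \<sigma> x ^ n) x = 0"
proof (induction n)
  case 0
  then show ?case by (simp add: lap_def)
next
  case (Suc n)
  have "pd i (pd i (zeta \<sigma>)) x = 0" for i
  proof -
    have "pd i (zeta \<sigma>) = (\<lambda>x. if i = 1 then 1 else \<i> * of_real \<sigma>)" using pd_zeta by (intro ext) auto
    then show ?thesis by simp
  qed
  then have l: "lap (zeta \<sigma>) x = 0" by (simp add: lap_def)
  have s: "(complex_of_real \<sigma>)\<^sup>2 = 1" using assms by (simp flip: of_real_power)
  have "lap (\<lambda>x. zeta \<sigma> x * zeta \<sigma> x ^ n) x = lap (zeta \<sigma>) x * zeta \<sigma> x ^ n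
     + 2 * (\<Sum>i\<in>UNIV. pd i (zeta \<sigma>) x * pd i (\<lambda>x. zeta \<sigma> x ^ n) x) + zeta \<sigma> x * lap (\<lambda>x. zeta \<sigma> x ^ n) x"
    by (rule lap_mult[OF open_UNIV UNIV_I smooth_zeta smooth_zeta_power])
  also have "\<dots> = 2 * (of_nat n * zeta \<sigma> x ^ (n - 1)) * (1 - (complex_of_real \<sigma>)\<^sup>2)"
    by (simp add: l Suc sum_UNIV_2 pd_zeta_power pd_zeta power2_eq_square algebra_simps)
  finally show ?case using s by simp
qed

lemma vrad_has_derivative: "(vrad c n m has_real_derivative vrad c n (Suc m) s) (at s)"
  unfolding vrad_def[abs_def]
  by (auto intro!: derivative_eq_intros besF_has_derivative[THEN DERIV_chain2])

lemma smooth_vrad: "smooth_on UNIV (\<lambda>x. complex_of_real (vrad c n m ((norm x)\<^sup>2)))"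
  by (rule smooth_on_radial[of "vrad c n"]) (auto intro: vrad_has_derivative)

lemma pd_vrad: "pd i (\<lambda>x. complex_of_real (vrad c n m ((norm x)\<^sup>2))) x = 2 * of_real (x $ i) * of_real (vrad c n (Suc m) ((norm x)\<^sup>2))"
  by (rule pd_radial) (rule vrad_has_derivative)

lemma lap_vrad: "lap (\<lambda>x. complex_of_real (vrad c n m ((norm x)\<^sup>2))) x =
   of_real (4 * vrad c n (Suc m) ((norm x)\<^sup>2) + 4 * (norm x)\<^sup>2 * vrad c n (Suc (Suc m)) ((norm x)\<^sup>2))"
proof -
  have "pd i (pd i (\<lambda>x. complex_of_real (vrad c n m ((norm x)\<^sup>2)))) x =
      2 * of_real (vrad c n (Suc m) ((norm x)\<^sup>2)) + 4 * (of_real (x $ i))\<^sup>2 * of_real (vrad c n (Suc (Suc m)) ((norm x)\<^sup>2))" for i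
  proof -
    have "pd i (\<lambda>x. complex_of_real (vrad c n m ((norm x)\<^sup>2))) =
      (\<lambda>x. (2 * of_real (x $ i)) * of_real (vrad c n (Suc m) ((norm x)\<^sup>2)))"
      using pd_vrad by (intro ext)
    then have "pd i (pd i (\<lambda>x. complex_of_real (vrad c n m ((norm x)\<^sup>2)))) x =
      pd i (\<lambda>x. (2 * of_real (x $ i)) * of_real (vrad c n (Suc m) ((norm x)\<^sup>2))) x" by (simp only:)
    also have "\<dots> = pd i (\<lambda>x. 2 * of_real (x $ i)) x * of_real (vrad c n (Suc m) ((norm x)\<^sup>2)) +
       2 * of_real (x $ i) * pd i (\<lambda>x. complex_of_real (vrad c n (Suc m) ((norm x)\<^sup>2))) x"
      by (intro pd_mult smooth_on_imp_differentiable[of UNIV] smooth_on_cmult smooth_on_coord smooth_vrad) auto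
    also have "pd i (\<lambda>x. 2 * of_real (x $ i)) x = 2 * pd i (\<lambda>x. of_real (x $ i)) x"
      by (intro pd_cmult smooth_on_imp_differentiable[of UNIV] smooth_on_coord) auto
    finally show ?thesis unfolding pd_vrad pd_coord by (simp add: power2_eq_square)
  qed
  then have "lap (\<lambda>x. complex_of_real (vrad c n m ((norm x)\<^sup>2))) x = 4 * of_real (vrad c n (Suc m) ((norm x)\<^sup>2)) +
     4 * of_real ((x $ 1)\<^sup>2 + (x $ 2)\<^sup>2) * of_real (vrad c n (Suc (Suc m)) ((norm x)\<^sup>2))"
    by (simp add: lap_def sum_UNIV_2 algebra_simps)
  then show ?thesis by (simp add: norm_sq_vec2)
qed

lemma smooth_vsol: "smooth_on UNIV (vsol c \<sigma> n)"
  unfolding vsol_def by (intro smooth_on_mult smooth_zeta_power smooth_vrad open_UNIV)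

text \<open>Euler's identity for the homogeneous factor zeta^n turns the mixed term into n zeta^n
  times a radial derivative. With g the radial factor as a function of s = |x|^2, the Laplacian is
  zeta^n times 4 (n + 1) g' + 4 s g'', and the recurrence makes the latter equal to c g.\<close>

lemma lap_vsol:
  assumes "\<sigma>\<^sup>2 = 1"
  shows "lap (vsol c \<sigma> n) x = of_real c * vsol c \<sigma> n x"
proof -
  let ?z = "zeta \<sigma> x" and ?s = "(norm x)\<^sup>2"
  have z: "of_real (x $ 1) * pd 1 (zeta \<sigma>) x + of_real (x $ 2) * pd 2 (zeta \<sigma>) x = ?z"
    by (simp add: pd_zeta zeta_def)
  have "(\<Sum>i\<in>UNIV. pd i (\<lambda>x. zeta \<sigma> x ^ n) x * pd i (\<lambda>x. complex_of_real (vrad c n 0 ((norm x)\<^sup>2))) x)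
    = of_nat n * ?z ^ (n - 1) * (of_real (x $ 1) * pd 1 (zeta \<sigma>) x + of_real (x $ 2) * pd 2 (zeta \<sigma>) x) * 2 * of_real (vrad c n 1 ?s)"
    unfolding sum_UNIV_2 pd_vrad pd_zeta_power by (simp add: algebra_simps)
  also have "\<dots> = 2 * of_nat n * ?z ^ n * of_real (vrad c n 1 ?s)"
    unfolding z by (cases n) (auto simp: algebra_simps)
  finally have g: "(\<Sum>i\<in>UNIV. pd i (\<lambda>x. zeta \<sigma> x ^ n) x * pd i (\<lambda>x. complex_of_real (vrad c n 0 ((norm x)\<^sup>2))) x)
    = 2 * of_nat n * ?z ^ n * of_real (vrad c n 1 ?s)" .
  have "lap (vsol c \<sigma> n) x = 2 * (2 * of_nat n * ?z ^ n * of_real (vrad c n 1 ?s)) +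
    ?z ^ n * of_real (4 * vrad c n 1 ?s + 4 * ?s * vrad c n 2 ?s)"
    unfolding vsol_def[abs_def] lap_mult[OF open_UNIV UNIV_I smooth_zeta_power smooth_vrad] g lap_vrad lap_zeta_power[OF assms]
    by (simp add: numeral_2_eq_2)
  also have "\<dots> = ?z ^ n * of_real (4 * (real n + 1) * vrad c n 1 ?s + 4 * ?s * vrad c n 2 ?s)"
    by (simp add: algebra_simps)
  also have "4 * (real n + 1) * vrad c n 1 ?s + 4 * ?s * vrad c n 2 ?s
     = c * (c / 4 * ?s * besF (Suc (Suc n)) (c / 4 * ?s) + (real n + 1) * besF (Suc n) (c / 4 * ?s))"
    by (simp add: vrad_def power2_eq_square algebra_simps)
  also have "\<dots> = c * vrad c n 0 ?s" unfolding besF_recurrence[symmetric] by (simp add: vrad_def)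
  finally show ?thesis by (simp add: vsol_def[of _ _ _ x])
qed

section \<open>Smooth entire solutions as elements of \<open>H_space\<close>\<close>

lemma L2_on_smooth_ball:
  assumes "smooth_on UNIV v"
  shows "L2_on (ball 0 R) v" "brep (ball 0 R) v (\<lambda>x. indicator (ball 0 R) x *\<^sub>R v x)"
    "L2_ball R (\<lambda>x. indicator (ball 0 R) x *\<^sub>R v x)"
proof -
  have c: "continuous_on UNIV v" by (rule smooth_on_continuous[OF assms])
  then have [measurable]: "v \<in> borel_measurable borel" by (rule borel_measurable_continuous_onI)
  show b: "brep (ball 0 R) v (\<lambda>x. indicator (ball 0 R) x *\<^sub>R v x)"
    by (rule brep_indicator) auto
  have i: "integrable lborel (\<lambda>x. indicator (cball 0 R) x *\<^sub>R (cmod (v x))\<^sup>2)"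
    using c by (intro borel_integrable_compact continuous_intros) (auto intro: continuous_on_subset)
  have "integrable lborel (\<lambda>x. (cmod (indicator (ball 0 R) x *\<^sub>R v x))\<^sup>2)"
  proof (rule Bochner_Integration.integrable_bound[OF i])
    have "norm ((cmod (indicator (ball 0 R) x *\<^sub>R v x))\<^sup>2) \<le> norm (indicator (cball 0 R) x *\<^sub>R (cmod (v x))\<^sup>2)" for x
      by (auto simp: indicator_def)
    then show "AE x in lborel. norm ((cmod (indicator (ball 0 R) x *\<^sub>R v x))\<^sup>2) \<le> norm (indicator (cball 0 R) x *\<^sub>R (cmod (v x))\<^sup>2)"
      by simp
    show "(\<lambda>x. (cmod (indicator (ball 0 R) x *\<^sub>R v x))\<^sup>2) \<in> borel_measurable lborel"
      using brepD(1)[OF b] by (intro borel_measurable_power measurable_compose[OF _ borel_measurable_norm]) simp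
  qed
  then have "L2b (\<lambda>x. indicator (ball 0 R) x *\<^sub>R v x)" using brepD(1)[OF b] by (simp add: L2b_def)
  then show "L2_ball R (\<lambda>x. indicator (ball 0 R) x *\<^sub>R v x)" "L2_on (ball 0 R) v"
    using L2_on_brep[OF open_ball b] by (auto simp: L2_ball_def)
qed

lemma smooth_is_weak_pd:
  assumes "smooth_on UNIV v"
  shows "is_weak_pd (ball 0 R) i v (pd i v)"
proof -
  note b = L2_on_smooth_ball(2)[OF assms, of R] L2_on_smooth_ball(2)[OF smooth_on_pd[OF assms], of R i]
  note L = L2_on_smooth_ball(3)[OF assms, of R] L2_on_smooth_ball(3)[OF smooth_on_pd[OF assms], of R i]
  have "(\<integral>x. indicator (ball 0 R) x *\<^sub>R v x * pd i \<phi> x \<partial>lborel) = - (\<integral>x. indicator (ball 0 R) x *\<^sub>R pd i v x * \<phi> x \<partial>lborel)"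
    if \<phi>: "\<phi> \<in> test_functions (ball 0 R)" for \<phi>
  proof -
    have z: "\<psi> x = 0" if "x \<notin> ball 0 R" "\<psi> \<in> test_functions (ball 0 R)" for x \<psi>
      using that by (auto simp: test_functions_def)
    have "(\<lambda>x. indicator (ball 0 R) x *\<^sub>R v x * pd i \<phi> x) = (\<lambda>x. v x * pd i \<phi> x)"
      "(\<lambda>x. indicator (ball 0 R) x *\<^sub>R pd i v x * \<phi> x) = (\<lambda>x. pd i v x * \<phi> x)"
      using z[OF _ \<phi>] z[OF _ test_functions_pd[OF \<phi>]] by (auto simp: indicator_def fun_eq_iff)
    then show ?thesis
      using integral_by_parts[OF open_UNIV assms test_functions_mono[OF \<phi> subset_UNIV]] by simp
  qed
  then show ?thesis
    unfolding weak_pd_brep[OF open_ball b]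
    using brep_L2_ball_locally_integrable[OF b(1) L(1)] brep_L2_ball_locally_integrable[OF b(2) L(2)] by blast
qed

lemma smooth_sobolev: "smooth_on UNIV v \<Longrightarrow> sobolev m (ball 0 R) v"
proof (induction m arbitrary: v)
  case 0
  then show ?case using L2_on_smooth_ball(1) by simp
next
  case (Suc m)
  then show ?case
    using L2_on_smooth_ball(1) smooth_is_weak_pd smooth_on_pd unfolding sobolev.simps by blast
qed

lemma smooth_wlap_AE:
  assumes "smooth_on UNIV v"
  shows "AE x in lborel. x \<in> ball 0 R \<longrightarrow> wlap (ball 0 R) v x = lap v x"
proof -
  have 1: "AE x in lborel. x \<in> ball 0 R \<longrightarrow> pd i v x = wpd (ball 0 R) i v x" for i
    using wpd_AE[OF open_ball smooth_is_weak_pd[OF assms, of R i]] by eventually_elim auto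
  have w: "is_weak_pd (ball 0 R) i (wpd (ball 0 R) i v) (pd i (pd i v))" for i
    by (rule is_weak_pd_AE_cong[OF open_ball 1 _ smooth_is_weak_pd[OF smooth_on_pd[OF assms], of R i i]]) simp
  show ?thesis
    using wpd_AE[OF open_ball w[of 1]] wpd_AE[OF open_ball w[of 2]]
    by eventually_elim (auto simp: wlap_def lap_def sum_UNIV_2)
qed

text \<open>One factor c comes from the almost everywhere identity of \<open>wlap\<close> with the
  classical Laplacian, the other from integrating by parts; their product is k^4.\<close>

lemma smooth_weak_solution:
  assumes v: "smooth_on UNIV v" and l: "\<And>x. lap v x = of_real c * v x" and c: "c\<^sup>2 = k^4"
  shows "v \<in> weak_solutions k R"
proof -
  have "(LINT x|lebesgue_on (ball 0 R). wlap (ball 0 R) v x * lap \<phi> x - complex_of_real (k^4) * v x * \<phi> x)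
        = (LINT x|lebesgue_on (ball 0 R). 0 * \<phi> x)" if \<phi>: "\<phi> \<in> test_functions (ball 0 R)" for \<phi>
  proof -
    let ?B = "ball 0 R :: (real^2) set"
    have m: "v \<in> borel_measurable borel" by (intro borel_measurable_continuous_onI smooth_on_continuous v)
    have ae: "AE x in lborel. x \<in> ?B \<longrightarrow> of_real c * v x = wlap ?B v x"
      using smooth_wlap_AE[OF v, of R] by eventually_elim (auto simp: l)
    have b: "brep ?B (wlap ?B v) (\<lambda>x. indicator ?B x *\<^sub>R (of_real c * v x))"
      by (rule brep_AE_cong[OF brep_indicator ae]) (use m in auto)
    have b2: "brep ?B v (\<lambda>x. indicator ?B x *\<^sub>R v x)" by (rule brep_indicator) (use m in auto)
    have z: "\<psi> x = 0" if "x \<notin> ?B" "\<psi> \<in> test_functions ?B" for x \<psi>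
      using that by (auto simp: test_functions_def)
    note tm = test_measurable[OF \<phi>] test_measurable[OF test_functions_lap[OF \<phi>]]
    have ex: "brep ?B (\<lambda>x. wlap ?B v x * lap \<phi> x - complex_of_real (k^4) * v x * \<phi> x)
        (\<lambda>x. of_real c * v x * lap \<phi> x - complex_of_real (k^4) * v x * \<phi> x)"
      unfolding brep_def
    proof (intro conjI allI impI)
      show "(\<lambda>x. of_real c * v x * lap \<phi> x - complex_of_real (k^4) * v x * \<phi> x) \<in> borel_measurable borel"
        using m tm by measurable
      show "of_real c * v x * lap \<phi> x - complex_of_real (k^4) * v x * \<phi> x = 0" if "x \<notin> ?B" for x
        using z[OF that \<phi>] z[OF that test_functions_lap[OF \<phi>]] by simp
      show "AE x in lborel. x \<in> ?B \<longrightarrow> wlap ?B v x * lap \<phi> x - complex_of_real (k^4) * v x * \<phi> x =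
         of_real c * v x * lap \<phi> x - complex_of_real (k^4) * v x * \<phi> x"
        using ae by eventually_elim auto
    qed
    have "(LINT x|lebesgue_on ?B. wlap ?B v x * lap \<phi> x - complex_of_real (k^4) * v x * \<phi> x)
      = (\<integral>x. of_real c * v x * lap \<phi> x - complex_of_real (k^4) * v x * \<phi> x \<partial>lborel)"
      using lint_on_mult_brep[OF open_ball ex, of "\<lambda>_. 1"] by simp
    also have "\<dots> = of_real c * (\<integral>x. v x * lap \<phi> x \<partial>lborel) - complex_of_real (k^4) * (\<integral>x. v x * \<phi> x \<partial>lborel)"
    proof -
      have "integrable lborel (\<lambda>x. v x * lap \<phi> x)" "integrable lborel (\<lambda>x. v x * \<phi> x)"
        using test_integrable[OF test_functions_mult[OF test_functions_lap[OF \<phi>] open_ball smooth_on_subset[OF v subset_UNIV]]]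
          test_integrable[OF test_functions_mult[OF \<phi> open_ball smooth_on_subset[OF v subset_UNIV]]]
        by (simp_all add: mult.commute)
      then show ?thesis by (simp add: mult.assoc)
    qed
    also have "(\<integral>x. v x * lap \<phi> x \<partial>lborel) = (\<integral>x. lap v x * \<phi> x \<partial>lborel)"
      by (rule integral_lap_by_parts[OF open_UNIV v test_functions_mono[OF \<phi> subset_UNIV]])
    also have "\<dots> = of_real c * (\<integral>x. v x * \<phi> x \<partial>lborel)" by (simp add: l mult.assoc)
    also have "of_real c * (of_real c * (\<integral>x. v x * \<phi> x \<partial>lborel)) - complex_of_real (k^4) * (\<integral>x. v x * \<phi> x \<partial>lborel)
       = complex_of_real (c\<^sup>2 - k^4) * (\<integral>x. v x * \<phi> x \<partial>lborel)"
      by (simp add: power2_eq_square algebra_simps)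
    finally show ?thesis using c by simp
  qed
  then show ?thesis
    unfolding weak_solutions_def weak_biharmonic_wave_def using smooth_sobolev[OF v] by blast
qed

lemma weak_solutions_subset_H_space: "v \<in> weak_solutions k R \<Longrightarrow> v \<in> H_space k R"
proof -
  assume v: "v \<in> weak_solutions k R"
  then have "L2_on (ball 0 R) v"
    using sobolev_L2 by (auto simp: weak_solutions_def weak_biharmonic_wave_def)
  moreover have "L2_norm_on (ball 0 R) (\<lambda>x. v x - v x) = 0" by (simp add: L2_norm_on_def)
  ultimately show ?thesis unfolding H_space_def using v by force
qed

text \<open>The inner product conjugates its second argument. As c is real, the conjugate of v
  solves the same equation, so the pairing without conjugation vanishes too; the weak equation is
  stated with that pairing.\<close>

lemma H_perp_orthogonal:
  assumes S: "S \<in> H_perp k R" and v: "smooth_on UNIV v" "\<And>x. lap v x = of_real c * v x" and c: "c\<^sup>2 = k^4"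
  shows "(LINT x|lebesgue_on (ball 0 R). S x * v x) = 0"
proof -
  have "lap (\<lambda>x. cnj (v x)) x = of_real c * cnj (v x)" for x
    using lap_cnj[OF open_UNIV UNIV_I v(1)] v(2) by simp
  then have "(\<lambda>x. cnj (v x)) \<in> H_space k R"
    by (intro weak_solutions_subset_H_space smooth_weak_solution[OF smooth_on_cnj[OF open_UNIV v(1)] _ c])
  then show ?thesis using S by (auto simp: H_perp_def L2_inner_on_def)
qed

section \<open>The radial equation\<close>

text \<open>Radial equation \<open>P'' + P'/r - N P/r\<^sup>2 = q P\<close> for the Fourier modes of a solution of \<open>\<Delta>p = q p\<close>.\<close>
locale radial_ode =
  fixes R q N :: real and a a1 :: "real \<Rightarrow> real"
  assumes R0: "0 \<le> R"
    and da: "\<And>r. R < r \<Longrightarrow> (a has_real_derivative a1 r) (at r)"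
    and da1: "\<And>r. R < r \<Longrightarrow> (a1 has_real_derivative (- a1 r / r + (N / r\<^sup>2 + q) * a r)) (at r)"

text \<open>Gronwall run backwards: for C large enough, (a^2 + a1^2) exp(C s) is nondecreasing on
  the interval from r to r0, so vanishing at the right end forces vanishing at the left.\<close>

lemma radial_ode_backward:
  assumes "radial_ode R q N a a1" "R < r0" "a r0 = 0" "a1 r0 = 0" "R < r" "r \<le> r0"
  shows "a r = 0"
proof -
  interpret radial_ode R q N a a1 by fact
  \<comment> \<open>The summands bound, for s >= r, the contributions of the cross term a a1, of the
    damping a1/s and of the coefficient N/s^2 + q.\<close>
  define C where "C = 1 + 2 / r + \<bar>N\<bar> / r\<^sup>2 + \<bar>q\<bar>"
  have r: "0 < r" using R0 assms by simp
  define F where "F s = (a s)\<^sup>2 + (a1 s)\<^sup>2" for s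
  have "F r * exp (C * r) \<le> F r0 * exp (C * r0)"
  proof (rule DERIV_nonneg_imp_nondecreasing[OF \<open>r \<le> r0\<close>])
    fix s assume s: "r \<le> s" "s \<le> r0"
    then have Rs: "R < s" "0 < s" using assms r by auto
    let ?Q = "N / s\<^sup>2 + q"
    let ?F' = "2 * a s * a1 s + 2 * a1 s * (- a1 s / s + ?Q * a s)"
    have dF: "(F has_real_derivative ?F') (at s)"
      unfolding F_def[abs_def] using da[OF Rs(1)] da1[OF Rs(1)] by (auto intro!: derivative_eq_intros)
    have "((\<lambda>s. F s * exp (C * s)) has_real_derivative (?F' + C * F s) * exp (C * s)) (at s)"
      using dF by (auto intro!: derivative_eq_intros simp: algebra_simps)
    moreover have "0 \<le> (?F' + C * F s) * exp (C * s)"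
    proof -
      have ab: "2 * \<bar>x * y\<bar> \<le> x\<^sup>2 + y\<^sup>2" for x y :: real
        using sum_squares_ge_zero[of "\<bar>x\<bar> - \<bar>y\<bar>" 0] by (simp add: power2_eq_square algebra_simps abs_mult)
      have 1: "- (2 * a s * a1 s) \<le> F s" using ab[of "a s" "a1 s"] by (simp add: F_def abs_if split: if_splits)
      have "2 * (a1 s)\<^sup>2 / s \<le> 2 * (a1 s)\<^sup>2 / r" using s r by (intro divide_left_mono) auto
      also have "\<dots> \<le> 2 / r * F s" using r by (simp add: F_def field_simps)
      finally have 2: "- (2 * a1 s * (- a1 s / s)) \<le> 2 / r * F s" by (simp add: power2_eq_square)
      have "\<bar>?Q\<bar> \<le> \<bar>N\<bar> / s\<^sup>2 + \<bar>q\<bar>" using abs_triangle_ineq[of "N / s\<^sup>2" q] by (simp add: abs_divide)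
      also have "\<bar>N\<bar> / s\<^sup>2 \<le> \<bar>N\<bar> / r\<^sup>2" using s r by (intro divide_left_mono power_mono) auto
      finally have Q: "\<bar>?Q\<bar> \<le> \<bar>N\<bar> / r\<^sup>2 + \<bar>q\<bar>" by simp
      have gen: "- (2 * y * (Q * x)) \<le> \<bar>Q\<bar> * (2 * \<bar>x * y\<bar>)" for x y Q :: real
        using abs_ge_minus_self[of "2 * y * (Q * x)"] by (simp add: abs_mult mult_ac)
      have "- (2 * a1 s * (?Q * a s)) \<le> \<bar>?Q\<bar> * (2 * \<bar>a s * a1 s\<bar>)" by (rule gen)
      also have "\<dots> \<le> \<bar>?Q\<bar> * F s" using ab[of "a s" "a1 s"] by (intro mult_left_mono) (auto simp: F_def)
      also have "\<dots> \<le> (\<bar>N\<bar> / r\<^sup>2 + \<bar>q\<bar>) * F s" using Q by (intro mult_right_mono) (auto simp: F_def)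
      finally have 3: "- (2 * a1 s * (?Q * a s)) \<le> (\<bar>N\<bar> / r\<^sup>2 + \<bar>q\<bar>) * F s" .
      have "- ?F' \<le> C * F s" using 1 2 3 by (simp add: C_def algebra_simps)
      then show ?thesis by (intro mult_nonneg_nonneg) auto
    qed
    ultimately show "\<exists>y. ((\<lambda>s. F s * exp (C * s)) has_real_derivative y) (at s) \<and> 0 \<le> y" by blast
  qed
  then have "F r * exp (C * r) \<le> 0" using assms by (simp add: F_def)
  then have "F r \<le> 0" by (simp add: mult_le_0_iff)
  then show ?thesis by (simp add: F_def add_nonneg_eq_0_iff sum_power2_le_zero_iff)
qed

text \<open>Adding \<open>Re (P' cnj P)\<close> to the energy \<open>r (|P'|\<^sup>2 + k\<^sup>2 |P|\<^sup>2)\<close> makes its logarithmic derivative \<open>O(r\<^sup>-\<^sup>2)\<close>,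
  so that the energy cannot tend to zero unless it vanishes.\<close>

lemma radial_ode_decay:
  assumes A: "radial_ode R (- k\<^sup>2) N a a1" and B: "radial_ode R (- k\<^sup>2) N b b1" and k: "0 < k"
    and lim: "((\<lambda>r. r * ((a1 r)\<^sup>2 + (b1 r)\<^sup>2 + k\<^sup>2 * ((a r)\<^sup>2 + (b r)\<^sup>2))) \<longlongrightarrow> 0) at_top"
  obtains r0 where "R < r0" "\<And>r. r0 \<le> r \<Longrightarrow> a r = 0 \<and> a1 r = 0 \<and> b r = 0 \<and> b1 r = 0"
proof -
  interpret A: radial_ode R "- k\<^sup>2" N a a1 by fact
  interpret B: radial_ode R "- k\<^sup>2" N b b1 by fact
  \<comment> \<open>Beyond 1/k the correction \<open>\<rho>\<close> is at most half of the energy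
    \<open>G\<close>, so \<open>E\<close> and \<open>G\<close> are comparable.\<close>
  define r0 where "r0 = max (R + 1) (max 1 (1 / k))"
  define \<rho> where "\<rho> r = a r * a1 r + b r * b1 r" for r
  define G where "G r = r * ((a1 r)\<^sup>2 + (b1 r)\<^sup>2 + k\<^sup>2 * ((a r)\<^sup>2 + (b r)\<^sup>2))" for r
  define E where "E r = G r + \<rho> r" for r
  define C where "C = \<bar>2 * N - 1\<bar> / k + 2 * \<bar>N\<bar> / k\<^sup>2"
  have r0: "R < r0" "1 \<le> r0" "1 / k \<le> r0" by (auto simp: r0_def)
  have \<rho>: "\<bar>\<rho> r\<bar> * (2 * k * r) \<le> G r" if "r0 \<le> r" for r
  proof -
    have ab: "2 * k * \<bar>x * y\<bar> \<le> y\<^sup>2 + k\<^sup>2 * x\<^sup>2" for x y :: real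
      using sum_squares_ge_zero[of "k * \<bar>x\<bar> - \<bar>y\<bar>" 0] by (simp add: power2_eq_square algebra_simps abs_mult)
    have "2 * k * \<bar>\<rho> r\<bar> \<le> 2 * k * (\<bar>a r * a1 r\<bar> + \<bar>b r * b1 r\<bar>)"
      unfolding \<rho>_def using k by (intro mult_left_mono abs_triangle_ineq) auto
    also have "\<dots> \<le> (a1 r)\<^sup>2 + (b1 r)\<^sup>2 + k\<^sup>2 * ((a r)\<^sup>2 + (b r)\<^sup>2)"
      using ab[of "a r" "a1 r"] ab[of "b r" "b1 r"] by (simp add: algebra_simps)
    finally have "r * (2 * k * \<bar>\<rho> r\<bar>) \<le> G r"
      unfolding G_def using that r0 by (intro mult_left_mono) auto
    then show ?thesis by (simp add: mult_ac)
  qed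
  have G0: "0 \<le> G r" if "r0 \<le> r" for r using that r0 by (auto simp: G_def)
  have \<rho>2: "\<bar>\<rho> r\<bar> \<le> G r / 2" if "r0 \<le> r" for r
  proof -
    have "1 \<le> k * r0" using r0(3) k by (simp add: field_simps)
    also have "\<dots> \<le> k * r" using that k by (intro mult_left_mono) auto
    finally have "1 \<le> k * r" .
    then have "2 \<le> 2 * k * r" by simp
    then have "\<bar>\<rho> r\<bar> * 2 \<le> \<bar>\<rho> r\<bar> * (2 * k * r)" by (intro mult_left_mono) auto
    from order_trans[OF this \<rho>[OF that]] show ?thesis by simp
  qed
  have EG: "G r \<le> 2 * E r" "E r \<le> 2 * G r" if "r0 \<le> r" for r
    using \<rho>2[OF that] G0[OF that] by (auto simp: E_def)
  \<comment> \<open>The derivative of \<open>\<rho>\<close> cancels the terms k^2 |P|^2 - |P'|^2 in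
    the derivative of \<open>G\<close>, which are of the order G/r; what is left is of the order
    G/r^2.\<close>
  have E': "(E has_real_derivative ((2 * N - 1) * \<rho> r / r + N * ((a r)\<^sup>2 + (b r)\<^sup>2) / r\<^sup>2)) (at r)" if "r0 \<le> r" for r
  proof -
    have r: "R < r" "0 < r" using that r0 by auto
    note d = A.da[OF r(1)] A.da1[OF r(1)] B.da[OF r(1)] B.da1[OF r(1)]
    have "(E has_real_derivative
       (1 * ((a1 r)\<^sup>2 + (b1 r)\<^sup>2 + k\<^sup>2 * ((a r)\<^sup>2 + (b r)\<^sup>2)) +
        r * (2 * a1 r * (- a1 r / r + (N / r\<^sup>2 + - k\<^sup>2) * a r) + 2 * b1 r * (- b1 r / r + (N / r\<^sup>2 + - k\<^sup>2) * b r)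
          + k\<^sup>2 * (2 * a r * a1 r + 2 * b r * b1 r)) +
        (a1 r * a1 r + a r * (- a1 r / r + (N / r\<^sup>2 + - k\<^sup>2) * a r) + (b1 r * b1 r + b r * (- b1 r / r + (N / r\<^sup>2 + - k\<^sup>2) * b r))))) (at r)"
      unfolding E_def[abs_def] G_def[abs_def] \<rho>_def[abs_def]
      using d by (auto intro!: derivative_eq_intros simp: algebra_simps)
    moreover have "(1 * ((a1 r)\<^sup>2 + (b1 r)\<^sup>2 + k\<^sup>2 * ((a r)\<^sup>2 + (b r)\<^sup>2)) +
        r * (2 * a1 r * (- a1 r / r + (N / r\<^sup>2 + - k\<^sup>2) * a r) + 2 * b1 r * (- b1 r / r + (N / r\<^sup>2 + - k\<^sup>2) * b r)
          + k\<^sup>2 * (2 * a r * a1 r + 2 * b r * b1 r)) +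
        (a1 r * a1 r + a r * (- a1 r / r + (N / r\<^sup>2 + - k\<^sup>2) * a r) + (b1 r * b1 r + b r * (- b1 r / r + (N / r\<^sup>2 + - k\<^sup>2) * b r))))
        = (2 * N - 1) * \<rho> r / r + N * ((a r)\<^sup>2 + (b r)\<^sup>2) / r\<^sup>2"
      using r(2) by (simp add: \<rho>_def field_simps power2_eq_square)
    ultimately show ?thesis by simp
  qed
  have bd: "- ((2 * N - 1) * \<rho> r / r + N * ((a r)\<^sup>2 + (b r)\<^sup>2) / r\<^sup>2) \<le> C * E r / r\<^sup>2" if "r0 \<le> r" for r
  proof -
    have r: "1 \<le> r" using that r0 by auto
    have "\<bar>\<rho> r\<bar> \<le> G r / (2 * k * r)" using \<rho>[OF that] r k by (simp add: field_simps)
    then have "\<bar>2 * N - 1\<bar> * \<bar>\<rho> r\<bar> / r \<le> \<bar>2 * N - 1\<bar> * (G r / (2 * k * r)) / r"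
      using r by (intro divide_right_mono mult_left_mono) auto
    also have "\<dots> = \<bar>2 * N - 1\<bar> / k * (G r / 2) / r\<^sup>2" using r k by (simp add: field_simps power2_eq_square)
    also have "\<dots> \<le> \<bar>2 * N - 1\<bar> / k * E r / r\<^sup>2"
      using EG(1)[OF that] r k by (intro divide_right_mono mult_left_mono) auto
    finally have 1: "\<bar>2 * N - 1\<bar> * \<bar>\<rho> r\<bar> / r \<le> \<bar>2 * N - 1\<bar> / k * E r / r\<^sup>2" .
    have "k\<^sup>2 * ((a r)\<^sup>2 + (b r)\<^sup>2) \<le> 1 * ((a1 r)\<^sup>2 + (b1 r)\<^sup>2 + k\<^sup>2 * ((a r)\<^sup>2 + (b r)\<^sup>2))" by simp
    also have "\<dots> \<le> G r" unfolding G_def using r by (intro mult_right_mono) auto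
    also have "\<dots> \<le> 2 * E r" by (rule EG(1)[OF that])
    finally have "(a r)\<^sup>2 + (b r)\<^sup>2 \<le> 2 * E r / k\<^sup>2" using k by (simp add: field_simps)
    then have "\<bar>N\<bar> * ((a r)\<^sup>2 + (b r)\<^sup>2) / r\<^sup>2 \<le> \<bar>N\<bar> * (2 * E r / k\<^sup>2) / r\<^sup>2"
      by (intro divide_right_mono mult_left_mono) auto
    also have "\<dots> = 2 * \<bar>N\<bar> / k\<^sup>2 * E r / r\<^sup>2" by simp
    finally have 2: "\<bar>N\<bar> * ((a r)\<^sup>2 + (b r)\<^sup>2) / r\<^sup>2 \<le> 2 * \<bar>N\<bar> / k\<^sup>2 * E r / r\<^sup>2" .
    have "- ((2 * N - 1) * \<rho> r / r) \<le> \<bar>2 * N - 1\<bar> * \<bar>\<rho> r\<bar> / r"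
      using abs_ge_minus_self[of "(2 * N - 1) * \<rho> r / r"] r by (simp add: abs_mult)
    moreover have "- (N * ((a r)\<^sup>2 + (b r)\<^sup>2) / r\<^sup>2) \<le> \<bar>N\<bar> * ((a r)\<^sup>2 + (b r)\<^sup>2) / r\<^sup>2"
      using abs_ge_minus_self[of "N * ((a r)\<^sup>2 + (b r)\<^sup>2) / r\<^sup>2"] by (simp add: abs_mult)
    ultimately have "- ((2 * N - 1) * \<rho> r / r + N * ((a r)\<^sup>2 + (b r)\<^sup>2) / r\<^sup>2) \<le>
       \<bar>2 * N - 1\<bar> / k * E r / r\<^sup>2 + 2 * \<bar>N\<bar> / k\<^sup>2 * E r / r\<^sup>2" using 1 2 by linarith
    also have "\<dots> = C * E r / r\<^sup>2" by (simp add: C_def add_divide_distrib distrib_right)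
    finally show ?thesis .
  qed
  \<comment> \<open>exp(-C/r) is the integrating factor for the rate C/r^2. It stays between two
    positive constants beyond \<open>r0\<close>, so it cannot account for a decay to zero.\<close>
  have mono: "E r * exp (- (C / r)) \<le> E s * exp (- (C / s))" if rs: "r0 \<le> r" "r \<le> s" for r s
  proof (rule DERIV_nonneg_imp_nondecreasing[OF rs(2)])
    fix t assume t: "r \<le> t" "t \<le> s"
    then have t0: "r0 \<le> t" "0 < t" using rs r0 by auto
    let ?E' = "(2 * N - 1) * \<rho> t / t + N * ((a t)\<^sup>2 + (b t)\<^sup>2) / t\<^sup>2"
    have "((\<lambda>t. E t * exp (- (C / t))) has_real_derivative (?E' + C * E t / t\<^sup>2) * exp (- (C / t))) (at t)"
      using t0(2) by (auto intro!: derivative_eq_intros E'[OF t0(1)] simp: field_simps power2_eq_square)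
    moreover have "0 \<le> (?E' + C * E t / t\<^sup>2) * exp (- (C / t))"
      using bd[OF t0(1)] by (intro mult_nonneg_nonneg) auto
    ultimately show "\<exists>y. ((\<lambda>t. E t * exp (- (C / t))) has_real_derivative y) (at t) \<and> 0 \<le> y" by blast
  qed
  have C0: "0 \<le> C" using k by (simp add: C_def)
  have "E r * exp (- (C / r)) \<le> 0" if r: "r0 \<le> r" for r
  proof (rule tendsto_lowerbound)
    show "((\<lambda>s. 2 * G s) \<longlongrightarrow> 0) at_top"
      using tendsto_mult[OF tendsto_const lim, of 2] by (simp add: G_def[abs_def])
    show "\<forall>\<^sub>F s in at_top. E r * exp (- (C / r)) \<le> 2 * G s"
      using eventually_ge_at_top[of r]
    proof eventually_elim
      case (elim s)
      then have s: "r0 \<le> s" "0 < s" using r r0 by auto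
      have "E r * exp (- (C / r)) \<le> E s * exp (- (C / s))" by (rule mono[OF r elim])
      also have "\<dots> \<le> E s * 1" using EG(1)[OF s(1)] G0[OF s(1)] C0 s by (intro mult_left_mono) auto
      also have "\<dots> \<le> 2 * G s" using EG(2)[OF s(1)] by simp
      finally show ?case .
    qed
  qed simp
  then have "E r \<le> 0" if "r0 \<le> r" for r using that by (simp add: mult_le_0_iff)
  then have Gz: "G r = 0" if "r0 \<le> r" for r using EG(1)[OF that] G0[OF that] that by fastforce
  have "a r = 0 \<and> a1 r = 0 \<and> b r = 0 \<and> b1 r = 0" if "r0 \<le> r" for r
  proof -
    have "(a1 r)\<^sup>2 + (b1 r)\<^sup>2 + k\<^sup>2 * ((a r)\<^sup>2 + (b r)\<^sup>2) = 0"
      using Gz[OF that] that r0 by (simp add: G_def)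
    moreover have "0 \<le> k\<^sup>2 * ((a r)\<^sup>2 + (b r)\<^sup>2)" by simp
    ultimately have "(a1 r)\<^sup>2 + (b1 r)\<^sup>2 = 0" "k\<^sup>2 * ((a r)\<^sup>2 + (b r)\<^sup>2) = 0"
      using sum_power2_ge_zero[of "a1 r" "b1 r"] by linarith+
    then show ?thesis using k by (simp add: sum_power2_eq_zero_iff)
  qed
  with r0(1) show thesis using that by blast
qed

text \<open>The flux \<open>r Im (P' cnj P)\<close> is constant; when it vanishes, the radiation condition makes the energy
  \<open>r (|P'|\<^sup>2 + k\<^sup>2 |P|\<^sup>2)\<close> tend to zero.\<close>
lemma radiating_mode_zero:
  fixes P P1 :: "real \<Rightarrow> complex"
  assumes R: "0 \<le> R" and k: "0 < k"
    and P: "\<And>r. R < r \<Longrightarrow> (P has_vector_derivative P1 r) (at r)"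
      "\<And>r. R < r \<Longrightarrow> (P1 has_vector_derivative (- P1 r / of_real r + of_real (N / r\<^sup>2 - k\<^sup>2) * P r)) (at r)"
    and rad: "((\<lambda>r. of_real (sqrt r) * (P1 r - \<i> * of_real k * P r)) \<longlongrightarrow> 0) at_top"
    and r1: "R < r1" "Im (P1 r1 * cnj (P r1)) = 0" and r: "R < r"
  shows "P r = 0"
proof -
  define a b a1 b1 where "a = (\<lambda>r. Re (P r))" and "b = (\<lambda>r. Im (P r))" and "a1 = (\<lambda>r. Re (P1 r))" and "b1 = (\<lambda>r. Im (P1 r))"
  have re: "((\<lambda>r. Re (f r)) has_real_derivative Re D) (at r)" and im: "((\<lambda>r. Im (f r)) has_real_derivative Im D) (at r)"
    if "(f has_vector_derivative D) (at r)" for f D r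
    using bounded_linear.has_vector_derivative[OF bounded_linear_Re that]
      bounded_linear.has_vector_derivative[OF bounded_linear_Im that]
    by (simp_all add: has_real_derivative_iff_has_vector_derivative)
  have A: "radial_ode R (- k\<^sup>2) N a a1"
  proof
    show "0 \<le> R" by fact
    fix r assume "R < r"
    show "(a has_real_derivative a1 r) (at r)" unfolding a_def a1_def by (rule re[OF P(1)[OF \<open>R < r\<close>]])
    show "(a1 has_real_derivative - a1 r / r + (N / r\<^sup>2 + - k\<^sup>2) * a r) (at r)"
      using re[OF P(2)[OF \<open>R < r\<close>]] unfolding a_def a1_def
      by (simp add: Re_divide_of_real Re_complex_div_eq_0 del: of_real_diff of_real_divide of_real_power)
  qed
  have B: "radial_ode R (- k\<^sup>2) N b b1"
  proof
    show "0 \<le> R" by fact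
    fix r assume "R < r"
    show "(b has_real_derivative b1 r) (at r)" unfolding b_def b1_def by (rule im[OF P(1)[OF \<open>R < r\<close>]])
    show "(b1 has_real_derivative - b1 r / r + (N / r\<^sup>2 + - k\<^sup>2) * b r) (at r)"
      using im[OF P(2)[OF \<open>R < r\<close>]] unfolding b_def b1_def
      by (simp add: Im_divide_of_real del: of_real_diff of_real_divide of_real_power)
  qed
  interpret A: radial_ode R "- k\<^sup>2" N a a1 by fact
  interpret B: radial_ode R "- k\<^sup>2" N b b1 by fact
  \<comment> \<open>The flux r Im (P' cnj P) is r times the Wronskian of the real and the imaginary
    part, which solve the same real equation.\<close>
  define D where "D r = r * (a r * b1 r - b r * a1 r)" for r
  have "\<exists>c. \<forall>r\<in>{R<..}. D r = c"
  proof (rule has_field_derivative_zero_constant)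
    fix r assume "r \<in> {R<..}"
    then have r: "R < r" "0 < r" using R by auto
    have "(D has_real_derivative 0) (at r)"
      unfolding D_def[abs_def]
      using A.da[OF r(1)] A.da1[OF r(1)] B.da[OF r(1)] B.da1[OF r(1)] r(2)
      by (auto intro!: derivative_eq_intros simp: field_simps)
    then show "(D has_real_derivative 0) (at r within {R<..})" by (rule has_field_derivative_at_within)
  qed simp
  then obtain c where c: "\<And>r. R < r \<Longrightarrow> D r = c" by auto
  have "D r1 = 0" using r1(2) by (simp add: D_def a_def b_def a1_def b1_def algebra_simps)
  then have D0: "D r = 0" if "R < r" for r using c[OF that] c[OF r1(1)] by simp
  have "((\<lambda>r. (cmod (of_real (sqrt r) * (P1 r - \<i> * of_real k * P r)))\<^sup>2) \<longlongrightarrow> 0\<^sup>2) at_top"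
    using rad by (intro tendsto_power) (simp add: tendsto_norm_zero)
  then have "((\<lambda>r. r * ((a1 r)\<^sup>2 + (b1 r)\<^sup>2 + k\<^sup>2 * ((a r)\<^sup>2 + (b r)\<^sup>2))) \<longlongrightarrow> 0\<^sup>2) at_top"
  proof (rule Lim_transform_eventually)
    show "\<forall>\<^sub>F r in at_top. (cmod (of_real (sqrt r) * (P1 r - \<i> * of_real k * P r)))\<^sup>2 =
       r * ((a1 r)\<^sup>2 + (b1 r)\<^sup>2 + k\<^sup>2 * ((a r)\<^sup>2 + (b r)\<^sup>2))"
      using eventually_gt_at_top[of R]
    proof eventually_elim
      case (elim r)
      have "(cmod (of_real (sqrt r) * (P1 r - \<i> * of_real k * P r)))\<^sup>2 = r * (cmod (P1 r - \<i> * of_real k * P r))\<^sup>2"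
        using elim R by (simp add: norm_mult power_mult_distrib)
      also have "(cmod (P1 r - \<i> * of_real k * P r))\<^sup>2 = (a1 r + k * b r)\<^sup>2 + (b1 r - k * a r)\<^sup>2"
        by (simp add: cmod_power2 a_def b_def a1_def b1_def)
      \<comment> \<open>The squared radiation condition expands into the energy minus 2 k times the
        flux, and the flux is zero.\<close>
      also have "r * ((a1 r + k * b r)\<^sup>2 + (b1 r - k * a r)\<^sup>2) = r * ((a1 r)\<^sup>2 + (b1 r)\<^sup>2 + k\<^sup>2 * ((a r)\<^sup>2 + (b r)\<^sup>2)) - 2 * k * D r"
        by (simp add: D_def power2_eq_square algebra_simps)
      finally show ?case using D0[OF elim] by simp
    qed
  qed
  then have lim: "((\<lambda>r. r * ((a1 r)\<^sup>2 + (b1 r)\<^sup>2 + k\<^sup>2 * ((a r)\<^sup>2 + (b r)\<^sup>2))) \<longlongrightarrow> 0) at_top"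
    by simp
  obtain r0 where r0: "R < r0" "\<And>r. r0 \<le> r \<Longrightarrow> a r = 0 \<and> a1 r = 0 \<and> b r = 0 \<and> b1 r = 0"
    by (rule radial_ode_decay[OF A B k lim]) blast
  \<comment> \<open>The decay argument gives zero only far out; backward uniqueness carries it down
    to any radius beyond \<open>R\<close>.\<close>
  have "a r = 0 \<and> b r = 0"
  proof (cases "r0 \<le> r")
    case False
    then show ?thesis
      using radial_ode_backward[OF A r0(1) _ _ r] radial_ode_backward[OF B r0(1) _ _ r] r0(2)[of r0] by auto
  qed (use r0 in auto)
  then show ?thesis by (simp add: a_def b_def complex_eq_iff)
qed

text \<open>A vanishing Wronskian makes P a multiple c j of a real function, for which |P' - i k P|
  is at least |c| k j, hence at least |c| k \<delta> for r >= 1. The factor sqrt r only enlarges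
  this, so the radiation condition forces c = 0.\<close>

lemma growing_mode_zero:
  fixes P P1 :: "real \<Rightarrow> complex" and j j1 :: "real \<Rightarrow> real"
  assumes R: "0 \<le> R" and k: "0 < k" and \<delta>: "0 < \<delta>"
    and P: "\<And>r. R < r \<Longrightarrow> (P has_vector_derivative P1 r) (at r)"
    and j: "\<And>r. R < r \<Longrightarrow> (j has_real_derivative j1 r) (at r)" "\<And>r. R < r \<Longrightarrow> 0 < j r" "\<And>r. 1 \<le> r \<Longrightarrow> \<delta> \<le> j r"
    and W: "\<And>r. R < r \<Longrightarrow> P r * of_real (j1 r) = P1 r * of_real (j r)"
    and rad: "((\<lambda>r. of_real (sqrt r) * (P1 r - \<i> * of_real k * P r)) \<longlongrightarrow> 0) at_top"
    and r: "R < r"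
  shows "P r = 0"
proof -
  obtain c where "\<And>r. r \<in> {R<..} \<Longrightarrow> P r / of_real (j r) = c"
  proof (rule has_vector_derivative_zero_constant[of "{R<..}" "\<lambda>r. P r / of_real (j r)"])
    fix r assume "r \<in> {R<..}"
    then have r: "R < r" by simp
    have ji: "((\<lambda>r. 1 / j r) has_real_derivative (- j1 r / (j r)\<^sup>2)) (at r)"
      using j(1,2)[OF r] by (auto intro!: derivative_eq_intros simp: power2_eq_square)
    have "((\<lambda>r. (1 / j r) *\<^sub>R P r) has_vector_derivative ((1 / j r) *\<^sub>R P1 r + (- j1 r / (j r)\<^sup>2) *\<^sub>R P r)) (at r)"
      by (rule has_vector_derivative_scaleR[OF ji P[OF r]])
    moreover have "(1 / j r) *\<^sub>R P1 r + (- j1 r / (j r)\<^sup>2) *\<^sub>R P r = (1 / (j r)\<^sup>2) *\<^sub>R (P1 r * of_real (j r) - P r * of_real (j1 r))"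
      using j(2)[OF r] by (simp add: scaleR_conv_of_real field_simps power2_eq_square)
    ultimately have "((\<lambda>r. P r / of_real (j r)) has_vector_derivative 0) (at r)"
      using W[OF r] by (simp add: scaleR_conv_of_real field_simps)
    then show "((\<lambda>r. P r / of_real (j r)) has_vector_derivative 0) (at r within {R<..})"
      by (rule has_vector_derivative_at_within)
  qed auto
  then have c: "P r = c * of_real (j r)" if "R < r" for r
    using that j(2)[OF that] by (metis greaterThan_iff nonzero_divide_eq_eq of_real_eq_0_iff less_irrefl)
  have P1: "P1 r = c * of_real (j1 r)" if "R < r" for r
    using W[OF that] j(2)[OF that] by (simp add: c[OF that])
  have "c = 0"
  proof (rule ccontr)
    assume c0: "c \<noteq> 0"
    have "((\<lambda>r. cmod (of_real (sqrt r) * (P1 r - \<i> * of_real k * P r))) \<longlongrightarrow> 0) at_top"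
      using rad by (rule tendsto_norm_zero)
    then have "\<forall>\<^sub>F r in at_top. cmod (of_real (sqrt r) * (P1 r - \<i> * of_real k * P r)) < cmod c * k * \<delta>"
      using c0 k \<delta> by (intro order_tendstoD) auto
    then have "\<forall>\<^sub>F r in at_top. cmod (of_real (sqrt r) * (P1 r - \<i> * of_real k * P r)) < cmod c * k * \<delta> \<and> R < r \<and> 1 \<le> r"
      by (intro eventually_conj eventually_gt_at_top eventually_ge_at_top)
    from eventually_happens'[OF trivial_limit_at_top_linorder this]
    obtain r where elim: "cmod (of_real (sqrt r) * (P1 r - \<i> * of_real k * P r)) < cmod c * k * \<delta>" "R < r" "1 \<le> r"
      by blast
    have "P1 r - \<i> * of_real k * P r = c * Complex (j1 r) (- k * j r)"
      using P1[OF elim(2)] c[OF elim(2)] by (simp add: complex_eq_iff algebra_simps)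
    then have "cmod (of_real (sqrt r) * (P1 r - \<i> * of_real k * P r)) = sqrt r * (cmod c * cmod (Complex (j1 r) (- k * j r)))"
      using elim by (simp add: norm_mult)
    moreover have "1 * (cmod c * (k * \<delta>)) \<le> sqrt r * (cmod c * cmod (Complex (j1 r) (- k * j r)))"
    proof (intro mult_mono mult_left_mono)
      have "k * \<delta> \<le> \<bar>Im (Complex (j1 r) (- k * j r))\<bar>"
        using j(3)[OF elim(3)] k \<delta> by (simp add: abs_mult)
      also have "\<dots> \<le> cmod (Complex (j1 r) (- k * j r))" by (rule abs_Im_le_cmod)
      finally show "k * \<delta> \<le> cmod (Complex (j1 r) (- k * j r))" .
    qed (use elim k \<delta> in auto)
    ultimately show False using elim(1) by simp
  qed
  then show ?thesis using c[OF r] by simp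
qed

section \<open>Angular modes\<close>

text \<open>Trigonometric polynomials. The class contains the restrictions of real polynomials to
  the unit circle and so links the Stone-Weierstrass theorem with Fourier coefficients.\<close>

inductive trig :: "(real \<Rightarrow> complex) \<Rightarrow> bool" where
  trig_base: "trig (\<lambda>t. a * cis (of_int m * t))"
| trig_add: "trig f \<Longrightarrow> trig g \<Longrightarrow> trig (\<lambda>t. f t + g t)"

lemma trig_mult: "trig f \<Longrightarrow> trig g \<Longrightarrow> trig (\<lambda>t. f t * g t)"
proof (induction rule: trig.induct)
  case (trig_base a m)
  from \<open>trig g\<close> show ?case
  proof (induction rule: trig.induct)
    case (trig_base b n)
    have "(\<lambda>t. a * cis (of_int m * t) * (b * cis (of_int n * t))) = (\<lambda>t. (a * b) * cis (of_int (m + n) * t))"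
      by (auto simp: cis_mult[symmetric] algebra_simps)
    then show ?case using trig.trig_base by metis
  next
    case (trig_add f g)
    then show ?case using trig.trig_add[OF trig_add.IH] by (simp add: distrib_left)
  qed
next
  case (trig_add f1 f2)
  then show ?case using trig.trig_add[of "\<lambda>t. f1 t * g t" "\<lambda>t. f2 t * g t"] by (simp add: distrib_right)
qed

lemma trig_continuous: "trig f \<Longrightarrow> continuous_on S f"
  by (induction rule: trig.induct) (auto intro!: continuous_intros simp: cis_conv_exp)

lemma trig_integral_0:
  assumes f: "continuous_on {0..2*pi} f"
    and 0: "\<And>m. integral {0..2*pi} (\<lambda>t. f t * cis (of_int m * t)) = 0"
  shows "trig h \<Longrightarrow> integral {0..2*pi} (\<lambda>t. f t * h t) = 0"
proof (induction rule: trig.induct)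
  case (trig_base a m)
  have "(\<lambda>t. f t * (a * cis (of_int m * t))) = (\<lambda>t. a * (f t * cis (of_int m * t)))" by (auto simp: mult_ac)
  then show ?case using 0[of m] by simp
next
  case (trig_add g h)
  have "(\<lambda>t. f t * g t) integrable_on {0..2*pi}" "(\<lambda>t. f t * h t) integrable_on {0..2*pi}"
    by (intro integrable_continuous_interval continuous_on_mult f trig_continuous trig_add.hyps)+
  then show ?case using trig_add.IH by (simp add: distrib_left Henstock_Kurzweil_Integration.integral_add)
qed

lemma circle_pt_eq: "circle_pt r t = (r * cos t) *\<^sub>R axis 1 1 + (r * sin t) *\<^sub>R axis 2 1"
  by (simp add: circle_pt_def vec_eq_iff forall_2 axis_def)

lemma circle_pt_scale: "circle_pt r t = r *\<^sub>R circle_pt 1 t"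
  by (simp add: circle_pt_def vec_eq_iff forall_2)

lemma norm_circle_pt: "norm (circle_pt r t) = \<bar>r\<bar>"
proof -
  have "(norm (circle_pt r t))\<^sup>2 = r\<^sup>2 * ((cos t)\<^sup>2 + (sin t)\<^sup>2)"
    by (simp add: norm_sq_vec2 circle_pt_def power_mult_distrib distrib_left del: sin_cos_squared_add2)
  then have "(norm (circle_pt r t))\<^sup>2 = \<bar>r\<bar>\<^sup>2" by simp
  then show ?thesis by (rule power2_eq_imp_eq) auto
qed

lemma circle_pt_continuous [continuous_intros]:
  fixes r t :: "'a::t2_space \<Rightarrow> real"
  shows "continuous_on S r \<Longrightarrow> continuous_on S t \<Longrightarrow> continuous_on S (\<lambda>x. circle_pt (r x) (t x))"
  unfolding circle_pt_eq by (intro continuous_intros)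

lemma polynomial_trig:
  "real_polynomial_function q \<Longrightarrow> trig (\<lambda>t. complex_of_real (q (circle_pt 1 t)))"
proof (induction rule: real_polynomial_function.induct)
  case (linear q)
  interpret bounded_linear q by fact
  have c: "complex_of_real (cos t) = 1/2 * cis (of_int 1 * t) + 1/2 * cis (of_int (-1) * t)"
    and s: "complex_of_real (sin t) = (- \<i> / 2) * cis (of_int 1 * t) + (\<i> / 2) * cis (of_int (-1) * t)" for t
    by (simp_all add: complex_eq_iff)
  have "complex_of_real (q (circle_pt 1 t)) = complex_of_real (cos t) * (of_real (q (axis 1 1)) * cis (of_int 0 * t))
      + complex_of_real (sin t) * (of_real (q (axis 2 1)) * cis (of_int 0 * t))" for t
    unfolding circle_pt_eq add scaleR by simp
  moreover have "trig (\<lambda>t. complex_of_real (cos t))" "trig (\<lambda>t. complex_of_real (sin t))"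
    unfolding c s by (intro trig.intros)+
  ultimately show ?case by (simp only:) (intro trig.intros trig_mult)
next
  case (const c)
  show ?case using trig_base[of "of_real c" 0] by simp
next
  case (add f g)
  then show ?case using trig_add by simp
next
  case (mult f g)
  then show ?case using trig_mult by simp
qed

text \<open>Let h be a trigonometric polynomial uniformly close to cnj f. Since f integrates to zero
  against h, the integral of |f|^2 equals that of f (cnj f - h), which is arbitrarily small.\<close>

lemma circle_Fourier_unique:
  assumes g: "continuous_on (sphere 0 1) g"
    and 0: "\<And>m. integral {0..2*pi} (\<lambda>t. g (circle_pt 1 t) * cis (of_int m * t)) = 0"
    and t: "t \<in> {0..2*pi}"
  shows "g (circle_pt 1 t) = (0::complex)"
proof -
  define f where "f t = g (circle_pt 1 t)" for t
  have f: "continuous_on {0..2*pi} f"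
    unfolding f_def by (intro continuous_on_compose2[OF g] continuous_intros) (auto simp: norm_circle_pt)
  have "compact (f ` {0..2*pi})" using f by (intro compact_continuous_image) auto
  then obtain M where "\<And>z. z \<in> f ` {0..2*pi} \<Longrightarrow> cmod z \<le> M" by (metis compact_imp_bounded bounded_iff)
  then have M: "cmod (f t) \<le> \<bar>M\<bar>" if "t \<in> {0..2*pi}" for t using that by fastforce
  have bound: "integral {0..2*pi} (\<lambda>t. (cmod (f t))\<^sup>2) \<le> \<bar>M\<bar> * (2 * e) * (2 * pi)" if e: "0 < e" for e
  proof -
    have "continuous_on (sphere 0 1) (\<lambda>x. Re (g x))" "continuous_on (sphere 0 1) (\<lambda>x. Im (g x))"
      using g by (auto intro: continuous_intros)
    then obtain q1 q2 where q: "real_polynomial_function q1" "real_polynomial_function q2"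
      "\<And>x. x \<in> sphere 0 1 \<Longrightarrow> \<bar>Re (g x) - q1 x\<bar> < e" "\<And>x. x \<in> sphere 0 1 \<Longrightarrow> \<bar>Im (g x) - q2 x\<bar> < e"
      using Stone_Weierstrass_real_polynomial_function[OF compact_sphere _ e] by metis
    \<comment> \<open>The conjugate is approximated, hence -i in front of the imaginary part; the
      constant carries a \<open>cis\<close> of frequency 0 to fit \<open>trig_base\<close>.\<close>
    define h where "h t = complex_of_real (q1 (circle_pt 1 t)) + (- \<i> * cis (of_int 0 * t)) * complex_of_real (q2 (circle_pt 1 t))" for t
    have h: "trig h" unfolding h_def[abs_def] using q by (intro trig_add trig_mult trig_base polynomial_trig)
    have hc: "continuous_on {0..2*pi} h" by (rule trig_continuous[OF h])
    have fh: "cmod (cnj (f t) - h t) \<le> 2 * e" for t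
    proof -
      have s: "circle_pt 1 t \<in> sphere 0 1" by (simp add: norm_circle_pt)
      have "cmod (cnj (f t) - h t) \<le> \<bar>Re (cnj (f t) - h t)\<bar> + \<bar>Im (cnj (f t) - h t)\<bar>" by (rule cmod_le)
      also have "\<dots> \<le> e + e" using q(3,4)[OF s] by (intro add_mono) (auto simp: h_def f_def)
      finally show ?thesis by simp
    qed
    have "integral {0..2*pi} (\<lambda>t. complex_of_real ((cmod (f t))\<^sup>2)) = integral {0..2*pi} (\<lambda>t. f t * (cnj (f t) - h t) + f t * h t)"
      by (intro Henstock_Kurzweil_Integration.integral_cong) (simp add: complex_norm_square right_diff_distrib del: of_real_power)
    also have "\<dots> = integral {0..2*pi} (\<lambda>t. f t * (cnj (f t) - h t)) + integral {0..2*pi} (\<lambda>t. f t * h t)"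
      using f hc by (intro Henstock_Kurzweil_Integration.integral_add integrable_continuous_interval continuous_intros)
    also have "integral {0..2*pi} (\<lambda>t. f t * h t) = 0"
      using trig_integral_0[OF f _ h] 0 by (simp add: f_def)
    finally have "cmod (integral {0..2*pi} (\<lambda>t. complex_of_real ((cmod (f t))\<^sup>2))) = cmod (integral {0..2*pi} (\<lambda>t. f t * (cnj (f t) - h t)))"
      by simp
    also have "\<dots> \<le> \<bar>M\<bar> * (2 * e) * (2 * pi - 0)"
    proof (rule integral_bound)
      show "cmod (f t * (cnj (f t) - h t)) \<le> \<bar>M\<bar> * (2 * e)" if "t \<in> {0..2*pi}" for t
        unfolding norm_mult using M[OF that] fh[of t] by (intro mult_mono) auto
      show "continuous_on {0..2*pi} (\<lambda>t. f t * (cnj (f t) - h t))" using f hc by (intro continuous_intros)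
    qed auto
    also have "integral {0..2*pi} (\<lambda>t. complex_of_real ((cmod (f t))\<^sup>2)) = complex_of_real (integral {0..2*pi} (\<lambda>t. (cmod (f t))\<^sup>2))"
      using integral_linear[OF integrable_continuous_interval bounded_linear_of_real, of 0 "2*pi" "\<lambda>t. (cmod (f t))\<^sup>2"] f
      by (simp add: o_def continuous_intros)
    also have "cmod (complex_of_real (integral {0..2*pi} (\<lambda>t. (cmod (f t))\<^sup>2))) = integral {0..2*pi} (\<lambda>t. (cmod (f t))\<^sup>2)"
      using f by (simp add: integral_nonneg integrable_continuous_interval continuous_intros)
    finally show ?thesis by simp
  qed
  have "integral {0..2*pi} (\<lambda>t. (cmod (f t))\<^sup>2) \<le> 0"
  proof (rule field_le_epsilon)
    fix d :: real assume d: "0 < d"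
    have "0 < d / ((\<bar>M\<bar> + 1) * (4 * pi))" using d by simp
    note bound[OF this]
    also have "\<bar>M\<bar> * (2 * (d / (X * (4 * pi)))) * (2 * pi) = \<bar>M\<bar> / X * d" if "X \<noteq> 0" for X
      using that by (simp add: field_simps)
    then have "\<bar>M\<bar> * (2 * (d / ((\<bar>M\<bar> + 1) * (4 * pi)))) * (2 * pi) = \<bar>M\<bar> / (\<bar>M\<bar> + 1) * d" by force
    also have "\<dots> \<le> 1 * d" using d by (intro mult_right_mono) auto
    finally show "integral {0..2*pi} (\<lambda>t. (cmod (f t))\<^sup>2) \<le> 0 + d" by simp
  qed
  moreover have "0 \<le> integral {0..2*pi} (\<lambda>t. (cmod (f t))\<^sup>2)"
    using f by (intro integral_nonneg integrable_continuous_interval continuous_intros) auto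
  ultimately have "integral {0..2*pi} (\<lambda>t. (cmod (f t))\<^sup>2) = 0" by simp
  moreover have "continuous_on {0..2*pi} (\<lambda>t. (cmod (f t))\<^sup>2)" using f by (intro continuous_intros)
  ultimately have "\<forall>t\<in>{0..2*pi}. (cmod (f t))\<^sup>2 = 0"
    by (subst (asm) integral_eq_0_iff) auto
  then have "(cmod (f t))\<^sup>2 = 0" using t by blast
  then show ?thesis by (simp add: f_def)
qed

section \<open>Differentiation along curves and weighted integrals over circles\<close>

lemma has_vector_derivative_along:
  fixes f :: cfun
  assumes "(\<gamma> has_vector_derivative \<gamma>') (at s)" "f differentiable (at (\<gamma> s))"
  shows "((\<lambda>s. f (\<gamma> s)) has_vector_derivative (\<Sum>i\<in>UNIV. of_real (\<gamma>' $ i) * pd i f (\<gamma> s))) (at s)"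
proof -
  have "((\<lambda>s. f (\<gamma> s)) has_derivative (\<lambda>h. \<Sum>i\<in>UNIV. of_real ((h *\<^sub>R \<gamma>') $ i) * pd i f (\<gamma> s))) (at s)"
    using has_derivative_compose[OF assms(1)[unfolded has_vector_derivative_def] has_derivative_pd[OF assms(2)]] .
  moreover have "(\<lambda>h. \<Sum>i\<in>UNIV. of_real ((h *\<^sub>R \<gamma>') $ i) * pd i f (\<gamma> s)) = (\<lambda>h. h *\<^sub>R (\<Sum>i\<in>UNIV. of_real (\<gamma>' $ i) * pd i f (\<gamma> s)))"
    by (simp add: scaleR_conv_of_real[where 'a = complex] sum_distrib_left mult.assoc)
  ultimately show ?thesis by (simp add: has_vector_derivative_def)
qed

lemma circle_pt_derivative_r: "((\<lambda>r. circle_pt r t) has_vector_derivative circle_pt 1 t) (at r)"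
  unfolding circle_pt_eq by (auto intro!: derivative_eq_intros simp: scaleR_add_right)

lemma circle_pt_derivative_t: "((\<lambda>t. circle_pt r t) has_vector_derivative vector [- r * sin t, r * cos t]) (at t)"
proof -
  have "((\<lambda>t. circle_pt r t) has_vector_derivative ((- r * sin t) *\<^sub>R axis 1 1 + (r * cos t) *\<^sub>R axis 2 1)) (at t)"
    unfolding circle_pt_eq has_vector_derivative_def
    by (auto intro!: derivative_eq_intros simp: fun_eq_iff vec_eq_iff forall_2 axis_def algebra_simps)
  moreover have "(- r * sin t) *\<^sub>R axis 1 1 + (r * cos t) *\<^sub>R axis 2 1 = (vector [- r * sin t, r * cos t] :: real^2)"
    by (simp add: vec_eq_iff forall_2 axis_def)
  ultimately show ?thesis by simp
qed

text \<open>The weight \<open>a\<close> is kept general because the components cos t and sin t of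
  the normal and the tangent are absorbed into it.\<close>

definition circle_int :: "cfun \<Rightarrow> (real \<Rightarrow> complex) \<Rightarrow> real \<Rightarrow> complex" where
  "circle_int f a r = integral {0..2*pi} (\<lambda>t. f (circle_pt r t) * a t)"

lemma circle_pt_in: "0 \<le> R \<Longrightarrow> R < r \<Longrightarrow> circle_pt r t \<in> - cball 0 R"
  by (simp add: norm_circle_pt)

lemma smooth_circle_continuous:
  assumes "smooth_on (- cball 0 R) f" "0 \<le> R" "R < r"
  shows "continuous_on S (\<lambda>t. f (circle_pt r t))"
  by (rule continuous_on_compose2[OF smooth_on_continuous[OF assms(1)]])
    (use assms circle_pt_in in \<open>auto intro!: continuous_intros simp del: mem_cball_0 Compl_iff\<close>)

lemma circle_int_integrable:
  assumes "smooth_on (- cball 0 R) f" "0 \<le> R" "R < r" "continuous_on UNIV a"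
  shows "(\<lambda>t. f (circle_pt r t) * a t) integrable_on {0..2*pi}"
  by (intro integrable_continuous_interval continuous_on_mult smooth_circle_continuous[OF assms(1-3)]
      continuous_on_subset[OF assms(4)]) auto

lemma circle_int_add_right:
  assumes "smooth_on (- cball 0 R) f" "0 \<le> R" "R < r" "continuous_on UNIV a" "continuous_on UNIV b"
  shows "circle_int f (\<lambda>t. a t + b t) r = circle_int f a r + circle_int f b r"
  unfolding circle_int_def distrib_left
  by (intro Henstock_Kurzweil_Integration.integral_add circle_int_integrable[OF assms(1-3)] assms)

lemma circle_int_add_left:
  assumes "smooth_on (- cball 0 R) f" "smooth_on (- cball 0 R) g" "0 \<le> R" "R < r" "continuous_on UNIV a"
  shows "circle_int (\<lambda>x. f x + g x) a r = circle_int f a r + circle_int g a r"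
  unfolding circle_int_def distrib_right
  by (intro Henstock_Kurzweil_Integration.integral_add circle_int_integrable[OF _ assms(3,4)] assms)

lemma circle_int_cmult_right: "circle_int f (\<lambda>t. z * a t) r = z * circle_int f a r"
proof -
  have "(\<lambda>t. f (circle_pt r t) * (z * a t)) = (\<lambda>t. z * (f (circle_pt r t) * a t))" by (auto simp: mult_ac)
  then show ?thesis by (simp add: circle_int_def)
qed

lemma circle_int_cong:
  assumes "\<And>x. x \<in> - cball 0 R \<Longrightarrow> f x = g x" "0 \<le> R" "R < r"
  shows "circle_int f a r = circle_int g a r"
  unfolding circle_int_def using assms(1)[OF circle_pt_in[OF assms(2,3)]] by simp

text \<open>Along a ray the derivative of f is cos t times the first partial derivative plus sin t
  times the second; differentiation under the integral moves these factors into the weight.\<close>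

lemma circle_int_derivative:
  assumes f: "smooth_on (- cball 0 R) f" and R: "0 \<le> R" "R < r" and a: "continuous_on UNIV a"
  shows "(circle_int f a has_vector_derivative (circle_int (pd 1 f) (\<lambda>t. a t * of_real (cos t)) r + circle_int (pd 2 f) (\<lambda>t. a t * of_real (sin t)) r)) (at r)"
proof -
  let ?d = "\<lambda>r t. pd 1 f (circle_pt r t) * (a t * of_real (cos t)) + pd 2 f (circle_pt r t) * (a t * of_real (sin t))"
  have cp: "continuous_on ({R<..} \<times> cbox 0 (2*pi)) (\<lambda>x. g (circle_pt (fst x) (snd x)))" if g: "smooth_on (- cball 0 R) g" for g
    by (rule continuous_on_compose2[OF smooth_on_continuous[OF g]])
      (use R in \<open>auto intro!: continuous_intros simp: norm_circle_pt\<close>)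
  have ca: "continuous_on ({R<..} \<times> cbox 0 (2*pi)) (\<lambda>x. a (snd x))"
    by (rule continuous_on_compose2[OF a]) (auto intro: continuous_intros)
  have "((\<lambda>r. integral (cbox 0 (2*pi)) (\<lambda>t. f (circle_pt r t) * a t)) has_vector_derivative
      integral (cbox 0 (2*pi)) (?d r)) (at r within {R<..})"
  proof (rule leibniz_rule_vector_derivative)
    fix s t assume s: "s \<in> {R<..}"
    then have "f differentiable (at (circle_pt s t))"
      using R by (intro smooth_on_imp_differentiable[OF f] circle_pt_in) auto
    from has_vector_derivative_along[OF circle_pt_derivative_r this]
    have "((\<lambda>s. f (circle_pt s t)) has_vector_derivative (of_real (cos t) * pd 1 f (circle_pt s t) + of_real (sin t) * pd 2 f (circle_pt s t))) (at s)"
      by (simp add: sum_UNIV_2 circle_pt_def)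
    from has_vector_derivative_mult_left[OF this, of "a t"]
    have "((\<lambda>s. f (circle_pt s t) * a t) has_vector_derivative ?d s t) (at s)" by (simp add: algebra_simps)
    then show "((\<lambda>s. f (circle_pt s t) * a t) has_vector_derivative ?d s t) (at s within {R<..})"
      by (rule has_vector_derivative_at_within)
  next
    fix s assume "s \<in> {R<..}"
    then show "(\<lambda>t. f (circle_pt s t) * a t) integrable_on cbox 0 (2*pi)"
      using circle_int_integrable[OF f R(1) _ a] by simp
  next
    show "continuous_on ({R<..} \<times> cbox 0 (2*pi)) (\<lambda>(s, t). ?d s t)"
      unfolding split_beta
      by (intro continuous_on_add continuous_on_mult cp smooth_on_pd f ca continuous_on_of_real continuous_on_cos continuous_on_sin continuous_on_snd continuous_on_id)
  qed (use R in auto)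
  then have "((\<lambda>r. integral {0..2*pi} (\<lambda>t. f (circle_pt r t) * a t)) has_vector_derivative integral {0..2*pi} (?d r)) (at r)"
    using R by (simp add: at_within_open[of r "{R<..}"])
  moreover have "integral {0..2*pi} (?d r) = circle_int (pd 1 f) (\<lambda>t. a t * of_real (cos t)) r + circle_int (pd 2 f) (\<lambda>t. a t * of_real (sin t)) r"
    unfolding circle_int_def
    by (intro Henstock_Kurzweil_Integration.integral_add circle_int_integrable[OF _ R] smooth_on_pd f continuous_on_mult a continuous_intros)
  ultimately show ?thesis by (simp add: circle_int_def[abs_def])
qed

text \<open>Integration by parts in the angle: the sum is the integral of the t-derivative of the
  product of f on the circle with a(t), and this product takes equal values at 0 and 2 pi.\<close>

lemma circle_int_angular:
  assumes f: "smooth_on (- cball 0 R) f" and R: "0 \<le> R" "R < r"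
    and a: "\<And>t. (a has_vector_derivative a' t) (at t)" "continuous_on UNIV a'" "a (2*pi) = a 0"
  shows "of_real r * (circle_int (pd 2 f) (\<lambda>t. a t * of_real (cos t)) r - circle_int (pd 1 f) (\<lambda>t. a t * of_real (sin t)) r) + circle_int f a' r = 0"
proof -
  have ca: "continuous_on UNIV a"
    using a(1) by (auto intro!: continuous_at_imp_continuous_on has_vector_derivative_continuous)
  let ?d = "\<lambda>t. of_real r * (pd 2 f (circle_pt r t) * (a t * of_real (cos t)) - pd 1 f (circle_pt r t) * (a t * of_real (sin t))) + f (circle_pt r t) * a' t"
  have "(?d has_integral (f (circle_pt r (2*pi)) * a (2*pi) - f (circle_pt r 0) * a 0)) {0..2*pi}"
  proof (rule fundamental_theorem_of_calculus)
    fix t :: real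
    have "f differentiable (at (circle_pt r t))"
      using R by (intro smooth_on_imp_differentiable[OF f] circle_pt_in) auto
    from has_vector_derivative_along[OF circle_pt_derivative_t this]
    have "((\<lambda>t. f (circle_pt r t)) has_vector_derivative (of_real (- r * sin t) * pd 1 f (circle_pt r t) + of_real (r * cos t) * pd 2 f (circle_pt r t))) (at t)"
      by (simp add: sum_UNIV_2)
    from has_vector_derivative_mult[OF this a(1)]
    have "((\<lambda>t. f (circle_pt r t) * a t) has_vector_derivative ?d t) (at t)" by (simp add: algebra_simps)
    then show "((\<lambda>t. f (circle_pt r t) * a t) has_vector_derivative ?d t) (at t within {0..2*pi})"
      by (rule has_vector_derivative_at_within)
  qed simp
  moreover have "circle_pt r (2*pi) = circle_pt r 0" by (simp add: circle_pt_def)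
  ultimately have "(?d has_integral 0) {0..2*pi}" using a(3) by simp
  then have "integral {0..2*pi} ?d = 0" by (rule integral_unique)
  moreover have i: "(\<lambda>t. pd 2 f (circle_pt r t) * (a t * of_real (cos t))) integrable_on {0..2*pi}"
     "(\<lambda>t. pd 1 f (circle_pt r t) * (a t * of_real (sin t))) integrable_on {0..2*pi}"
     "(\<lambda>t. f (circle_pt r t) * a' t) integrable_on {0..2*pi}"
    by (intro circle_int_integrable[OF _ R] smooth_on_pd f continuous_on_mult ca a(2) continuous_intros)+
  have "integral {0..2*pi} ?d = of_real r * (integral {0..2*pi} (\<lambda>t. pd 2 f (circle_pt r t) * (a t * of_real (cos t))) -
      integral {0..2*pi} (\<lambda>t. pd 1 f (circle_pt r t) * (a t * of_real (sin t)))) + integral {0..2*pi} (\<lambda>t. f (circle_pt r t) * a' t)"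
    using i by (subst Henstock_Kurzweil_Integration.integral_add)
      (auto intro!: integrable_diff integrable_on_mult_right simp: Henstock_Kurzweil_Integration.integral_diff)
  ultimately show ?thesis by (simp add: circle_int_def)
qed

text \<open>The unnormalised Fourier coefficient of p on the circle of radius r, for the frequency
  -\<nu>.\<close>

definition mode :: "real \<Rightarrow> cfun \<Rightarrow> real \<Rightarrow> complex" where
  "mode \<nu> p = circle_int p (\<lambda>t. cis (\<nu> * t))"

definition mode1 :: "real \<Rightarrow> cfun \<Rightarrow> real \<Rightarrow> complex" where
  "mode1 \<nu> p r = circle_int (pd 1 p) (\<lambda>t. cis (\<nu> * t) * of_real (cos t)) r + circle_int (pd 2 p) (\<lambda>t. cis (\<nu> * t) * of_real (sin t)) r"

lemma cis_derivative: "((\<lambda>t. cis (\<nu> * t)) has_vector_derivative (\<i> * of_real \<nu> * cis (\<nu> * t))) (at t)"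
proof -
  have "((\<lambda>t. cis (\<nu> * t)) has_derivative (\<lambda>h. (\<nu> * h) *\<^sub>R (\<i> * cis (\<nu> * t)))) (at t)"
    by (rule has_derivative_cis) (auto intro!: derivative_eq_intros)
  then show ?thesis by (simp add: has_vector_derivative_def scaleR_conv_of_real mult_ac)
qed

lemma cis_continuous: "continuous_on S (\<lambda>t. cis (\<nu> * t))"
  by (auto intro!: continuous_intros simp: cis_conv_exp)

lemma mode_derivative:
  assumes "smooth_on (- cball 0 R) p" "0 \<le> R" "R < r"
  shows "(mode \<nu> p has_vector_derivative mode1 \<nu> p r) (at r)"
  unfolding mode_def mode1_def by (rule circle_int_derivative[OF assms cis_continuous])

lemma cos_derivative_complex: "((\<lambda>t. complex_of_real (cos t)) has_vector_derivative - complex_of_real (sin t)) (at t)"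
  and sin_derivative_complex: "((\<lambda>t. complex_of_real (sin t)) has_vector_derivative complex_of_real (cos t)) (at t)"
  using has_vector_derivative_of_real[of cos "- sin t" "at t"] has_vector_derivative_of_real[of sin "cos t" "at t"]
  by (auto simp: has_real_derivative_iff_has_vector_derivative[symmetric] intro!: derivative_eq_intros)

text \<open>The Laplacian is the sum of the radial and the tangential second derivatives in the
  Hessian. The former give the derivative of \<open>mode1\<close>; integrating the latter by parts
  in the angle reduces them to first derivatives and then to the mode itself, which produces the
  terms P'/r and \<nu>^2 P/r^2.\<close>

lemma mode_ode:
  assumes p: "smooth_on (- cball 0 R) p" and R: "0 \<le> R" "R < r"
    and lap: "\<And>x. x \<in> - cball 0 R \<Longrightarrow> lap p x = of_real c * p x" and \<nu>: "cis (\<nu> * (2*pi)) = 1"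
  shows "(mode1 \<nu> p has_vector_derivative (- mode1 \<nu> p r / of_real r + of_real (\<nu>\<^sup>2 / r\<^sup>2 + c) * mode \<nu> p r)) (at r)"
proof -
  let ?E = "\<lambda>t. cis (\<nu> * t)" and ?c = "\<lambda>t. complex_of_real (cos t)" and ?s = "\<lambda>t. complex_of_real (sin t)"
  let ?n = "\<i> * of_real \<nu>"
  let ?p = "\<lambda>i j. pd j (pd i p)"
  have sp: "smooth_on (- cball 0 R) (pd i p)" for i by (rule smooth_on_pd[OF p])
  have spp: "smooth_on (- cball 0 R) (pd j (pd i p))" for i j by (rule smooth_on_pd[OF sp])
  have cE: "continuous_on UNIV ?E" by (rule cis_continuous)
  have cc: "continuous_on UNIV ?c" and cs: "continuous_on UNIV ?s" by (intro continuous_intros)+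
  note cont = continuous_on_mult cE cc cs continuous_on_const continuous_on_add continuous_on_diff continuous_on_minus
  have r: "r \<noteq> 0" using R by simp
  define A where "A i j a = circle_int (?p i j) a r" for i j a
  have D: "(mode1 \<nu> p has_vector_derivative
     ((A 1 1 (\<lambda>t. ?E t * ?c t * ?c t) + A 1 2 (\<lambda>t. ?E t * ?c t * ?s t)) +
      (A 2 1 (\<lambda>t. ?E t * ?s t * ?c t) + A 2 2 (\<lambda>t. ?E t * ?s t * ?s t)))) (at r)"
    unfolding mode1_def[abs_def] A_def
    by (intro has_vector_derivative_add circle_int_derivative[OF sp R] cont)
  have E1: "((\<lambda>t. ?E t * ?s t) has_vector_derivative (?E t * ?c t + ?n * ?E t * ?s t)) (at t)" for t
    by (rule has_vector_derivative_mult[OF cis_derivative sin_derivative_complex])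
  have E2: "((\<lambda>t. ?E t * ?c t) has_vector_derivative (?E t * (- ?s t) + ?n * ?E t * ?c t)) (at t)" for t
    by (rule has_vector_derivative_mult[OF cis_derivative cos_derivative_complex])
  have E3: "((\<lambda>t. ?n * ?E t) has_vector_derivative (?n * (?n * ?E t))) (at t)" for t
    by (rule has_vector_derivative_mult_right[OF cis_derivative])
  \<comment> \<open>\<open>T1\<close> and \<open>T2\<close> integrate by parts the tangential
    derivatives of the two components of the gradient, \<open>T3\<close> that of p itself.\<close>
  have T1: "of_real r * (A 1 2 (\<lambda>t. ?E t * ?s t * ?c t) - A 1 1 (\<lambda>t. ?E t * ?s t * ?s t)) + circle_int (pd 1 p) (\<lambda>t. ?E t * ?c t + ?n * ?E t * ?s t) r = 0"
    unfolding A_def by (rule circle_int_angular[OF sp R E1]) (intro cont, simp)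
  have T2: "of_real r * (A 2 2 (\<lambda>t. ?E t * ?c t * ?c t) - A 2 1 (\<lambda>t. ?E t * ?c t * ?s t)) + circle_int (pd 2 p) (\<lambda>t. ?E t * (- ?s t) + ?n * ?E t * ?c t) r = 0"
    unfolding A_def by (rule circle_int_angular[OF sp R E2]) (intro cont, simp add: \<nu>)
  have T3: "of_real r * (circle_int (pd 2 p) (\<lambda>t. ?n * ?E t * ?c t) r - circle_int (pd 1 p) (\<lambda>t. ?n * ?E t * ?s t) r) + circle_int p (\<lambda>t. ?n * (?n * ?E t)) r = 0"
    by (rule circle_int_angular[OF p R E3]) (intro cont, simp add: \<nu>)
  have s1: "circle_int (pd 1 p) (\<lambda>t. ?E t * ?c t + ?n * ?E t * ?s t) r = circle_int (pd 1 p) (\<lambda>t. ?E t * ?c t) r + circle_int (pd 1 p) (\<lambda>t. ?n * ?E t * ?s t) r"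
    by (rule circle_int_add_right[OF sp R]) (intro cont)+
  have s2: "circle_int (pd 2 p) (\<lambda>t. ?E t * (- ?s t) + ?n * ?E t * ?c t) r = - circle_int (pd 2 p) (\<lambda>t. ?E t * ?s t) r + circle_int (pd 2 p) (\<lambda>t. ?n * ?E t * ?c t) r"
  proof -
    have "circle_int (pd 2 p) (\<lambda>t. ?E t * (- ?s t) + ?n * ?E t * ?c t) r = circle_int (pd 2 p) (\<lambda>t. (-1) * (?E t * ?s t)) r + circle_int (pd 2 p) (\<lambda>t. ?n * ?E t * ?c t) r"
      by (subst circle_int_add_right[OF sp R, symmetric]) (intro cont, intro cont, simp)
    then show ?thesis by (simp only: circle_int_cmult_right) simp
  qed
  have s3: "circle_int p (\<lambda>t. ?n * (?n * ?E t)) r = - of_real (\<nu>\<^sup>2) * mode \<nu> p r"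
    unfolding circle_int_cmult_right mode_def by (simp add: power2_eq_square mult.assoc[symmetric])
      (simp add: mult.commute mult.left_commute)
  have cs1: "(cos t)\<^sup>2 + (sin t)\<^sup>2 = 1" for t :: real by simp
  have E_eq: "?E t = ?E t * ?c t * ?c t + ?E t * ?s t * ?s t" for t
  proof -
    have "?c t * ?c t + ?s t * ?s t = complex_of_real ((cos t)\<^sup>2 + (sin t)\<^sup>2)" by (simp only: of_real_add of_real_mult power2_eq_square)
    then have "?c t * ?c t + ?s t * ?s t = 1" using cs1 by simp
    then show ?thesis by (simp add: mult.assoc flip: distrib_left)
  qed
  have L: "of_real c * mode \<nu> p r = (A 1 1 (\<lambda>t. ?E t * ?c t * ?c t) + A 1 1 (\<lambda>t. ?E t * ?s t * ?s t)) +
      (A 2 2 (\<lambda>t. ?E t * ?c t * ?c t) + A 2 2 (\<lambda>t. ?E t * ?s t * ?s t))"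
  proof -
    have "of_real c * mode \<nu> p r = circle_int (\<lambda>x. of_real c * p x) ?E r"
      unfolding mode_def circle_int_def by (simp add: mult.assoc)
    also have "\<dots> = circle_int (\<lambda>x. ?p 1 1 x + ?p 2 2 x) ?E r"
      by (rule circle_int_cong[OF _ R]) (simp only: lap[symmetric], simp add: lap_def sum_UNIV_2)
    also have "\<dots> = circle_int (?p 1 1) ?E r + circle_int (?p 2 2) ?E r" by (rule circle_int_add_left[OF spp spp R cE])
    finally have 1: "of_real c * mode \<nu> p r = circle_int (?p 1 1) ?E r + circle_int (?p 2 2) ?E r" .
    have "circle_int (?p i i) ?E r = A i i (\<lambda>t. ?E t * ?c t * ?c t) + A i i (\<lambda>t. ?E t * ?s t * ?s t)" for i
      unfolding A_def by (subst E_eq, rule circle_int_add_right[OF spp R]) (intro cont)+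
    then show ?thesis using 1 by simp
  qed
  have comm: "A i j (\<lambda>t. ?E t * ?s t * ?c t) = A i j (\<lambda>t. ?E t * ?c t * ?s t)" for i j
    by (simp add: mult_ac)
  \<comment> \<open>The difference of \<open>T1\<close> and \<open>T2\<close>, with the Laplacian
    expanded by cos^2 + sin^2 = 1.\<close>
  have key: "of_real r * ((A 1 1 (\<lambda>t. ?E t * ?c t * ?c t) + A 1 2 (\<lambda>t. ?E t * ?c t * ?s t)) +
      (A 2 1 (\<lambda>t. ?E t * ?s t * ?c t) + A 2 2 (\<lambda>t. ?E t * ?s t * ?s t)) - of_real c * mode \<nu> p r) + mode1 \<nu> p r
     + (circle_int (pd 1 p) (\<lambda>t. ?n * ?E t * ?s t) r - circle_int (pd 2 p) (\<lambda>t. ?n * ?E t * ?c t) r) = 0"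
    using T1 T2 unfolding s1 s2 L mode1_def comm by (simp add: algebra_simps)
  have T3': "circle_int (pd 1 p) (\<lambda>t. ?n * ?E t * ?s t) r - circle_int (pd 2 p) (\<lambda>t. ?n * ?E t * ?c t) r = - of_real (\<nu>\<^sup>2) * mode \<nu> p r / of_real r"
    using T3 r unfolding s3 by (simp add: field_simps)
  define X where "X = (A 1 1 (\<lambda>t. ?E t * ?c t * ?c t) + A 1 2 (\<lambda>t. ?E t * ?c t * ?s t)) +
      (A 2 1 (\<lambda>t. ?E t * ?s t * ?c t) + A 2 2 (\<lambda>t. ?E t * ?s t * ?s t))"
  have "of_real r * (X - of_real c * mode \<nu> p r) + mode1 \<nu> p r - of_real (\<nu>\<^sup>2) * mode \<nu> p r / of_real r = 0"
    using key unfolding T3' X_def by simp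
  moreover have "X = - m1 / Z + (N2 / Z\<^sup>2 + C) * m0" if "Z * (X - C * m0) + m1 - N2 * m0 / Z = 0" "Z \<noteq> 0" for m0 m1 Z N2 C
  proof -
    have "Z * (X - C * m0) = N2 * m0 / Z - m1" using that(1) by (simp add: algebra_simps)
    then have "X - C * m0 = (N2 * m0 / Z - m1) / Z" using that(2) by (simp add: nonzero_eq_divide_eq mult.commute)
    then show ?thesis by (simp add: algebra_simps power2_eq_square diff_divide_distrib)
  qed
  ultimately have "X = - mode1 \<nu> p r / of_real r + of_real (\<nu>\<^sup>2 / r\<^sup>2 + c) * mode \<nu> p r"
    using r by simp
  then show ?thesis using D unfolding X_def by simp
qed

lemma periodic_integral_shift:
  fixes f :: "real \<Rightarrow> complex"
  assumes f: "continuous_on UNIV f" and per: "\<And>t. f (t + 2*pi) = f t" and s: "0 \<le> s" "s \<le> 2*pi"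
  shows "integral {0..2*pi} (\<lambda>t. f (s + t)) = integral {0..2*pi} f"
proof -
  have i: "f integrable_on {a..b}" for a b
    using f by (intro integrable_continuous_interval) (auto intro: continuous_on_subset)
  have "integral {0..2*pi} (\<lambda>t. f (s + t)) = integral {s..2*pi+s} f"
    using integral_shift_Icc_real[of 0 "2*pi" f s] by (simp add: o_def)
  also have "\<dots> = integral {s..2*pi} f + integral {2*pi..2*pi+s} f"
    using s by (intro Henstock_Kurzweil_Integration.integral_combine[symmetric] i) auto
  also have "integral {2*pi..2*pi+s} f = integral {0..s} (\<lambda>t. f (2*pi + t))"
    using integral_shift_Icc_real[of 0 s f "2*pi"] by (simp add: o_def add.commute)
  also have "\<dots> = integral {0..s} f" using per by (simp add: add.commute)
  also have "integral {s..2*pi} f + integral {0..s} f = integral {0..2*pi} f"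
    using s Henstock_Kurzweil_Integration.integral_combine[of 0 s "2*pi" f] i by (simp add: add.commute)
  finally show ?thesis .
qed

lemma polar_exists:
  fixes x :: "real^2"
  obtains s where "0 \<le> s" "s \<le> 2*pi" "x = circle_pt (norm x) s"
proof (cases "x = 0")
  case True
  then show ?thesis using that[of 0] by (simp add: circle_pt_eq)
next
  case False
  then have n: "norm x \<noteq> 0" by simp
  have "(x $ 1 / norm x)\<^sup>2 + (x $ 2 / norm x)\<^sup>2 = 1"
  proof -
    have "((x $ 1)\<^sup>2 + (x $ 2)\<^sup>2) / (norm x)\<^sup>2 = (norm x)\<^sup>2 / (norm x)\<^sup>2" by (simp only: norm_sq_vec2)
    also have "\<dots> = 1" using False by simp
    finally have "((x $ 1)\<^sup>2 + (x $ 2)\<^sup>2) / (norm x)\<^sup>2 = 1" .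
    then show ?thesis by (simp add: power_divide add_divide_distrib)
  qed
  then obtain t where t: "0 \<le> t" "t \<le> 2*pi" "x $ 1 / norm x = cos t" "x $ 2 / norm x = sin t"
    using sincos_total_2pi_le by metis
  have "x $ 1 = norm x * cos t" "x $ 2 = norm x * sin t"
    using n by (simp_all add: t(3,4)[symmetric])
  then have "x = circle_pt (norm x) t"
    by (simp add: vec_eq_iff forall_2 circle_pt_def)
  with t show ?thesis using that by blast
qed

section \<open>Orthogonality to the separated solutions\<close>

definition rot :: "real \<Rightarrow> real^2 \<Rightarrow> real^2" where
  "rot t x = (cos t * x $ 1 - sin t * x $ 2) *\<^sub>R axis 1 1 + (sin t * x $ 1 + cos t * x $ 2) *\<^sub>R axis 2 1"

lemma rot_nth: "rot t x $ 1 = cos t * x $ 1 - sin t * x $ 2" "rot t x $ 2 = sin t * x $ 1 + cos t * x $ 2"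
  by (simp_all add: rot_def axis_def)

lemma rot_circle_pt: "rot t (circle_pt r s) = circle_pt r (s + t)"
  by (simp add: vec_eq_iff forall_2 rot_nth circle_pt_def cos_add sin_add algebra_simps)

lemma rot_rot: "rot t (rot (- t) x) = x"
proof -
  obtain s where "x = circle_pt (norm x) s" using polar_exists by metis
  then show ?thesis by (metis rot_circle_pt add.assoc add.left_inverse add.right_neutral)
qed

lemma orthogonal_rot: "orthogonal_transformation (rot t)"
  unfolding orthogonal_transformation
proof
  show "linear (rot t)"
    by (intro linearI) (auto simp: vec_eq_iff forall_2 rot_nth algebra_simps)
  show "\<forall>v. norm (rot t v) = norm v"
  proof
    fix v :: "real^2"
    obtain s where "v = circle_pt (norm v) s" using polar_exists by metis
    then show "norm (rot t v) = norm v" by (metis rot_circle_pt norm_circle_pt abs_norm_cancel)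
  qed
qed

lemma rot_continuous: "continuous_on UNIV (\<lambda>z. rot (fst z) (snd z))"
  unfolding rot_def by (intro continuous_intros)

lemma rot_continuous2: "continuous_on UNIV (rot t)"
  unfolding rot_def[abs_def] by (intro continuous_intros)

text \<open>Boxes determine the measure, and orthogonal maps preserve the Lebesgue measure of a
  box.\<close>

lemma lborel_rot: "distr lborel borel (rot t) = lborel"
proof (rule lborel_eqI[symmetric])
  fix l u :: "real^2" assume lu: "\<And>b. b \<in> Basis \<Longrightarrow> l \<bullet> b \<le> u \<bullet> b"
  have m: "rot t \<in> borel_measurable borel" by (intro borel_measurable_continuous_onI rot_continuous2)
  have eq: "rot t -` box l u = rot (- t) ` box l u"
  proof (intro set_eqI iffI)
    fix x assume "x \<in> rot t -` box l u"
    moreover have "x = rot (- t) (rot t x)" using rot_rot[of "- t" x] by simp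
    ultimately show "x \<in> rot (- t) ` box l u" by auto
  qed (auto simp: rot_rot)
  have meas: "rot (- t) ` box l u \<in> lmeasurable" "measure lebesgue (rot (- t) ` box l u) = measure lebesgue (box l u)"
    by (rule measurable_orthogonal_image[OF orthogonal_rot], simp, rule measure_orthogonal_image[OF orthogonal_rot], simp)
  have b: "rot t -` box l u \<in> sets borel" using measurable_sets[OF m, of "box l u"] by simp
  have "emeasure (distr lborel borel (rot t)) (box l u) = emeasure lborel (rot t -` box l u)"
    using m by (subst emeasure_distr) auto
  also have "\<dots> = emeasure lebesgue (rot t -` box l u)" using b by (simp add: emeasure_completion)
  also have "\<dots> = ennreal (measure lebesgue (rot t -` box l u))"
    unfolding eq using meas(1) by (intro emeasure_eq_measure2)
  also have "\<dots> = ennreal (measure lborel (box l u))"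
    unfolding eq meas(2) by (simp add: measure_completion)
  also have "\<dots> = emeasure lborel (box l u)"
    using emeasure_lborel_box_finite[of l u] by (simp add: emeasure_eq_ennreal_measure less_top)
  also have "\<dots> = (\<Prod>b\<in>Basis. (u - l) \<bullet> b)" using lu by (rule emeasure_lborel_box)
  finally show "emeasure (distr lborel borel (rot t)) (box l u) = ennreal (\<Prod>b\<in>Basis. (u - l) \<bullet> b)" .
qed simp

lemma integral_rot:
  fixes \<Phi> :: cfun
  assumes "\<Phi> \<in> borel_measurable borel"
  shows "(\<integral>x. \<Phi> (rot t x) \<partial>lborel) = (\<integral>x. \<Phi> x \<partial>lborel)"
proof -
  have m: "rot t \<in> borel_measurable borel" by (intro borel_measurable_continuous_onI rot_continuous2)
  have "(\<integral>x. \<Phi> x \<partial>lborel) = (\<integral>x. \<Phi> x \<partial>distr lborel borel (rot t))" by (simp add: lborel_rot)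
  also have "\<dots> = (\<integral>x. \<Phi> (rot t x) \<partial>lborel)" using m assms by (subst integral_distr) auto
  finally show ?thesis by simp
qed

text \<open>Rotation invariance and Fubini allow averaging over all rotations, which replaces the
  integrand by its integral over the circle through x. This takes the place of polar
  coordinates.\<close>

lemma rot_average:
  fixes \<Phi> :: cfun
  assumes c: "continuous_on UNIV \<Phi>" and B: "\<And>x. x \<notin> cball 0 B \<Longrightarrow> \<Phi> x = 0"
  shows "of_real (2*pi) * (\<integral>x. \<Phi> x \<partial>lborel) = (\<integral>x. integral {0..2*pi} (\<lambda>t. \<Phi> (circle_pt (norm (x::real^2)) t)) \<partial>lborel)"
proof -
  have nr: "norm (rot t x) = norm x" for t and x :: "real^2"
    using orthogonal_rot by (simp add: orthogonal_transformation_norm)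
  have m: "\<Phi> \<in> borel_measurable borel" using c by (rule borel_measurable_continuous_onI)
  define \<Psi> where "\<Psi> t x = indicator {0..2*pi} t *\<^sub>R \<Phi> (rot t x)" for t x
  have cr: "continuous_on S (\<lambda>z. \<Phi> (rot (fst z) (snd z)))" for S
    by (rule continuous_on_compose2[OF c continuous_on_subset[OF rot_continuous]]) auto
  have "integrable lborel (\<lambda>z. indicator ({0..2*pi} \<times> cball 0 B) z *\<^sub>R \<Phi> (rot (fst z) (snd z)))"
    by (intro borel_integrable_compact compact_Times cr) auto
  moreover have "(\<lambda>z. indicator ({0..2*pi} \<times> cball 0 B) z *\<^sub>R \<Phi> (rot (fst z) (snd z))) = (\<lambda>(t, x). \<Psi> t x)"
  proof -
    have "\<Phi> (rot t x) = 0" if "x \<notin> cball 0 B" for t x using B[of "rot t x"] nr that by simp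
    then show ?thesis by (auto simp: \<Psi>_def indicator_def fun_eq_iff)
  qed
  ultimately have "integrable (lborel \<Otimes>\<^sub>M lborel) (\<lambda>(t, x). \<Psi> t x)" by (simp add: lborel_prod)
  then have "(\<integral>x. (\<integral>t. \<Psi> t x \<partial>lborel) \<partial>lborel) = (\<integral>t. (\<integral>x. \<Psi> t x \<partial>lborel) \<partial>lborel)"
    by (rule lborel_pair.Fubini_integral)
  also have "\<dots> = (\<integral>t. indicator {0..2*pi} t *\<^sub>R (\<integral>x. \<Phi> x \<partial>lborel) \<partial>lborel)"
    unfolding \<Psi>_def by (simp add: integral_rot[OF m])
  also have "\<dots> = of_real (2*pi) * (\<integral>x. \<Phi> x \<partial>lborel)"
    by (simp add: scaleR_conv_of_real)
  finally have f1: "(\<integral>x. (\<integral>t. \<Psi> t x \<partial>lborel) \<partial>lborel) = of_real (2*pi) * (\<integral>x. \<Phi> x \<partial>lborel)" .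
  have f2: "(\<integral>t. \<Psi> t x \<partial>lborel) = integral {0..2*pi} (\<lambda>t. \<Phi> (circle_pt (norm x) t))" for x
  proof -
    have ct: "continuous_on UNIV (\<lambda>t. \<Phi> (rot t x))"
    proof -
      have "continuous_on UNIV (\<lambda>t::real. (t, x))" by (intro continuous_intros)
      from continuous_on_compose2[OF cr[of UNIV] this] show ?thesis by simp
    qed
    have "(\<integral>t. \<Psi> t x \<partial>lborel) = integral {0..2*pi} (\<lambda>t. \<Phi> (rot t x))"
    proof -
      have "set_integrable lborel {0..2*pi} (\<lambda>t. \<Phi> (rot t x))"
        unfolding set_integrable_def by (intro borel_integrable_compact continuous_on_subset[OF ct]) auto
      from set_borel_integral_eq_integral(2)[OF this] show ?thesis
        by (simp add: \<Psi>_def set_lebesgue_integral_def)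
    qed
    moreover obtain s where s: "0 \<le> s" "s \<le> 2*pi" "x = circle_pt (norm x) s" by (rule polar_exists)
    have "rot t x = circle_pt (norm x) (s + t)" for t using s(3) by (metis rot_circle_pt)
    moreover have "integral {0..2*pi} (\<lambda>t. \<Phi> (circle_pt (norm x) (s + t))) = integral {0..2*pi} (\<lambda>t. \<Phi> (circle_pt (norm x) t))"
    proof (rule periodic_integral_shift[OF _ _ s(1,2)])
      show "continuous_on UNIV (\<lambda>t. \<Phi> (circle_pt (norm x) t))"
        by (rule continuous_on_compose2[OF c]) (auto intro: continuous_intros)
      show "\<Phi> (circle_pt (norm x) (t + 2*pi)) = \<Phi> (circle_pt (norm x) t)" for t by (simp add: circle_pt_def)
    qed
    ultimately show ?thesis by simp
  qed
  show ?thesis by (simp only: f1[symmetric] f2)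
qed

section \<open>Wronskians of modes with the regular radial solution\<close>

definition jrad :: "real \<Rightarrow> nat \<Rightarrow> real \<Rightarrow> real" where
  "jrad c n r = r ^ n * vrad c n 0 (r\<^sup>2)"

definition jrad1 :: "real \<Rightarrow> nat \<Rightarrow> real \<Rightarrow> real" where
  "jrad1 c n r = real n * r ^ (n - 1) * vrad c n 0 (r\<^sup>2) + r ^ n * (vrad c n 1 (r\<^sup>2) * (2 * r))"

lemma jrad_derivative: "(jrad c n has_real_derivative jrad1 c n r) (at r)"
  unfolding jrad_def[abs_def] jrad1_def
  by (auto intro!: derivative_eq_intros vrad_has_derivative[THEN DERIV_chain2] simp: algebra_simps)

lemma vsol_circle:
  assumes "\<sigma> = 1 \<or> \<sigma> = -1"
  shows "vsol c \<sigma> n (circle_pt r t) = of_real (jrad c n r) * cis (\<sigma> * real n * t)"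
proof -
  have "zeta \<sigma> (circle_pt r t) = of_real r * cis (\<sigma> * t)"
    using assms by (auto simp: zeta_def circle_pt_def complex_eq_iff)
  moreover have "cis (\<sigma> * t) ^ n = cis (\<sigma> * real n * t)"
    by (simp add: Complex.DeMoivre mult_ac)
  ultimately show ?thesis
    by (simp add: vsol_def jrad_def norm_circle_pt power_mult_distrib mult_ac)
qed

text \<open>\<open>jrad\<close> is itself a mode up to the factor 2 pi: for \<sigma> = -1 the weight
  of frequency n cancels the angular factor of \<open>vsol\<close>. The equation is therefore
  \<open>mode_ode\<close> on the punctured plane.\<close>

lemma radial_ode_jrad: "radial_ode 0 c ((real n)\<^sup>2) (jrad c n) (jrad1 c n)"
proof
  have sm: "smooth_on (- cball 0 0) (vsol c (-1) n)" by (rule smooth_on_subset[OF smooth_vsol]) auto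
  have m: "mode (real n) (vsol c (-1) n) r = of_real (2 * pi * jrad c n r)" for r
  proof -
    have "cis (- (real n * t)) * cis (real n * t) = 1" for t by (simp add: cis_mult)
    then show ?thesis
      by (simp add: mode_def circle_int_def vsol_circle mult.assoc scaleR_conv_of_real)
  qed
  have m1: "mode1 (real n) (vsol c (-1) n) r = of_real (2 * pi * jrad1 c n r)" if "0 < r" for r
  proof (rule vector_derivative_unique_at)
    show "(mode (real n) (vsol c (-1) n) has_vector_derivative mode1 (real n) (vsol c (-1) n) r) (at r)"
      by (rule mode_derivative[OF sm _ that]) simp
    have "((\<lambda>r. 2 * pi * jrad c n r) has_real_derivative 2 * pi * jrad1 c n r) (at r)"
      using jrad_derivative by (auto intro!: derivative_eq_intros)
    then have "((\<lambda>r. of_real (2 * pi * jrad c n r)) has_vector_derivative of_real (2 * pi * jrad1 c n r)) (at r)"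
      by (rule has_vector_derivative_of_real)
    then show "(mode (real n) (vsol c (-1) n) has_vector_derivative of_real (2 * pi * jrad1 c n r)) (at r)"
      using m by (metis (no_types, lifting) ext)
  qed
  fix r :: real assume r: "0 < r"
  have "cis (real n * (2*pi)) = 1" using cis_multiple_2pi[of "real n"] by (simp add: mult_ac)
  then have "(mode1 (real n) (vsol c (-1) n) has_vector_derivative (- mode1 (real n) (vsol c (-1) n) r / of_real r
      + of_real ((real n)\<^sup>2 / r\<^sup>2 + c) * mode (real n) (vsol c (-1) n) r)) (at r)"
    by (intro mode_ode[OF sm _ r] lap_vsol) auto
  then have "((\<lambda>r. of_real (2 * pi * jrad1 c n r)) has_vector_derivative (- mode1 (real n) (vsol c (-1) n) r / of_real r
      + of_real ((real n)\<^sup>2 / r\<^sup>2 + c) * mode (real n) (vsol c (-1) n) r)) (at r)"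
    by (rule has_vector_derivative_transform_within_open[where S = "{0<..}"]) (use r m1 in auto)
  then have "((\<lambda>r. of_real (2 * pi * jrad1 c n r)) has_vector_derivative
      complex_of_real (2 * pi * (- jrad1 c n r / r + ((real n)\<^sup>2 / r\<^sup>2 + c) * jrad c n r))) (at r)"
    unfolding m m1[OF r] by (simp add: algebra_simps)
  from bounded_linear.has_vector_derivative[OF bounded_linear_Re this]
  have "((\<lambda>r. 2 * pi * jrad1 c n r) has_real_derivative 2 * pi * (- jrad1 c n r / r + ((real n)\<^sup>2 / r\<^sup>2 + c) * jrad c n r)) (at r)"
    unfolding Re_complex_of_real by (simp add: has_real_derivative_iff_has_vector_derivative)
  from DERIV_cmult[OF this, of "1 / (2 * pi)"]
  show "(jrad1 c n has_real_derivative - jrad1 c n r / r + ((real n)\<^sup>2 / r\<^sup>2 + c) * jrad c n r) (at r)" by simp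
  show "(jrad c n has_real_derivative jrad1 c n r) (at r)" by (rule jrad_derivative)
qed simp

text \<open>Abel's identity: both functions solve the same linear equation with damping 1/r, so r
  times their Wronskian has derivative zero.\<close>

lemma mode_wronskian_constant:
  assumes p: "smooth_on (- cball 0 R) p" and R: "0 \<le> R"
    and lap: "\<And>x. x \<in> - cball 0 R \<Longrightarrow> lap p x = of_real c * p x" and \<nu>: "cis (\<nu> * (2*pi)) = 1" "\<nu>\<^sup>2 = (real n)\<^sup>2"
  obtains W where "\<And>r. R < r \<Longrightarrow> of_real r * (mode \<nu> p r * of_real (jrad1 c n r) - mode1 \<nu> p r * of_real (jrad c n r)) = W"
proof -
  interpret j: radial_ode 0 c "(real n)\<^sup>2" "jrad c n" "jrad1 c n" by (rule radial_ode_jrad)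
  let ?P = "mode \<nu> p" and ?P1 = "mode1 \<nu> p" and ?j = "\<lambda>r. complex_of_real (jrad c n r)" and ?j1 = "\<lambda>r. complex_of_real (jrad1 c n r)"
  show thesis
  proof (rule has_vector_derivative_zero_constant[of "{R<..}" "\<lambda>r. of_real r * (?P r * ?j1 r - ?P1 r * ?j r)"])
    fix r assume "r \<in> {R<..}"
    then have r: "R < r" "0 < r" using R by auto
    let ?Q = "complex_of_real ((real n)\<^sup>2 / r\<^sup>2 + c)"
    have dj: "(?j has_vector_derivative ?j1 r) (at r)"
      by (rule has_vector_derivative_of_real[OF j.da[OF r(2)]])
    have dj1: "(?j1 has_vector_derivative (- ?j1 r / of_real r + ?Q * ?j r)) (at r)"
      using has_vector_derivative_of_real[where 'a = complex, OF j.da1[OF r(2)]] by simp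
    have dr: "(complex_of_real has_vector_derivative 1) (at r)"
      using has_vector_derivative_of_real[OF DERIV_ident] by simp
    note dP = mode_derivative[OF p R r(1), of \<nu>]
    note dP1 = mode_ode[OF p R r(1) lap \<nu>(1), unfolded \<nu>(2)]
    have "((\<lambda>r. of_real r * (?P r * ?j1 r - ?P1 r * ?j r)) has_vector_derivative
      (of_real r * ((?P r * (- ?j1 r / of_real r + ?Q * ?j r) + ?P1 r * ?j1 r) -
         (?P1 r * ?j1 r + (- ?P1 r / of_real r + ?Q * ?P r) * ?j r)) + 1 * (?P r * ?j1 r - ?P1 r * ?j r))) (at r)"
      by (intro has_vector_derivative_mult has_vector_derivative_diff dr dP dP1 dj dj1)
    moreover have "of_real r * ((?P r * (- ?j1 r / of_real r + ?Q * ?j r) + ?P1 r * ?j1 r) -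
         (?P1 r * ?j1 r + (- ?P1 r / of_real r + ?Q * ?P r) * ?j r)) + 1 * (?P r * ?j1 r - ?P1 r * ?j r) = 0"
      using r(2) by (simp add: field_simps)
    ultimately show "((\<lambda>r. of_real r * (?P r * ?j1 r - ?P1 r * ?j r)) has_vector_derivative 0) (at r within {R<..})"
      by (simp add: has_vector_derivative_at_within)
  next
    fix W assume "\<And>r. r \<in> {R<..} \<Longrightarrow> of_real r * (?P r * ?j1 r - ?P1 r * ?j r) = W"
    then show thesis by (intro that[of W]) auto
  qed auto
qed

text \<open>The cutoff is constant near the disc and far out, so its gradient lives on the annulus
  from a to b. The gradient is thus a test function of the exterior, which the cutoff itself is
  not.\<close>

lemma test_pd_cutoff:
  assumes "0 \<le> R" "R < a" "a < b"
  shows "pd i (\<lambda>x. complex_of_real (cutoff (a\<^sup>2) (b\<^sup>2) ((norm x)\<^sup>2))) \<in> test_functions (- cball 0 R)"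
proof (rule test_functionsI)
  have ab: "a\<^sup>2 < b\<^sup>2" using assms by (simp add: power_strict_mono)
  show "smooth_on UNIV (pd i (\<lambda>x. complex_of_real (cutoff (a\<^sup>2) (b\<^sup>2) ((norm x)\<^sup>2))))"
    by (intro smooth_on_pd smooth_cutoff ab)
  have "closed {x::real^2. a \<le> norm x}" by (intro closed_Collect_le continuous_intros)
  then show "compact (cball 0 b \<inter> {x::real^2. a \<le> norm x})" by (intro compact_Int_closed) auto
  show "cball 0 b \<inter> {x. a \<le> norm x} \<subseteq> - cball 0 R" using assms by auto
  fix x :: "real^2" assume x: "x \<notin> cball 0 b \<inter> {x. a \<le> norm x}"
  have "(norm x)\<^sup>2 \<le> a\<^sup>2 \<or> b\<^sup>2 \<le> (norm x)\<^sup>2"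
    using x assms power_mono[of "norm x" a 2] power_mono[of b "norm x" 2] by auto
  then show "pd i (\<lambda>x. complex_of_real (cutoff (a\<^sup>2) (b\<^sup>2) ((norm x)\<^sup>2))) x = 0"
    using cutoff'_eq_0[OF ab] by (simp add: pd_cutoff[OF ab] del: of_real_power)
qed

lemma cutoff'_continuous: "a < b \<Longrightarrow> continuous_on UNIV (cutoff' a b)"
proof -
  assume "a < b"
  have c: "continuous_on UNIV (flat_deriv m)" for m
    using flat_deriv_has_derivative by (intro continuous_at_imp_continuous_on ballI DERIV_isCont)
  show ?thesis
    unfolding cutoff'_def[abs_def] using flat_deriv_0_bounds(3)[of "b - a"] flat_deriv_0_bounds(3)[of 1] \<open>a < b\<close>
    by (intro continuous_intros continuous_on_compose2[OF c]) auto
qed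

text \<open>A continuous nonpositive function that is negative inside the annulus has a nonzero
  integral. This integral is the weight that multiplies the Wronskian constant in the smeared Green
  identity.\<close>

lemma integral_cutoff'_neq_0:
  assumes "0 \<le> a" "a < b"
  shows "(\<integral>x. complex_of_real (cutoff' (a\<^sup>2) (b\<^sup>2) ((norm (x::real^2))\<^sup>2)) \<partial>lborel) \<noteq> 0"
proof
  have ab: "a\<^sup>2 < b\<^sup>2" using assms by (simp add: power_strict_mono)
  let ?g = "\<lambda>x::real^2. cutoff' (a\<^sup>2) (b\<^sup>2) ((norm x)\<^sup>2)"
  have gc: "continuous_on UNIV ?g"
    by (rule continuous_on_compose2[OF cutoff'_continuous[OF ab]]) (auto intro: continuous_intros)
  have cc: "continuous_on UNIV (\<lambda>x. complex_of_real (?g x))" using gc by (intro continuous_intros)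
  have i: "integrable lborel (\<lambda>x. complex_of_real (?g x))"
  proof (rule integrable_compact_support[OF cc])
    show "compact (cball (0::real^2) b)" by simp
    fix x :: "real^2" assume "x \<notin> cball 0 b"
    then have "b\<^sup>2 \<le> (norm x)\<^sup>2" using assms by (intro power_mono) auto
    then show "complex_of_real (?g x) = 0" using cutoff'_eq_0[OF ab] by simp
  qed
  have ir: "integrable lborel ?g" using integrable_Re[OF i] unfolding Re_complex_of_real .
  assume "(\<integral>x. complex_of_real (?g x) \<partial>lborel) = 0"
  then have "(\<integral>x. ?g x \<partial>lborel) = 0" by simp
  then have "(\<integral>x. - ?g x \<partial>lborel) = 0" by simp
  then have "AE x in lborel. - ?g x = 0"
    using integral_nonneg_eq_0_iff_AE[of lborel "\<lambda>x. - ?g x"] ir cutoff'_nonpos by simp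
  then have ae: "AE x in lborel. x \<in> UNIV \<longrightarrow> complex_of_real (?g x) = 0" by eventually_elim simp
  have "complex_of_real (?g (circle_pt ((a + b) / 2) 0)) = 0"
    by (rule continuous_AE_zero[OF open_UNIV cc ae]) simp
  moreover have "a\<^sup>2 < ((a + b) / 2)\<^sup>2" "((a + b) / 2)\<^sup>2 < b\<^sup>2"
    using assms by (auto intro!: power_strict_mono)
  ultimately show False
    using cutoff'_neg[of "a\<^sup>2" "((a + b) / 2)\<^sup>2" "b\<^sup>2"] assms by (simp add: norm_circle_pt abs_of_nonneg)
qed

text \<open>Green's identity on an annulus, with the boundary terms smeared out by a radial cutoff.\<close>
lemma mode_wronskian_zero:
  assumes p: "smooth_on (- cball 0 R) p" and R: "0 \<le> R"
    and lap: "\<And>x. x \<in> - cball 0 R \<Longrightarrow> lap p x = of_real c * p x" and \<sigma>: "\<sigma> = 1 \<or> \<sigma> = -1"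
    and test: "\<And>a b. R < a \<Longrightarrow> a < b \<Longrightarrow> (\<integral>x. p x * (lap (\<lambda>x. complex_of_real (cutoff (a\<^sup>2) (b\<^sup>2) ((norm x)\<^sup>2)) * vsol c \<sigma> n x) x
       - of_real c * (complex_of_real (cutoff (a\<^sup>2) (b\<^sup>2) ((norm x)\<^sup>2)) * vsol c \<sigma> n x)) \<partial>lborel) = 0"
    and r: "R < r"
  shows "mode (\<sigma> * real n) p r * of_real (jrad1 c n r) = mode1 (\<sigma> * real n) p r * of_real (jrad c n r)"
proof -
  \<comment> \<open>Any two radii beyond \<open>R\<close> serve, since r times the Wronskian does
    not depend on r.\<close>
  define a b where "a = R + 1" and "b = R + 2"
  have ab: "R < a" "a < b" "0 \<le> a" using R by (auto simp: a_def b_def)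
  have ab2: "a\<^sup>2 < b\<^sup>2" using ab by (simp add: power_strict_mono)
  define ct where "ct x = complex_of_real (cutoff (a\<^sup>2) (b\<^sup>2) ((norm x)\<^sup>2))" for x :: "real^2"
  let ?\<Omega> = "- cball 0 R :: (real^2) set" and ?v = "vsol c \<sigma> n" and ?\<nu> = "\<sigma> * real n"
  let ?g = "\<lambda>x::real^2. cutoff' (a\<^sup>2) (b\<^sup>2) ((norm x)\<^sup>2)"
  have o: "open ?\<Omega>" by (simp add: open_Compl)
  have s2: "\<sigma>\<^sup>2 = 1" using \<sigma> by auto
  have t: "pd i ct \<in> test_functions ?\<Omega>" for i unfolding ct_def[abs_def] by (rule test_pd_cutoff[OF R ab(1,2)])
  have sv: "smooth_on ?\<Omega> ?v" by (rule smooth_on_subset[OF smooth_vsol]) auto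
  have sct: "smooth_on UNIV ct" unfolding ct_def[abs_def] by (rule smooth_cutoff[OF ab2])
  have pdct: "pd i ct x = 2 * of_real (x $ i) * of_real (?g x)" for i x
    unfolding ct_def[abs_def] by (rule pd_cutoff[OF ab2])
  have z: "pd i ct x = 0" if "x \<notin> ?\<Omega>" for i x using t[of i] that by (auto simp: test_functions_def)
  define W where "W i x = p x * pd i ?v x - ?v x * pd i p x" for i x
  have sW: "smooth_on ?\<Omega> (W i)" for i
    unfolding W_def[abs_def] by (intro smooth_on_diff smooth_on_mult smooth_on_pd p sv o)
  define \<Phi> where "\<Phi> x = pd 1 ct x * W 1 x + pd 2 ct x * W 2 x" for x
  have t\<Phi>: "\<Phi> \<in> test_functions ?\<Omega>"
    unfolding \<Phi>_def[abs_def] by (intro test_functions_add test_functions_mult[OF t o sW])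
  \<comment> \<open>Because v solves the equation, only terms with a derivative of the cutoff
    survive, so the integrand lives on the annulus.\<close>
  have \<psi>: "lap (\<lambda>x. ct x * ?v x) x - of_real c * (ct x * ?v x) = lap ct x * ?v x + 2 * (\<Sum>i\<in>UNIV. pd i ct x * pd i ?v x)" for x
    using lap_mult[OF open_UNIV UNIV_I sct smooth_vsol[of c \<sigma> n], of x] lap_vsol[OF s2, of c n x] by (simp add: algebra_simps)
  have itf: "integrable lborel (\<lambda>x. \<phi> x * f x)" if "\<phi> \<in> test_functions ?\<Omega>" "smooth_on ?\<Omega> f" for \<phi> f
    by (rule test_integrable[OF test_functions_mult[OF that(1) o that(2)]])
  have i1: "integrable lborel (\<lambda>x. pd i (pd i ct) x * (p x * ?v x))" "integrable lborel (\<lambda>x. pd i ct x * (p x * pd i ?v x))"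
    "integrable lborel (\<lambda>x. pd i ct x * (?v x * pd i p x))" "integrable lborel (\<lambda>x. pd i ct x * W i x)" for i
    by (rule itf; intro test_functions_pd t smooth_on_mult smooth_on_pd p sv o sW)+
  \<comment> \<open>One derivative of the cutoff is moved onto p v, which leaves the gradient of the
    cutoff against p grad v - v grad p.\<close>
  have parts: "(\<integral>x. pd i (pd i ct) x * (p x * ?v x) \<partial>lborel) + 2 * (\<integral>x. pd i ct x * (p x * pd i ?v x) \<partial>lborel) = (\<integral>x. pd i ct x * W i x \<partial>lborel)" for i
  proof -
    have "(\<integral>x. (p x * ?v x) * pd i (pd i ct) x \<partial>lborel) = - (\<integral>x. pd i (\<lambda>x. p x * ?v x) x * pd i ct x \<partial>lborel)"
      by (rule integral_by_parts[OF o smooth_on_mult[OF o p sv] t])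
    also have "(\<lambda>x. pd i (\<lambda>x. p x * ?v x) x * pd i ct x) = (\<lambda>x. pd i ct x * (?v x * pd i p x) + pd i ct x * (p x * pd i ?v x))"
    proof
      fix x
      show "pd i (\<lambda>x. p x * ?v x) x * pd i ct x = pd i ct x * (?v x * pd i p x) + pd i ct x * (p x * pd i ?v x)"
      proof (cases "x \<in> ?\<Omega>")
        case True
        then show ?thesis
          using smooth_on_imp_differentiable[OF p True] smooth_on_imp_differentiable[OF sv True]
          by (simp add: pd_mult algebra_simps)
      qed (simp add: z)
    qed
    finally have "(\<integral>x. pd i (pd i ct) x * (p x * ?v x) \<partial>lborel) = - ((\<integral>x. pd i ct x * (?v x * pd i p x) \<partial>lborel) + (\<integral>x. pd i ct x * (p x * pd i ?v x) \<partial>lborel))"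
      using i1 by (simp add: mult.commute)
    moreover have "(\<integral>x. pd i ct x * W i x \<partial>lborel) = (\<integral>x. pd i ct x * (p x * pd i ?v x) \<partial>lborel) - (\<integral>x. pd i ct x * (?v x * pd i p x) \<partial>lborel)"
      unfolding W_def right_diff_distrib using i1 by simp
    ultimately show ?thesis by simp
  qed
  have "(\<integral>x. \<Phi> x \<partial>lborel) = (\<integral>x. pd 1 ct x * W 1 x \<partial>lborel) + (\<integral>x. pd 2 ct x * W 2 x \<partial>lborel)"
    unfolding \<Phi>_def using i1 by simp
  also have "\<dots> = (\<integral>x. (pd 1 (pd 1 ct) x * (p x * ?v x) + 2 * (pd 1 ct x * (p x * pd 1 ?v x))) + (pd 2 (pd 2 ct) x * (p x * ?v x) + 2 * (pd 2 ct x * (p x * pd 2 ?v x))) \<partial>lborel)"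
    unfolding parts[symmetric] using i1 by simp
  also have "\<dots> = (\<integral>x. p x * (lap (\<lambda>x. ct x * ?v x) x - of_real c * (ct x * ?v x)) \<partial>lborel)"
    unfolding \<psi> by (simp add: lap_def sum_UNIV_2 algebra_simps)
  also have "\<dots> = 0" using test[OF ab(1,2)] by (simp add: ct_def)
  finally have I0: "(\<integral>x. \<Phi> x \<partial>lborel) = 0" .
  have \<nu>: "cis (?\<nu> * (2*pi)) = 1" "?\<nu>\<^sup>2 = (real n)\<^sup>2"
    using cis_multiple_2pi[of ?\<nu>] \<sigma> by (auto simp: mult_ac)
  obtain C where C: "\<And>r. R < r \<Longrightarrow> of_real r * (mode ?\<nu> p r * of_real (jrad1 c n r) - mode1 ?\<nu> p r * of_real (jrad c n r)) = C"
    using mode_wronskian_constant[OF p R lap \<nu>] by blast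
  \<comment> \<open>The gradient of the cutoff is 2 g x, and x . grad is r times the radial
    derivative, so the circle integral of \<open>\<Phi>\<close> is 2 g times r times the Wronskian,
    that is 2 g C.\<close>
  have avg: "integral {0..2*pi} (\<lambda>t. \<Phi> (circle_pt (norm x) t)) = complex_of_real (?g x) * (2 * C)" for x :: "real^2"
  proof (cases "x \<in> ?\<Omega>")
    case True
    define r where "r = norm x"
    have r: "R < r" using True by (simp add: r_def)
    let ?E = "\<lambda>t. cis (?\<nu> * t)"
    have rv: "of_real (cos t) * pd 1 ?v (circle_pt r t) + of_real (sin t) * pd 2 ?v (circle_pt r t) = of_real (jrad1 c n r) * ?E t" for t
    proof (rule vector_derivative_unique_at)
      have "?v differentiable (at (circle_pt r t))" by (rule smooth_on_imp_differentiable[OF smooth_vsol UNIV_I])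
      from has_vector_derivative_along[OF circle_pt_derivative_r this]
      show "((\<lambda>r. ?v (circle_pt r t)) has_vector_derivative (of_real (cos t) * pd 1 ?v (circle_pt r t) + of_real (sin t) * pd 2 ?v (circle_pt r t))) (at r)"
        by (simp add: sum_UNIV_2 circle_pt_def)
      have "((\<lambda>r. complex_of_real (jrad c n r)) has_vector_derivative complex_of_real (jrad1 c n r)) (at r)"
        by (rule has_vector_derivative_of_real[OF jrad_derivative])
      from has_vector_derivative_mult_left[OF this, of "?E t"]
      show "((\<lambda>r. ?v (circle_pt r t)) has_vector_derivative of_real (jrad1 c n r) * ?E t) (at r)"
        by (simp add: vsol_circle[OF \<sigma>])
    qed
    have "\<Phi> (circle_pt r t) = of_real (2 * ?g x * r) * (of_real (jrad1 c n r) * (p (circle_pt r t) * ?E t)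
       - of_real (jrad c n r) * (pd 1 p (circle_pt r t) * (?E t * of_real (cos t)) + pd 2 p (circle_pt r t) * (?E t * of_real (sin t))))" for t
    proof -
      have g: "?g (circle_pt r t) = ?g x" using r R by (simp add: norm_circle_pt r_def)
      have "\<Phi> (circle_pt r t) = of_real (2 * ?g x * r) * (p (circle_pt r t) * (of_real (cos t) * pd 1 ?v (circle_pt r t) + of_real (sin t) * pd 2 ?v (circle_pt r t))
         - ?v (circle_pt r t) * (of_real (cos t) * pd 1 p (circle_pt r t) + of_real (sin t) * pd 2 p (circle_pt r t)))"
        unfolding \<Phi>_def pdct W_def g by (simp add: circle_pt_def algebra_simps)
      then show ?thesis unfolding rv vsol_circle[OF \<sigma>] by (simp add: algebra_simps)
    qed
    then have "integral {0..2*pi} (\<lambda>t. \<Phi> (circle_pt r t)) = integral {0..2*pi} (\<lambda>t. of_real (2 * ?g x * r) * (of_real (jrad1 c n r) * (p (circle_pt r t) * ?E t)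
       - of_real (jrad c n r) * (pd 1 p (circle_pt r t) * (?E t * of_real (cos t)) + pd 2 p (circle_pt r t) * (?E t * of_real (sin t)))))"
      by simp
    also have "\<dots> = of_real (2 * ?g x * r) * (of_real (jrad1 c n r) * mode ?\<nu> p r - of_real (jrad c n r) * mode1 ?\<nu> p r)"
    proof -
      have i: "(\<lambda>t. p (circle_pt r t) * ?E t) integrable_on {0..2*pi}"
         "(\<lambda>t. pd 1 p (circle_pt r t) * (?E t * of_real (cos t))) integrable_on {0..2*pi}"
         "(\<lambda>t. pd 2 p (circle_pt r t) * (?E t * of_real (sin t))) integrable_on {0..2*pi}"
        by (intro circle_int_integrable[OF _ R r] smooth_on_pd p continuous_on_mult cis_continuous continuous_intros)+
      show ?thesis
        unfolding mode_def mode1_def circle_int_def using i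
        by (simp add: Henstock_Kurzweil_Integration.integral_diff Henstock_Kurzweil_Integration.integral_add integrable_add integrable_on_mult_right)
    qed
    also have "\<dots> = of_real (?g x) * (2 * C)" unfolding C[OF r, symmetric] by (simp add: algebra_simps)
    finally show ?thesis by (simp add: r_def)
  next
    case False
    then have "norm x \<le> R" by simp
    moreover then have "circle_pt (norm x) t \<notin> ?\<Omega>" for t by (simp add: norm_circle_pt)
    moreover have "(norm x)\<^sup>2 \<le> a\<^sup>2" using \<open>norm x \<le> R\<close> ab by (intro power_mono) auto
    ultimately show ?thesis using cutoff'_eq_0[OF ab2] by (simp add: \<Phi>_def z)
  qed
  obtain K where K: "smooth_on UNIV \<Phi>" "compact K" "\<And>x. x \<notin> K \<Longrightarrow> \<Phi> x = 0" using t\<Phi> by (rule test_functionsE) blast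
  obtain B where B: "K \<subseteq> cball 0 B" by (metis compact_imp_bounded[OF K(2)] bounded_iff mem_cball_0 subsetI)
  have "of_real (2*pi) * (\<integral>x. \<Phi> x \<partial>lborel) = (\<integral>x. integral {0..2*pi} (\<lambda>t. \<Phi> (circle_pt (norm (x::real^2)) t)) \<partial>lborel)"
    by (rule rot_average[OF test_continuous[OF t\<Phi>], of B]) (use K B in blast)
  then have "(\<integral>x. complex_of_real (?g x) * (2 * C) \<partial>lborel) = 0" unfolding I0 avg by simp
  then have "(\<integral>x. complex_of_real (?g x) \<partial>lborel) * (2 * C) = 0" by simp
  then have "C = 0" using integral_cutoff'_neq_0[OF ab(3,2)] by simp
  then show ?thesis using C[OF r] r R by simp
qed

text \<open>Uniformity of the radiation condition in the direction is used here: a bound on the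
  integrand valid for every angle integrates to a bound for the mode.\<close>

lemma mode_radiation:
  assumes p: "smooth_on (- cball 0 R) p" and R: "0 \<le> R" and som: "sommerfeld k p"
  shows "((\<lambda>r. of_real (sqrt r) * (mode1 \<nu> p r - \<i> * of_real k * mode \<nu> p r)) \<longlongrightarrow> 0) at_top"
proof (rule tendstoI)
  fix e :: real assume e: "0 < e"
  define d where "d = e / (4 * pi)"
  have d: "0 < d" "d * (2 * pi) < e" using e by (auto simp: d_def)
  have "\<forall>\<^sub>F r in at_top. \<forall>y\<in>sphere 0 1. dist (complex_of_real (sqrt r) * (vector_derivative (\<lambda>s. p (s *\<^sub>R y)) (at r) - \<i> * of_real k * p (r *\<^sub>R y))) 0 < d"
    using som d(1) unfolding sommerfeld_def uniform_limit_iff by blast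
  then show "\<forall>\<^sub>F r in at_top. dist (of_real (sqrt r) * (mode1 \<nu> p r - \<i> * of_real k * mode \<nu> p r)) 0 < e"
    using eventually_gt_at_top[of R]
  proof eventually_elim
    case (elim r)
    let ?E = "\<lambda>t. cis (\<nu> * t)"
    let ?F = "\<lambda>t. of_real (sqrt r) * ((pd 1 p (circle_pt r t) * (?E t * of_real (cos t)) + pd 2 p (circle_pt r t) * (?E t * of_real (sin t))) - \<i> * of_real k * (p (circle_pt r t) * ?E t))"
    have i: "(\<lambda>t. p (circle_pt r t) * ?E t) integrable_on {0..2*pi}"
         "(\<lambda>t. pd 1 p (circle_pt r t) * (?E t * of_real (cos t))) integrable_on {0..2*pi}"
         "(\<lambda>t. pd 2 p (circle_pt r t) * (?E t * of_real (sin t))) integrable_on {0..2*pi}"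
      by (intro circle_int_integrable[OF _ R elim(2)] smooth_on_pd p continuous_on_mult cis_continuous continuous_intros)+
    have eq: "of_real (sqrt r) * (mode1 \<nu> p r - \<i> * of_real k * mode \<nu> p r) = integral {0..2*pi} ?F"
      unfolding mode_def mode1_def circle_int_def using i
      by (simp add: Henstock_Kurzweil_Integration.integral_diff Henstock_Kurzweil_Integration.integral_add integrable_add integrable_on_mult_right)
    have bd: "cmod (?F t) \<le> d" for t
    proof -
      have "p differentiable (at (circle_pt r t))"
        using R elim(2) by (intro smooth_on_imp_differentiable[OF p] circle_pt_in) auto
      from has_vector_derivative_along[OF circle_pt_derivative_r this]
      have "((\<lambda>s. p (s *\<^sub>R circle_pt 1 t)) has_vector_derivative (of_real (cos t) * pd 1 p (circle_pt r t) + of_real (sin t) * pd 2 p (circle_pt r t))) (at r)"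
        by (simp add: sum_UNIV_2 circle_pt_scale[symmetric]) (simp add: circle_pt_def)
      then have vd: "vector_derivative (\<lambda>s. p (s *\<^sub>R circle_pt 1 t)) (at r) = of_real (cos t) * pd 1 p (circle_pt r t) + of_real (sin t) * pd 2 p (circle_pt r t)"
        by (rule vector_derivative_at)
      have "circle_pt 1 t \<in> sphere 0 1" by (simp add: norm_circle_pt)
      with elim(1) have "cmod (of_real (sqrt r) * (vector_derivative (\<lambda>s. p (s *\<^sub>R circle_pt 1 t)) (at r) - \<i> * of_real k * p (r *\<^sub>R circle_pt 1 t))) < d"
        by (auto simp: dist_norm)
      then have "cmod (of_real (sqrt r) * ((of_real (cos t) * pd 1 p (circle_pt r t) + of_real (sin t) * pd 2 p (circle_pt r t)) - \<i> * of_real k * p (circle_pt r t))) < d"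
        unfolding vd[unfolded circle_pt_scale[symmetric]] circle_pt_scale[symmetric] .
      moreover have "?F t = of_real (sqrt r) * ((of_real (cos t) * pd 1 p (circle_pt r t) + of_real (sin t) * pd 2 p (circle_pt r t)) - \<i> * of_real k * p (circle_pt r t)) * ?E t"
        by (simp add: algebra_simps)
      ultimately show ?thesis by (simp only: norm_mult norm_cis mult_1_right less_imp_le)
    qed
    have "cmod (integral {0..2*pi} ?F) \<le> d * (2*pi - 0)"
    proof (rule integral_bound)
      show "continuous_on {0..2*pi} ?F"
        by (intro continuous_on_mult continuous_on_add continuous_on_diff continuous_on_const cis_continuous
            smooth_circle_continuous[OF _ R elim(2)] smooth_on_pd p continuous_intros)
    qed (use bd in auto)
    then show ?case unfolding eq using d(2) by simp
  qed
qed

text \<open>If \<open>jrad\<close> vanished beyond \<open>R\<close>, backward uniqueness would carry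
  the zero down to the origin, where the series factor has the value 1/n!. The radius found here
  allows division by j in the Wronskian identity.\<close>

lemma jrad_nonzero:
  assumes "0 \<le> R"
  obtains r where "R < r" "jrad c n r \<noteq> 0"
proof (rule ccontr)
  assume "\<not> thesis"
  then have z: "jrad c n r = 0" if "R < r" for r using that \<open>\<And>r. R < r \<Longrightarrow> jrad c n r \<noteq> 0 \<Longrightarrow> thesis\<close> by blast
  have z1: "jrad1 c n (R + 1) = 0"
  proof (rule DERIV_unique[OF jrad_derivative])
    have "((\<lambda>r. 0) has_real_derivative 0) (at (R + 1))" by simp
    then show "(jrad c n has_real_derivative 0) (at (R + 1))"
      by (rule has_field_derivative_transform_within_open[where S = "{R<..}"]) (use z in auto)
  qed
  have zz: "jrad c n r = 0" if "0 < r" "r \<le> R + 1" for r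
    by (rule radial_ode_backward[OF radial_ode_jrad _ z z1]) (use assms that in auto)
  have "((\<lambda>r. vrad c n 0 (r\<^sup>2)) \<longlongrightarrow> vrad c n 0 (0\<^sup>2)) (at_right 0)"
    by (rule isCont_tendsto_compose[OF DERIV_isCont[OF vrad_has_derivative]]) (intro tendsto_intros)
  moreover have "\<forall>\<^sub>F r in at_right 0. vrad c n 0 (r\<^sup>2) = (0::real)"
    unfolding eventually_at_right_field using zz assms
    by (intro exI[of _ "R + 1"]) (auto simp: jrad_def)
  ultimately have "((\<lambda>r::real. 0) \<longlongrightarrow> vrad c n 0 (0\<^sup>2)) (at_right 0)"
    by (rule Lim_transform_eventually)
  then have "vrad c n 0 0 = 0" using tendsto_unique[OF trivial_limit_at_right_real _ tendsto_const] by fastforce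
  then show False using besF_ge[of 0 n] fact_gt_zero[of n, where 'a = real] by (simp add: vrad_def)
qed

lemma exterior_solution_zero:
  assumes p: "smooth_on (- cball 0 R) p" and R: "0 \<le> R" and k: "0 < k" and c: "c = k\<^sup>2 \<or> c = - k\<^sup>2"
    and lap: "\<And>x. x \<in> - cball 0 R \<Longrightarrow> lap p x = of_real c * p x" and som: "sommerfeld k p"
    and test: "\<And>\<sigma> n a b. \<sigma>\<^sup>2 = 1 \<Longrightarrow> R < a \<Longrightarrow> a < b \<Longrightarrow> (\<integral>x. p x * (lap (\<lambda>x. complex_of_real (cutoff (a\<^sup>2) (b\<^sup>2) ((norm x)\<^sup>2)) * vsol c \<sigma> n x) x
       - of_real c * (complex_of_real (cutoff (a\<^sup>2) (b\<^sup>2) ((norm x)\<^sup>2)) * vsol c \<sigma> n x)) \<partial>lborel) = 0"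
    and x: "x \<in> - cball 0 R"
  shows "p x = 0"
proof -
  have zero: "mode (\<sigma> * real n) p r = 0" if \<sigma>: "\<sigma> = 1 \<or> \<sigma> = -1" and r: "R < r" for \<sigma> n r
  proof -
    let ?\<nu> = "\<sigma> * real n"
    have s2: "\<sigma>\<^sup>2 = 1" using \<sigma> by auto
    have \<nu>: "cis (?\<nu> * (2*pi)) = 1" "?\<nu>\<^sup>2 = (real n)\<^sup>2"
      using cis_multiple_2pi[of ?\<nu>] \<sigma> by (auto simp: mult_ac)
    have W: "mode ?\<nu> p r * of_real (jrad1 c n r) = mode1 ?\<nu> p r * of_real (jrad c n r)" if "R < r" for r
      by (rule mode_wronskian_zero[OF p R lap \<sigma> test[OF s2] that])
    note rad = mode_radiation[OF p R som, of ?\<nu>]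
    show ?thesis
      using c
    proof
      \<comment> \<open>With a nonnegative argument the series is at least 1/n!, so
        \<open>jrad\<close> is positive and bounded below for r >= 1.\<close>
      assume ck: "c = k\<^sup>2"
      have ge: "inverse (fact n) \<le> vrad c n 0 (r\<^sup>2)" for r
        using besF_ge[of "c / 4 * r\<^sup>2" n] by (simp add: vrad_def ck)
      have pos: "0 < vrad c n 0 (r\<^sup>2)" for r using ge[of r] by (rule less_le_trans[rotated]) simp
      show ?thesis
      proof (rule growing_mode_zero[OF R k _ mode_derivative[OF p R] jrad_derivative _ _ W rad r])
        show "0 < (inverse (fact n) :: real)" by simp
        show "0 < jrad c n r" if "R < r" for r using that R pos by (simp add: jrad_def)
        show "inverse (fact n) \<le> jrad c n r" if "1 \<le> r" for r
        proof -
          have "1 * inverse (fact n) \<le> r ^ n * vrad c n 0 (r\<^sup>2)"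
            using that ge[of r] by (intro mult_mono) (auto simp: one_le_power)
          then show ?thesis by (simp add: jrad_def)
        qed
      qed
    next
      assume ck: "c = - k\<^sup>2"
      obtain r1 where r1: "R < r1" "jrad c n r1 \<noteq> 0" by (rule jrad_nonzero[OF R])
      \<comment> \<open>Where j is nonzero, P' is a real multiple of P, so the flux vanishes at this
        radius.\<close>
      have "mode1 ?\<nu> p r1 = mode ?\<nu> p r1 * of_real (jrad1 c n r1 / jrad c n r1)"
        using W[OF r1(1)] r1(2) by (simp add: field_simps)
      then have "mode1 ?\<nu> p r1 * cnj (mode ?\<nu> p r1) = of_real (jrad1 c n r1 / jrad c n r1) * (mode ?\<nu> p r1 * cnj (mode ?\<nu> p r1))"
        by (simp add: mult_ac)
      also have "\<dots> = complex_of_real (jrad1 c n r1 / jrad c n r1 * (cmod (mode ?\<nu> p r1))\<^sup>2)"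
        by (simp only: complex_norm_square[symmetric] of_real_mult of_real_power)
      finally have im: "Im (mode1 ?\<nu> p r1 * cnj (mode ?\<nu> p r1)) = 0" by (simp only: Im_complex_of_real)
      have ode: "(mode1 ?\<nu> p has_vector_derivative (- mode1 ?\<nu> p r / of_real r + of_real ((real n)\<^sup>2 / r\<^sup>2 - k\<^sup>2) * mode ?\<nu> p r)) (at r)" if "R < r" for r
        using mode_ode[OF p R that lap \<nu>(1)] unfolding \<nu>(2) ck by simp
      show ?thesis
        by (rule radiating_mode_zero[OF R k mode_derivative[OF p R] ode rad r1(1) im r])
    qed
  qed
  define r where "r = norm x"
  have r: "R < r" using x by (simp add: r_def)
  obtain s where s: "0 \<le> s" "s \<le> 2*pi" "x = circle_pt r s" unfolding r_def by (rule polar_exists)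
  \<comment> \<open>Fourier uniqueness is stated on the unit circle, so the circle through x is
    rescaled.\<close>
  define g where "g y = p (r *\<^sub>R y)" for y
  have "g (circle_pt 1 s) = 0"
  proof (rule circle_Fourier_unique)
    show "continuous_on (sphere 0 1) g"
      unfolding g_def by (rule continuous_on_compose2[OF smooth_on_continuous[OF p]])
        (use r R in \<open>auto intro!: continuous_intros\<close>)
    show "integral {0..2*pi} (\<lambda>t. g (circle_pt 1 t) * cis (of_int m * t)) = 0" for m
    proof -
      define \<sigma> :: real where "\<sigma> = (if 0 \<le> m then 1 else -1)"
      have m: "of_int m = \<sigma> * real (nat \<bar>m\<bar>)" by (simp add: \<sigma>_def)
      have "mode (\<sigma> * real (nat \<bar>m\<bar>)) p r = 0" by (rule zero[OF _ r]) (simp add: \<sigma>_def)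
      then show ?thesis unfolding m mode_def circle_int_def g_def circle_pt_scale[symmetric] .
    qed
  qed (use s in auto)
  then show ?thesis using s(3) by (simp add: g_def circle_pt_scale[symmetric])
qed

section \<open>The radiating solution\<close>

text \<open>\<open>vector_derivative\<close> is known to be additive only where the derivatives
  exist, here outside the disc. The limit concerns large r, so eventual agreement of the two
  expressions is enough.\<close>

lemma sommerfeld_add:
  assumes f: "smooth_on (- cball 0 R) f" and g: "smooth_on (- cball 0 R) g" and R: "0 \<le> R"
    and "sommerfeld k f" "sommerfeld k g"
  shows "sommerfeld k (\<lambda>x. f x + c * g x)"
proof -
  let ?F = "\<lambda>f r d. complex_of_real (sqrt r) * (vector_derivative (\<lambda>s. f (s *\<^sub>R d)) (at r) - \<i> * complex_of_real k * f (r *\<^sub>R d))"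
  have 1: "uniform_limit (sphere 0 1) (\<lambda>r d. ?F f r d + c * ?F g r d) (\<lambda>_. 0 + c * 0) at_top"
    using assms(4,5) unfolding sommerfeld_def
    by (intro uniform_limit_add bounded_linear.uniform_limit[OF bounded_linear_mult_right])
  have "\<forall>\<^sub>F r in at_top. \<forall>d\<in>sphere 0 1. ?F f r d + c * ?F g r d = ?F (\<lambda>x. f x + c * g x) r d"
    using eventually_gt_at_top[of R]
  proof eventually_elim
    case (elim r)
    show ?case
    proof
      fix d :: "real^2" assume d: "d \<in> sphere 0 1"
      have vd: "((\<lambda>s. h (s *\<^sub>R d)) has_vector_derivative vector_derivative (\<lambda>s. h (s *\<^sub>R d)) (at r)) (at r)"
        if h: "smooth_on (- cball 0 R) h" for h
      proof -
        have "r *\<^sub>R d \<in> - cball 0 R" using d elim R by simp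
        then have "h differentiable (at (r *\<^sub>R d))" by (rule smooth_on_imp_differentiable[OF h])
        moreover have "((\<lambda>s. s *\<^sub>R d) has_vector_derivative d) (at r)"
          by (auto intro!: derivative_eq_intros)
        ultimately show ?thesis
          by (intro vector_derivative_works[THEN iffD1] differentiableI_vector[OF has_vector_derivative_along])
      qed
      have "((\<lambda>s. f (s *\<^sub>R d) + c * g (s *\<^sub>R d)) has_vector_derivative
         vector_derivative (\<lambda>s. f (s *\<^sub>R d)) (at r) + c * vector_derivative (\<lambda>s. g (s *\<^sub>R d)) (at r)) (at r)"
        by (intro has_vector_derivative_add has_vector_derivative_mult_right vd f g)
      from vector_derivative_at[OF this]
      show "?F f r d + c * ?F g r d = ?F (\<lambda>x. f x + c * g x) r d" by (simp add: algebra_simps)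
    qed
  qed
  then have "uniform_limit (sphere 0 1) (?F (\<lambda>x. f x + c * g x)) (\<lambda>_. 0 + c * 0) at_top"
    using 1 by (subst (asm) uniform_limit_cong) auto
  then show ?thesis by (simp add: sommerfeld_def)
qed

lemma brep_eq_outside:
  assumes "brep V f f'" "V \<subseteq> U" "\<And>x. x \<in> V \<Longrightarrow> g x = f x" "\<And>x. x \<notin> V \<Longrightarrow> g x = 0"
  shows "brep U g f'"
proof -
  have "AE x in lborel. x \<in> U \<longrightarrow> g x = f' x"
    using brepD(3)[OF assms(1)] by eventually_elim (metis assms(3,4) brepD(2)[OF assms(1)])
  then show ?thesis using assms(1,2) by (auto simp: brep_def)
qed

lemma L2b_mult_test_integrable: "L2b f \<Longrightarrow> \<phi> \<in> test_functions U \<Longrightarrow> integrable lborel (\<lambda>x. f x * \<phi> x)"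
  using Cauchy_Schwarz_L2b(1) L2b_test by blast

text \<open>The fourth-order equation is split into two of second order: f' is the weak Laplacian of
  u', and the distributional Laplacian of f' is k^4 u' + F'. Later arguments use this pair of
  identities in place of the chosen weak derivatives.\<close>

lemma weak_biharmonic_wave_brep:
  assumes U: "open U" and w: "weak_biharmonic_wave k U F u" and F: "brep U F F'" "L2b F'"
  obtains u' f' where "brep U u u'" "L2b u'" "L2b f'"
    "\<And>\<phi>. \<phi> \<in> test_functions U \<Longrightarrow> (\<integral>x. u' x * lap \<phi> x \<partial>lborel) = (\<integral>x. f' x * \<phi> x \<partial>lborel)"
    "\<And>\<phi>. \<phi> \<in> test_functions U \<Longrightarrow> (\<integral>x. f' x * lap \<phi> x \<partial>lborel) = of_real (k^4) * (\<integral>x. u' x * \<phi> x \<partial>lborel) + (\<integral>x. F' x * \<phi> x \<partial>lborel)"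
proof -
  have s: "sobolev (Suc 1) U u" using w by (simp only: weak_biharmonic_wave_def Suc_1)
  have s1: "is_weak_pd U i u (wpd U i u)" "sobolev (Suc 0) U (wpd U i u)" for i
    using sobolev_Suc_wpd[OF U s] by (simp_all only: One_nat_def)
  have s2: "is_weak_pd U i (wpd U i u) (wpd U i (wpd U i u))" "sobolev 0 U (wpd U i (wpd U i u))" for i
    using sobolev_Suc_wpd[OF U s1(2)] by simp_all
  obtain u' where u': "brep U u u'" "L2b u'" using L2_on_ex_brep[OF U sobolev_L2[OF s]] by blast
  have "\<forall>i. \<exists>d. brep U (wpd U i u) d" using L2_on_ex_brep[OF U sobolev_L2[OF s1(2)]] by metis
  from choice[OF this] obtain d where d: "\<And>i. brep U (wpd U i u) (d i)" by blast
  have "\<forall>i. \<exists>D. brep U (wpd U i (wpd U i u)) D \<and> L2b D" using L2_on_ex_brep[OF U sobolev_L2[OF s2(2)]] by metis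
  from choice[OF this] obtain D where D: "\<And>i. brep U (wpd U i (wpd U i u)) (D i)" "\<And>i. L2b (D i)" by blast
  define f' where "f' x = D 1 x + D 2 x" for x
  have bf: "brep U (wlap U u) f'"
    using brep_add[OF D(1) D(1), of 1 2] by (simp add: f'_def[abs_def] wlap_def[abs_def] sum_UNIV_2)
  have Lf: "L2b f'" unfolding f'_def[abs_def] by (intro L2b_add D)
  show thesis
  proof (rule that[OF u' Lf])
    fix \<phi> assume \<phi>: "\<phi> \<in> test_functions U"
    note t = test_functions_pd[OF \<phi>] test_functions_pd[OF test_functions_pd[OF \<phi>]] test_functions_lap[OF \<phi>]
    have "(\<integral>x. u' x * pd i (pd i \<phi>) x \<partial>lborel) = (\<integral>x. D i x * \<phi> x \<partial>lborel)" for i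
      using s1(1)[of i, unfolded weak_pd_brep[OF U u'(1) d]] s2(1)[of i, unfolded weak_pd_brep[OF U d D(1)]] \<phi> t(1)[of i]
      by simp
    then show "(\<integral>x. u' x * lap \<phi> x \<partial>lborel) = (\<integral>x. f' x * \<phi> x \<partial>lborel)"
      using L2b_mult_test_integrable[OF u'(2) t(2)] L2b_mult_test_integrable[OF D(2) \<phi>]
      by (simp add: lap_def sum_UNIV_2 f'_def distrib_left distrib_right)
    have bx: "brep U (\<lambda>x. wlap U u x * lap \<phi> x - complex_of_real (k^4) * u x * \<phi> x) (\<lambda>x. f' x * lap \<phi> x - complex_of_real (k^4) * u' x * \<phi> x)"
      unfolding brep_def
    proof (intro conjI allI impI)
      show "(\<lambda>x. f' x * lap \<phi> x - complex_of_real (k^4) * u' x * \<phi> x) \<in> borel_measurable borel"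
        using L2b_measurable[OF Lf] L2b_measurable[OF u'(2)] test_measurable[OF \<phi>] test_measurable[OF t(3)] by measurable
      show "f' x * lap \<phi> x - complex_of_real (k^4) * u' x * \<phi> x = 0" if "x \<notin> U" for x
        using brepD(2)[OF bf that] brepD(2)[OF u'(1) that] by simp
      show "AE x in lborel. x \<in> U \<longrightarrow> wlap U u x * lap \<phi> x - complex_of_real (k^4) * u x * \<phi> x = f' x * lap \<phi> x - complex_of_real (k^4) * u' x * \<phi> x"
        using brepD(3)[OF bf] brepD(3)[OF u'(1)] by eventually_elim auto
    qed
    have "(LINT x|lebesgue_on U. wlap U u x * lap \<phi> x - complex_of_real (k^4) * u x * \<phi> x) = (\<integral>x. f' x * lap \<phi> x - complex_of_real (k^4) * u' x * \<phi> x \<partial>lborel)"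
      using lint_on_mult_brep[OF U bx, of "\<lambda>_. 1"] by simp
    moreover have "(LINT x|lebesgue_on U. F x * \<phi> x) = (\<integral>x. F' x * \<phi> x \<partial>lborel)"
      by (rule lint_on_mult_brep[OF U F(1) test_measurable[OF \<phi>]])
    ultimately have "(\<integral>x. f' x * lap \<phi> x - complex_of_real (k^4) * (u' x * \<phi> x) \<partial>lborel) = (\<integral>x. F' x * \<phi> x \<partial>lborel)"
      using w \<phi> by (simp add: weak_biharmonic_wave_def mult.assoc)
    then show "(\<integral>x. f' x * lap \<phi> x \<partial>lborel) = of_real (k^4) * (\<integral>x. u' x * \<phi> x \<partial>lborel) + (\<integral>x. F' x * \<phi> x \<partial>lborel)"
      using L2b_mult_test_integrable[OF Lf t(3)] L2b_mult_test_integrable[OF u'(2) \<phi>]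
        Bochner_Integration.integral_diff[of lborel "\<lambda>x. f' x * lap \<phi> x" "\<lambda>x. complex_of_real (k^4) * (u' x * \<phi> x)"]
      by (simp add: diff_eq_eq add.commute)
  qed
qed

text \<open>The representatives of \<open>u\<close> and of its Laplacian depend on the disc on which
  the weak equation is read, so they are not fixed here but obtained anew from
  \<open>weak_form\<close>.\<close>

locale radiating =
  fixes R k :: real and S u S' w :: cfun
  assumes R: "0 < R" and k: "0 < k" and S: "S \<in> H_perp k R"
    and S': "brep (ball 0 R) S S'" "L2_ball R S'"
    and weak: "\<And>\<rho>. 0 < \<rho> \<Longrightarrow> weak_biharmonic_wave k (ball 0 \<rho>) (zero_ext R S) u"
    and w: "smooth_on (- cball 0 R) w" "AE x in lborel. x \<notin> cball 0 R \<longrightarrow> u x = w x"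
    and som: "sommerfeld k w" "sommerfeld k (lap w)"
begin

abbreviation \<Omega> :: "(real^2) set" where "\<Omega> \<equiv> - cball 0 R"

lemma open_\<Omega>: "open \<Omega>"
  by (simp add: open_Compl)

lemma weak_form:
  assumes "R \<le> \<rho>"
  obtains u' f' where "brep (ball 0 \<rho>) u u'" "L2b u'" "L2b f'"
    "\<And>\<phi>. \<phi> \<in> test_functions (ball 0 \<rho>) \<Longrightarrow> (\<integral>x. u' x * lap \<phi> x \<partial>lborel) = (\<integral>x. f' x * \<phi> x \<partial>lborel)"
    "\<And>\<phi>. \<phi> \<in> test_functions (ball 0 \<rho>) \<Longrightarrow> (\<integral>x. f' x * lap \<phi> x \<partial>lborel) = of_real (k^4) * (\<integral>x. u' x * \<phi> x \<partial>lborel) + (\<integral>x. S' x * \<phi> x \<partial>lborel)"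
proof -
  have "0 < \<rho>" using assms R by simp
  moreover have "brep (ball 0 \<rho>) (zero_ext R S) S'"
    by (rule brep_eq_outside[OF S'(1)]) (use assms in \<open>auto simp: zero_ext_def\<close>)
  ultimately show thesis
    by (rule weak_biharmonic_wave_brep[OF open_ball weak _ L2_ballD(1)[OF S'(2)]]) (rule that)
qed

text \<open>Where the test function lives, \<open>u'\<close> and the smooth \<open>w\<close> agree
  almost everywhere. This transfers the weak identities to a function with classical
  derivatives.\<close>

lemma exterior_test_integral:
  assumes u': "brep (ball 0 \<rho>) u u'" and \<psi>: "\<psi> \<in> test_functions \<Omega>" "\<psi> \<in> test_functions (ball 0 \<rho>)"
  shows "(\<integral>x. u' x * \<psi> x \<partial>lborel) = (\<integral>x. w x * \<psi> x \<partial>lborel)"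
proof (rule integral_cong_AE)
  have z: "\<psi> x = 0" if "x \<notin> ball 0 \<rho> \<or> x \<notin> \<Omega>" for x
    using \<psi> that by (auto simp: test_functions_def)
  show "AE x in lborel. u' x * \<psi> x = w x * \<psi> x"
    using brepD(3)[OF u'] w(2) by eventually_elim (use z in auto)
  show "(\<lambda>x. u' x * \<psi> x) \<in> borel_measurable lborel"
    using brepD(1)[OF u'] test_measurable[OF \<psi>(1)] by simp
  show "(\<lambda>x. w x * \<psi> x) \<in> borel_measurable lborel"
    using test_measurable[OF test_functions_mult[OF \<psi>(1) open_\<Omega> w(1)]] by (simp add: mult.commute)
qed

lemma S'_exterior: "\<phi> \<in> test_functions \<Omega> \<Longrightarrow> (\<integral>x. S' x * \<phi> x \<partial>lborel) = 0"
proof -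
  assume \<phi>: "\<phi> \<in> test_functions \<Omega>"
  have "(\<lambda>x. S' x * \<phi> x) = (\<lambda>_. 0)"
  proof
    fix x show "S' x * \<phi> x = 0"
      using L2_ballD(3)[OF S'(2), of x] \<phi> by (cases "x \<in> cball 0 R") (auto simp: test_functions_def)
  qed
  then show ?thesis by (simp only: Bochner_Integration.integral_zero)
qed

text \<open>On an annulus that contains x the source is invisible. All derivatives can be moved from
  the test function onto \<open>w\<close>, and the fundamental lemma with continuity yields the
  pointwise equation.\<close>

lemma exterior_equation:
  assumes x: "x \<in> \<Omega>"
  shows "lap (lap w) x = of_real (k^4) * w x"
proof -
  define \<rho> where "\<rho> = norm x + R"
  have \<rho>: "R \<le> \<rho>" "x \<in> ball 0 \<rho>" using x R by (auto simp: \<rho>_def)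
  let ?V = "ball 0 \<rho> \<inter> \<Omega>"
  obtain u' f' where u': "brep (ball 0 \<rho>) u u'"
    and 1: "\<And>\<phi>. \<phi> \<in> test_functions (ball 0 \<rho>) \<Longrightarrow> (\<integral>x. u' x * lap \<phi> x \<partial>lborel) = (\<integral>x. f' x * \<phi> x \<partial>lborel)"
    and 2: "\<And>\<phi>. \<phi> \<in> test_functions (ball 0 \<rho>) \<Longrightarrow> (\<integral>x. f' x * lap \<phi> x \<partial>lborel) = of_real (k^4) * (\<integral>x. u' x * \<phi> x \<partial>lborel) + (\<integral>x. S' x * \<phi> x \<partial>lborel)"
    by (rule weak_form[OF \<rho>(1)]) blast
  have oV: "open ?V" using open_\<Omega> by (intro open_Int) auto
  define h where "h x = lap (lap w) x - of_real (k^4) * w x" for x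
  have sh: "smooth_on \<Omega> h" unfolding h_def[abs_def]
    by (intro smooth_on_diff smooth_on_cmult smooth_on_lap w(1) open_\<Omega>)
  have hc: "continuous_on ?V h" using smooth_on_continuous[OF sh] by (rule continuous_on_subset) auto
  define g where "g x = indicator ?V x *\<^sub>R h x" for x
  have "AE x in lborel. x \<in> ?V \<longrightarrow> g x = 0"
  proof (rule fundamental_lemma[OF oV])
    show "g \<in> borel_measurable borel"
      unfolding g_def[abs_def] by (rule borel_measurable_continuous_on_indicator[OF _ hc]) (use oV in simp)
    fix K assume K: "compact K" "K \<subseteq> ?V"
    have "integrable lborel (\<lambda>x. indicator K x *\<^sub>R h x)"
      by (rule borel_integrable_compact[OF K(1) continuous_on_subset[OF hc K(2)]])
    moreover have "(\<lambda>x. indicator K x *\<^sub>R g x) = (\<lambda>x. indicator K x *\<^sub>R h x)"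
      using K(2) by (auto simp: g_def indicator_def fun_eq_iff)
    ultimately show "integrable lborel (\<lambda>x. indicator K x *\<^sub>R g x)" by simp
  next
    fix \<phi> assume \<phi>: "\<phi> \<in> test_functions ?V"
    have tb: "\<phi> \<in> test_functions (ball 0 \<rho>)" and to: "\<phi> \<in> test_functions \<Omega>"
      using \<phi> by (auto intro: test_functions_mono)
    have "(\<integral>x. u' x * lap (lap \<phi>) x \<partial>lborel) = of_real (k^4) * (\<integral>x. u' x * \<phi> x \<partial>lborel)"
      using 1[OF test_functions_lap[OF tb]] 2[OF tb] S'_exterior[OF to] by simp
    then have "(\<integral>x. w x * lap (lap \<phi>) x \<partial>lborel) = of_real (k^4) * (\<integral>x. w x * \<phi> x \<partial>lborel)"
      using exterior_test_integral[OF u' to tb] exterior_test_integral[OF u' test_functions_lap[OF test_functions_lap[OF to]] test_functions_lap[OF test_functions_lap[OF tb]]]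
      by simp
    moreover have "(\<integral>x. w x * lap (lap \<phi>) x \<partial>lborel) = (\<integral>x. lap (lap w) x * \<phi> x \<partial>lborel)"
      using integral_lap_by_parts[OF open_\<Omega> w(1) test_functions_lap[OF to]]
        integral_lap_by_parts[OF open_\<Omega> smooth_on_lap[OF open_\<Omega> w(1)] to] by simp
    moreover have "integrable lborel (\<lambda>x. lap (lap w) x * \<phi> x)" "integrable lborel (\<lambda>x. w x * \<phi> x)"
      using test_integrable[OF test_functions_mult[OF to open_\<Omega> smooth_on_lap[OF open_\<Omega> smooth_on_lap[OF open_\<Omega> w(1)]]]]
        test_integrable[OF test_functions_mult[OF to open_\<Omega> w(1)]] by (simp_all add: mult.commute)
    ultimately have "(\<integral>x. h x * \<phi> x \<partial>lborel) = 0"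
      by (simp add: h_def left_diff_distrib mult.assoc)
    moreover have "(\<lambda>x. g x * \<phi> x) = (\<lambda>x. h x * \<phi> x)"
      using \<phi> by (auto simp: g_def indicator_def fun_eq_iff test_functions_def)
    ultimately show "(\<integral>x. g x * \<phi> x \<partial>lborel) = 0" by simp
  qed
  then have "AE x in lborel. x \<in> ?V \<longrightarrow> h x = 0" by eventually_elim (auto simp: g_def)
  from continuous_AE_zero[OF oV hc this] have "h x = 0" using x \<rho> by auto
  then show ?thesis by (simp add: h_def)
qed

text \<open>The only place where orthogonality of the source is used. Let \<phi> be the cutoff times
  an entire solution v. On the disc it equals v, so the source term vanishes and u pairs to zero
  with (Laplacian^2 - k^4) \<phi> = (Laplacian + c) \<psi>, where \<psi> = (Laplacian - c) \<phi>.
  As v is annihilated by Laplacian - c, \<psi> is supported in an annulus outside the disc, where u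
  is the smooth \<open>w\<close> and Laplacian + c can be moved back onto it.\<close>

lemma test_exterior:
  assumes c: "c\<^sup>2 = k^4" and \<sigma>: "\<sigma>\<^sup>2 = 1" and ab: "R < a" "a < b"
  shows "(\<integral>x. (lap w x + of_real c * w x) * (lap (\<lambda>x. complex_of_real (cutoff (a\<^sup>2) (b\<^sup>2) ((norm x)\<^sup>2)) * vsol c \<sigma> n x) x
       - of_real c * (complex_of_real (cutoff (a\<^sup>2) (b\<^sup>2) ((norm x)\<^sup>2)) * vsol c \<sigma> n x)) \<partial>lborel) = 0"
proof -
  define ct where "ct x = complex_of_real (cutoff (a\<^sup>2) (b\<^sup>2) ((norm x)\<^sup>2))" for x :: "real^2"
  define \<phi> where "\<phi> x = ct x * vsol c \<sigma> n x" for x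
  define \<psi> where "\<psi> x = lap \<phi> x - of_real c * \<phi> x" for x
  define \<rho> where "\<rho> = b + 1"
  have \<rho>: "R \<le> \<rho>" "cball 0 b \<subseteq> ball (0::real^2) \<rho>" using ab by (auto simp: \<rho>_def)
  have ab2: "a\<^sup>2 < b\<^sup>2" using ab R by (simp add: power_strict_mono)
  have tct: "ct \<in> test_functions (ball 0 \<rho>)"
    unfolding ct_def[abs_def] using ab R \<rho> by (intro test_cutoff) auto
  have sv: "smooth_on V (vsol c \<sigma> n)" for V by (rule smooth_on_subset[OF smooth_vsol]) auto
  have t\<phi>: "\<phi> \<in> test_functions (ball 0 \<rho>)"
    unfolding \<phi>_def[abs_def] by (rule test_functions_mult[OF tct open_ball sv])
  have t\<psi>: "\<psi> \<in> test_functions (ball 0 \<rho>)"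
    unfolding \<psi>_def[abs_def] by (intro test_functions_diff test_functions_cmult test_functions_lap t\<phi>)
  have tpd: "pd i ct \<in> test_functions \<Omega>" for i
    unfolding ct_def[abs_def] using ab R by (intro test_pd_cutoff) auto
  have \<psi>_eq: "\<psi> = (\<lambda>x. (pd 1 (pd 1 ct) x * vsol c \<sigma> n x + pd 2 (pd 2 ct) x * vsol c \<sigma> n x)
      + 2 * (pd 1 ct x * pd 1 (vsol c \<sigma> n) x + pd 2 ct x * pd 2 (vsol c \<sigma> n) x))"
  proof
    fix x
    have "lap \<phi> x = lap ct x * vsol c \<sigma> n x + 2 * (\<Sum>i\<in>UNIV. pd i ct x * pd i (vsol c \<sigma> n) x) + ct x * lap (vsol c \<sigma> n) x"
      unfolding \<phi>_def[abs_def] by (rule lap_mult[OF open_UNIV UNIV_I test_functions_smooth[OF tct] smooth_vsol])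
    then show "\<psi> x = (pd 1 (pd 1 ct) x * vsol c \<sigma> n x + pd 2 (pd 2 ct) x * vsol c \<sigma> n x)
      + 2 * (pd 1 ct x * pd 1 (vsol c \<sigma> n) x + pd 2 ct x * pd 2 (vsol c \<sigma> n) x)"
      using lap_vsol[OF \<sigma>, of c n x] by (simp add: \<psi>_def \<phi>_def lap_def[of ct] sum_UNIV_2 algebra_simps)
  qed
  \<comment> \<open>Every summand contains a derivative of the cutoff, so the support avoids the
    disc.\<close>
  have to: "\<psi> \<in> test_functions \<Omega>"
    unfolding \<psi>_eq by (intro test_functions_add test_functions_cmult test_functions_mult[OF _ open_\<Omega>]
        test_functions_pd tpd sv smooth_on_pd)
  obtain u' f' where u': "brep (ball 0 \<rho>) u u'" "L2b u'"
    and 1: "\<And>\<phi>. \<phi> \<in> test_functions (ball 0 \<rho>) \<Longrightarrow> (\<integral>x. u' x * lap \<phi> x \<partial>lborel) = (\<integral>x. f' x * \<phi> x \<partial>lborel)"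
    and 2: "\<And>\<phi>. \<phi> \<in> test_functions (ball 0 \<rho>) \<Longrightarrow> (\<integral>x. f' x * lap \<phi> x \<partial>lborel) = of_real (k^4) * (\<integral>x. u' x * \<phi> x \<partial>lborel) + (\<integral>x. S' x * \<phi> x \<partial>lborel)"
    by (rule weak_form[OF \<rho>(1)]) blast
  \<comment> \<open>The cutoff equals 1 on the disc, where \<open>S'\<close> lives, so orthogonality
    to the entire solution applies.\<close>
  have "(\<integral>x. S' x * \<phi> x \<partial>lborel) = (\<integral>x. S' x * vsol c \<sigma> n x \<partial>lborel)"
  proof (rule Bochner_Integration.integral_cong)
    fix x
    show "S' x * \<phi> x = S' x * vsol c \<sigma> n x"
    proof (cases "x \<in> ball 0 R")
      case True
      then have "(norm x)\<^sup>2 \<le> a\<^sup>2" using ab by (intro power_mono) auto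
      then show ?thesis by (simp add: \<phi>_def ct_def cutoff_eq_1)
    qed (use L2_ballD(2)[OF S'(2)] in simp)
  qed simp
  also have "\<dots> = (LINT x|lebesgue_on (ball 0 R). S x * vsol c \<sigma> n x)"
    by (rule lint_on_mult_brep[symmetric, OF open_ball S'(1)])
      (intro borel_measurable_continuous_onI smooth_on_continuous smooth_vsol)
  also have "\<dots> = 0" by (rule H_perp_orthogonal[OF S smooth_vsol lap_vsol[OF \<sigma>] c])
  finally have "(\<integral>x. u' x * lap (lap \<phi>) x \<partial>lborel) = of_real (k^4) * (\<integral>x. u' x * \<phi> x \<partial>lborel)"
    using 1[OF test_functions_lap[OF t\<phi>]] 2[OF t\<phi>] by simp
  moreover have iu: "integrable lborel (\<lambda>x. u' x * lap (lap \<phi>) x)" "integrable lborel (\<lambda>x. u' x * \<phi> x)" "integrable lborel (\<lambda>x. u' x * lap \<phi> x)"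
    by (rule L2b_mult_test_integrable[OF u'(2)], rule t\<phi> test_functions_lap[OF t\<phi>] test_functions_lap[OF test_functions_lap[OF t\<phi>]])+
  have "lap \<psi> x = lap (lap \<phi>) x - of_real c * lap \<phi> x" for x
    unfolding \<psi>_def[abs_def]
    using lap_diff[OF open_UNIV UNIV_I smooth_on_lap[OF open_UNIV test_functions_smooth[OF t\<phi>]] smooth_on_cmult[OF open_UNIV test_functions_smooth[OF t\<phi>], of "of_real c"], of x]
      lap_cmult[OF open_UNIV UNIV_I test_functions_smooth[OF t\<phi>], of "of_real c" x] by simp
  then have "lap \<psi> x + of_real c * \<psi> x = lap (lap \<phi>) x - of_real (k^4) * \<phi> x" for x
    unfolding c[symmetric] by (simp add: \<psi>_def power2_eq_square algebra_simps)
  then have "(\<integral>x. u' x * (lap \<psi> x + of_real c * \<psi> x) \<partial>lborel) = (\<integral>x. u' x * lap (lap \<phi>) x - of_real (k^4) * (u' x * \<phi> x) \<partial>lborel)"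
    by (simp only: right_diff_distrib mult.left_commute)
  ultimately have "(\<integral>x. u' x * (lap \<psi> x + of_real c * \<psi> x) \<partial>lborel) = 0" using iu by simp
  moreover have "(\<integral>x. u' x * (lap \<psi> x + of_real c * \<psi> x) \<partial>lborel) = (\<integral>x. w x * (lap \<psi> x + of_real c * \<psi> x) \<partial>lborel)"
    by (rule exterior_test_integral[OF u'(1)]; intro test_functions_add test_functions_cmult test_functions_lap to t\<psi>)
  ultimately have "(\<integral>x. w x * lap \<psi> x + of_real c * (w x * \<psi> x) \<partial>lborel) = 0" by (simp add: algebra_simps)
  moreover have iw: "integrable lborel (\<lambda>x. w x * lap \<psi> x)" "integrable lborel (\<lambda>x. w x * \<psi> x)" "integrable lborel (\<lambda>x. lap w x * \<psi> x)"
    using test_integrable[OF test_functions_mult[OF test_functions_lap[OF to] open_\<Omega> w(1)]]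
      test_integrable[OF test_functions_mult[OF to open_\<Omega> w(1)]]
      test_integrable[OF test_functions_mult[OF to open_\<Omega> smooth_on_lap[OF open_\<Omega> w(1)]]] by (simp_all add: mult.commute)
  ultimately have "(\<integral>x. lap w x * \<psi> x \<partial>lborel) + of_real c * (\<integral>x. w x * \<psi> x \<partial>lborel) = 0"
    using integral_lap_by_parts[OF open_\<Omega> w(1) to] by simp
  then have "(\<integral>x. (lap w x + of_real c * w x) * \<psi> x \<partial>lborel) = 0"
    using iw by (simp add: distrib_right mult.assoc)
  then show ?thesis by (simp add: \<psi>_def \<phi>_def[abs_def] ct_def[abs_def])
qed

lemma exterior_component_zero:
  assumes c: "c = k\<^sup>2 \<or> c = - k\<^sup>2" and x: "x \<in> \<Omega>"
  shows "lap w x + of_real c * w x = 0"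
proof -
  have c2: "c\<^sup>2 = k^4" using c by (auto simp: power2_eq_square power4_eq_xxxx)
  have sl: "smooth_on \<Omega> (lap w)" by (rule smooth_on_lap[OF open_\<Omega> w(1)])
  have sp: "smooth_on \<Omega> (\<lambda>x. lap w x + of_real c * w x)"
    by (intro smooth_on_add smooth_on_cmult sl w(1) open_\<Omega>)
  show ?thesis
  proof (rule exterior_solution_zero[OF sp _ k c _ _ _ x])
    show "0 \<le> R" using R by simp
    show "lap (\<lambda>x. lap w x + of_real c * w x) x = of_real c * (lap w x + of_real c * w x)" if "x \<in> \<Omega>" for x
    proof -
      have "lap (\<lambda>x. lap w x + of_real c * w x) x = lap (lap w) x + of_real c * lap w x"
        using lap_add[OF open_\<Omega> that sl smooth_on_cmult[OF open_\<Omega> w(1)], of "of_real c"] lap_cmult[OF open_\<Omega> that w(1), of "of_real c"] by simp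
      also have "lap (lap w) x = of_real (c\<^sup>2) * w x" unfolding c2 by (rule exterior_equation[OF that])
      finally show ?thesis by (simp add: power2_eq_square algebra_simps)
    qed
    show "sommerfeld k (\<lambda>x. lap w x + of_real c * w x)"
      using R by (intro sommerfeld_add[OF sl w(1)] som) auto
  qed (rule test_exterior[OF c2])
qed

text \<open>Subtracting the components for c = k^2 and c = -k^2 leaves 2 k^2 w.\<close>

lemma exterior_zero: "x \<in> \<Omega> \<Longrightarrow> w x = 0"
proof -
  assume x: "x \<in> \<Omega>"
  have "lap w x + of_real (k\<^sup>2) * w x = 0" "lap w x + of_real (- k\<^sup>2) * w x = 0"
    by (rule exterior_component_zero[OF _ x]; simp)+
  then have "2 * of_real (k\<^sup>2) * w x = 0" by (simp add: algebra_simps)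
  then show "w x = 0" using k by simp
qed

text \<open>Since \<open>u\<close> and its weak Laplacian vanish just outside the disc, their zero
  extensions satisfy both distributional equations on the whole plane, which is the form that
  \<open>traces_vanish\<close> requires.\<close>

lemma traces:
  "has_trace R u (\<lambda>_. 0)" "has_trace R (wlap (ball 0 R) u) (\<lambda>_. 0)"
  "has_normal_trace R u (\<lambda>_. 0)" "has_normal_trace R (wlap (ball 0 R) u) (\<lambda>_. 0)"
proof -
  define \<rho> where "\<rho> = R + 1"
  have \<rho>: "R \<le> \<rho>" by (simp add: \<rho>_def)
  obtain u' f' where u': "brep (ball 0 \<rho>) u u'" "L2b u'" and f': "L2b f'"
    and 1: "\<And>\<phi>. \<phi> \<in> test_functions (ball 0 \<rho>) \<Longrightarrow> (\<integral>x. u' x * lap \<phi> x \<partial>lborel) = (\<integral>x. f' x * \<phi> x \<partial>lborel)"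
    and 2: "\<And>\<phi>. \<phi> \<in> test_functions (ball 0 \<rho>) \<Longrightarrow> (\<integral>x. f' x * lap \<phi> x \<partial>lborel) = of_real (k^4) * (\<integral>x. u' x * \<phi> x \<partial>lborel) + (\<integral>x. S' x * \<phi> x \<partial>lborel)"
    by (rule weak_form[OF \<rho>]) blast
  have u0: "AE x in lborel. x \<notin> cball 0 R \<longrightarrow> u' x = 0"
    using brepD(3)[OF u'(1)] w(2)
  proof eventually_elim
    case (elim x)
    show ?case
    proof
      assume x: "x \<notin> cball 0 R"
      show "u' x = 0"
      proof (cases "x \<in> ball 0 \<rho>")
        case True
        then show ?thesis using elim x exterior_zero[of x] by simp
      next
        case False
        then show ?thesis by (rule brepD(2)[OF u'(1)])
      qed
    qed
  qed
  define h where "h x = indicator (ball 0 R) x *\<^sub>R u' x" for x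
  have h: "L2_ball R h" "AE x in lborel. u' x = h x"
    using L2_ball_truncate[OF u'(2) u0] by (simp_all add: h_def[abs_def])
  have bh: "brep (ball 0 R) u h" unfolding h_def[abs_def] by (rule brep_restrict[OF u'(1)]) (use \<rho> in auto)
  define f where "f x = indicator (ball 0 R) x *\<^sub>R f' x" for x
  \<comment> \<open>The weak Laplacian inherits the vanishing of u on the annulus between R and
    \<open>\<rho>\<close>.\<close>
  have f0: "AE x in lborel. x \<in> ball 0 \<rho> \<inter> \<Omega> \<longrightarrow> f' x = 0"
  proof (rule fundamental_lemma)
    show "open (ball 0 \<rho> \<inter> \<Omega>)" using open_\<Omega> by (intro open_Int) auto
    show "f' \<in> borel_measurable borel" by (rule L2b_measurable[OF f'])
    show "integrable lborel (\<lambda>x. indicator K x *\<^sub>R f' x)" if K: "compact K" for K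
    proof -
      obtain B where "K \<subseteq> cball 0 B" using compact_imp_bounded[OF K] unfolding bounded_iff by (metis mem_cball_0 subsetI)
      have [measurable]: "K \<in> sets borel" using K by (simp add: borel_compact)
      have "L2b (\<lambda>x. f' x * of_real (indicator K x))"
        by (rule L2b_bounded_mult[OF f', of _ 1]) (auto simp: indicator_def)
      from L2b_integrable[OF this, of B] show ?thesis
        using \<open>K \<subseteq> cball 0 B\<close> by (fastforce simp: scaleR_conv_of_real[where 'a = complex] mult.commute indicator_def)
    qed
    fix \<phi> assume \<phi>: "\<phi> \<in> test_functions (ball 0 \<rho> \<inter> \<Omega>)"
    have tb: "\<phi> \<in> test_functions (ball 0 \<rho>)" and to: "\<phi> \<in> test_functions \<Omega>"
      using \<phi> by (auto intro: test_functions_mono)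
    have "(\<integral>x. f' x * \<phi> x \<partial>lborel) = (\<integral>x. w x * lap \<phi> x \<partial>lborel)"
      using 1[OF tb] exterior_test_integral[OF u'(1) test_functions_lap[OF to] test_functions_lap[OF tb]] by simp
    also have "(\<lambda>x. w x * lap \<phi> x) = (\<lambda>_. 0)"
    proof
      fix x show "w x * lap \<phi> x = 0"
        using exterior_zero[of x] test_functions_lap[OF to] by (cases "x \<in> \<Omega>") (auto simp: test_functions_def)
    qed
    finally show "(\<integral>x. f' x * \<phi> x \<partial>lborel) = 0" by simp
  qed
  define g where "g x = of_real (k^4) * h x + S' x" for x
  have f: "L2_ball R f"
  proof -
    have [measurable]: "f' \<in> borel_measurable borel" by (rule L2b_measurable[OF f'])
    have "L2b (\<lambda>x. f' x * of_real (indicator (ball 0 R) x))"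
      by (rule L2b_bounded_mult[OF f', of _ 1]) (auto simp: indicator_def)
    then show ?thesis by (auto simp: L2_ball_def f_def[abs_def] scaleR_conv_of_real mult.commute)
  qed
  have g: "L2_ball R g"
    using h(1) S'(2) by (auto simp: L2_ball_def g_def[abs_def] intro!: L2b_add L2b_cmult)
  \<comment> \<open>The weak identities accept only test functions supported in the larger disc.
    Multiplication by this cutoff admits all test functions of the plane and changes nothing on the
    disc of radius \<open>R\<close>; both radii lie strictly between R and R + 1.\<close>
  define ct where "ct x = complex_of_real (cutoff ((R + 1/3)\<^sup>2) ((R + 2/3)\<^sup>2) ((norm x)\<^sup>2))" for x :: "real^2"
  have tct: "ct \<in> test_functions (ball 0 \<rho>)"
    unfolding ct_def[abs_def] using R by (intro test_cutoff) (auto simp: \<rho>_def)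
  have ct1: "ct x = 1" if "x \<in> ball 0 R" for x
  proof -
    have "(norm x)\<^sup>2 \<le> (R + 1/3)\<^sup>2" using that R by (intro power_mono) auto
    then show ?thesis by (simp add: ct_def cutoff_eq_1)
  qed
  have AEu: "(\<integral>x. u' x * \<phi> x \<partial>lborel) = (\<integral>x. h x * \<phi> x \<partial>lborel)"
    and AEf: "(\<integral>x. f' x * \<phi> x \<partial>lborel) = (\<integral>x. f x * \<phi> x \<partial>lborel)"
    if \<phi>: "\<phi> \<in> test_functions (ball 0 \<rho>)" for \<phi>
  proof -
    have [measurable]: "u' \<in> borel_measurable borel" "f' \<in> borel_measurable borel"
      "h \<in> borel_measurable borel" "f \<in> borel_measurable borel" "\<phi> \<in> borel_measurable borel"
      using L2b_measurable[OF u'(2)] L2b_measurable[OF f'] L2_ballD(5)[OF h(1)] L2_ballD(5)[OF f] test_measurable[OF \<phi>]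
      by simp_all
    show "(\<integral>x. u' x * \<phi> x \<partial>lborel) = (\<integral>x. h x * \<phi> x \<partial>lborel)"
      by (rule integral_cong_AE) (use h(2) in \<open>auto elim: eventually_mono\<close>)
    have "AE x in lborel. f' x * \<phi> x = f x * \<phi> x"
      using f0 null_sphere[of R]
    proof eventually_elim
      case (elim x)
      consider "x \<in> ball 0 R" | "x \<in> ball 0 \<rho> \<inter> \<Omega>" | "x \<notin> ball 0 \<rho>"
        using elim(2) by fastforce
      then show ?case
      proof cases
        case 3
        then have "\<phi> x = 0" using \<phi> by (auto simp: test_functions_def)
        then show ?thesis by simp
      qed (use elim(1) in \<open>auto simp: f_def\<close>)
    qed
    then show "(\<integral>x. f' x * \<phi> x \<partial>lborel) = (\<integral>x. f x * \<phi> x \<partial>lborel)"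
      by (intro integral_cong_AE) auto
  qed
  have cut: "(\<lambda>x. ct x * \<phi> x) \<in> test_functions (ball 0 \<rho>)"
      "X x * (ct x * \<phi> x) = X x * \<phi> x" "X x * lap (\<lambda>x. ct x * \<phi> x) x = X x * lap \<phi> x"
    if \<phi>: "\<phi> \<in> test_functions UNIV" and X: "L2_ball R X" for \<phi> X x
  proof -
    show "(\<lambda>x. ct x * \<phi> x) \<in> test_functions (ball 0 \<rho>)"
      by (rule test_functions_mult[OF tct open_ball smooth_on_subset[OF test_functions_smooth[OF \<phi>] subset_UNIV]])
    show "X x * (ct x * \<phi> x) = X x * \<phi> x" "X x * lap (\<lambda>x. ct x * \<phi> x) x = X x * lap \<phi> x"
      using L2_ballD(2)[OF X, of x] ct1 lap_cong[OF open_ball, of x 0 R "\<lambda>x. ct x * \<phi> x" \<phi>]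
      by (cases "x \<in> ball 0 R"; simp)+
  qed
  have h_lap: "(\<integral>x. h x * lap \<phi> x \<partial>lborel) = (\<integral>x. f x * \<phi> x \<partial>lborel)"
    and f_lap: "(\<integral>x. f x * lap \<phi> x \<partial>lborel) = (\<integral>x. g x * \<phi> x \<partial>lborel)"
    if \<phi>: "\<phi> \<in> test_functions UNIV" for \<phi>
  proof -
    note t = cut(1)[OF \<phi> h(1)]
    note e = AEu[OF t] AEu[OF test_functions_lap[OF t]] AEf[OF t] AEf[OF test_functions_lap[OF t]]
    show "(\<integral>x. h x * lap \<phi> x \<partial>lborel) = (\<integral>x. f x * \<phi> x \<partial>lborel)"
      using 1[OF t] unfolding e by (simp only: cut(2,3)[OF \<phi> h(1)] cut(2,3)[OF \<phi> f])
    have "(\<integral>x. f x * lap \<phi> x \<partial>lborel) = of_real (k^4) * (\<integral>x. h x * \<phi> x \<partial>lborel) + (\<integral>x. S' x * \<phi> x \<partial>lborel)"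
      using 2[OF t] unfolding e by (simp only: cut(2,3)[OF \<phi> h(1)] cut(2,3)[OF \<phi> f] cut(2)[OF \<phi> S'(2)])
    also have "\<dots> = (\<integral>x. of_real (k^4) * (h x * \<phi> x) + S' x * \<phi> x \<partial>lborel)"
      using L2b_mult_test_integrable[OF L2_ballD(1)[OF h(1)] \<phi>] L2b_mult_test_integrable[OF L2_ballD(1)[OF S'(2)] \<phi>]
      by simp
    finally show "(\<integral>x. f x * lap \<phi> x \<partial>lborel) = (\<integral>x. g x * \<phi> x \<partial>lborel)"
      by (simp add: g_def distrib_right mult.assoc)
  qed
  show "has_trace R u (\<lambda>_. 0)" "has_trace R (wlap (ball 0 R) u) (\<lambda>_. 0)"
    "has_normal_trace R u (\<lambda>_. 0)" "has_normal_trace R (wlap (ball 0 R) u) (\<lambda>_. 0)"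
    by (rule traces_vanish[OF R bh h(1) f g h_lap f_lap]; assumption)+
qed

end

theorem theorem2p3:
  fixes R k :: real and S u :: "real^2 \<Rightarrow> complex"
  assumes "R > 0" and "k > 0"
    and "S \<in> H_perp k R"
    and "radiating_solution k R (zero_ext R S) u"
  shows "has_trace R u (\<lambda>_. 0) \<and>
    has_trace R (wlap (ball 0 R) u) (\<lambda>_. 0) \<and>
    has_normal_trace R u (\<lambda>_. 0) \<and>
    has_normal_trace R (wlap (ball 0 R) u) (\<lambda>_. 0)"
proof -
  obtain S' where S': "brep (ball 0 R) S S'" "L2b S'"
    using L2_on_ex_brep[OF open_ball] assms(3) unfolding H_perp_def by blast
  then have "L2_ball R S'" using brepD(2)[OF S'(1)] by (simp add: L2_ball_def)
  moreover obtain w where "smooth_on (- cball 0 R) w" "AE x in lebesgue. x \<notin> cball 0 R \<longrightarrow> u x = w x"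
    "sommerfeld k w" "sommerfeld k (lap w)"
    using assms(4) unfolding radiating_solution_def by blast
  ultimately interpret radiating R k S u S' w
    using assms S'(1) by unfold_locales (auto simp: radiating_solution_def AE_completion_iff)
  show ?thesis using traces by blast
qed

end
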